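(* Assume the Generalized Riemann Hypothesis (in particular the Riemann Hypothesis, so that every nontrivial zero of $\zeta(s)$ has the form $\tfrac12+i\gamma$ with $\gamma\in\mathbb{R}$). For consecutive ordinates $0<\gamma\le\gamma'$ of nontrivial zeros of $\zeta(s)$ define the normalized gap $\delta(\gamma)=(\gamma'-\gamma)\frac{\log\gamma}{2\pi}$, and let $\lambda=\limsup_{\gamma}\delta(\gamma)$, where $\gamma$ runs over all positive ordinates of nontrivial zeros of $\zeta(s)$. Then $\lambda>3.033$.
   Context: The number of nontrivial zeros of $\zeta(s)$ with ordinates in $[0,T]$ is $\frac{1}{2\pi}T\log T+O(T)$, so $\delta(\gamma)$ is $1$ on average. *)

theory Defs
  imports "HOL-Complex_Analysis.Complex_Analysis"
begin

(* The analytic continuation to S of the Dirichlet series with coefficients a, assumed to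
   converge absolutely for Re s > 1; it is unique when S is open, connected and contains that
   half-plane.  Values outside S are set to 0. *)
definition dirichlet_series_continuation ::
    "complex set \<Rightarrow> (nat \<Rightarrow> complex) \<Rightarrow> complex \<Rightarrow> complex" where
  "dirichlet_series_continuation S a = (THE f.
     f holomorphic_on S \<and> (\<forall>s. s \<notin> S \<longrightarrow> f s = 0) \<and>
     (\<forall>s. Re s > 1 \<longrightarrow> f s = (\<Sum>n. a (Suc n) / of_nat (Suc n) powr s)))"

definition riemann_zeta :: "complex \<Rightarrow> complex" where
  "riemann_zeta = dirichlet_series_continuation (- {1}) (\<lambda>_. 1)"

definition dirichlet_character :: "nat \<Rightarrow> (nat \<Rightarrow> complex) \<Rightarrow> bool" where
  "dirichlet_character q \<psi> \<longleftrightarrow>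
     q > 0 \<and> \<psi> 1 = 1 \<and>
     (\<forall>m n. \<psi> (m * n) = \<psi> m * \<psi> n) \<and>
     (\<forall>n. \<psi> (n + q) = \<psi> n) \<and>
     (\<forall>n. \<psi> n = 0 \<longleftrightarrow> \<not> coprime n q)"

definition principal_character :: "nat \<Rightarrow> (nat \<Rightarrow> complex) \<Rightarrow> bool" where
  "principal_character q \<psi> \<longleftrightarrow> (\<forall>n. \<psi> n = (if coprime n q then 1 else 0))"

(* Only the L-functions of principal characters have a pole, namely at 1. *)
definition dirichlet_L :: "nat \<Rightarrow> (nat \<Rightarrow> complex) \<Rightarrow> complex \<Rightarrow> complex" where
  "dirichlet_L q \<psi> =
     dirichlet_series_continuation (if principal_character q \<psi> then - {1} else UNIV) \<psi>"

(* Zeros in the open critical strip are exactly the nontrivial ones; for imprimitive characters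
   the strip also excludes the zeros on Re s = 0 coming from the missing Euler factors. *)
definition generalized_riemann_hypothesis :: bool where
  "generalized_riemann_hypothesis \<longleftrightarrow>
     (\<forall>q \<psi> s. dirichlet_character q \<psi> \<and> 0 < Re s \<and> Re s < 1 \<and> dirichlet_L q \<psi> s = 0
        \<longrightarrow> Re s = 1 / 2)"

definition nontrivial_zeta_zeros :: "complex set" where
  "nontrivial_zeta_zeros = {\<rho>. riemann_zeta \<rho> = 0 \<and> 0 < Re \<rho> \<and> Re \<rho> < 1}"

lemma generalized_riemann_hypothesis_imp_riemann_hypothesis:
  assumes generalized_riemann_hypothesis and "\<rho> \<in> nontrivial_zeta_zeros"
  shows "Re \<rho> = 1 / 2"
proof -
  have "dirichlet_character 1 (\<lambda>_. 1)" and "dirichlet_L 1 (\<lambda>_. 1) = riemann_zeta"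
    by (simp_all add: dirichlet_character_def dirichlet_L_def principal_character_def
          riemann_zeta_def)
  with assms show ?thesis
    unfolding generalized_riemann_hypothesis_def nontrivial_zeta_zeros_def by force
qed

definition zeta_zero_count :: "real \<Rightarrow> nat" where
  "zeta_zero_count T =
     (\<Sum>\<rho> \<in> {\<rho> \<in> nontrivial_zeta_zeros. 0 < Im \<rho> \<and> Im \<rho> \<le> T}. nat (zorder riemann_zeta \<rho>))"

(* The positive ordinates in nondecreasing order, repeated according to multiplicity and indexed
   from 0: the n-th one is the smallest height up to which there are at least n + 1 zeros. *)
definition zeta_ordinate :: "nat \<Rightarrow> real" where
  "zeta_ordinate n = (LEAST T. n < zeta_zero_count T)"

definition normalized_zeta_gap :: "nat \<Rightarrow> real" where
  "normalized_zeta_gap n =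
     (zeta_ordinate (Suc n) - zeta_ordinate n) * (ln (zeta_ordinate n) / (2 * pi))"

(* Taken in the extended reals, since finiteness is not presupposed. *)
definition zeta_gap_limsup :: ereal where
  "zeta_gap_limsup = limsup (\<lambda>n. ereal (normalized_zeta_gap n))"

end

theory Submission
 imports Defs "HOL-Probability.Probability" "HOL-Number_Theory.Number_Theory" "HOL-Real_Asymp.Real_Asymp"
  "HOL-Computational_Algebra.Squarefree"
begin

text \<open>
Let \<open>X = exp Y\<close>, let the height \<open>T\<close> be slightly larger than \<open>X\<^sup>2\<close>
and put \<open>a = 4.77\<close>. If all large normalized gaps were below 3.034, every \<open>t\<close> in \<open>[T/2, 3T/2]\<close> would lie within
\<open>a / Y\<close> of an ordinate. Hence, for a nonnegative \<open>F\<close> concentrated near \<open>T\<close>, the integral of \<open>F\<close> would be at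
most the integral over \<open>\<bar>\<alpha>\<bar> \<le> a / Y\<close> of the sum of \<open>F (\<gamma> + \<alpha>)\<close> over the ordinates \<open>\<gamma>\<close>, which the explicit
formula evaluates. This is the method of Montgomery and Odlyzko, with \<open>F\<close> a Gaussian times the square of a Dirichlet
polynomial. Here the latter is a sum of \<open>sqrt (g h * g k) * (h / k) powr (- \<i> t)\<close> with \<open>g n = d(n) / n\<close> over reduced
fractions \<open>h / k\<close> of squarefree numbers up to \<open>X\<close> without small prime factors, instead of a sum over integers. A prime
\<open>p\<close> then relates \<open>h / k\<close> both to \<open>p h / k\<close> and to \<open>h / (k / p)\<close>, which doubles its weight in the prime sum, while only
the trivial solutions of \<open>h k' = k h'\<close> enter the mean value. In the limit the covering would require
\<open>\<pi> \<le> 2.005 a - 4 sqrt 2 J\<close> up to small errors, with \<open>J\<close> the integral of \<open>cos (b v) (1 - v)\<^sup>2\<close> over \<open>0 \<le> b \<le> a\<close>,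
\<open>0 \<le> v \<le> 1\<close>; this is false, because \<open>J\<close> exceeds 1.144.
\<close>

subsection \<open>Contour and Gaussian integrals\<close>

text \<open>An uncovered t forces a gap above 2 a / Y between neighbouring ordinates, and log T =
  2.005 Y makes the normalized gap about 2.005 * 4.77 / pi > 3.04; this is why a = 4.77 refutes
  3.034. The Riemann hypothesis enters through positivity: F is real and nonnegative on the critical
  line, so distant zeros and multiplicities only enlarge the sum over zeros. The height must exceed
  X^2 because distinct values n h / k and h' / k' may have a ratio as close to 1 as 1 + X^(-2): a
  Gaussian slightly wider than X^2 separates them, and the width has to stay below the height. With
  S(y) the sum of g up to exp y, a prime p meets S(Y - log p) S(Y), and S(y) is asymptotic to a
  constant times y^2; hence the weight (1 - v)^2 with v = log p / Y. Passing from all pairs to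
  coprime squarefree ones would cost a constant factor; leaving out the primes up to z reduces the
  loss to O(1 / z). The sum of g(h) g(k) over the admissible pairs, which is the mass of F, is
  compared with S(Y)^2 only from above.\<close>

lemma contour_integral_rectpath_eq:
 fixes f :: "complex \<Rightarrow> complex"
 assumes "a < b" "Y > 0"
  and cont: "continuous_on (path_image (rectpath (Complex a (-Y)) (Complex b Y))) f"
 shows "contour_integral (rectpath (Complex a (-Y)) (Complex b Y)) f =
  \<i> * integral {-Y..Y} (\<lambda>y. f (Complex b y)) - \<i> * integral {-Y..Y} (\<lambda>y. f (Complex a y))
  + contour_integral (linepath (Complex a (-Y)) (Complex b (-Y))) f
  - contour_integral (linepath (Complex a Y) (Complex b Y)) f"
proof -
 let ?l1 = "linepath (Complex a (-Y)) (Complex b (-Y))" and ?l2 = "linepath (Complex b (-Y)) (Complex b Y)"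
 and ?l3 = "linepath (Complex b Y) (Complex a Y)" and ?l4 = "linepath (Complex a Y) (Complex a (-Y))"
 have rp: "rectpath (Complex a (-Y)) (Complex b Y) = ?l1 +++ ?l2 +++ ?l3 +++ ?l4"
  by (simp add: rectpath_def Let_def)
 have im: "path_image (rectpath (Complex a (-Y)) (Complex b Y)) =
  closed_segment (Complex a (-Y)) (Complex b (-Y)) \<union> closed_segment (Complex b (-Y)) (Complex b Y)
  \<union> closed_segment (Complex b Y) (Complex a Y) \<union> closed_segment (Complex a Y) (Complex a (-Y))"
  unfolding rp by (simp add: path_image_join Un_assoc)
 have i: "f contour_integrable_on ?l1" "f contour_integrable_on ?l2" "f contour_integrable_on ?l3" "f contour_integrable_on ?l4"
  using cont unfolding im by (auto intro!: contour_integrable_continuous_linepath elim: continuous_on_subset)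
 have "contour_integral (rectpath (Complex a (-Y)) (Complex b Y)) f =
  contour_integral ?l1 f + contour_integral ?l2 f + contour_integral ?l3 f + contour_integral ?l4 f"
  unfolding rp using i by (simp add: valid_path_join)
 moreover have "contour_integral ?l2 f = \<i> * integral {-Y..Y} (\<lambda>y. f (Complex b y))"
  using assms by (subst contour_integral_linepath_same_Re[of _ b _ "-Y" Y]) auto
 moreover have "contour_integral ?l4 f = - contour_integral (linepath (Complex a (-Y)) (Complex a Y)) f"
  using contour_integral_reversepath[of "linepath (Complex a (-Y)) (Complex a Y)" f] by simp
 moreover have "contour_integral (linepath (Complex a (-Y)) (Complex a Y)) f = \<i> * integral {-Y..Y} (\<lambda>y. f (Complex a y))"
  using assms by (subst contour_integral_linepath_same_Re[of _ a _ "-Y" Y]) auto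
 moreover have "contour_integral ?l3 f = - contour_integral (linepath (Complex a Y) (Complex b Y)) f"
  using contour_integral_reversepath[of "linepath (Complex a Y) (Complex b Y)" f] by simp
 ultimately show ?thesis by simp
qed

lemma tendsto_integral_symmetric:
 fixes f :: "real \<Rightarrow> complex"
 assumes f: "integrable lborel f" and Y: "filterlim Y at_top sequentially"
 shows "(\<lambda>n. integral {-Y n..Y n} f) \<longlonglongrightarrow> (LINT y|lborel. f y)"
proof -
 have "integral {-Y n..Y n} f = (LINT y|lborel. indicator {-Y n..Y n} y *\<^sub>R f y)" for n
  using set_borel_integral_eq_integral(2)[of "{-Y n..Y n}" f] f
  by (simp add: set_integrable_def set_lebesgue_integral_def integrable_mult_indicator)
 moreover have "(\<lambda>n. LINT y|lborel. indicator {-Y n..Y n} y *\<^sub>R f y) \<longlonglongrightarrow> (LINT y|lborel. f y)"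
 proof (rule integral_dominated_convergence[where w="\<lambda>y. norm (f y)"])
  show "AE x in lborel. (\<lambda>n. indicator {-Y n..Y n} x *\<^sub>R f x) \<longlonglongrightarrow> f x"
  proof (rule AE_I2)
   fix x :: real
   have "\<forall>\<^sub>F n in sequentially. \<bar>x\<bar> \<le> Y n"
    using Y by (simp add: filterlim_at_top)
   then have "\<forall>\<^sub>F n in sequentially. indicator {-Y n..Y n} x *\<^sub>R f x = f x"
   proof eventually_elim
    case (elim n)
    then have "x \<in> {-Y n..Y n}" by simp linarith
    then show ?case by simp
   qed
   then show "(\<lambda>n. indicator {-Y n..Y n} x *\<^sub>R f x) \<longlonglongrightarrow> f x"
    by (rule tendsto_eventually)
  qed
  show "integrable lborel (\<lambda>y. norm (f y))" using f by simp
  show "f \<in> borel_measurable lborel" using f by simp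
  then show "(\<lambda>y. indicator {-Y n..Y n} y *\<^sub>R f y) \<in> borel_measurable lborel" for n by measurable
  show "AE x in lborel. norm (indicator {-Y n..Y n} x *\<^sub>R f x) \<le> norm (f x)" for n
   by (auto simp: indicator_def)
 qed
 ultimately show ?thesis by simp
qed

text \<open>The horizontal sides vanish in the limit and the vertical ones converge to integrals
  over full lines. The heights \<open>Y n\<close> form a sequence because the integrand may have
  poles at other heights: integers for \<open>theta_kernel\<close>, ordinates of zeros for
  \<open>completed_log_deriv\<close>.\<close>

lemma rectpath_strip_limit:
 fixes f :: "complex \<Rightarrow> complex"
 assumes ab: "a < b" and Y: "filterlim Y at_top sequentially" and Ypos: "\<And>n. Y n > 0"
  and cont: "\<And>n. continuous_on (path_image (rectpath (Complex a (-Y n)) (Complex b (Y n)))) f"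
  and inta: "integrable lborel (\<lambda>y. f (Complex a y))"
  and intb: "integrable lborel (\<lambda>y. f (Complex b y))"
  and horiz: "\<And>n x. a \<le> x \<Longrightarrow> x \<le> b \<Longrightarrow> norm (f (Complex x (Y n))) \<le> e n \<and> norm (f (Complex x (- Y n))) \<le> e n"
  and e: "e \<longlonglongrightarrow> 0"
 shows "(\<lambda>n. contour_integral (rectpath (Complex a (-Y n)) (Complex b (Y n))) f)
  \<longlonglongrightarrow> \<i> * (LINT y|lborel. f (Complex b y)) - \<i> * (LINT y|lborel. f (Complex a y))"
proof -
 have hb: "norm (contour_integral (linepath (Complex a u) (Complex b u)) f) \<le> e n * (b - a)"
  if u: "u = Y n \<or> u = - Y n" for n u
 proof -
  have seg: "closed_segment (Complex a u) (Complex b u) \<subseteq> path_image (rectpath (Complex a (-Y n)) (Complex b (Y n)))"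
   using ab Ypos[of n] u by (auto simp: path_image_rectpath closed_segment_same_Im closed_segment_eq_real_ivl)
  have "norm (contour_integral (linepath (Complex a u) (Complex b u)) f) \<le> e n * norm (Complex b u - Complex a u)"
  proof (rule contour_integral_bound_linepath)
   show "f contour_integrable_on linepath (Complex a u) (Complex b u)"
    using continuous_on_subset[OF cont seg] by (rule contour_integrable_continuous_linepath)
   show "0 \<le> e n" using order_trans[OF norm_ge_zero, of "f (Complex a (Y n))" "e n"] horiz[of a n] ab by simp
   fix x assume "x \<in> closed_segment (Complex a u) (Complex b u)"
   then obtain v where "x = Complex v u" "a \<le> v" "v \<le> b"
    using ab by (cases x) (auto simp: closed_segment_same_Im closed_segment_eq_real_ivl)
   then show "norm (f x) \<le> e n" using horiz[of v n] u by auto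
  qed
  moreover have "norm (Complex b u - Complex a u) = b - a"
   using ab by (simp add: complex_diff cmod_def)
  ultimately show ?thesis by simp
 qed
 have z1: "(\<lambda>n. contour_integral (linepath (Complex a (Y n)) (Complex b (Y n))) f) \<longlonglongrightarrow> 0"
  by (rule Lim_null_comparison[OF _ tendsto_mult_left_zero[OF e, of "b - a"]]) (use hb in auto)
 have z2: "(\<lambda>n. contour_integral (linepath (Complex a (-Y n)) (Complex b (-Y n))) f) \<longlonglongrightarrow> 0"
  by (rule Lim_null_comparison[OF _ tendsto_mult_left_zero[OF e, of "b - a"]]) (use hb in auto)
 have "contour_integral (rectpath (Complex a (-Y n)) (Complex b (Y n))) f =
  \<i> * integral {-Y n..Y n} (\<lambda>y. f (Complex b y)) - \<i> * integral {-Y n..Y n} (\<lambda>y. f (Complex a y))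
  + contour_integral (linepath (Complex a (-Y n)) (Complex b (-Y n))) f
  - contour_integral (linepath (Complex a (Y n)) (Complex b (Y n))) f" for n
  using contour_integral_rectpath_eq[OF ab Ypos cont] .
 moreover have "(\<lambda>n. \<i> * integral {-Y n..Y n} (\<lambda>y. f (Complex b y)) - \<i> * integral {-Y n..Y n} (\<lambda>y. f (Complex a y))
  + contour_integral (linepath (Complex a (-Y n)) (Complex b (-Y n))) f
  - contour_integral (linepath (Complex a (Y n)) (Complex b (Y n))) f) \<longlonglongrightarrow>
   \<i> * (LINT y|lborel. f (Complex b y)) - \<i> * (LINT y|lborel. f (Complex a y)) + 0 - 0"
  by (intro tendsto_intros tendsto_integral_symmetric inta intb Y z1 z2)
 ultimately show ?thesis by simp
qed

text \<open>Substituting x = sqrt (2 A) v turns the integral into the characteristic function of the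
  standard normal distribution, whose value is known.\<close>

lemma gaussian_fourier:
 fixes A w :: real
 assumes A: "A > 0"
 shows "integrable lborel (\<lambda>v. exp (of_real (- (A * v\<^sup>2)) + \<i> * of_real (w * v)) :: complex)"
  and "(LINT v|lborel. exp (of_real (- (A * v\<^sup>2)) + \<i> * of_real (w * v)) :: complex) =
   of_real (sqrt (pi / A) * exp (- (w\<^sup>2) / (4 * A)))"
proof -
 define c where "c = sqrt (2 * A)"
 have c: "c > 0" "c\<^sup>2 = 2 * A" using A by (auto simp: c_def)
 define g where "g = (\<lambda>x::real. of_real (std_normal_density x) * iexp (w / c * x))"
 have gint: "integrable lborel g"
 proof -
  have "integrable lborel (\<lambda>x. norm (std_normal_density x))" by simp
  then show ?thesis
   by (rule Bochner_Integration.integrable_bound)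
     (auto simp: g_def norm_mult intro!: AE_I2)
 qed
 have gval: "(LINT x|lborel. g x) = of_real (exp (- ((w / c)\<^sup>2) / 2))"
 proof -
  have "char std_normal_distribution (w / c) = (LINT x|lborel. std_normal_density x *\<^sub>R iexp (w / c * x))"
   unfolding char_def by (subst integral_density) (auto simp: normal_density_nonneg)
  then show ?thesis unfolding g_def char_std_normal_distribution by (simp add: scaleR_conv_of_real)
 qed
 have eq: "exp (of_real (- (A * v\<^sup>2)) + \<i> * of_real (w * v)) = of_real (sqrt (2 * pi)) * g (0 + c * v)" for v
 proof -
  have h: "(c * v)\<^sup>2 / 2 = A * v\<^sup>2" using c by (simp add: power_mult_distrib)
  have "g (0 + c * v) = of_real (1 / sqrt (2 * pi)) * (exp (of_real (- (A * v\<^sup>2))) * exp (\<i> * of_real (w * v)))"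
   using c(1) unfolding g_def std_normal_density_def exp_of_real minus_divide_left[symmetric] add_0 h by simp
  moreover have "complex_of_real (sqrt (2 * pi)) * of_real (1 / sqrt (2 * pi)) = 1"
   unfolding of_real_mult[symmetric] by simp
  ultimately show ?thesis unfolding exp_add by (simp add: mult.assoc[symmetric] del: of_real_mult of_real_divide)
 qed
 show "integrable lborel (\<lambda>v. exp (of_real (- (A * v\<^sup>2)) + \<i> * of_real (w * v)) :: complex)"
  unfolding eq using lborel_integrable_real_affine[OF gint, of c 0] c(1) by simp
 have "(LINT v|lborel. g (0 + c * v)) = (LINT x|lborel. g x) / of_real c"
  using lborel_integral_real_affine[of c g 0] c(1) by (simp add: scaleR_conv_of_real)
 then have "(LINT v|lborel. exp (of_real (- (A * v\<^sup>2)) + \<i> * of_real (w * v)) :: complex) =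
   of_real (sqrt (2 * pi)) * (of_real (exp (- ((w / c)\<^sup>2) / 2)) / of_real c)"
  unfolding eq using gval by simp
 also have "\<dots> = of_real (sqrt (2 * pi) / c * exp (- ((w / c)\<^sup>2) / 2))" by simp
 also have "sqrt (2 * pi) / c = sqrt (pi / A)"
  unfolding c_def using A by (simp add: real_sqrt_divide[symmetric] real_sqrt_mult)
 also have "- ((w / c)\<^sup>2) / 2 = - (w\<^sup>2) / (4 * A)" using c by (simp add: power_divide)
 finally show "(LINT v|lborel. exp (of_real (- (A * v\<^sup>2)) + \<i> * of_real (w * v)) :: complex) =
   of_real (sqrt (pi / A) * exp (- (w\<^sup>2) / (4 * A)))" by simp
qed

subsection \<open>The theta function\<close>

text \<open>With \<theta>(t) the sum of exp (- \<pi> n^2 t) over all integers n, this is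
  (\<theta>(t) - 1) / 2.\<close>

definition theta_tail :: "real \<Rightarrow> real" where
 "theta_tail t = (\<Sum>n. exp (- (pi * (real (Suc n))\<^sup>2 * t)))"

lemma exp_square_le_geometric:
 assumes "t > 0"
 shows "exp (- (pi * (real (Suc n))\<^sup>2 * t)) \<le> exp (- (pi * t)) * exp (- (pi * t)) ^ n"
proof -
 have "real (Suc n) \<le> (real (Suc n))\<^sup>2" by (simp add: power2_eq_square)
 then have "real (Suc n) * (pi * t) \<le> (real (Suc n))\<^sup>2 * (pi * t)"
  using assms by (intro mult_right_mono) auto
 then have "exp (- (pi * (real (Suc n))\<^sup>2 * t)) \<le> exp (- (pi * t) + real n * (- (pi * t)))"
  by (simp add: algebra_simps)
 also have "\<dots> = exp (- (pi * t)) * exp (- (pi * t)) ^ n"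
  unfolding exp_add by (simp add: exp_of_nat_mult[symmetric])
 finally show ?thesis .
qed

lemma summable_theta_tail:
 assumes "t > 0"
 shows "summable (\<lambda>n. exp (- (pi * (real (Suc n))\<^sup>2 * t)))"
proof (rule summable_comparison_test')
 show "summable (\<lambda>n. exp (- (pi * t)) * exp (- (pi * t)) ^ n)"
  using assms by (intro summable_mult summable_geometric) auto
 show "norm (exp (- (pi * (real (Suc n))\<^sup>2 * t))) \<le> exp (- (pi * t)) * exp (- (pi * t)) ^ n" for n
  using exp_square_le_geometric[OF assms, of n] by simp
qed

text \<open>This is exp (\<pi> t s^2) coth (\<pi> s), written so that it expands into a geometric
  series on Re s = 1. Its pole at i n has residue exp (- \<pi> n^2 t) / \<pi>, so contour integrals
  of it collect the theta series.\<close>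

definition theta_kernel :: "real \<Rightarrow> complex \<Rightarrow> complex" where
 "theta_kernel t s = exp (of_real (pi * t) * s\<^sup>2) * (1 + exp (- (2 * of_real pi * s))) / (1 - exp (- (2 * of_real pi * s)))"

lemma exp_2pi_eq_1: "exp (- (2 * of_real pi * s)) = (1::complex) \<longleftrightarrow> (\<exists>n::int. s = Complex 0 (of_int n))"
proof
 assume "exp (- (2 * of_real pi * s)) = 1"
 then obtain n :: int where n: "Re s = 0" "- (2 * (pi * Im s)) = of_int (2 * n) * pi"
  unfolding exp_eq_1 by (auto simp: mult.assoc)
 then have "pi * Im s = pi * of_int (- n)" by simp
 then have "Im s = of_int (- n)" unfolding mult_cancel_left by simp
 then show "\<exists>n::int. s = Complex 0 (of_int n)" using n(1) by (intro exI[of _ "-n"]) (simp add: complex_eq_iff)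
next
 assume "\<exists>n::int. s = Complex 0 (of_int n)"
 then obtain n :: int where "s = Complex 0 (of_int n)" by auto
 then show "exp (- (2 * of_real pi * s)) = 1"
  unfolding exp_eq_1 by (auto intro!: exI[of _ "-n"])
qed

lemma norm_exp_square: "norm (exp (of_real c * (Complex x y)\<^sup>2)) = exp (c * (x\<^sup>2 - y\<^sup>2))"
 by (simp add: power2_eq_square)

lemma sum_int_symmetric:
 fixes g :: "int \<Rightarrow> complex"
 assumes "\<And>n. g (- n) = g n"
 shows "(\<Sum>n\<in>{- int N..int N}. g n) = g 0 + 2 * (\<Sum>k<N. g (int (Suc k)))"
proof (induction N)
 case (Suc N)
 have "{- int (Suc N)..int (Suc N)} = insert (- int (Suc N)) (insert (int (Suc N)) {- int N..int N})"
  by auto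
 then have "(\<Sum>n\<in>{- int (Suc N)..int (Suc N)}. g n) = g (- int (Suc N)) + (g (int (Suc N)) + (\<Sum>n\<in>{- int N..int N}. g n))"
  by simp
 then show ?case using Suc assms[of "int (Suc N)"] by (simp add: algebra_simps)
qed simp

lemma theta_kernel_contour:
 assumes t: "t > 0"
 shows "contour_integral (rectpath (Complex (-1) (- (real N + 1/2))) (Complex 1 (real N + 1/2))) (theta_kernel t) =
  2 * \<i> * (1 + 2 * (\<Sum>k<N. of_real (exp (- (pi * (real (Suc k))\<^sup>2 * t)))))"
proof -
 let ?Y = "real N + 1/2"
 let ?g = "rectpath (Complex (-1) (- ?Y)) (Complex 1 ?Y)"
 define S where "S = {s::complex. \<bar>Im s\<bar> < real N + 1}"
 define pts where "pts = (\<lambda>n::int. Complex 0 (of_int n)) ` {- int N..int N}"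
 have S_eq: "S = {s. Im s < real N + 1} \<inter> {s. Im s > - (real N + 1)}" unfolding S_def by auto
 have "open S" unfolding S_eq by (intro open_Int open_halfspace_Im_lt open_halfspace_Im_gt)
 have "convex S" unfolding S_eq by (intro convex_Int convex_halfspace_Im_lt convex_halfspace_Im_gt)
 then have "connected S" by (rule convex_connected)
 have fin: "finite pts" unfolding pts_def by simp
 have nz: "1 - exp (- (2 * of_real pi * s)) \<noteq> 0" if s: "s \<in> S - pts" for s
 proof
  assume "1 - exp (- (2 * of_real pi * s)) = 0"
  then obtain n :: int where n: "s = Complex 0 (of_int n)" using exp_2pi_eq_1[of s] by auto
  then have "\<bar>of_int n\<bar> < real N + 1" using s by (simp add: S_def)
  then have "n \<in> {- int N..int N}" by (simp, linarith)
  then show False using s n by (auto simp: pts_def)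
 qed
 have holo: "theta_kernel t holomorphic_on S - pts"
  unfolding theta_kernel_def using nz by (intro holomorphic_intros) auto
 have img: "path_image ?g \<subseteq> S - pts"
 proof
  fix s assume "s \<in> path_image ?g"
  then have "Re s \<in> {-1, 1} \<and> Im s \<in> {- ?Y..?Y} \<or> Im s \<in> {- ?Y, ?Y} \<and> Re s \<in> {-1..1}"
   by (auto simp: path_image_rectpath)
  \<comment> \<open>Doubled, this compares an even integer with an odd one; it keeps the path off
    the poles.\<close>
  moreover have "of_int n \<noteq> ?Y" "of_int n \<noteq> - ?Y" for n :: int
  proof -
   have "of_int (2 * n) \<noteq> (of_int (2 * int N + 1) :: real)" unfolding of_int_eq_iff by presburger
   then show "of_int n \<noteq> ?Y" by auto
   have "of_int (2 * n) \<noteq> (of_int (- (2 * int N + 1)) :: real)" unfolding of_int_eq_iff by presburger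
   then show "of_int n \<noteq> - ?Y" by auto
  qed
  ultimately show "s \<in> S - pts" by (auto simp: S_def pts_def)
 qed
 have "contour_integral ?g (theta_kernel t) = 2 * pi * \<i> * (\<Sum>p\<in>pts. winding_number ?g p * residue (theta_kernel t) p)"
 proof (rule Residue_theorem[OF \<open>open S\<close> \<open>connected S\<close> fin holo])
  show "\<forall>z. z \<notin> S \<longrightarrow> winding_number ?g z = 0"
   by (intro allI impI winding_number_rectpath_outside) (auto simp: S_def in_cbox_complex_iff)
 qed (use img in auto)
 also have "(\<Sum>p\<in>pts. winding_number ?g p * residue (theta_kernel t) p) =
  (\<Sum>n\<in>{- int N..int N}. of_real (exp (- (pi * (of_int n)\<^sup>2 * t)) / pi))"
  unfolding pts_def
 proof (subst sum.reindex)
  show "inj_on (\<lambda>n::int. Complex 0 (of_int n)) {- int N..int N}" by (auto simp: inj_on_def)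
  show "sum ((\<lambda>p. winding_number ?g p * residue (theta_kernel t) p) \<circ> (\<lambda>n. Complex 0 (real_of_int n))) {- int N..int N} =
   (\<Sum>n\<in>{- int N..int N}. of_real (exp (- (pi * (of_int n)\<^sup>2 * t)) / pi))"
  proof (rule sum.cong[OF refl], unfold o_def)
   fix n :: int assume n: "n \<in> {- int N..int N}"
   let ?z = "Complex 0 (of_int n)"
   have "real_of_int n \<le> real N" "- real N \<le> real_of_int n" using n by (auto simp: of_int_le_iff[symmetric, where ?'a=real] simp del: of_int_le_iff)
   then have "?z \<in> box (Complex (-1) (- ?Y)) (Complex 1 ?Y)" by (auto simp: in_box_complex_iff)
   then have w: "winding_number ?g ?z = 1" by (rule winding_number_rectpath)
   have e1: "exp (- (2 * of_real pi * ?z)) = 1" unfolding exp_2pi_eq_1 by auto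
   have "residue (\<lambda>s. (exp (of_real (pi * t) * s\<^sup>2) * (1 + exp (- (2 * of_real pi * s)))) / (1 - exp (- (2 * of_real pi * s)))) ?z =
    (exp (of_real (pi * t) * ?z\<^sup>2) * (1 + exp (- (2 * of_real pi * ?z)))) / (2 * of_real pi)"
   proof (rule residue_simple_pole_deriv[where s = UNIV])
    show "((\<lambda>s. 1 - exp (- (2 * of_real pi * s))) has_field_derivative (2 * of_real pi)) (at ?z)"
     using e1 by (auto intro!: derivative_eq_intros)
   qed (use e1 in \<open>auto intro!: holomorphic_intros\<close>)
   moreover have "of_real (pi * t) * ?z\<^sup>2 = of_real (- (pi * (of_int n)\<^sup>2 * t))"
    by (simp add: complex_eq_iff power2_eq_square)
   ultimately have "residue (theta_kernel t) ?z = of_real (exp (- (pi * (of_int n)\<^sup>2 * t)) / pi)"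
    unfolding theta_kernel_def using e1 by (simp add: exp_of_real[symmetric])
   with w show "winding_number ?g ?z * residue (theta_kernel t) ?z = of_real (exp (- (pi * (of_int n)\<^sup>2 * t)) / pi)"
    by simp
  qed
 qed
 also have "\<dots> = of_real (1 / pi) + 2 * (\<Sum>k<N. of_real (exp (- (pi * (real (Suc k))\<^sup>2 * t)) / pi))"
  by (subst sum_int_symmetric) auto
 also have "2 * pi * \<i> * \<dots> = 2 * \<i> * (1 + 2 * (\<Sum>k<N. of_real (exp (- (pi * (real (Suc k))\<^sup>2 * t)))))"
  by (simp add: field_simps sum_divide_distrib[symmetric])
 finally show ?thesis .
qed

lemma integrable_gaussian_exp:
 assumes "c > 0"
 shows "integrable lborel (\<lambda>v. C * exp (- (c * v\<^sup>2)) :: real)"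
proof -
 have "integrable lborel (\<lambda>v. norm (exp (of_real (- (c * v\<^sup>2)) + \<i> * of_real (0 * v)) :: complex))"
  by (intro integrable_norm gaussian_fourier(1) assms)
 then show ?thesis by (intro integrable_mult_right) simp
qed

lemma integral_gaussian_exp:
 assumes "c > 0"
 shows "(LINT v|lborel. exp (- (c * v\<^sup>2)) :: real) = sqrt (pi / c)"
proof -
 have "complex_of_real (LINT v|lborel. exp (- (c * v\<^sup>2))) = (LINT v|lborel. exp (of_real (- (c * v\<^sup>2)) + \<i> * of_real (0 * v)))"
  by (subst integral_complex_of_real[symmetric]) (simp add: exp_of_real[symmetric] del: integral_complex_of_real)
 also have "\<dots> = of_real (sqrt (pi / c))" using gaussian_fourier(2)[OF assms, of 0] by simp
 finally show ?thesis by (simp only: of_real_eq_iff)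
qed

text \<open>On Re s = 1 the hyperbolic cotangent is a geometric series in exp (- 2 \<pi> s). The
  k-th term gives a Gaussian Fourier integral with value exp (- \<pi> k^2 / t) / sqrt t, so the line
  integral is the theta series at the inverse argument.\<close>

lemma theta_kernel_line_integral:
 assumes t: "t > 0"
 shows "integrable lborel (\<lambda>y. theta_kernel t (Complex 1 y))"
  and "(LINT y|lborel. theta_kernel t (Complex 1 y)) = of_real ((1 + 2 * theta_tail (1 / t)) / sqrt t)"
proof -
 define q where "q = (\<lambda>y::real. exp (- (2 * of_real pi * Complex 1 y)))"
 define E where "E = (\<lambda>y::real. exp (of_real (pi * t) * (Complex 1 y)\<^sup>2))"
 define f where "f = (\<lambda>(k::nat) y. (if k = 0 then 1 else 2) * E y * q y ^ k)"
 have nq: "norm (q y) = exp (- 2 * pi)" for y by (simp add: q_def)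
 then have nq1: "norm (q y) < 1" for y by simp
 have tm: "E y * q y ^ k = of_real (exp (pi * t - 2 * pi * real k)) * exp (of_real (- ((pi * t) * y\<^sup>2)) + \<i> * of_real ((2 * pi * (t - real k)) * y))" for y k
  unfolding E_def q_def exp_of_nat_mult[symmetric] exp_add[symmetric] exp_of_real[symmetric]
  by (intro arg_cong[where f=exp]) (simp add: complex_eq_iff power2_eq_square algebra_simps)
 have pt: "pi * t > 0" using t by simp
 have fint: "integrable lborel (f k)" for k
 proof -
  have "f k = (\<lambda>y. ((if k = 0 then 1 else 2) * of_real (exp (pi * t - 2 * pi * real k))) *
   exp (of_real (- ((pi * t) * y\<^sup>2)) + \<i> * of_real ((2 * pi * (t - real k)) * y)))"
   unfolding f_def using tm[of _ k] by (intro ext) (simp only: mult.assoc)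
  then show ?thesis by (simp only:) (intro integrable_mult_right gaussian_fourier(1)[OF pt])
 qed
 have Eqval: "(LINT y|lborel. E y * q y ^ k) = of_real (exp (- (pi * (real k)\<^sup>2 * (1 / t))) / sqrt t)" for k
 proof -
  have "(LINT y|lborel. E y * q y ^ k) = of_real (exp (pi * t - 2 * pi * real k)) *
    of_real (sqrt (pi / (pi * t)) * exp (- ((2 * pi * (t - real k))\<^sup>2) / (4 * (pi * t))))"
   unfolding tm using gaussian_fourier(2)[OF pt, of "2 * pi * (t - real k)"] by simp
  also have "\<dots> = of_real (sqrt (1 / t) * exp (pi * t - 2 * pi * real k + - ((2 * pi * (t - real k))\<^sup>2) / (4 * (pi * t))))"
  proof -
   have "sqrt (pi / (pi * t)) = sqrt (1 / t)" by simp
   then show ?thesis by (simp only: exp_add of_real_mult) (simp only: mult_ac)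
  qed
  also have "pi * t - 2 * pi * real k + - ((2 * pi * (t - real k))\<^sup>2) / (4 * (pi * t)) = - (pi * (real k)\<^sup>2 * (1 / t))"
   using t by (simp add: field_simps power2_eq_square)
  finally show ?thesis by (simp add: real_sqrt_divide)
 qed
 have fval: "(LINT y|lborel. f k y) = of_real ((if k = 0 then 1 else 2) * exp (- (pi * (real k)\<^sup>2 * (1 / t))) / sqrt t)" for k
  unfolding f_def mult.assoc using Eqval[of k] by simp
 have nE: "norm (E y) = exp (pi * t) * exp (- (pi * t * y\<^sup>2))" for y
  unfolding E_def norm_exp_square by (simp add: exp_add[symmetric] algebra_simps)
 have nf: "norm (f k y) \<le> 2 * exp (pi * t) * exp (- (pi * t * y\<^sup>2)) * exp (- 2 * pi) ^ k" for k y
  unfolding f_def norm_mult norm_power nE nq by auto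
 have sumf: "(\<lambda>k. f k y) sums theta_kernel t (Complex 1 y)" for y
 proof -
  have "(\<lambda>k. q y ^ k) sums (1 / (1 - q y))" using geometric_sums[OF nq1] .
  then have "(\<lambda>k. 2 * E y * q y ^ k - (if k = 0 then E y else 0)) sums (2 * E y * (1 / (1 - q y)) - E y)"
   using sums_single[of 0 "\<lambda>_. E y"] by (intro sums_diff sums_mult) (simp_all add: eq_commute)
  moreover have "(\<lambda>k. 2 * E y * q y ^ k - (if k = 0 then E y else 0)) = (\<lambda>k. f k y)"
   by (auto simp: f_def)
  moreover have "1 - q y \<noteq> 0" using nq1[of y] by auto
  then have "2 * E y * (1 / (1 - q y)) - E y = E y * (1 + q y) / (1 - q y)" by (simp add: field_simps)
  ultimately show ?thesis unfolding theta_kernel_def E_def q_def by simp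
 qed
 have summ: "summable (\<lambda>k. 2 * exp (pi * t) * exp (- (pi * t * y\<^sup>2)) * exp (- 2 * pi) ^ k)" for y
  by (intro summable_mult summable_geometric) auto
 have s1: "AE y in lborel. summable (\<lambda>k. norm (f k y))"
  by (rule AE_I2, rule summable_comparison_test'[OF summ]) (use nf in auto)
 have s2: "summable (\<lambda>k. LINT y|lborel. norm (f k y))"
 proof (rule summable_comparison_test')
  show "summable (\<lambda>k. (2 * exp (pi * t) * sqrt (pi / (pi * t))) * exp (- 2 * pi) ^ k)"
   by (intro summable_mult summable_geometric) auto
  fix k
  have "(LINT y|lborel. norm (f k y)) \<le> (LINT y|lborel. 2 * exp (pi * t) * exp (- 2 * pi) ^ k * exp (- (pi * t * y\<^sup>2)))"
   using nf[of k] by (intro integral_mono integrable_norm fint integrable_gaussian_exp pt) (auto simp: mult_ac)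
  also have "\<dots> = 2 * exp (pi * t) * exp (- 2 * pi) ^ k * sqrt (pi / (pi * t))"
   using integral_gaussian_exp[OF pt] by simp
  finally show "norm (LINT y|lborel. norm (f k y)) \<le> (2 * exp (pi * t) * sqrt (pi / (pi * t))) * exp (- 2 * pi) ^ k"
   by (simp add: mult_ac)
 qed
 have ker: "theta_kernel t (Complex 1 y) = (\<Sum>k. f k y)" for y using sumf[of y] by (simp add: sums_iff)
 show "integrable lborel (\<lambda>y. theta_kernel t (Complex 1 y))"
  unfolding ker by (rule integrable_suminf[OF fint s1 s2])
 have "(LINT y|lborel. theta_kernel t (Complex 1 y)) = (\<Sum>k. LINT y|lborel. f k y)"
  unfolding ker by (rule integral_suminf[OF fint s1 s2])
 moreover have "(\<lambda>k. LINT y|lborel. f k y) sums of_real ((1 + 2 * theta_tail (1 / t)) / sqrt t)"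
 proof -
  have "(\<lambda>k. exp (- (pi * (real (Suc k))\<^sup>2 * (1 / t)))) sums theta_tail (1 / t)"
   unfolding theta_tail_def using summable_theta_tail[of "1 / t"] t by (intro summable_sums) auto
  then have "(\<lambda>k. complex_of_real (2 * exp (- (pi * (real (Suc k))\<^sup>2 * (1 / t))) / sqrt t)) sums of_real (2 * theta_tail (1 / t) / sqrt t)"
   by (intro sums_of_real sums_divide sums_mult)
  then have "(\<lambda>k. LINT y|lborel. f (Suc k) y) sums of_real (2 * theta_tail (1 / t) / sqrt t)"
   unfolding fval by simp
  then have "(\<lambda>k. LINT y|lborel. f k y) sums (of_real (2 * theta_tail (1 / t) / sqrt t) + (LINT y|lborel. f 0 y))"
   by (rule sums_Suc)
  moreover have "of_real (2 * theta_tail (1 / t) / sqrt t) + (LINT y|lborel. f 0 y) = of_real ((1 + 2 * theta_tail (1 / t)) / sqrt t)"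
   unfolding fval by (simp add: add_divide_distrib)
  ultimately show ?thesis by simp
 qed
 ultimately show "(LINT y|lborel. theta_kernel t (Complex 1 y)) = of_real ((1 + 2 * theta_tail (1 / t)) / sqrt t)"
  by (simp add: sums_iff)
qed

lemma theta_kernel_odd: "theta_kernel t (- s) = - theta_kernel t s"
proof -
 have *: "(1 + inverse e) / (1 - inverse e) = - ((1 + e) / (1 - e))" if "e \<noteq> 0" for e :: complex
  using that by (cases "e = 1") (auto simp: field_simps)
 have "(1 + exp (2 * of_real pi * s)) / (1 - exp (2 * of_real pi * s)) = - ((1 + exp (- (2 * of_real pi * s))) / (1 - exp (- (2 * of_real pi * s))))"
  using *[of "exp (- (2 * of_real pi * s))"] by (simp add: exp_minus)
 then show ?thesis unfolding theta_kernel_def times_divide_eq_right[symmetric] by simp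
qed

text \<open>Residues give the theta series at t, the lines Re s = 1 and Re s = -1 give it at 1 / t,
  and oddness of the kernel makes the two lines contribute equally. This takes the place of Poisson
  summation.\<close>

theorem theta_tail_inversion:
 assumes t: "t > 0"
 shows "1 + 2 * theta_tail (1 / t) = sqrt t * (1 + 2 * theta_tail t)"
proof -
 define Y where "Y = (\<lambda>N::nat. real N + 1/2)"
 let ?R = "\<lambda>N. contour_integral (rectpath (Complex (-1) (- Y N)) (Complex 1 (Y N))) (theta_kernel t)"
 define J where "J = (LINT y|lborel. theta_kernel t (Complex 1 y))"
 have neg: "theta_kernel t (Complex (-1) y) = - theta_kernel t (Complex 1 (0 + (-1) * y))" for y
 proof -
  have "Complex (-1) y = - Complex 1 (0 + (-1) * y)" by (simp add: complex_eq_iff)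
  then show ?thesis using theta_kernel_odd[of t "Complex 1 (0 + (-1) * y)"] by simp
 qed
 have inta: "integrable lborel (\<lambda>y. theta_kernel t (Complex (-1) y))"
  unfolding neg using lborel_integrable_real_affine[OF theta_kernel_line_integral(1)[OF t], of "-1" 0] by simp
 have Ja: "(LINT y|lborel. theta_kernel t (Complex (-1) y)) = - J"
  unfolding neg J_def using lborel_integral_real_affine[of "-1" "\<lambda>y. theta_kernel t (Complex 1 y)" 0] by simp
 have "?R \<longlonglongrightarrow> \<i> * (LINT y|lborel. theta_kernel t (Complex 1 y)) - \<i> * (LINT y|lborel. theta_kernel t (Complex (-1) y))"
 proof (rule rectpath_strip_limit[where e = "\<lambda>N. exp (pi * t * (1 - (Y N)\<^sup>2))"])
  show "filterlim Y at_top sequentially" unfolding Y_def by real_asymp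
  show "Y n > 0" for n by (simp add: Y_def)
  show "(\<lambda>N. exp (pi * t * (1 - (Y N)\<^sup>2))) \<longlonglongrightarrow> 0" unfolding Y_def using t by real_asymp
  \<comment> \<open>Halfway between the poles the exponential is a negative real, so the quotient in
    the kernel becomes (1 - r) / (1 + r) with r > 0, of modulus at most 1.\<close>
  have aux: "exp (- (2 * of_real pi * Complex x u)) = of_real (- exp (- (2 * pi * x)))" if "u = Y n \<or> u = - Y n" for x u n
  proof -
   have "exp (- (2 * of_real pi * Complex x u)) = of_real (exp (- (2 * pi * x))) * cis (- (2 * pi * u))"
    by (simp add: exp_eq_polar)
   also have "cis (- (2 * pi * u)) = -1"
   proof -
    have "2 * pi * u = pi * (2 * real n + 1) \<or> 2 * pi * u = - (pi * (2 * real n + 1))"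
    proof (rule disjE[OF that])
     assume "u = Y n" then show ?thesis by (simp add: Y_def algebra_simps)
    next
     assume "u = - Y n"
     then have "2 * pi * u = 2 * pi * - (real n + 1 / 2)" by (simp only: Y_def)
     also have "\<dots> = - (pi * (2 * real n + 1))" by (simp add: algebra_simps)
     finally show ?thesis ..
    qed
    moreover have "cos (pi * (2 * real n + 1)) = -1" "sin (pi * (2 * real n + 1)) = 0"
     using cos_npi2[of "2 * n + 1"] sin_npi2[of "2 * n + 1"] by (simp_all add: algebra_simps)
    ultimately have "cos (2 * pi * u) = -1" "sin (2 * pi * u) = 0"
     by (metis cos_minus, metis sin_minus minus_zero)
    then show ?thesis by (simp add: complex_eq_iff)
   qed
   finally show ?thesis by simp
  qed
  have nb: "norm (theta_kernel t (Complex x u)) \<le> exp (pi * t * (1 - (Y n)\<^sup>2))" if u: "u = Y n \<or> u = - Y n" and x: "-1 \<le> x" "x \<le> 1" for x u n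
  proof -
   let ?r = "exp (- (2 * pi * x))"
   have "theta_kernel t (Complex x u) = exp (of_real (pi * t) * (Complex x u)\<^sup>2) * of_real ((1 - ?r) / (1 + ?r))"
    unfolding theta_kernel_def aux[OF u] by simp
   then have "norm (theta_kernel t (Complex x u)) = exp (pi * t * (x\<^sup>2 - u\<^sup>2)) * \<bar>(1 - ?r) / (1 + ?r)\<bar>"
    by (simp only: norm_mult norm_exp_square norm_of_real)
   also have "\<bar>(1 - ?r) / (1 + ?r)\<bar> \<le> 1" using exp_gt_zero[of "- (2 * pi * x)"]
    by (simp add: abs_divide divide_le_eq abs_le_iff del: exp_gt_zero)
   then have "exp (pi * t * (x\<^sup>2 - u\<^sup>2)) * \<bar>(1 - ?r) / (1 + ?r)\<bar> \<le> exp (pi * t * (x\<^sup>2 - u\<^sup>2))"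
    using mult_left_mono[of "\<bar>(1 - ?r) / (1 + ?r)\<bar>" 1 "exp (pi * t * (x\<^sup>2 - u\<^sup>2))"] by simp
   also have "\<dots> \<le> exp (pi * t * (1 - (Y n)\<^sup>2))"
   proof -
    have "u\<^sup>2 = (Y n)\<^sup>2" using u by auto
    moreover have "x\<^sup>2 \<le> 1" unfolding abs_square_le_1 using x by linarith
    ultimately show ?thesis using t by (simp add: mult_left_mono)
   qed
   finally show ?thesis .
  qed
  show "norm (theta_kernel t (Complex x (Y n))) \<le> exp (pi * t * (1 - (Y n)\<^sup>2)) \<and>
   norm (theta_kernel t (Complex x (- Y n))) \<le> exp (pi * t * (1 - (Y n)\<^sup>2))" if "-1 \<le> x" "x \<le> 1" for n x
   using nb that by blast
  show "continuous_on (path_image (rectpath (Complex (-1) (- Y n)) (Complex 1 (Y n)))) (theta_kernel t)" for n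
  proof -
   have "1 - exp (- (2 * of_real pi * s)) \<noteq> 0" if "s \<in> path_image (rectpath (Complex (-1) (- Y n)) (Complex 1 (Y n)))" for s
   proof
    assume "1 - exp (- (2 * of_real pi * s)) = 0"
    then obtain m :: int where m: "s = Complex 0 (of_int m)" using exp_2pi_eq_1[of s] by auto
    have "Im s = Y n \<or> Im s = - Y n" using that m by (auto simp: path_image_rectpath Y_def)
    then have "of_real (- exp (- (2 * pi * Re s))) = (1::complex)"
     using aux[of "Im s" n "Re s"] \<open>1 - exp (- (2 * of_real pi * s)) = 0\<close>
     by (simp only: complex_surj right_minus_eq)
    then have "- exp (- (2 * pi * Re s)) = 1" unfolding of_real_eq_1_iff .
    then show False using exp_gt_zero[of "- (2 * pi * Re s)"] by linarith
   qed
   then show ?thesis unfolding theta_kernel_def by (intro continuous_intros) auto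
  qed
 qed (use inta theta_kernel_line_integral(1)[OF t] in auto)
 then have "?R \<longlonglongrightarrow> 2 * \<i> * J" unfolding Ja J_def[symmetric] by (simp add: algebra_simps)
 moreover have "?R \<longlonglongrightarrow> 2 * \<i> * (1 + 2 * of_real (theta_tail t))"
 proof -
  have "(\<lambda>N. \<Sum>k<N. complex_of_real (exp (- (pi * (real (Suc k))\<^sup>2 * t)))) \<longlonglongrightarrow> of_real (theta_tail t)"
   unfolding theta_tail_def using summable_LIMSEQ[OF summable_theta_tail[OF t]] by (simp only: of_real_sum[symmetric] tendsto_of_real_iff)
  then show ?thesis unfolding Y_def theta_kernel_contour[OF t] by (intro tendsto_intros)
 qed
 ultimately have "2 * \<i> * J = 2 * \<i> * (1 + 2 * of_real (theta_tail t))" by (rule LIMSEQ_unique)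
 then have "J = of_real (1 + 2 * theta_tail t)" by simp
 then have "of_real ((1 + 2 * theta_tail (1 / t)) / sqrt t) = complex_of_real (1 + 2 * theta_tail t)"
  unfolding J_def theta_kernel_line_integral(2)[OF t] .
 then have "(1 + 2 * theta_tail (1 / t)) / sqrt t = 1 + 2 * theta_tail t" unfolding of_real_eq_iff .
 then show ?thesis using t by (simp add: field_simps)
qed

subsection \<open>The xi function\<close>

text \<open>Expanding the exponential and integrating termwise gives a power series in s that
  converges everywhere, so holomorphy follows without differentiating under the integral. The
  majorant exp (r |u|) with r = |s| + 1 dominates all partial sums.\<close>

lemma exponential_moment_holomorphic:
 fixes g :: "real \<Rightarrow> complex"
 assumes int: "\<And>r. r > 0 \<Longrightarrow> integrable lborel (\<lambda>u. norm (g u) * exp (r * \<bar>u\<bar>))"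
  and meas: "g \<in> borel_measurable lborel"
 shows "integrable lborel (\<lambda>u. g u * exp (s * of_real u))"
  and "(\<lambda>s. LINT u|lborel. g u * exp (s * of_real u)) holomorphic_on UNIV"
proof -
 note [measurable] = meas
 show "integrable lborel (\<lambda>u. g u * exp (s * of_real u))" for s
 proof (rule Bochner_Integration.integrable_bound[OF int[of "\<bar>Re s\<bar> + 1"]])
  show "AE u in lborel. norm (g u * exp (s * of_real u)) \<le> norm (norm (g u) * exp ((\<bar>Re s\<bar> + 1) * \<bar>u\<bar>))"
  proof (rule AE_I2)
   fix u :: real
   have "Re s * u \<le> \<bar>Re s\<bar> * \<bar>u\<bar>" by (metis abs_ge_self abs_mult)
   then have "exp (Re s * u) \<le> exp ((\<bar>Re s\<bar> + 1) * \<bar>u\<bar>)" by (simp add: distrib_right)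
   then show "norm (g u * exp (s * of_real u)) \<le> norm (norm (g u) * exp ((\<bar>Re s\<bar> + 1) * \<bar>u\<bar>))"
    by (simp add: norm_mult mult_left_mono)
  qed
 qed auto
 define a where "a = (\<lambda>k. LINT u|lborel. g u * of_real (u ^ k / fact k))"
 have series: "(\<lambda>k. a k * s ^ k) sums (LINT u|lborel. g u * exp (s * of_real u))" for s
 proof -
  define f where "f = (\<lambda>k u. g u * of_real (u ^ k / fact k) * s ^ k)"
  define r where "r = norm s + 1"
  have r: "r > 0" "norm s \<le> r" by (auto simp: r_def add_nonneg_pos)
  have nf: "norm (f k u) = norm (g u) * ((norm s * \<bar>u\<bar>) ^ k / fact k)" for k u
   by (simp add: f_def norm_mult norm_power norm_divide power_mult_distrib)
  have psum: "(\<Sum>k\<in>K. norm (f k u)) \<le> norm (g u) * exp (r * \<bar>u\<bar>)" if "finite K" for K u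
  proof -
   have es: "(\<lambda>k. (norm s * \<bar>u\<bar>) ^ k / fact k) sums exp (norm s * \<bar>u\<bar>)"
    using exp_converges[of "norm s * \<bar>u\<bar>"] by (simp add: field_simps)
   have "(\<Sum>k\<in>K. (norm s * \<bar>u\<bar>) ^ k / fact k) \<le> exp (norm s * \<bar>u\<bar>)"
    using sum_le_suminf[OF sums_summable[OF es] that] es by (simp add: sums_iff)
   also have "\<dots> \<le> exp (r * \<bar>u\<bar>)" using r by (simp add: mult_right_mono)
   finally show ?thesis unfolding nf sum_distrib_left[symmetric] by (rule mult_left_mono) simp
  qed
  have fint: "integrable lborel (f k)" for k
  proof (rule Bochner_Integration.integrable_bound[OF int[OF r(1)]])
   show "f k \<in> borel_measurable lborel" unfolding f_def by measurable
   show "AE u in lborel. norm (f k u) \<le> norm (norm (g u) * exp (r * \<bar>u\<bar>))"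
    using psum[of "{k}"] by auto
  qed
  have "(\<lambda>k. LINT u|lborel. f k u) sums (LINT u|lborel. (\<Sum>k. f k u))"
  proof (rule sums_integral[OF fint])
   show "AE u in lborel. summable (\<lambda>k. norm (f k u))"
    using psum by (intro AE_I2 bounded_imp_summable[where B = "norm (g u) * exp (r * \<bar>u\<bar>)" for u]) auto
   show "summable (\<lambda>k. LINT u|lborel. norm (f k u))"
   proof (rule bounded_imp_summable)
    fix N
    have "(\<Sum>k\<le>N. LINT u|lborel. norm (f k u)) = (LINT u|lborel. (\<Sum>k\<le>N. norm (f k u)))"
     using fint by (subst Bochner_Integration.integral_sum) auto
    also have "\<dots> \<le> (LINT u|lborel. norm (g u) * exp (r * \<bar>u\<bar>))"
     using psum fint int[OF r(1)] by (intro integral_mono) auto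
    finally show "(\<Sum>k\<le>N. LINT u|lborel. norm (f k u)) \<le> (LINT u|lborel. norm (g u) * exp (r * \<bar>u\<bar>))" .
   qed auto
  qed
  moreover have "(LINT u|lborel. f k u) = a k * s ^ k" for k
   unfolding f_def a_def by simp
  moreover have "(\<Sum>k. f k u) = g u * exp (s * of_real u)" for u
  proof -
   have "(\<lambda>k. g u * ((s * of_real u) ^ k /\<^sub>R fact k)) sums (g u * exp (s * of_real u))"
    by (intro sums_mult exp_converges)
   moreover have "g u * ((s * of_real u) ^ k /\<^sub>R fact k) = f k u" for k
    by (simp add: f_def scaleR_conv_of_real power_mult_distrib field_simps)
   ultimately show ?thesis by (simp add: sums_iff)
  qed
  ultimately show ?thesis by simp
 qed
 have "(\<lambda>s. LINT u|lborel. g u * exp (s * of_real u)) holomorphic_on ball 0 (norm w + 1)" for w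
  by (rule power_series_holomorphic[where a = a]) (use series in auto)
 then have "(\<lambda>s. LINT u|lborel. g u * exp (s * of_real u)) field_differentiable (at w)" for w
  by (rule holomorphic_on_imp_differentiable_at[of _ "ball 0 (norm w + 1)"]) auto
 then show "(\<lambda>s. LINT u|lborel. g u * exp (s * of_real u)) holomorphic_on UNIV"
  by (simp add: holomorphic_on_def field_differentiable_at_within)
qed

lemma theta_tail_bounds:
 assumes "t > 0"
 shows "0 \<le> theta_tail t" and "t \<ge> 1 \<Longrightarrow> theta_tail t \<le> 2 * exp (- (pi * t))"
proof -
 show "0 \<le> theta_tail t"
  unfolding theta_tail_def by (intro suminf_nonneg summable_theta_tail assms) auto
 assume t: "t \<ge> 1"
 have e: "exp (- (pi * t)) \<le> 1 / 2"
 proof -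
  have "1 \<le> pi * t" using t pi_gt3 by (intro order_trans[OF _ mult_mono[of 1 pi 1 t]]) auto
  then have "2 \<le> exp (pi * t)" using exp_ge_add_one_self[of "pi * t"] by linarith
  then show ?thesis by (simp add: exp_minus field_simps)
 qed
 have gs: "(\<lambda>n. exp (- (pi * t)) * exp (- (pi * t)) ^ n) sums (exp (- (pi * t)) * (1 / (1 - exp (- (pi * t)))))"
  using assms by (intro sums_mult geometric_sums) simp
 have "theta_tail t \<le> exp (- (pi * t)) * (1 / (1 - exp (- (pi * t))))"
  unfolding theta_tail_def
  using suminf_le[OF exp_square_le_geometric[OF assms] summable_theta_tail[OF assms] sums_summable[OF gs]] gs
  by (simp add: sums_iff)
 also have "\<dots> \<le> exp (- (pi * t)) * 2"
 proof (rule mult_left_mono)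
  have "0 < 1 - exp (- (pi * t))" using e by linarith
  then show "1 / (1 - exp (- (pi * t))) \<le> 2" using e by (simp add: pos_divide_le_eq)
 qed simp
 finally show "theta_tail t \<le> 2 * exp (- (pi * t))" by simp
qed

text \<open>In the variable u with t = exp (2 u), this carries the part t \<ge> 1 of the Mellin
  integral of \<theta> - 1; the part t < 1 is folded onto it by
  \<open>theta_tail_inversion\<close>.\<close>

definition theta_density :: "real \<Rightarrow> complex" where
 "theta_density u = of_real (indicator {0..} u * (2 * theta_tail (exp (2 * u))))"

lemma theta_density_measurable [measurable]: "theta_density \<in> borel_measurable lborel"
 unfolding theta_density_def theta_tail_def by measurable

text \<open>The tail decays doubly exponentially in u. Comparison with a Gaussian, by way of
  \<open>2 * u\<^sup>2 \<le> exp (2 * u)\<close>, already beats every exp (r u).\<close>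

lemma theta_density_moments:
 assumes "r > 0"
 shows "integrable lborel (\<lambda>u. norm (theta_density u) * exp (r * \<bar>u\<bar>))"
proof (rule Bochner_Integration.integrable_bound[OF integrable_gaussian_exp[of 1 "4 * exp (r\<^sup>2)"]])
 show "AE u in lborel. norm (norm (theta_density u) * exp (r * \<bar>u\<bar>)) \<le> norm (4 * exp (r\<^sup>2) * exp (- (1 * u\<^sup>2)))"
 proof (rule AE_I2)
  fix u :: real
  show "norm (norm (theta_density u) * exp (r * \<bar>u\<bar>)) \<le> norm (4 * exp (r\<^sup>2) * exp (- (1 * u\<^sup>2)))"
  proof (cases "u \<ge> 0")
   case True
   have "theta_tail (exp (2 * u)) \<le> 2 * exp (- (pi * exp (2 * u)))"
    using True by (intro theta_tail_bounds(2)) auto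
   moreover have "2 * u\<^sup>2 \<le> exp (2 * u)"
    using exp_lower_Taylor_quadratic[of "2 * u"] True by (simp add: power2_eq_square)
   then have "3 * (2 * u\<^sup>2) \<le> pi * exp (2 * u)" using pi_gt3 by (intro mult_mono) auto
   then have "exp (- (pi * exp (2 * u))) \<le> exp (- (6 * u\<^sup>2))" by simp
   ultimately have "2 * theta_tail (exp (2 * u)) \<le> 4 * exp (- (6 * u\<^sup>2))" by linarith
   then have "2 * theta_tail (exp (2 * u)) * exp (r * u) \<le> 4 * exp (- (6 * u\<^sup>2)) * exp (r * u)"
    by (intro mult_right_mono) auto
   also have "\<dots> = 4 * exp (- (6 * u\<^sup>2) + r * u)" by (simp only: exp_add mult.assoc)
   also have "\<dots> \<le> 4 * exp (r\<^sup>2 - u\<^sup>2)"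
   proof -
    have "0 \<le> (r - u)\<^sup>2 + r\<^sup>2 + 9 * u\<^sup>2" by simp
    then have "- (6 * u\<^sup>2) + r * u \<le> r\<^sup>2 - u\<^sup>2" by (simp add: power2_eq_square algebra_simps)
    then show ?thesis by simp
   qed
   also have "\<dots> = 4 * exp (r\<^sup>2) * exp (- (1 * u\<^sup>2))" by (simp add: exp_diff exp_minus field_simps)
   finally show ?thesis
    using True theta_tail_bounds(1)[of "exp (2 * u)"] by (simp add: theta_density_def)
  qed (simp add: theta_density_def)
 qed
qed auto

definition theta_moment :: "complex \<Rightarrow> complex" where
 "theta_moment s = (LINT u|lborel. theta_density u * exp (s * of_real u))"

lemma theta_moment_integrable: "integrable lborel (\<lambda>u. theta_density u * exp (s * of_real u))"
 by (rule exponential_moment_holomorphic(1)[OF theta_density_moments theta_density_measurable])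

lemma holomorphic_theta_moment: "theta_moment holomorphic_on UNIV"
 unfolding theta_moment_def[abs_def]
 by (rule exponential_moment_holomorphic(2)[OF theta_density_moments theta_density_measurable])

text \<open>Twice the usual \<xi> of Riemann, so that the values at 0 and 1 are 1. In this form it
  is visibly entire and symmetric under the reflection s to 1 - s, before any relation to \<zeta> is
  established.\<close>

definition riemann_xi :: "complex \<Rightarrow> complex" where
 "riemann_xi s = 1 - s * (1 - s) * (theta_moment s + theta_moment (1 - s))"

lemma holomorphic_riemann_xi: "riemann_xi holomorphic_on A"
proof -
 have "theta_moment \<circ> (\<lambda>s. 1 - s) holomorphic_on UNIV"
  by (rule holomorphic_on_compose_gen[OF _ holomorphic_theta_moment]) (auto intro!: holomorphic_intros)
 then have "riemann_xi holomorphic_on UNIV"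
  unfolding riemann_xi_def[abs_def] o_def using holomorphic_theta_moment by (intro holomorphic_intros)
 then show ?thesis by (rule holomorphic_on_subset) simp
qed

lemma riemann_xi_reflect: "riemann_xi (1 - s) = riemann_xi s"
 by (simp add: riemann_xi_def algebra_simps)

lemma riemann_xi_0 [simp]: "riemann_xi 0 = 1" and riemann_xi_1 [simp]: "riemann_xi 1 = 1"
 by (simp_all add: riemann_xi_def)

lemma theta_moment_cnj: "theta_moment (cnj s) = cnj (theta_moment s)"
proof -
 have "theta_density u * exp (cnj s * of_real u) = cnj (theta_density u * exp (s * of_real u))" for u
  by (simp add: theta_density_def exp_cnj)
 then show ?thesis unfolding theta_moment_def
  by (simp only: Bochner_Integration.integral_cnj)
qed

lemma riemann_xi_cnj: "riemann_xi (cnj s) = cnj (riemann_xi s)"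
 using theta_moment_cnj[of s] theta_moment_cnj[of "1 - s"] by (simp add: riemann_xi_def)

lemma norm_theta_moment_le:
 assumes "\<bar>Re s\<bar> \<le> r" "r > 0"
 shows "norm (theta_moment s) \<le> (LINT u|lborel. norm (theta_density u) * exp (r * \<bar>u\<bar>))"
proof -
 have "norm (theta_moment s) \<le> (LINT u|lborel. norm (theta_density u * exp (s * of_real u)))"
  unfolding theta_moment_def by (rule integral_norm_bound)
 also have "\<dots> \<le> (LINT u|lborel. norm (theta_density u) * exp (r * \<bar>u\<bar>))"
 proof (rule integral_mono[OF integrable_norm[OF theta_moment_integrable] theta_density_moments[OF assms(2)]])
  fix u :: real
  have "Re s * u \<le> \<bar>Re s\<bar> * \<bar>u\<bar>" by (metis abs_ge_self abs_mult)
  also have "\<dots> \<le> r * \<bar>u\<bar>" using assms by (intro mult_right_mono) auto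
  finally show "norm (theta_density u * exp (s * of_real u)) \<le> norm (theta_density u) * exp (r * \<bar>u\<bar>)"
   by (simp add: norm_mult mult_left_mono)
 qed
 finally show ?thesis .
qed

section \<open>Mellin transform of the theta series\<close>

lemma mellin_exp:
 fixes c :: real and s :: complex
 assumes c: "c > 0" and s: "Re s > 0"
 shows "integrable lborel (\<lambda>u. of_real (2 * exp (- (c * exp (2 * u)))) * exp (s * of_real u))"
  and "(LINT u|lborel. of_real (2 * exp (- (c * exp (2 * u)))) * exp (s * of_real u)) =
   of_real c powr (- (s / 2)) * Gamma (s / 2)"
proof -
 define f where "f = (\<lambda>t::real. of_real t powr (s / 2 - 1) / of_real (exp t))"
 \<comment> \<open>The substitution t = c exp (2 u) in the Gamma integral at s / 2.\<close>
 define g where "g = (\<lambda>u::real. c * exp (2 * u))"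
 define F where "F = (\<lambda>u::real. of_real (2 * exp (- (c * exp (2 * u)))) * exp (s * of_real u))"
 have rg: "g ` UNIV = {0<..}"
 proof
  show "{0<..} \<subseteq> g ` UNIV"
  proof
   fix x :: real assume "x \<in> {0<..}"
   then have "x = g (ln (x / c) / 2)" using c by (simp add: g_def)
   then show "x \<in> g ` UNIV" by blast
  qed
 qed (use c in \<open>auto simp: g_def\<close>)
 have sub: "(\<lambda>x. \<bar>2 * g x\<bar> *\<^sub>R f (g x)) absolutely_integrable_on UNIV \<and> integral UNIV (\<lambda>x. \<bar>2 * g x\<bar> *\<^sub>R f (g x)) = Gamma (s / 2)"
 proof (subst has_absolute_integral_change_of_variables_real)
  show "(g has_field_derivative 2 * g x) (at x within UNIV)" for x
   unfolding g_def by (auto intro!: derivative_eq_intros)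
  show "inj_on g UNIV" using c by (auto simp: inj_on_def g_def)
  have "Re (s / 2) > 0" using s by simp
  then show "f absolutely_integrable_on range g \<and> integral (range g) f = Gamma (s / 2)"
   unfolding rg f_def using absolutely_integrable_Gamma_integral'[of "s / 2"] Gamma_integral_complex'[of "s / 2"]
   by (auto intro: integral_unique)
 qed auto
 have eq: "\<bar>2 * g u\<bar> *\<^sub>R f (g u) = of_real c powr (s / 2) * F u" for u
 proof -
  have gp: "g u > 0" using c by (simp add: g_def)
  have "of_real (g u) powr (s / 2 - 1) = of_real (g u) powr (s / 2) / of_real (g u)"
   using gp by (simp add: powr_diff)
  also have "of_real (g u) powr (s / 2) = of_real c powr (s / 2) * exp (s * of_real u)"
  proof -
   have "of_real (g u) powr (s / 2) = exp (s / 2 * of_real (ln (g u)))"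
    using gp by (simp add: powr_def Ln_of_real)
   also have "ln (g u) = ln c + 2 * u" using c by (simp add: g_def ln_mult)
   also have "exp (s / 2 * of_real (ln c + 2 * u)) = exp (s / 2 * of_real (ln c)) * exp (s * of_real u)"
    by (simp add: exp_add[symmetric] algebra_simps)
   also have "exp (s / 2 * of_real (ln c)) = of_real c powr (s / 2)"
    using c by (simp add: powr_def Ln_of_real)
   finally show ?thesis .
  qed
  finally show ?thesis using gp unfolding f_def F_def
   by (simp add: scaleR_conv_of_real g_def exp_minus field_simps)
 qed
 have cz: "of_real c powr (s / 2) \<noteq> (0::complex)" using c by simp
 have "integrable lebesgue (\<lambda>u. of_real c powr (s / 2) * F u)"
  using sub unfolding eq by (simp add: set_integrable_def)
 then have "integrable lborel (\<lambda>u. of_real c powr (s / 2) * F u)"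
  by (subst (asm) integrable_completion) (auto simp: F_def)
 then have "integrable lborel (\<lambda>u. inverse (of_real c powr (s / 2)) * (of_real c powr (s / 2) * F u))"
  by (rule integrable_mult_right)
 moreover have "(\<lambda>u. inverse (of_real c powr (s / 2)) * (of_real c powr (s / 2) * F u)) = F"
  using cz by (simp add: fun_eq_iff mult.assoc[symmetric])
 ultimately show i: "integrable lborel F" by (simp only:)
 have "(LINT u|lborel. F u) = integral UNIV F"
  using has_integral_integral_lborel[OF i] by (simp add: integral_unique)
 moreover have "Gamma (s / 2) = of_real c powr (s / 2) * integral UNIV F"
  using sub unfolding eq by simp
 ultimately show "(LINT u|lborel. F u) = of_real c powr (- (s / 2)) * Gamma (s / 2)"
  using cz by (simp add: powr_minus)
qed

definition zeta_series :: "complex \<Rightarrow> complex" where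
 "zeta_series s = (\<Sum>n. 1 / of_nat (Suc n) powr s)"

lemma norm_inverse_nat_powr: "norm (1 / of_nat (Suc n) powr s :: complex) = real (Suc n) powr (- Re s)"
proof -
 have "norm (of_nat (Suc n) powr s :: complex) = real (Suc n) powr Re s"
  using norm_powr_real_powr[of "of_nat (Suc n)" s] by simp
 then show ?thesis by (simp only: norm_divide norm_one powr_minus_divide)
qed

lemma summable_zeta_real:
 assumes "x > 1"
 shows "summable (\<lambda>n. real (Suc n) powr (- x))"
 using assms summable_real_powr_iff[of "- x"] summable_Suc_iff[of "\<lambda>n. real n powr (-x)"] by simp

lemma zeta_series_summable:
 assumes "Re s > 1"
 shows "summable (\<lambda>n. norm (1 / of_nat (Suc n) powr s :: complex))"
 unfolding norm_inverse_nat_powr using summable_zeta_real assms by blast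

lemma theta_full_mellin:
 assumes s: "Re s > 1"
 shows "integrable lborel (\<lambda>u. of_real (2 * theta_tail (exp (2 * u))) * exp (s * of_real u))"
  and "(LINT u|lborel. of_real (2 * theta_tail (exp (2 * u))) * exp (s * of_real u)) =
   of_real pi powr (- (s / 2)) * Gamma (s / 2) * zeta_series s"
proof -
 define c where "c = (\<lambda>n. pi * (real (Suc n))\<^sup>2)"
 have c: "c n > 0" for n by (simp add: c_def)
 define f where "f = (\<lambda>n u. of_real (2 * exp (- (c n * exp (2 * u)))) * exp (s * of_real u))"
 have cp: "of_real (c n) powr (- (w / 2)) = of_real pi powr (- (w / 2)) * (1 / of_nat (Suc n) powr w)" for n and w :: complex
 proof -
  let ?l = "complex_of_real (ln (real (Suc n)))"
  have l: "ln (c n) = ln pi + 2 * ln (real (Suc n))" unfolding c_def by (simp add: ln_mult ln_realpow)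
  have "of_real (c n) powr (- (w / 2)) = exp (- (w / 2) * of_real (ln (c n)))"
   using c[of n] by (simp add: powr_def Ln_of_real)
  also have "- (w / 2) * of_real (ln (c n)) = - (w / 2) * of_real (ln pi) + - (w * ?l)"
   unfolding l by (simp add: algebra_simps del: of_nat_Suc)
  also have "exp (- (w / 2) * of_real (ln pi) + - (w * ?l)) = exp (- (w / 2) * of_real (ln pi)) * (1 / exp (w * ?l))"
   by (simp only: exp_add exp_minus divide_inverse mult_1)
  also have "exp (w * ?l) = of_nat (Suc n) powr w"
   using Ln_of_real[of "real (Suc n)"] by (simp add: powr_def del: of_nat_Suc)
  also have "exp (- (w / 2) * of_real (ln pi)) = of_real pi powr (- (w / 2))"
   by (simp add: powr_def Ln_of_real)
  finally show ?thesis .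
 qed
 have fint: "integrable lborel (f n)" for n unfolding f_def using s by (intro mellin_exp c) auto
 have fval: "(LINT u|lborel. f n u) = of_real pi powr (- (s / 2)) * Gamma (s / 2) * (1 / of_nat (Suc n) powr s)" for n
  unfolding f_def using s mellin_exp(2)[OF c, of s n] cp[of n s] by simp
 \<comment> \<open>The norm of a term is the same term at the real point Re s, so the Mellin formula
   itself evaluates the integrals of the norms and shows that they are summable.\<close>
 have nf: "complex_of_real (norm (f n u)) = of_real (2 * exp (- (c n * exp (2 * u)))) * exp (of_real (Re s) * of_real u)" for n u
  unfolding f_def norm_mult norm_exp_eq_Re by (simp add: exp_of_real[symmetric])
 have nval: "complex_of_real (LINT u|lborel. norm (f n u)) = of_real pi powr (- (of_real (Re s) / 2)) * Gamma (of_real (Re s) / 2) * (1 / of_nat (Suc n) powr of_real (Re s))" for n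
 proof -
  have "complex_of_real (LINT u|lborel. norm (f n u)) = (LINT u|lborel. complex_of_real (norm (f n u)))"
   by simp
  also have "\<dots> = of_real (c n) powr (- (of_real (Re s) / 2)) * Gamma (of_real (Re s) / 2)"
   unfolding nf using s by (intro mellin_exp(2) c) auto
  finally show ?thesis unfolding cp by simp
 qed
 have "Re (complex_of_real (Re s)) > 1" using s by simp
 then have "summable (\<lambda>n. 1 / of_nat (Suc n) powr of_real (Re s) :: complex)"
  by (rule summable_norm_cancel[OF zeta_series_summable])
 then have "summable (\<lambda>n. complex_of_real (LINT u|lborel. norm (f n u)))"
  unfolding nval by (rule summable_mult)
 then have s2: "summable (\<lambda>n. LINT u|lborel. norm (f n u))"
  by (simp only: summable_of_real_iff)
 have th: "(\<lambda>n. exp (- (c n * exp (2 * u)))) sums theta_tail (exp (2 * u))" for u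
  unfolding theta_tail_def c_def by (intro summable_sums summable_theta_tail) auto
 have s1: "summable (\<lambda>n. norm (f n u))" for u
 proof -
  have "norm (f n u) = 2 * exp (Re s * u) * exp (- (c n * exp (2 * u)))" for n
   unfolding f_def norm_mult norm_exp_eq_Re by simp
  then show ?thesis using sums_summable[OF th[of u]] by (simp add: summable_mult)
 qed
 have sm: "(\<Sum>n. f n u) = of_real (2 * theta_tail (exp (2 * u))) * exp (s * of_real u)" for u
 proof -
  have "(\<lambda>n. complex_of_real (2 * exp (- (c n * exp (2 * u)))) * exp (s * of_real u)) sums (of_real (2 * theta_tail (exp (2 * u))) * exp (s * of_real u))"
   by (intro sums_mult2 sums_of_real sums_mult th)
  then show ?thesis unfolding f_def by (simp add: sums_iff)
 qed
 show "integrable lborel (\<lambda>u. of_real (2 * theta_tail (exp (2 * u))) * exp (s * of_real u))"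
  unfolding sm[symmetric] using s1 by (intro integrable_suminf fint s2) auto
 have "(LINT u|lborel. of_real (2 * theta_tail (exp (2 * u))) * exp (s * of_real u)) = (\<Sum>n. LINT u|lborel. f n u)"
  unfolding sm[symmetric] using s1 by (intro integral_suminf fint s2) auto
 also have "\<dots> = of_real pi powr (- (s / 2)) * Gamma (s / 2) * zeta_series s"
  unfolding fval zeta_series_def using summable_norm_cancel[OF zeta_series_summable[OF s]] by (intro suminf_mult)
 finally show "(LINT u|lborel. of_real (2 * theta_tail (exp (2 * u))) * exp (s * of_real u)) =
   of_real pi powr (- (s / 2)) * Gamma (s / 2) * zeta_series s" .
qed

lemma exp_integral_half_line:
 fixes w :: complex
 assumes "Re w > 0"
 shows "integrable lborel (\<lambda>u. of_real (indicator {0<..} u) * exp (- w * of_real u))"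
  and "(LINT u|lborel. of_real (indicator {0<..} u) * exp (- w * of_real u)) = 1 / w"
proof -
 have r: "integrable lborel (\<lambda>u. indicator {0<..} u *\<^sub>R exp (- (Re w * u)))"
 proof -
  have "set_integrable lborel {0<..} (\<lambda>x. exp (- (x * Re w)))" by (rule integrable_I0i_exp_mscale[OF assms])
  then show ?thesis unfolding set_integrable_def by (simp only: mult.commute)
 qed
 show i: "integrable lborel (\<lambda>u. of_real (indicator {0<..} u) * exp (- w * of_real u))"
  by (rule Bochner_Integration.integrable_bound[OF r]) (auto simp: norm_mult indicator_def)
 have "(LBINT x=ereal 0..\<infinity>. exp (- w * of_real x)) = 0 - (- 1 / w)"
 proof (rule interval_integral_FTC_integrable[where F = "\<lambda>x. - exp (- w * of_real x) / w"])
  fix x :: real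
  have "((\<lambda>z. - exp (- w * z) / w) has_field_derivative exp (- w * of_real x)) (at (of_real x))"
   using assms by (auto intro!: derivative_eq_intros)
  then show "((\<lambda>x. - exp (- w * of_real x) / w) has_vector_derivative exp (- w * of_real x)) (at x)"
   by (rule has_vector_derivative_real_field)
  show "isCont (\<lambda>x. exp (- w * complex_of_real x)) x" by (intro continuous_intros)
 next
  show "set_integrable lborel (einterval (ereal 0) \<infinity>) (\<lambda>x. exp (- w * complex_of_real x))"
   using i by (simp add: set_integrable_def scaleR_conv_of_real einterval_eq_Ici greaterThan_def[symmetric] einterval_def)
  have "((\<lambda>x. - exp (- w * of_real x) / w) \<longlongrightarrow> - exp (- w * of_real 0) / w) (at_right 0)"
   using assms by (intro tendsto_intros) auto
  then show "(((\<lambda>x. - exp (- w * complex_of_real x) / w) \<circ> real_of_ereal) \<longlongrightarrow> - 1 / w) (at_right (ereal 0))"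
   by (simp add: ereal_tendsto_simps)
  have "((\<lambda>x. - exp (- w * of_real x) / w) \<longlongrightarrow> 0) at_top"
  proof (rule Lim_null_comparison)
   have "w \<noteq> 0" using assms by auto
   then have "norm w > 0" by simp
   then show "((\<lambda>x. exp (- (Re w * x)) / norm w) \<longlongrightarrow> 0) at_top" using assms by real_asymp
  qed (auto simp: norm_divide)
  then show "(((\<lambda>x. - exp (- w * complex_of_real x) / w) \<circ> real_of_ereal) \<longlongrightarrow> 0) (at_left \<infinity>)"
   by (simp add: ereal_tendsto_simps)
 qed auto
 then show "(LINT u|lborel. of_real (indicator {0<..} u) * exp (- w * of_real u)) = 1 / w"
  by (simp add: interval_lebesgue_integral_def set_lebesgue_integral_def scaleR_conv_of_real einterval_def greaterThan_def[symmetric])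
qed

text \<open>The half line u < 0 is reflected onto u > 0. By the inversion formula it turns into
  \<open>theta_moment (1 - s)\<close> and two elementary exponential integrals, which account for
  the terms 1 / (s - 1) and 1 / s.\<close>

lemma xi_eq_zeta_series:
 assumes s: "Re s > 1"
 shows "of_real pi powr (- (s / 2)) * Gamma (s / 2) * zeta_series s =
  theta_moment s + theta_moment (1 - s) + 1 / (s - 1) - 1 / s"
proof -
 define h where "h = (\<lambda>u. of_real (2 * theta_tail (exp (2 * u))) * exp (s * of_real u))"
 have hi: "integrable lborel h" unfolding h_def by (rule theta_full_mellin(1)[OF s])
 have i1: "integrable lborel (\<lambda>u. indicator {0..} u *\<^sub>R h u)" by (intro integrable_mult_indicator hi) auto
 have i2: "integrable lborel (\<lambda>u. indicator {..<0} u *\<^sub>R h u)" by (intro integrable_mult_indicator hi) auto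
 have "(LINT u|lborel. h u) = (LINT u|lborel. indicator {0..} u *\<^sub>R h u + indicator {..<0} u *\<^sub>R h u)"
  by (intro Bochner_Integration.integral_cong refl) (auto simp: indicator_def)
 also have "\<dots> = (LINT u|lborel. indicator {0..} u *\<^sub>R h u) + (LINT u|lborel. indicator {..<0} u *\<^sub>R h u)"
  by (rule Bochner_Integration.integral_add[OF i1 i2])
 also have "(LINT u|lborel. indicator {0..} u *\<^sub>R h u) = theta_moment s"
  unfolding theta_moment_def h_def theta_density_def by (intro Bochner_Integration.integral_cong refl) (auto simp: indicator_def)
 also have "(LINT u|lborel. indicator {..<0} u *\<^sub>R h u) = (LINT u|lborel. indicator {..<0} (0 + (-1) * u) *\<^sub>R h (0 + (-1) * u))"
  using lborel_integral_real_affine[of "-1" "\<lambda>u. indicator {..<0} u *\<^sub>R h u" 0] by simp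
 also have "\<dots> = (LINT u|lborel. theta_density u * exp ((1 - s) * of_real u) +
   (of_real (indicator {0<..} u) * exp (- (s - 1) * of_real u) - of_real (indicator {0<..} u) * exp (- s * of_real u)))"
 proof (rule integral_cong_AE)
  show "AE u in lborel. indicator {..<0} (0 + (-1) * u) *\<^sub>R h (0 + (-1) * u) = theta_density u * exp ((1 - s) * of_real u) +
   (of_real (indicator {0<..} u) * exp (- (s - 1) * of_real u) - of_real (indicator {0<..} u) * exp (- s * of_real u))"
   \<comment> \<open>At u = 0 the two sides differ: the indicator on the left is 0 there, while
     \<open>theta_density 0\<close> is positive.\<close>
   using AE_lborel_singleton[of 0]
  proof eventually_elim
   case (elim u)
   show ?case
   proof (cases "u > 0")
    case True
    define E where "E = exp u"
    have E: "E > 0" "exp (2 * u) = E\<^sup>2" "exp (- (2 * u)) = 1 / E\<^sup>2"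
     by (simp_all add: E_def exp_double exp_minus divide_inverse)
    have "1 + 2 * theta_tail (1 / E\<^sup>2) = sqrt (E\<^sup>2) * (1 + 2 * theta_tail (E\<^sup>2))"
     using E by (intro theta_tail_inversion) simp
    then have th: "2 * theta_tail (exp (2 * (0 + (-1) * u))) = E * (2 * theta_tail (exp (2 * u))) + E - 1"
     using E by (simp add: algebra_simps)
    have e1: "exp ((1 - s) * of_real u) = of_real E * exp (- s * of_real u)"
     by (simp add: E_def exp_of_real[symmetric] exp_add[symmetric] algebra_simps)
    have e2: "exp (- (s - 1) * of_real u) = of_real E * exp (- s * of_real u)"
     by (simp add: E_def exp_of_real[symmetric] exp_add[symmetric] algebra_simps)
    have "h (0 + (-1) * u) = of_real (E * (2 * theta_tail (exp (2 * u))) + E - 1) * exp (- s * of_real u)"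
     unfolding h_def th by simp
    then show ?thesis using True unfolding theta_density_def e1 e2 by (simp add: algebra_simps)
   qed (use elim in \<open>auto simp: theta_density_def indicator_def\<close>)
  qed
  show "(\<lambda>u. indicator {..<0} (0 + (-1) * u) *\<^sub>R h (0 + (-1) * u)) \<in> borel_measurable lborel"
   unfolding h_def theta_tail_def by measurable
 qed measurable
 also have "\<dots> = theta_moment (1 - s) + (1 / (s - 1) - 1 / s)"
  unfolding theta_moment_def using s exp_integral_half_line[of "s - 1"] exp_integral_half_line[of s] theta_moment_integrable[of "1 - s"]
  by (subst Bochner_Integration.integral_add) (auto simp: Bochner_Integration.integral_diff)
 finally have "(LINT u|lborel. h u) = theta_moment s + (theta_moment (1 - s) + (1 / (s - 1) - 1 / s))" .
 then show ?thesis unfolding h_def theta_full_mellin(2)[OF s] by simp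
qed

text \<open>The reciprocal \<open>rGamma (s / 2 + 1)\<close> is entire and equals 1 / ((s / 2) Gamma
  (s / 2)). It absorbs the factor s of \<xi>, so that s = 1 is the only remaining
  singularity.\<close>

definition zeta_cont :: "complex \<Rightarrow> complex" where
 "zeta_cont s = of_real pi powr (s / 2) * rGamma (s / 2 + 1) / 2 * riemann_xi s / (s - 1)"

lemma zeta_cont_eq_series:
 assumes s: "Re s > 1"
 shows "zeta_cont s = zeta_series s"
proof -
 have s0: "s \<noteq> 0" "s \<noteq> 1" "Re (s / 2) > 0" using s by auto
 have G: "Gamma (s / 2) \<noteq> 0" using s0 by (intro Gamma_nonzero) (auto elim!: nonpos_Ints_cases)
 have rG: "rGamma (s / 2 + 1) = 1 / (s / 2 * Gamma (s / 2))"
  using rGamma_plus1[of "s / 2"] s0 G by (simp add: rGamma_inverse_Gamma field_simps)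
 define A where "A = theta_moment s + theta_moment (1 - s)"
 define p where "p = (of_real pi powr (s / 2) :: complex)"
 have p: "p \<noteq> 0" "of_real pi powr (- (s / 2)) = 1 / p"
  unfolding p_def powr_minus inverse_eq_divide by simp_all
 have z: "1 / p * Gamma (s / 2) * zeta_series s = A + 1 / (s - 1) - 1 / s"
  using xi_eq_zeta_series[OF s] unfolding p(2) A_def .
 have "riemann_xi s = s * (s - 1) * (A + 1 / (s - 1) - 1 / s)"
  using s0 unfolding riemann_xi_def A_def[symmetric] by (simp add: field_simps)
 also have "\<dots> = s * (s - 1) * (1 / p * Gamma (s / 2) * zeta_series s)" unfolding z ..
 finally show ?thesis unfolding zeta_cont_def rG p_def[symmetric] using s0 p G by (simp add: field_simps)
qed

lemma holomorphic_zeta_cont: "zeta_cont holomorphic_on - {1}"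
 unfolding zeta_cont_def
 by (intro holomorphic_intros holomorphic_riemann_xi) auto

text \<open>Two continuations agree with the Dirichlet series on Re s > 1, hence on the connected
  punctured plane. The value 0 at s = 1 is the default of
  \<open>dirichlet_series_continuation\<close> outside its domain.\<close>

lemma riemann_zeta_eq:
 "riemann_zeta s = (if s = 1 then 0 else zeta_cont s)"
proof -
 let ?P = "\<lambda>f. f holomorphic_on - {1} \<and> (\<forall>s. s \<notin> - {1} \<longrightarrow> f s = 0) \<and>
   (\<forall>s. Re s > 1 \<longrightarrow> f s = (\<Sum>n. (\<lambda>_. 1 :: complex) (Suc n) / of_nat (Suc n) powr s))"
 let ?f = "\<lambda>s. if s = 1 then 0 else zeta_cont s"
 have "(THE f. ?P f) = ?f"
 proof (rule the_equality)
  have "?f holomorphic_on - {1} \<longleftrightarrow> zeta_cont holomorphic_on - {1}"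
   by (intro holomorphic_cong) auto
  then show "?P ?f" using holomorphic_zeta_cont zeta_cont_eq_series unfolding zeta_series_def by auto
 next
  fix f assume f: "?P f"
  show "f = ?f"
  proof
   fix s
   show "f s = ?f s"
   proof (cases "s = 1")
    case False
    have "f s = zeta_cont s"
    proof (rule analytic_continuation_open[of "{s. Re s > 1}" "- {1}" f zeta_cont])
     show "open {s::complex. 1 < Re s}" by (rule open_halfspace_Re_gt)
     have "2 \<in> {s::complex. 1 < Re s}" by simp
     then show "{s::complex. 1 < Re s} \<noteq> {}" by blast
     show "f z = zeta_cont z" if "z \<in> {s. 1 < Re s}" for z
      using f that zeta_cont_eq_series by (simp add: zeta_series_def)
     show "{s. 1 < Re s} \<subseteq> - {1::complex}" by auto
     show "connected (- {1::complex})" by (intro connected_punctured_universe) simp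
    qed (use f False holomorphic_zeta_cont in auto)
    then show ?thesis using False by simp
   qed (use f in auto)
  qed
 qed
 then show ?thesis unfolding riemann_zeta_def dirichlet_series_continuation_def by simp
qed

subsection \<open>The logarithmic derivative of zeta\<close>

definition nat_powr :: "complex \<Rightarrow> nat \<Rightarrow> complex" where
 "nat_powr s n = of_nat n powr (- s)"

lemma nat_powr_Suc: "nat_powr s (Suc n) = 1 / of_nat (Suc n) powr s"
 by (simp only: nat_powr_def powr_minus inverse_eq_divide)

lemma nat_powr_exp: "n > 0 \<Longrightarrow> nat_powr s n = exp (- s * of_real (ln (real n)))"
 using Ln_of_real[of "real n"] by (simp add: nat_powr_def powr_def)

lemma nat_powr_mult: "a > 0 \<Longrightarrow> b > 0 \<Longrightarrow> nat_powr s (a * b) = nat_powr s a * nat_powr s b"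
 by (simp add: nat_powr_exp ln_mult exp_add[symmetric] algebra_simps)

lemma norm_nat_powr: "n > 0 \<Longrightarrow> norm (nat_powr s n) = real n powr (- Re s)"
 by (simp add: nat_powr_exp powr_def)

lemma nat_powr_has_derivative:
 assumes "n > 0"
 shows "((\<lambda>s. nat_powr s n) has_field_derivative (- of_real (ln (real n)) * nat_powr s n)) (at s)"
 unfolding nat_powr_exp[OF assms] by (auto intro!: derivative_eq_intros)

lemma mangoldt_le_ln:
 assumes "n > 0"
 shows "mangoldt n \<le> ln (real n)"
proof -
 have "mangoldt n \<le> (\<Sum>d | d dvd n. mangoldt d :: real)"
  using assms by (intro member_le_sum) (auto simp: mangoldt_nonneg)
 then show ?thesis using assms mangoldt_sum[of n, where ?'a = real] by simp
qed

lemma summable_ln_powr: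
 assumes "x > 1"
 shows "summable (\<lambda>n. ln (real (Suc n)) * real (Suc n) powr (- x))"
proof -
 define e where "e = (x - 1) / 2"
 have e: "e > 0" "x - e > 1" using assms by (auto simp: e_def field_simps)
 show ?thesis
 proof (rule summable_comparison_test')
  show "summable (\<lambda>n. (1 / e) * real (Suc n) powr (- (x - e)))"
   using summable_zeta_real[OF e(2)] by (rule summable_mult)
  fix n :: nat
  have "ln (real (Suc n)) \<le> real (Suc n) powr e / e" using e by (intro ln_powr_bound) auto
  then have "ln (real (Suc n)) * real (Suc n) powr (- x) \<le> real (Suc n) powr e / e * real (Suc n) powr (- x)"
   by (rule mult_right_mono) simp
  also have "\<dots> = (1 / e) * real (Suc n) powr (- (x - e))"
   by (simp add: powr_add[symmetric] del: of_nat_Suc)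
  finally show "norm (ln (real (Suc n)) * real (Suc n) powr (- x)) \<le> (1 / e) * real (Suc n) powr (- (x - e))"
   by simp
 qed
qed

text \<open>On Re s > 1 this is minus the logarithmic derivative of \<zeta>, by
  \<open>zeta_series_deriv\<close> and \<open>zeta_series_nonzero\<close>.\<close>

definition mangoldt_series :: "complex \<Rightarrow> complex" where
 "mangoldt_series s = (\<Sum>n. mangoldt (Suc n) * nat_powr s (Suc n))"

lemma summable_mangoldt_powr:
 assumes "x > 1"
 shows "summable (\<lambda>n. mangoldt (Suc n) * real (Suc n) powr (- x))"
 by (rule summable_comparison_test'[OF summable_ln_powr[OF assms]])
   (auto simp: abs_mult mangoldt_nonneg intro!: mult_right_mono mangoldt_le_ln simp del: of_nat_Suc)

lemma norm_mangoldt_nat_powr: "norm (mangoldt (Suc n) * nat_powr s (Suc n)) = mangoldt (Suc n) * real (Suc n) powr (- Re s)"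
 by (simp add: norm_mult norm_nat_powr del: of_nat_Suc)

lemma mangoldt_series_summable:
 assumes "Re s > 1"
 shows "summable (\<lambda>n. norm (mangoldt (Suc n) * nat_powr s (Suc n) :: complex))"
 unfolding norm_mangoldt_nat_powr by (rule summable_mangoldt_powr[OF assms])

lemma norm_mangoldt_series_le:
 assumes "Re s \<ge> x" "x > 1"
 shows "norm (mangoldt_series s) \<le> (\<Sum>n. mangoldt (Suc n) * real (Suc n) powr (- x))"
proof -
 have s1: "Re s > 1" using assms by simp
 have "norm (mangoldt_series s) \<le> (\<Sum>n. norm (mangoldt (Suc n) * nat_powr s (Suc n)))"
  unfolding mangoldt_series_def by (rule summable_norm[OF mangoldt_series_summable[OF s1]])
 also have "\<dots> \<le> (\<Sum>n. mangoldt (Suc n) * real (Suc n) powr (- x))"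
 proof (rule suminf_le[OF _ mangoldt_series_summable[OF s1] summable_mangoldt_powr[OF assms(2)]])
  show "norm (mangoldt (Suc n) * nat_powr s (Suc n)) \<le> mangoldt (Suc n) * real (Suc n) powr (- x)" for n
   unfolding norm_mangoldt_nat_powr using assms by (intro mult_left_mono powr_mono) (auto simp: mangoldt_nonneg)
 qed
 finally show ?thesis .
qed

lemma has_sum_pos_nat:
 fixes f :: "nat \<Rightarrow> complex"
 assumes "summable (\<lambda>n. norm (f (Suc n)))"
 shows "(f has_sum (\<Sum>n. f (Suc n))) {0<..}" and "(\<lambda>x. norm (f x)) summable_on {0<..}"
proof -
 have bij: "bij_betw Suc UNIV {0<..}" by (auto simp: bij_betw_def image_iff) (metis gr0_implies_Suc)
 have "((\<lambda>n. f (Suc n)) has_sum (\<Sum>n. f (Suc n))) UNIV"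
  using assms by (intro norm_summable_imp_has_sum summable_sums summable_norm_cancel[OF assms])
 then show "(f has_sum (\<Sum>n. f (Suc n))) {0<..}" by (simp add: has_sum_reindex_bij_betw[OF bij])
 have "(\<lambda>n. norm (f (Suc n))) summable_on UNIV"
  using assms by (intro norm_summable_imp_summable_on) simp
 then show "(\<lambda>x. norm (f x)) summable_on {0<..}" using summable_on_reindex_bij_betw[OF bij, of "\<lambda>n. norm (f n)"] by simp
qed

text \<open>Grouping the absolutely convergent double sum over (d, m) by n = d m leaves the sum of
  \<open>mangoldt d\<close> over the divisors d of n, which is ln n.\<close>

lemma mangoldt_zeta_convolution:
 assumes s: "Re s > 1"
 shows "(\<Sum>n. of_real (ln (real (Suc n))) * nat_powr s (Suc n)) = mangoldt_series s * zeta_series s"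
proof -
 let ?P = "{0::nat<..}"
 define L where "L = (\<lambda>n. mangoldt n * nat_powr s n)"
 define z where "z = nat_powr s"
 have hz: "(z has_sum zeta_series s) ?P" "(\<lambda>x. norm (z x)) summable_on ?P"
  using has_sum_pos_nat[of z] zeta_series_summable[OF s] unfolding zeta_series_def z_def nat_powr_Suc by auto
 have hL: "(L has_sum mangoldt_series s) ?P" "(\<lambda>x. norm (L x)) summable_on ?P"
  using has_sum_pos_nat[of L] mangoldt_series_summable[OF s] unfolding mangoldt_series_def L_def by auto
 define F where "F = (\<lambda>(d, m). L d * z m)"
 have "(\<lambda>x. norm (F x)) summable_on ?P \<times> ?P"
  unfolding Infinite_Sum.abs_summable_on_Sigma_iff
 proof (intro conjI ballI)
  show "(\<lambda>y. norm (F (x, y))) summable_on ?P" for x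
   using hz(2) unfolding F_def by (simp add: norm_mult summable_on_cmult_right)
  have "(\<lambda>x. \<Sum>\<^sub>\<infinity>y\<in>?P. norm (F (x, y))) = (\<lambda>x. norm (L x) * (\<Sum>\<^sub>\<infinity>y\<in>?P. norm (z y)))"
   unfolding F_def by (simp add: norm_mult infsum_cmult_right')
  then show "(\<lambda>x. norm (\<Sum>\<^sub>\<infinity>y\<in>?P. norm (F (x, y)))) summable_on ?P"
   using summable_on_cmult_left[OF hL(2), of "\<Sum>\<^sub>\<infinity>y\<in>?P. norm (z y)"]
   by (simp add: abs_mult infsum_nonneg)
 qed
 then have "F summable_on ?P \<times> ?P" by (rule Infinite_Sum.abs_summable_summable)
 then obtain S where S: "(F has_sum S) (?P \<times> ?P)" unfolding summable_on_def by auto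
 have "((\<lambda>d. L d * zeta_series s) has_sum S) ?P"
  by (rule has_sum_SigmaD[OF S]) (auto simp: F_def intro!: has_sum_cmult_right hz)
 moreover have "((\<lambda>d. L d * zeta_series s) has_sum (mangoldt_series s * zeta_series s)) ?P"
  by (intro has_sum_cmult_left hL)
 ultimately have SV: "S = mangoldt_series s * zeta_series s" by (rule has_sum_unique)
 define G where "G = (\<lambda>(n, d). F (d, n div d))"
 have "(F has_sum S) (?P \<times> ?P) = (G has_sum S) (Sigma ?P (\<lambda>n. {d. d dvd n}))"
  by (rule has_sum_reindex_bij_witness[where j = "\<lambda>(d, m). (d * m, d)" and i = "\<lambda>(n, d). (d, n div d)"])
    (auto simp: G_def elim!: dvdE)
 with S have "(G has_sum S) (Sigma ?P (\<lambda>n. {d. d dvd n}))" by simp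
 then have "((\<lambda>n. of_real (ln (real n)) * nat_powr s n) has_sum S) ?P"
 proof (rule has_sum_SigmaD)
  fix n :: nat assume n: "n \<in> ?P"
  have fin: "finite {d. d dvd n}" using n by auto
  have "(\<Sum>d | d dvd n. G (n, d)) = (\<Sum>d | d dvd n. mangoldt d * nat_powr s n)"
  proof (rule sum.cong[OF refl])
   fix d assume d: "d \<in> {d. d dvd n}"
   then have "d > 0" "n div d > 0" using n by (auto elim!: dvdE)
   then have "nat_powr s d * nat_powr s (n div d) = nat_powr s n"
    using nat_powr_mult[of d "n div d" s] d by simp
   then show "G (n, d) = mangoldt d * nat_powr s n" by (simp add: G_def F_def L_def z_def mult.assoc)
  qed
  also have "\<dots> = of_real (ln (real n)) * nat_powr s n"
   unfolding sum_distrib_right[symmetric] using n by (subst mangoldt_sum) auto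
  finally show "((\<lambda>y. G (n, y)) has_sum of_real (ln (real n)) * nat_powr s n) {d. d dvd n}"
   using has_sum_finite[OF fin, of "\<lambda>d. G (n, d)"] by simp
 qed
 moreover have "((\<lambda>n. of_real (ln (real n)) * nat_powr s n) has_sum (\<Sum>n. of_real (ln (real (Suc n))) * nat_powr s (Suc n))) ?P"
 proof (rule has_sum_pos_nat(1))
  have "norm (of_real (ln (real (Suc n))) * nat_powr s (Suc n)) = ln (real (Suc n)) * real (Suc n) powr (- Re s)" for n
   by (simp add: norm_mult norm_nat_powr del: of_nat_Suc)
  then show "summable (\<lambda>n. norm (of_real (ln (real (Suc n))) * nat_powr s (Suc n)))"
   using summable_ln_powr[OF s] by simp
 qed
 ultimately show ?thesis using SV has_sum_unique by blast
qed

lemma zeta_series_deriv: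
 assumes s: "Re s > 1"
 shows "(zeta_series has_field_derivative (- (mangoldt_series s * zeta_series s))) (at s)"
proof -
 let ?S = "{s. Re s > 1}"
 have "\<exists>g g'. \<forall>x \<in> ?S. ((\<lambda>n. nat_powr x (Suc n)) sums g x) \<and>
   ((\<lambda>n. - of_real (ln (real (Suc n))) * nat_powr x (Suc n)) sums g' x) \<and> (g has_field_derivative g' x) (at x)"
 proof (rule series_and_derivative_comparison_complex)
  show "open ?S" by (rule open_halfspace_Re_gt)
  show "((\<lambda>s. nat_powr s (Suc n)) has_field_derivative - of_real (ln (real (Suc n))) * nat_powr x (Suc n)) (at x)" for n x
   by (rule nat_powr_has_derivative) simp
  fix x assume x: "x \<in> ?S"
  define d where "d = (Re x - 1) / 2"
  have d: "d > 0" "Re x - d > 1" using x by (auto simp: d_def field_simps)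
  show "\<exists>d h. 0 < d \<and> summable h \<and> range h \<subseteq> \<real>\<^sub>\<ge>\<^sub>0 \<and>
   (\<forall>\<^sub>F n in sequentially. \<forall>y\<in>ball x d \<inter> ?S. cmod (nat_powr y (Suc n)) \<le> cmod (h n))"
  proof (intro exI conjI)
   show "0 < d" by (rule d)
   show "summable (\<lambda>n. complex_of_real (real (Suc n) powr (- (Re x - d))))"
    unfolding summable_of_real_iff by (rule summable_zeta_real[OF d(2)])
   show "range (\<lambda>n. complex_of_real (real (Suc n) powr (- (Re x - d)))) \<subseteq> \<real>\<^sub>\<ge>\<^sub>0" by auto
   show "\<forall>\<^sub>F n in sequentially. \<forall>y\<in>ball x d \<inter> ?S. cmod (nat_powr y (Suc n)) \<le> cmod (complex_of_real (real (Suc n) powr (- (Re x - d))))"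
   proof (intro always_eventually allI ballI)
    fix n y assume y: "y \<in> ball x d \<inter> ?S"
    have "\<bar>Re (x - y)\<bar> \<le> norm (x - y)" by (rule abs_Re_le_cmod)
    then have "Re x - d \<le> Re y" using y by (simp add: dist_norm) linarith
    then have "real (Suc n) powr (- Re y) \<le> real (Suc n) powr (- (Re x - d))" by (intro powr_mono) auto
    then show "cmod (nat_powr y (Suc n)) \<le> cmod (complex_of_real (real (Suc n) powr (- (Re x - d))))"
     by (simp add: norm_nat_powr del: of_nat_Suc)
   qed
  qed
 qed
 then obtain g g' where g: "\<And>x. x \<in> ?S \<Longrightarrow> (\<lambda>n. nat_powr x (Suc n)) sums g x"
  "\<And>x. x \<in> ?S \<Longrightarrow> (\<lambda>n. - of_real (ln (real (Suc n))) * nat_powr x (Suc n)) sums g' x"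
  "\<And>x. x \<in> ?S \<Longrightarrow> (g has_field_derivative g' x) (at x)" by blast
 have gz: "g x = zeta_series x" if "x \<in> ?S" for x
  using g(1)[OF that] unfolding zeta_series_def nat_powr_Suc by (simp add: sums_iff)
 have "(\<lambda>n. of_real (ln (real (Suc n))) * nat_powr s (Suc n)) sums (- g' s)"
  using sums_minus[OF g(2)[of s]] s by simp
 then have g's: "g' s = - (mangoldt_series s * zeta_series s)"
  using mangoldt_zeta_convolution[OF s] by (simp add: sums_iff del: of_nat_Suc)
 show ?thesis
 proof (rule DERIV_cong_ev[THEN iffD1, OF refl _ _ g(3)])
  show "\<forall>\<^sub>F x in nhds s. g x = zeta_series x"
   using eventually_nhds_in_open[OF open_halfspace_Re_gt[of 1], of s] s gz by (auto elim!: eventually_mono)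
 qed (use s g's in auto)
qed

text \<open>Writing f(w) = g(w) (w - z)^n with g nonzero near z gives (w - z) f'/f = n + (w - z)
  g'/g. The limit reads off the order of vanishing, and it also covers points where f does not
  vanish, with order 0.\<close>

lemma log_derivative_limit:
 fixes f :: "complex \<Rightarrow> complex"
 assumes holo: "f holomorphic_on S" and S: "open S" "connected S" "z \<in> S" and nc: "\<exists>w\<in>S. f w \<noteq> 0"
 shows "((\<lambda>w. (w - z) * (deriv f w / f w)) \<longlongrightarrow> of_int (zorder f z)) (at z)"
  and "zorder f z \<ge> 0" and "f z = 0 \<Longrightarrow> zorder f z > 0"
proof -
 define n where "n = nat (zorder f z)"
 define g where "g = zor_poly f z"
 from zorder_exist_zero[OF holo S nc] obtain r where r: "r > 0" "cball z r \<subseteq> S" "g holomorphic_on cball z r"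
  "\<forall>w\<in>cball z r. f w = g w * (w - z) ^ n \<and> g w \<noteq> 0" and zo: "if f z = 0 then zorder f z > 0 else zorder f z = 0"
  unfolding n_def g_def by blast
 show nn: "zorder f z \<ge> 0" "f z = 0 \<Longrightarrow> zorder f z > 0" using zo by (auto split: if_splits)
 have gh: "g holomorphic_on ball z r" by (rule holomorphic_on_subset[OF r(3)]) auto
 have "(w - z) * (deriv f w / f w) = of_nat n + (w - z) * (deriv g w / g w)" if w: "w \<in> ball z r - {z}" for w
 proof -
  have gd: "(g has_field_derivative deriv g w) (at w)"
   using gh w by (intro holomorphic_derivI[of _ "ball z r"]) auto
  have "((\<lambda>w. g w * (w - z) ^ n) has_field_derivative (deriv g w * (w - z) ^ n + g w * (of_nat n * (w - z) ^ (n - 1)))) (at w)"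
   using gd by (auto intro!: derivative_eq_intros)
  then have "(f has_field_derivative (deriv g w * (w - z) ^ n + g w * (of_nat n * (w - z) ^ (n - 1)))) (at w)"
  proof (rule DERIV_cong_ev[THEN iffD1, OF refl _ refl, rotated])
   show "\<forall>\<^sub>F x in nhds w. g x * (x - z) ^ n = f x"
    using eventually_nhds_in_open[of "ball z r" w] w r(4) by (auto elim!: eventually_mono)
  qed
  then have d: "deriv f w = deriv g w * (w - z) ^ n + g w * (of_nat n * (w - z) ^ (n - 1))" by (rule DERIV_imp_deriv)
  have fw: "f w = g w * (w - z) ^ n" "g w \<noteq> 0" "w - z \<noteq> 0" using r(4) w by auto
  show ?thesis
  proof (cases n)
   case (Suc m)
   then show ?thesis unfolding d fw(1) using fw(2,3) by (simp add: field_simps)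
  qed (use d fw in \<open>simp add: field_simps\<close>)
 qed
 then have ev: "\<forall>\<^sub>F w in at z. of_nat n + (w - z) * (deriv g w / g w) = (w - z) * (deriv f w / f w)"
  using r(1) by (auto simp: eventually_at dist_commute intro!: exI[of _ r])
 have zb: "z \<in> ball z r" using r(1) by simp
 have "deriv g holomorphic_on ball z r" using gh by (intro holomorphic_deriv) auto
 then have "isCont (deriv g) z" using zb by (auto dest!: holomorphic_on_imp_continuous_on simp: continuous_on_eq_continuous_at)
 moreover have "isCont g z" using gh zb by (auto dest!: holomorphic_on_imp_continuous_on simp: continuous_on_eq_continuous_at)
 ultimately have "((\<lambda>w. of_nat n + (w - z) * (deriv g w / g w)) \<longlongrightarrow> of_nat n + (z - z) * (deriv g z / g z)) (at z)"
  using r(1,4) by (intro tendsto_intros) (auto simp: isCont_def)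
 then have "((\<lambda>w. of_nat n + (w - z) * (deriv g w / g w)) \<longlongrightarrow> of_int (zorder f z)) (at z)"
  using nn by (simp add: n_def)
 then show "((\<lambda>w. (w - z) * (deriv f w / f w)) \<longlongrightarrow> of_int (zorder f z)) (at z)"
  by (rule Lim_transform_eventually[OF _ ev])
qed

section \<open>Nonvanishing of zeta for Re s \<ge> 1\<close>

definition zeta_factor :: "complex \<Rightarrow> complex" where
 "zeta_factor s = of_real pi powr (s / 2) * rGamma (s / 2 + 1) / 2"

text \<open>This is (s - 1) \<zeta>(s) as an entire function. With the pole removed,
  \<open>log_derivative_limit\<close> applies at every point of the line Re s = 1, including s = 1
  itself.\<close>

definition zeta_entire :: "complex \<Rightarrow> complex" where
 "zeta_entire s = zeta_factor s * riemann_xi s"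

lemma holomorphic_zeta_factor: "zeta_factor holomorphic_on A"
 unfolding zeta_factor_def[abs_def] by (intro holomorphic_intros) auto

lemma zeta_factor_nonzero: "Re s > -2 \<Longrightarrow> zeta_factor s \<noteq> 0"
 unfolding zeta_factor_def by (auto simp: rGamma_eq_zero_iff elim!: nonpos_Ints_cases) (auto simp: complex_eq_iff)

lemma holomorphic_zeta_entire: "zeta_entire holomorphic_on A"
 unfolding zeta_entire_def[abs_def] by (intro holomorphic_intros holomorphic_zeta_factor holomorphic_riemann_xi)

lemma zeta_cont_eq: "zeta_cont s = zeta_entire s / (s - 1)"
 by (simp add: zeta_cont_def zeta_entire_def zeta_factor_def)

lemma zeta_entire_eq_series: "Re s > 1 \<Longrightarrow> zeta_entire s = (s - 1) * zeta_series s"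
proof -
 assume s: "Re s > 1"
 then have "s - 1 \<noteq> 0" by auto
 then show ?thesis using zeta_cont_eq_series[OF s] unfolding zeta_cont_eq by (metis nonzero_mult_div_cancel_left times_divide_eq_right)
qed

lemma zeta_entire_nonconst: "\<exists>w\<in>UNIV. zeta_entire w \<noteq> 0"
 using zeta_factor_nonzero[of 1] by (intro bexI[of _ 1]) (auto simp: zeta_entire_def)

lemma zeta_entire_deriv:
 assumes "Re s > 1"
 shows "deriv zeta_entire s = zeta_series s - (s - 1) * (mangoldt_series s * zeta_series s)"
proof -
 have "((\<lambda>s. (s - 1) * zeta_series s) has_field_derivative (zeta_series s - (s - 1) * (mangoldt_series s * zeta_series s))) (at s)"
  using zeta_series_deriv[OF assms] by (auto intro!: derivative_eq_intros)
 then have "(zeta_entire has_field_derivative (zeta_series s - (s - 1) * (mangoldt_series s * zeta_series s))) (at s)"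
 proof (rule DERIV_cong_ev[THEN iffD1, OF refl _ refl, rotated])
  show "\<forall>\<^sub>F x in nhds s. (x - 1) * zeta_series x = zeta_entire x"
   using eventually_nhds_in_open[OF open_halfspace_Re_gt[of 1], of s] assms zeta_entire_eq_series by (auto elim!: eventually_mono)
 qed
 then show ?thesis by (rule DERIV_imp_deriv)
qed

text \<open>The argument avoids the Euler product: at a zero s the limit in
  \<open>log_derivative_limit\<close> would be positive, whereas the logarithmic derivative 1 / (w -
  1) - \<open>mangoldt_series w\<close> stays bounded near s.\<close>

lemma zeta_series_nonzero:
 assumes s: "Re s > 1"
 shows "zeta_series s \<noteq> 0"
proof
 assume z: "zeta_series s = 0"
 let ?S = "{s. Re s > 1}"
 define x where "x = (1 + Re s) / 2"
 have x: "x > 1" "x < Re s" using s by (auto simp: x_def)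
 define B where "B = (\<Sum>n. mangoldt (Suc n) * real (Suc n) powr (- x))"
 have lim: "((\<lambda>w. (w - s) * (deriv zeta_entire w / zeta_entire w)) \<longlongrightarrow> of_int (zorder zeta_entire s)) (at s)"
  and zo: "zorder zeta_entire s > 0"
  using log_derivative_limit[OF holomorphic_zeta_entire open_UNIV connected_UNIV UNIV_I zeta_entire_nonconst]
   zeta_entire_eq_series[OF s] z by auto
 have "((\<lambda>w. (w - s) * (deriv zeta_entire w / zeta_entire w)) \<longlongrightarrow> 0) (at s)"
 proof (rule Lim_null_comparison)
  show "((\<lambda>w. norm (w - s) * (B + 1 / norm (w - 1))) \<longlongrightarrow> 0) (at s)"
  proof -
   have "((\<lambda>w. norm (w - s) * (B + 1 / norm (w - 1))) \<longlongrightarrow> norm (s - s) * (B + 1 / norm (s - 1))) (at s)"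
    using s by (intro tendsto_intros) auto
   then show ?thesis by simp
  qed
  have "\<forall>\<^sub>F w in at s. w \<in> {w. Re w > x}"
   using x by (intro eventually_at_in_open' open_halfspace_Re_gt) auto
  then show "\<forall>\<^sub>F w in at s. norm ((w - s) * (deriv zeta_entire w / zeta_entire w)) \<le> norm (w - s) * (B + 1 / norm (w - 1))"
  proof eventually_elim
   case (elim w)
   then have w: "Re w > 1" "Re w \<ge> x" "w \<noteq> 1" using x by auto
   have B0: "norm (mangoldt_series w) \<le> B" unfolding B_def by (rule norm_mangoldt_series_le[OF w(2) x(1)])
   have "norm (deriv zeta_entire w / zeta_entire w) \<le> B + 1 / norm (w - 1)"
   proof (cases "zeta_series w = 0")
    \<comment> \<open>At a zero of the denominator the quotient is 0, by the convention on
      division.\<close>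
    case True
    have "0 \<le> B" using B0 norm_ge_zero order_trans by blast
    then show ?thesis using True zeta_entire_eq_series[OF w(1)] by simp
   next
    case False
    then have "deriv zeta_entire w / zeta_entire w = 1 / (w - 1) - mangoldt_series w"
     unfolding zeta_entire_deriv[OF w(1)] zeta_entire_eq_series[OF w(1)] using w(3) by (simp add: field_simps)
    then show ?thesis using B0 norm_triangle_ineq4[of "1 / (w - 1)" "mangoldt_series w"] by (simp add: norm_divide)
   qed
   then show ?case unfolding norm_mult by (rule mult_left_mono) simp
  qed
 qed
 then have "complex_of_int (zorder zeta_entire s) = 0" using lim by (intro tendsto_unique[OF _ lim]) auto
 then show False using zo by simp
qed

lemma zeta_entire_log_deriv:
 assumes "Re s > 1"
 shows "deriv zeta_entire s / zeta_entire s = 1 / (s - 1) - mangoldt_series s"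
proof -
 have "(z - a * (m * z)) / (a * z) = 1 / a - m" if "a \<noteq> 0" "z \<noteq> 0" for a z m :: complex
  using that by (simp add: field_simps)
 moreover have "s - 1 \<noteq> 0" using assms by auto
 ultimately show ?thesis unfolding zeta_entire_deriv[OF assms] zeta_entire_eq_series[OF assms]
  using zeta_series_nonzero[OF assms] by blast
qed

text \<open>Termwise this is the inequality 3 + 4 cos x + cos (2 x) = 2 (1 + cos x)^2 \<ge> 0 with x
  = y ln n.\<close>

lemma mangoldt_series_341:
 assumes x: "x > 1"
 shows "0 \<le> 3 * Re (mangoldt_series (of_real x)) + 4 * Re (mangoldt_series (Complex x y)) + Re (mangoldt_series (Complex x (2 * y)))"
proof -
 have re: "(\<lambda>n. mangoldt (Suc n) * real (Suc n) powr (- x) * cos (u * ln (real (Suc n)))) sums Re (mangoldt_series (Complex x u))" for u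
 proof -
  have "Re (Complex x u) > 1" using x by simp
  then have "(\<lambda>n. mangoldt (Suc n) * nat_powr (Complex x u) (Suc n)) sums mangoldt_series (Complex x u)"
   unfolding mangoldt_series_def by (intro summable_sums summable_norm_cancel[OF mangoldt_series_summable])
  then have "(\<lambda>n. Re (mangoldt (Suc n) * nat_powr (Complex x u) (Suc n))) sums Re (mangoldt_series (Complex x u))"
   by (rule sums_Re)
  moreover have "Re (mangoldt (Suc n) * nat_powr (Complex x u) (Suc n)) = mangoldt (Suc n) * real (Suc n) powr (- x) * cos (u * ln (real (Suc n)))" for n
   by (subst nat_powr_exp) (simp_all add: Re_exp powr_def del: of_nat_Suc)
  ultimately show ?thesis by (simp only:)
 qed
 have A: "(\<lambda>n. 3 * (mangoldt (Suc n) * real (Suc n) powr (- x) * cos (0 * ln (real (Suc n)))) +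
   4 * (mangoldt (Suc n) * real (Suc n) powr (- x) * cos (y * ln (real (Suc n)))) +
   mangoldt (Suc n) * real (Suc n) powr (- x) * cos (2 * y * ln (real (Suc n)))) sums
   (3 * Re (mangoldt_series (Complex x 0)) + 4 * Re (mangoldt_series (Complex x y)) + Re (mangoldt_series (Complex x (2 * y))))"
  by (intro sums_add sums_mult re)
 have B: "0 \<le> 3 * (mangoldt (Suc n) * real (Suc n) powr (- x) * cos (0 * ln (real (Suc n)))) +
   4 * (mangoldt (Suc n) * real (Suc n) powr (- x) * cos (y * ln (real (Suc n)))) +
   mangoldt (Suc n) * real (Suc n) powr (- x) * cos (2 * y * ln (real (Suc n)))" for n
 proof -
  define c where "c = cos (y * ln (real (Suc n)))"
  have "cos (2 * y * ln (real (Suc n))) = 2 * c\<^sup>2 - 1"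
   using cos_double_cos[of "y * ln (real (Suc n))"] by (simp add: c_def mult.assoc)
  then have "3 * (mangoldt (Suc n) * real (Suc n) powr (- x) * cos (0 * ln (real (Suc n)))) +
   4 * (mangoldt (Suc n) * real (Suc n) powr (- x) * cos (y * ln (real (Suc n)))) +
   mangoldt (Suc n) * real (Suc n) powr (- x) * cos (2 * y * ln (real (Suc n))) =
   mangoldt (Suc n) * real (Suc n) powr (- x) * (2 * (1 + c)\<^sup>2)"
   unfolding \<open>cos (2 * y * ln (real (Suc n))) = 2 * c\<^sup>2 - 1\<close> c_def[symmetric] by (simp add: power2_eq_square algebra_simps)
  then show ?thesis by (simp add: mangoldt_nonneg)
 qed
 have "0 \<le> 3 * Re (mangoldt_series (Complex x 0)) + 4 * Re (mangoldt_series (Complex x y)) + Re (mangoldt_series (Complex x (2 * y)))"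
  by (rule sums_le[OF B sums_zero A])
 then show ?thesis by (simp add: complex_of_real_def)
qed

text \<open>On the line Re s = 1, let k(u) be the order of vanishing at 1 + i u. Multiplied by e and
  for e tending to 0, the inequality of \<open>mangoldt_series_341\<close> at 1 + e becomes 0 \<le>
  3 (1 - k(0)) - 4 k(y) - k(2 y), which excludes k(y) \<ge> 1.\<close>

lemma zeta_entire_nonzero:
 assumes "Re s \<ge> 1"
 shows "zeta_entire s \<noteq> 0"
proof (cases "Re s > 1")
 case True
 then show ?thesis using zeta_entire_eq_series[OF True] zeta_series_nonzero[OF True] by auto
next
 case False
 then obtain y where y: "s = Complex 1 y" using assms by (cases s) auto
 show ?thesis
 proof
  assume z: "zeta_entire s = 0"
  have y0: "y \<noteq> 0"
  proof
   assume "y = 0"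
   then have "s = 1" by (simp add: y complex_eq_iff)
   then show False using z zeta_factor_nonzero[of 1] by (simp add: zeta_entire_def)
  qed
  define Q where "Q = (\<lambda>w. deriv zeta_entire w / zeta_entire w)"
  define k where "k = (\<lambda>u. zorder zeta_entire (Complex 1 u))"
  note ldl = log_derivative_limit[OF holomorphic_zeta_entire open_UNIV connected_UNIV UNIV_I zeta_entire_nonconst]
  have kpos: "k y > 0" "k (2 * y) \<ge> 0" "k 0 \<ge> 0" unfolding k_def using ldl(2,3) z y by auto
  have lim: "((\<lambda>e. of_real e * Q (Complex (1 + e) u)) \<longlongrightarrow> of_int (k u)) (at_right 0)" for u
  proof -
   have "((\<lambda>w. (w - Complex 1 u) * Q w) \<longlongrightarrow> of_int (k u)) (at (Complex 1 u))"
    unfolding Q_def k_def by (rule ldl(1))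
   moreover have "filterlim (\<lambda>e. Complex (1 + e) u) (at (Complex 1 u)) (at_right 0)"
   proof (rule filterlim_atI)
    have "((\<lambda>e. Complex 1 u + of_real e) \<longlongrightarrow> Complex 1 u + of_real 0) (at_right 0)" by (intro tendsto_intros)
    moreover have "Complex 1 u + of_real e = Complex (1 + e) u" for e by (simp add: complex_eq_iff)
    ultimately show "((\<lambda>e. Complex (1 + e) u) \<longlongrightarrow> Complex 1 u) (at_right 0)" by simp
    show "\<forall>\<^sub>F e in at_right 0. Complex (1 + e) u \<noteq> Complex 1 u"
     by (auto simp: eventually_at_filter)
   qed
   ultimately have "((\<lambda>e. (Complex (1 + e) u - Complex 1 u) * Q (Complex (1 + e) u)) \<longlongrightarrow> of_int (k u)) (at_right 0)"
    by (rule filterlim_compose)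
   moreover have "Complex (1 + e) u - Complex 1 u = of_real e" for e by (simp add: complex_eq_iff)
   ultimately show ?thesis by simp
  qed
  \<comment> \<open>The 1 for u = 0 is the contribution of the pole of \<zeta> at s = 1.\<close>
  have limD: "((\<lambda>e. e * Re (mangoldt_series (Complex (1 + e) u))) \<longlongrightarrow> (if u = 0 then 1 else 0) - real_of_int (k u)) (at_right 0)" for u
  proof -
   have l2: "((\<lambda>e. of_real e / Complex e u) \<longlongrightarrow> (if u = 0 then 1 else 0)) (at_right 0)"
   proof (cases "u = 0")
    case True
    have "\<forall>\<^sub>F e in at_right (0::real). 1 = of_real e / Complex e u"
     using True by (auto simp: eventually_at_filter complex_of_real_def[symmetric])
    then show ?thesis using True by (auto intro: Lim_transform_eventually[OF tendsto_const])
   next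
    case False
    then have "((\<lambda>e. of_real e / (of_real e + \<i> * of_real u)) \<longlongrightarrow> of_real 0 / (of_real 0 + \<i> * of_real u)) (at_right 0)"
     by (intro tendsto_intros) auto
    moreover have "of_real e + \<i> * of_real u = Complex e u" for e by (simp add: complex_eq_iff)
    ultimately show ?thesis using False by simp
   qed
   have "((\<lambda>e. Re (of_real e / Complex e u - of_real e * Q (Complex (1 + e) u))) \<longlongrightarrow> Re ((if u = 0 then 1 else 0) - of_int (k u))) (at_right 0)"
    by (intro tendsto_intros l2 lim)
   moreover have "\<forall>\<^sub>F e in at_right (0::real). Re (of_real e / Complex e u - of_real e * Q (Complex (1 + e) u)) = e * Re (mangoldt_series (Complex (1 + e) u))"
   proof -
    have "Re (of_real e / Complex e u - of_real e * Q (Complex (1 + e) u)) = e * Re (mangoldt_series (Complex (1 + e) u))" if e: "e > 0" for e :: real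
    proof -
     have "Q (Complex (1 + e) u) = 1 / (Complex (1 + e) u - 1) - mangoldt_series (Complex (1 + e) u)"
      unfolding Q_def using e by (intro zeta_entire_log_deriv) auto
     moreover have "Complex (1 + e) u - 1 = Complex e u" by (simp add: complex_eq_iff)
     ultimately have "of_real e / Complex e u - of_real e * Q (Complex (1 + e) u) = of_real e * mangoldt_series (Complex (1 + e) u)"
      by (simp only: right_diff_distrib) simp
     then show ?thesis by simp
    qed
    then show ?thesis by (auto simp: eventually_at_filter)
   qed
   ultimately have "((\<lambda>e. e * Re (mangoldt_series (Complex (1 + e) u))) \<longlongrightarrow> Re ((if u = 0 then 1 else 0) - of_int (k u))) (at_right 0)"
    by (rule Lim_transform_eventually)
   then show ?thesis by (cases "u = 0") auto
  qed
  have "((\<lambda>e. 3 * (e * Re (mangoldt_series (Complex (1 + e) 0))) + 4 * (e * Re (mangoldt_series (Complex (1 + e) y)))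
    + e * Re (mangoldt_series (Complex (1 + e) (2 * y)))) \<longlongrightarrow>
    3 * ((if (0::real) = 0 then 1 else 0) - real_of_int (k 0)) + 4 * ((if y = 0 then 1 else 0) - real_of_int (k y)) + ((if 2 * y = 0 then 1 else 0) - real_of_int (k (2 * y)))) (at_right 0)"
   by (intro tendsto_intros limD)
  moreover have "\<forall>\<^sub>F e in at_right 0. 0 \<le> 3 * (e * Re (mangoldt_series (Complex (1 + e) 0))) + 4 * (e * Re (mangoldt_series (Complex (1 + e) y)))
    + e * Re (mangoldt_series (Complex (1 + e) (2 * y)))"
  proof -
   have "0 \<le> 3 * (e * Re (mangoldt_series (Complex (1 + e) 0))) + 4 * (e * Re (mangoldt_series (Complex (1 + e) y)))
    + e * Re (mangoldt_series (Complex (1 + e) (2 * y)))" if e: "e > 0" for e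
   proof -
    have "0 \<le> 3 * Re (mangoldt_series (Complex (1 + e) 0)) + 4 * Re (mangoldt_series (Complex (1 + e) y)) + Re (mangoldt_series (Complex (1 + e) (2 * y)))"
     using mangoldt_series_341[of "1 + e" y] e by (simp add: complex_of_real_def)
    then have "0 \<le> e * (3 * Re (mangoldt_series (Complex (1 + e) 0)) + 4 * Re (mangoldt_series (Complex (1 + e) y)) + Re (mangoldt_series (Complex (1 + e) (2 * y))))"
     using e by (intro mult_nonneg_nonneg) auto
    then show ?thesis by (simp add: algebra_simps)
   qed
   then show ?thesis by (auto simp: eventually_at_filter)
  qed
  ultimately have "0 \<le> 3 * ((if (0::real) = 0 then 1 else 0) - real_of_int (k 0)) + 4 * ((if y = 0 then 1 else 0) - real_of_int (k y)) + ((if 2 * y = 0 then 1 else 0) - real_of_int (k (2 * y)))"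
   by (intro tendsto_lowerbound[OF _ _ trivial_limit_at_right_real])
  then have "0 \<le> 3 - 3 * real_of_int (k 0) - 4 * real_of_int (k y) - real_of_int (k (2 * y))" using y0 by simp
  moreover have "real_of_int (k y) \<ge> 1" "real_of_int (k (2 * y)) \<ge> 0" "real_of_int (k 0) \<ge> 0" using kpos by auto
  ultimately show False by linarith
 qed
qed

lemma riemann_xi_zero_strip:
 assumes "riemann_xi s = 0"
 shows "0 < Re s" "Re s < 1"
proof -
 have *: "Re s < 1" if "riemann_xi s = 0" for s
  using zeta_entire_nonzero[of s] that by (force simp: zeta_entire_def)
 show "Re s < 1" by (rule *[OF assms])
 have "Re (1 - s) < 1" by (rule *) (simp add: riemann_xi_reflect assms)
 then show "0 < Re s" by simp
qed

text \<open>The strip condition disappears because \<xi> has no zeros elsewhere: to the right by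
  \<open>zeta_entire_nonzero\<close>, to the left by the reflection s to 1 - s.\<close>

lemma nontrivial_zeta_zeros_eq: "nontrivial_zeta_zeros = {s. riemann_xi s = 0}"
proof -
 have "riemann_zeta s = 0 \<longleftrightarrow> riemann_xi s = 0" if "0 < Re s" "Re s < 1" for s
  using that zeta_factor_nonzero[of s] by (auto simp: riemann_zeta_eq zeta_cont_eq zeta_entire_def)
 then show ?thesis unfolding nontrivial_zeta_zeros_def using riemann_xi_zero_strip by auto
qed

subsection \<open>Local factorization of xi\<close>

text \<open>Since Re k < A, the value k is closer to 0 than to 2 A, so k / (2 A - k) maps the
  rescaled disc into the unit disc and fixes 0. Schwarz's lemma for this quotient is solved for
  k.\<close>

lemma borel_caratheodory:
 assumes holo: "k holomorphic_on ball 0 \<rho>" and \<rho>: "\<rho> > 0" and k0: "k 0 = (0::complex)"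
  and A: "A > 0" and re: "\<And>z. z \<in> ball 0 \<rho> \<Longrightarrow> Re (k z) < A" and z: "z \<in> ball 0 \<rho>"
 shows "norm (k z) \<le> 2 * A * norm z / (\<rho> - norm z)"
proof -
 define \<phi> where "\<phi> = (\<lambda>w. k (of_real \<rho> * w) / (of_real (2 * A) - k (of_real \<rho> * w)))"
 have inb: "of_real \<rho> * w \<in> ball 0 \<rho>" if "norm w < 1" for w :: complex
  using that \<rho> by (simp add: norm_mult)
 have lt: "norm (k u) < norm (of_real (2 * A) - k u)" if "u \<in> ball 0 \<rho>" for u
 proof -
  have "(Re (k u))\<^sup>2 < (2 * A - Re (k u))\<^sup>2"
  proof -
   have "0 < 4 * A * (A - Re (k u))" using re[OF that] A by simp
   then show ?thesis by (simp add: power2_eq_square algebra_simps)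
  qed
  then have "(norm (k u))\<^sup>2 < (norm (of_real (2 * A) - k u))\<^sup>2" unfolding cmod_power2 by simp
  then show ?thesis by (rule power_less_imp_less_base) simp
 qed
 have sch: "norm (\<phi> w) \<le> norm w" if w: "norm w < 1" for w
 proof (rule Schwarz_Lemma(1))
  have "(k \<circ> (\<lambda>w. of_real \<rho> * w)) holomorphic_on ball 0 1"
   by (rule holomorphic_on_compose_gen[OF _ holo]) (use inb in \<open>auto intro!: holomorphic_intros\<close>)
  moreover have "of_real (2 * A) - k (of_real \<rho> * w) \<noteq> 0" if "w \<in> ball 0 1" for w
   using lt[OF inb[of w]] that by force
  ultimately show "\<phi> holomorphic_on ball 0 1"
   unfolding \<phi>_def o_def by (intro holomorphic_intros) auto
  show "\<phi> 0 = 0" by (simp add: \<phi>_def k0)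
  show "norm (\<phi> z) < 1" if "norm z < 1" for z
   using lt[OF inb[OF that]] unfolding \<phi>_def norm_divide by (subst divide_less_eq) (auto simp: norm_ge_zero intro: le_less_trans[OF norm_ge_zero])
 qed (rule w)
 define w where "w = z / of_real \<rho>"
 have w: "norm w < 1" "of_real \<rho> * w = z" "norm w = norm z / \<rho>" using z \<rho> by (auto simp: w_def norm_divide)
 have "norm (k z) / norm (of_real (2 * A) - k z) \<le> norm z / \<rho>"
  using sch[OF w(1)] w unfolding \<phi>_def norm_divide by simp
 moreover have dpos: "0 < norm (of_real (2 * A) - k z)" using le_less_trans[OF norm_ge_zero lt[OF z]] .
 ultimately have "norm (k z) * \<rho> \<le> norm z * norm (of_real (2 * A) - k z)" using \<rho> by (simp add: field_simps)
 also have "\<dots> \<le> norm z * (2 * A + norm (k z))"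
  using norm_triangle_ineq4[of "of_real (2 * A)" "k z"] A by (intro mult_left_mono) auto
 finally have "norm (k z) * (\<rho> - norm z) \<le> 2 * A * norm z" by (simp add: algebra_simps)
 then show ?thesis using z by (simp add: pos_le_divide_eq)
qed

text \<open>Induction on the number of distinct zeros in K: all copies of one zero are divided out
  at once, and the list records them with multiplicity.\<close>

lemma factor_out_zeros:
 fixes f :: "complex \<Rightarrow> complex"
 assumes "f holomorphic_on UNIV" "\<exists>w. f w \<noteq> 0" "compact K"
 shows "\<exists>zs g. g holomorphic_on UNIV \<and> (\<forall>s. f s = (\<Prod>z\<leftarrow>zs. (s - z)) * g s) \<and> (\<forall>s\<in>K. g s \<noteq> 0) \<and> set zs = {s\<in>K. f s = 0}"
proof -
 have fin: "finite {s\<in>K. f s = 0}" if "f holomorphic_on UNIV" "\<exists>w. f w \<noteq> 0" for f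
 proof (cases "f constant_on UNIV")
  case True
  then have "{s\<in>K. f s = 0} = {}" using that(2) unfolding constant_on_def by auto
  then show ?thesis by (simp only: finite.emptyI)
 next
  case False
  then show ?thesis using holomorphic_compact_finite_zeros[OF that(1) open_UNIV connected_UNIV assms(3)] by auto
 qed
 show ?thesis using assms(1,2)
 proof (induction "card {s\<in>K. f s = 0}" arbitrary: f rule: less_induct)
  case less
  show ?case
  proof (cases "{s\<in>K. f s = 0} = {}")
   case True
   then show ?thesis using less.prems by (intro exI[of _ "[]"] exI[of _ f]) auto
  next
   case False
   then obtain z where z: "z \<in> K" "f z = 0" by auto
   define n where "n = nat (zorder f z)"
   define g0 where "g0 = zor_poly f z"
   from zorder_exist_zero[OF less.prems(1) open_UNIV connected_UNIV, of z] less.prems(2) z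
   obtain r where r: "r > 0" "g0 holomorphic_on cball z r"
    "\<forall>w\<in>cball z r. f w = g0 w * (w - z) ^ n \<and> g0 w \<noteq> 0" and n: "n > 0"
    unfolding n_def g0_def by auto
   define g where "g = (\<lambda>s. if s = z then g0 z else f s / (s - z) ^ n)"
   have g_eq: "g s = g0 s" if "s \<in> cball z r" for s
    using r(3) that by (auto simp: g_def)
   have "g holomorphic_on ball z r"
    by (rule holomorphic_transform[OF holomorphic_on_subset[OF r(2), of "ball z r"]]) (auto simp: g_eq)
   moreover have "(\<lambda>s. f s / (s - z) ^ n) holomorphic_on (- {z})"
    by (intro holomorphic_intros holomorphic_on_subset[OF less.prems(1)]) auto
   then have "g holomorphic_on (- {z})" by (rule holomorphic_transform) (auto simp: g_def)
   ultimately have "g holomorphic_on (ball z r \<union> - {z})" by (rule holomorphic_on_Un) auto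
   moreover have "ball z r \<union> - {z} = UNIV" using r(1) by auto
   ultimately have gh: "g holomorphic_on UNIV" by simp
   have fg: "f s = (s - z) ^ n * g s" for s
    using z(2) n by (cases "s = z") (auto simp: g_def)
   have gz: "g z \<noteq> 0" using r g_eq[of z] by auto
   have sub: "{s\<in>K. f s = 0} = insert z {s\<in>K. g s = 0}"
    using fg z n by auto
   have "card {s\<in>K. g s = 0} < card {s\<in>K. f s = 0}"
    unfolding sub using gz fin[OF gh] by (subst card_insert_disjoint) auto
   from less.hyps[OF this gh] gz obtain zs h where h: "h holomorphic_on UNIV" "\<forall>s. g s = (\<Prod>z\<leftarrow>zs. (s - z)) * h s"
    "\<forall>s\<in>K. h s \<noteq> 0" "set zs = {s\<in>K. g s = 0}" by blast
   show ?thesis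
   proof (intro exI conjI)
    show "h holomorphic_on UNIV" by (rule h)
    show "\<forall>s. f s = (\<Prod>z\<leftarrow>replicate n z @ zs. (s - z)) * h s"
     using fg h(2) by (simp add: map_replicate prod_list_replicate)
    show "\<forall>s\<in>K. h s \<noteq> 0" by (rule h)
    show "set (replicate n z @ zs) = {s\<in>K. f s = 0}" unfolding sub using n h(4) by auto
   qed
  qed
 qed
qed

lemma log_deriv_product:
 fixes g :: "complex \<Rightarrow> complex"
 assumes "g holomorphic_on UNIV" "s \<notin> set zs" "g s \<noteq> 0"
 shows "deriv (\<lambda>s. (\<Prod>z\<leftarrow>zs. (s - z)) * g s) s / ((\<Prod>z\<leftarrow>zs. (s - z)) * g s) = (\<Sum>z\<leftarrow>zs. 1 / (s - z)) + deriv g s / g s"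
 using assms
proof (induction zs)
 case (Cons a zs)
 let ?P = "\<lambda>s. (\<Prod>z\<leftarrow>zs. (s - z)) * g s"
 have Ph: "?P holomorphic_on UNIV"
 proof -
  have "(\<lambda>s. \<Prod>z\<leftarrow>zs. (s - z)) holomorphic_on UNIV" by (induction zs) (auto intro!: holomorphic_intros)
  then show ?thesis using Cons.prems by (intro holomorphic_intros)
 qed
 have "(?P has_field_derivative deriv ?P s) (at s)" by (rule holomorphic_derivI[OF Ph open_UNIV UNIV_I])
 moreover have "((\<lambda>s. s - a) has_field_derivative 1) (at s)" by (auto intro!: derivative_eq_intros)
 ultimately have "((\<lambda>s. (s - a) * ?P s) has_field_derivative (1 * ?P s + deriv ?P s * (s - a))) (at s)"
  by (intro DERIV_mult)
 then have "((\<lambda>s. (s - a) * ?P s) has_field_derivative (?P s + (s - a) * deriv ?P s)) (at s)"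
  by (simp add: mult.commute)
 then have d: "deriv (\<lambda>s. (s - a) * ?P s) s = ?P s + (s - a) * deriv ?P s" by (rule DERIV_imp_deriv)
 have nz: "?P s \<noteq> 0" "s - a \<noteq> 0" using Cons.prems by (auto simp: prod_list_zero_iff)
 have "deriv (\<lambda>s. (s - a) * ?P s) s / ((s - a) * ?P s) = 1 / (s - a) + deriv ?P s / ?P s"
  unfolding d using nz by (simp add: add_divide_distrib)
 then show ?case using Cons by (simp add: mult.assoc add.assoc)
qed simp

text \<open>Divide f by its zeros in the disc of radius 3 R. On the circle of radius 9 R every
  factor is at least 6 R, at the centre at most 3 R, so each zero costs a factor 2 in the maximum
  principle; this bounds their number. The quotient has a holomorphic logarithm, which
  Borel-Caratheodory bounds for radius 2 R and Cauchy's inequality then differentiates for radius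
  R.\<close>

lemma local_log_derivative:
 fixes f :: "complex \<Rightarrow> complex"
 assumes holo: "f holomorphic_on UNIV" and R: "R > 0"
  and M: "\<And>s. s \<in> cball s0 (9 * R) \<Longrightarrow> norm (f s) \<le> M" and m: "m > 0" "m \<le> norm (f s0)"
 shows "\<exists>zs. real (length zs) * ln 2 \<le> ln (M / m) \<and> set zs = {s \<in> cball s0 (3 * R). f s = 0} \<and>
  (\<forall>s\<in>ball s0 R. f s \<noteq> 0 \<longrightarrow> norm (deriv f s / f s) \<le> (\<Sum>z\<leftarrow>zs. 1 / norm (s - z)) + 4 * (ln (M / m) + 1) / R)"
proof -
 have nz: "\<exists>w. f w \<noteq> 0" using m by (intro exI[of _ s0]) auto
 obtain zs g where g: "g holomorphic_on UNIV" "\<And>s. f s = (\<Prod>z\<leftarrow>zs. (s - z)) * g s"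
  "\<And>s. s \<in> cball s0 (3 * R) \<Longrightarrow> g s \<noteq> 0" "set zs = {s \<in> cball s0 (3 * R). f s = 0}"
  using factor_out_zeros[OF holo nz compact_cball[of s0 "3 * R"]] by blast
 define n where "n = length zs"
 have M0: "M > 0" using M[of s0] m R by auto
 have prodnorm: "norm (\<Prod>z\<leftarrow>zs. (s - z)) = (\<Prod>z\<leftarrow>zs. norm (s - z))" for s
  by (induction zs) (auto simp: norm_mult)
 have plow: "(6 * R) ^ n \<le> (\<Prod>z\<leftarrow>zs. norm (s - z))" if s: "dist s0 s = 9 * R" for s
 proof -
  have *: "set xs \<subseteq> cball s0 (3 * R) \<Longrightarrow> (6 * R) ^ length xs \<le> (\<Prod>z\<leftarrow>xs. norm (s - z))" for xs
  proof (induction xs)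
   case (Cons a xs)
   have "dist s0 s \<le> dist s0 a + dist a s" by (rule dist_triangle)
   then have "6 * R \<le> norm (s - a)" using s Cons.prems by (auto simp: dist_norm norm_minus_commute)
   then show ?case using Cons R by (auto intro!: mult_mono)
  qed simp
  show ?thesis unfolding n_def by (rule *) (use g(4) in auto)
 qed
 have pup: "(\<Prod>z\<leftarrow>zs. norm (s0 - z)) \<le> (3 * R) ^ n"
 proof -
  have *: "set xs \<subseteq> cball s0 (3 * R) \<Longrightarrow> (\<Prod>z\<leftarrow>xs. norm (s0 - z)) \<le> (3 * R) ^ length xs" for xs
  proof (induction xs)
   case (Cons a xs)
   then show ?case using R by (auto simp: dist_norm intro!: mult_mono prod_list_nonneg)
  qed simp
  show ?thesis unfolding n_def by (rule *) (use g(4) in auto)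
 qed
 have gM: "norm (g s) \<le> M / (6 * R) ^ n" if "s \<in> cball s0 (9 * R)" for s
 proof (rule maximum_modulus_frontier[OF _ _ _ _ that])
  fix z assume "z \<in> frontier (cball s0 (9 * R))"
  then have z: "dist s0 z = 9 * R" using R by simp
  have "norm (f z) \<le> M" using M z by simp
  then have "(\<Prod>w\<leftarrow>zs. norm (z - w)) * norm (g z) \<le> M" unfolding g(2)[of z] norm_mult prodnorm .
  then have "(6 * R) ^ n * norm (g z) \<le> M"
   using mult_right_mono[OF plow[OF z], of "norm (g z)"] by simp
  then show "norm (g z) \<le> M / (6 * R) ^ n" using R by (simp add: field_simps)
 next
  show "g holomorphic_on interior (cball s0 (9 * R))" using g(1) holomorphic_on_subset by blast
  show "continuous_on (closure (cball s0 (9 * R))) g"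
   using g(1) holomorphic_on_imp_continuous_on continuous_on_subset by blast
 qed auto
 have gs0: "m \<le> (3 * R) ^ n * norm (g s0)"
 proof -
  have "m \<le> (\<Prod>z\<leftarrow>zs. norm (s0 - z)) * norm (g s0)" using m(2) unfolding g(2)[of s0] norm_mult prodnorm .
  then show ?thesis using mult_right_mono[OF pup, of "norm (g s0)"] by simp
 qed
 have gs0pos: "norm (g s0) > 0" using g(3)[of s0] R by simp
 have "m * 2 ^ n \<le> M"
 proof -
  have "(3 * R) ^ n * norm (g s0) \<le> (3 * R) ^ n * (M / (6 * R) ^ n)"
   using gM[of s0] R by (intro mult_left_mono) auto
  also have "(6 * R) ^ n = 2 ^ n * (3 * R) ^ n"
   unfolding power_mult_distrib[symmetric] by (rule arg_cong[where f = "\<lambda>x. x ^ n"]) simp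
  finally have le: "(3 * R) ^ n * norm (g s0) \<le> (3 * R) ^ n * (M / (2 ^ n * (3 * R) ^ n))" .
  have "v * (M / (2 ^ n * v)) = M / 2 ^ n" if "v \<noteq> 0" for v using that by simp
  then have "(3 * R) ^ n * (M / (2 ^ n * (3 * R) ^ n)) = M / 2 ^ n" using R by simp
  then have "m \<le> M / 2 ^ n" using gs0 le by linarith
  then show ?thesis by (simp add: field_simps)
 qed
 then have "2 ^ n \<le> M / m" using m by (simp add: field_simps)
 then have "ln (2 ^ n) \<le> ln (M / m)" using M0 m by (subst ln_le_cancel_iff) auto
 then have nb: "real n * ln 2 \<le> ln (M / m)" by (simp add: ln_realpow)
 then have lnpos: "ln (M / m) \<ge> 0" by (rule order_trans[rotated]) simp
 have "g holomorphic_on ball s0 (3 * R)" using g(1) holomorphic_on_subset by blast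
 then obtain l where l: "l holomorphic_on ball s0 (3 * R)" "\<And>s. s \<in> ball s0 (3 * R) \<Longrightarrow> exp (l s) = g s"
  using holomorphic_logarithm_exists[of "ball s0 (3 * R)" g s0] g(3) R by auto
 define k where "k = (\<lambda>w. l (s0 + w) - l s0)"
 define A where "A = ln (M / m) + 1"
 have A: "A > 0" using lnpos by (simp add: A_def)
 have kh: "k holomorphic_on ball 0 (3 * R)"
 proof -
  have "(l \<circ> (\<lambda>w. s0 + w)) holomorphic_on ball 0 (3 * R)"
   by (rule holomorphic_on_compose_gen[OF _ l(1)]) (auto intro!: holomorphic_intros simp: dist_norm)
  then show ?thesis unfolding k_def o_def by (intro holomorphic_intros)
 qed
 \<comment> \<open>Re k is the logarithm of |g(s0 + w) / g(s0)|, and passing from f to g multiplies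
   the bound M / m by 2^(-n), which only helps.\<close>
 have kre: "Re (k w) < A" if w: "w \<in> ball 0 (3 * R)" for w
 proof -
  have ws: "s0 + w \<in> ball s0 (3 * R)" using w by (simp add: dist_norm)
  have "exp (Re (k w)) = norm (exp (l (s0 + w))) / norm (exp (l s0))"
   by (simp add: k_def exp_diff)
  also have "\<dots> = norm (g (s0 + w)) / norm (g s0)" using l(2)[OF ws] l(2)[of s0] R by simp
  also have "\<dots> \<le> (M / (6 * R) ^ n) / (m / (3 * R) ^ n)"
  proof (rule frac_le)
   show "norm (g (s0 + w)) \<le> M / (6 * R) ^ n" using gM ws R by auto
   show "m / (3 * R) ^ n \<le> norm (g s0)" using gs0 R by (simp add: field_simps)
  qed (use R m M0 in auto)
  also have "\<dots> = (M / m) * ((3 * R) / (6 * R)) ^ n"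
  proof -
   have "(M / u) / (m / v) = (M / m) * (v / u)" for u v by simp
   then show ?thesis by (simp only: power_divide)
  qed
  also have "\<dots> \<le> (M / m) * 1" using R M0 m by (intro mult_left_mono power_le_one) auto
  finally have "Re (k w) \<le> ln (M / m)" using M0 m by (simp add: ln_ge_iff)
  then show ?thesis by (simp add: A_def)
 qed
 have kb: "norm (k w) \<le> 4 * A" if w: "norm w < 2 * R" for w
 proof -
  have "norm (k w) \<le> 2 * A * norm w / (3 * R - norm w)"
   by (rule borel_caratheodory[OF kh _ _ A kre]) (use R w in \<open>auto simp: k_def\<close>)
  also have "\<dots> \<le> 2 * A * (2 * R) / R" using w A R by (intro frac_le mult_left_mono) auto
  finally show ?thesis using R by simp
 qed
 have kd: "norm (deriv g s / g s) \<le> 4 * A / R" if s: "s \<in> ball s0 R" for s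
 proof -
  have sb: "s \<in> ball s0 (3 * R)" using s R by auto
  have lb: "norm (l u - l s0) \<le> 4 * A" if "u \<in> ball s0 (2 * R)" for u
   using kb[of "u - s0"] that by (simp add: k_def dist_norm norm_minus_commute)
  define r where "r = R"
  have cb: "cball s (R - e) \<subseteq> ball s0 (2 * R)" if "e > 0" for e
  proof
   fix x assume "x \<in> cball s (R - e)"
   then show "x \<in> ball s0 (2 * R)" using s that dist_triangle[of s0 x s] by auto
  qed
  have ld: "deriv l s = deriv g s / g s"
  proof -
   have "(l has_field_derivative deriv l s) (at s)" by (rule holomorphic_derivI[OF l(1) open_ball sb])
   then have "((\<lambda>s. exp (l s)) has_field_derivative (exp (l s) * deriv l s)) (at s)" by (auto intro!: derivative_eq_intros)
   then have "(g has_field_derivative (exp (l s) * deriv l s)) (at s)"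
   proof (rule DERIV_cong_ev[THEN iffD1, OF refl _ refl, rotated])
    show "\<forall>\<^sub>F x in nhds s. exp (l x) = g x"
     using eventually_nhds_in_open[OF open_ball sb] l(2) by (auto elim!: eventually_mono)
   qed
   then have "deriv g s = exp (l s) * deriv l s" by (rule DERIV_imp_deriv)
   then show ?thesis using l(2)[OF sb] g(3)[of s] sb by simp
  qed
  have bound: "norm (deriv l s) * (R - e) \<le> 4 * A" if e: "0 < e" "e < R" for e
  proof -
   have lsub: "(\<lambda>u. l u - l s0) holomorphic_on cball s (R - e)"
    using cb[OF e(1)] R by (intro holomorphic_intros holomorphic_on_subset[OF l(1)]) auto
   have "norm ((deriv ^^ 1) (\<lambda>u. l u - l s0) s) \<le> fact 1 * (4 * A) / (R - e) ^ 1"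
   proof (rule Cauchy_inequality)
    show "(\<lambda>u. l u - l s0) holomorphic_on ball s (R - e)" using lsub holomorphic_on_subset by force
    show "continuous_on (cball s (R - e)) (\<lambda>u. l u - l s0)" using lsub by (rule holomorphic_on_imp_continuous_on)
    fix x assume "norm (s - x) = R - e"
    then have "x \<in> cball s (R - e)" by (simp add: dist_norm)
    then show "norm (l x - l s0) \<le> 4 * A" by (intro lb subsetD[OF cb[OF e(1)]])
   qed (use e in auto)
   moreover have "deriv (\<lambda>u. l u - l s0) s = deriv l s"
    using holomorphic_derivI[OF l(1) open_ball sb] by (intro DERIV_imp_deriv) (auto intro!: derivative_eq_intros)
   ultimately show ?thesis using e by (simp add: field_simps)
  qed
  have "norm (deriv l s) * R \<le> 4 * A"
  proof (rule tendsto_upperbound)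
   show "((\<lambda>e. norm (deriv l s) * (R - e)) \<longlongrightarrow> norm (deriv l s) * R) (at_right 0)"
    by (auto intro!: tendsto_eq_intros)
   show "\<forall>\<^sub>F e in at_right 0. norm (deriv l s) * (R - e) \<le> 4 * A"
    using bound R by (auto simp: eventually_at_right_field intro!: exI[of _ R])
  qed simp
  then show ?thesis unfolding ld[symmetric] using R by (simp add: field_simps)
 qed
 show ?thesis
 proof (intro exI conjI ballI impI)
  show "real (length zs) * ln 2 \<le> ln (M / m)" using nb by (simp add: n_def)
  show "set zs = {s \<in> cball s0 (3 * R). f s = 0}" by (rule g)
  fix s assume s: "s \<in> ball s0 R" and fs: "f s \<noteq> 0"
  have f_eq: "f = (\<lambda>s. (\<Prod>z\<leftarrow>zs. (s - z)) * g s)" using g(2) by auto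
  have "deriv f s / f s = (\<Sum>z\<leftarrow>zs. 1 / (s - z)) + deriv g s / g s"
   unfolding f_eq
  proof (rule log_deriv_product[OF g(1)])
   show "s \<notin> set zs" using fs g(4) by auto
   show "g s \<noteq> 0" using fs g(2)[of s] by auto
  qed
  moreover have "norm (\<Sum>z\<leftarrow>zs. 1 / (s - z)) \<le> (\<Sum>z\<leftarrow>zs. 1 / norm (s - z))"
  proof (induction zs)
   case (Cons a xs)
   have "norm (1 / (s - a) + (\<Sum>z\<leftarrow>xs. 1 / (s - z))) \<le> norm (1 / (s - a)) + norm (\<Sum>z\<leftarrow>xs. 1 / (s - z))"
    by (rule norm_triangle_ineq)
   then show ?case using Cons by (simp add: norm_divide)
  qed simp
  moreover have "norm ((\<Sum>z\<leftarrow>zs. 1 / (s - z)) + deriv g s / g s) \<le> norm (\<Sum>z\<leftarrow>zs. 1 / (s - z)) + norm (deriv g s / g s)"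
   by (rule norm_triangle_ineq)
  ultimately show "norm (deriv f s / f s) \<le> (\<Sum>z\<leftarrow>zs. 1 / norm (s - z)) + 4 * (ln (M / m) + 1) / R"
   using kd[OF s] by (simp add: A_def)
 qed
qed

section \<open>Horizontal lines away from the zeros\<close>

lemma point_avoiding_finite_set:
 fixes Z :: "real set"
 assumes "finite Z" "card Z \<le> n"
 shows "\<exists>Y. N \<le> Y \<and> Y \<le> N + 1 \<and> (\<forall>z\<in>Z. 1 / (4 * (real n + 1)) \<le> \<bar>Y - z\<bar>)"
proof (rule ccontr)
 assume neg: "\<not> ?thesis"
 \<comment> \<open>Pigeonhole: these n + 1 candidates are at mutual distance at least 1 / (n + 1).
   No point of Z is within 1 / (4 (n + 1)) of two of them, so some candidate stays clear of all the
   points.\<close>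
 define c where "c = (\<lambda>j::nat. N + real j / (real n + 1))"
 have "\<exists>z\<in>Z. \<bar>c j - z\<bar> < 1 / (4 * (real n + 1))" if "j \<in> {0..n}" for j
 proof -
  have "N \<le> c j" "c j \<le> N + 1" using that by (auto simp: c_def field_simps)
  then show ?thesis using neg by (meson not_le)
 qed
 then obtain z where z: "\<And>j. j \<in> {0..n} \<Longrightarrow> z j \<in> Z \<and> \<bar>c j - z j\<bar> < 1 / (4 * (real n + 1))" by metis
 have "inj_on z {0..n}"
 proof (rule inj_onI, rule ccontr)
  fix i j assume ij: "i \<in> {0..n}" "j \<in> {0..n}" "z i = z j" "i \<noteq> j"
  have "\<bar>c i - c j\<bar> \<le> \<bar>c i - z i\<bar> + \<bar>c j - z j\<bar>" using ij(3) by linarith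
  also have "\<dots> < 2 * (1 / (4 * (real n + 1)))" using z[OF ij(1)] z[OF ij(2)] by linarith
  also have "\<dots> \<le> 1 / (real n + 1)" by (simp add: field_simps)
  finally have "\<bar>c i - c j\<bar> < 1 / (real n + 1)" .
  moreover have "c i - c j = (real i - real j) / (real n + 1)" by (simp add: c_def diff_divide_distrib)
  moreover have "1 \<le> \<bar>real i - real j\<bar>" using ij(4) by linarith
  ultimately show False by (simp add: abs_divide divide_less_cancel)
 qed
 moreover have "z ` {0..n} \<subseteq> Z" using z by auto
 ultimately have "card {0..n} \<le> card Z" using assms(1) by (rule card_inj_on_le)
 then show False using assms(2) by simp
qed

text \<open>By the reflection formula |rGamma (1 + i t)|^2 equals |sin (\<pi> i t)| / (\<pi> |t|),
  and one step of the recursion moves to 2 + i t. A crude exponential bound is enough, as only its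
  logarithm matters later.\<close>

lemma norm_rGamma_le:
 assumes "\<bar>t\<bar> \<ge> 1"
 shows "norm (rGamma (2 + \<i> * of_real t)) \<le> exp (pi * \<bar>t\<bar>)"
proof -
 define w where "w = \<i> * complex_of_real t"
 have w0: "w \<noteq> 0" "norm w = \<bar>t\<bar>" using assms by (auto simp: w_def norm_mult)
 have "w * rGamma (1 + w) * rGamma (1 - w) = sin (of_real pi * w) / of_real pi"
  using rGamma_plus1[of w] rGamma_reflection_complex[of w] by (simp add: add.commute)
 moreover have "rGamma (1 - w) = cnj (rGamma (1 + w))" unfolding cnj_rGamma by (simp add: w_def)
 ultimately have "norm (w * rGamma (1 + w) * cnj (rGamma (1 + w))) = norm (sin (of_real pi * w) / of_real pi)" by simp
 then have e: "\<bar>t\<bar> * (norm (rGamma (1 + w)))\<^sup>2 = norm (sin (of_real pi * w)) / pi"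
  by (simp add: norm_mult w0 norm_divide power2_eq_square)
 have "norm (sin (of_real pi * w)) \<le> exp (pi * \<bar>t\<bar>)"
 proof -
  have "norm (sin (of_real pi * w)) = norm (exp (\<i> * (of_real pi * w)) - exp (- (\<i> * (of_real pi * w)))) / 2"
   unfolding sin_exp_eq by (simp add: norm_divide norm_mult)
  also have "\<dots> \<le> (norm (exp (\<i> * (of_real pi * w))) + norm (exp (- (\<i> * (of_real pi * w))))) / 2"
   by (intro divide_right_mono norm_triangle_ineq4) simp
  also have "\<dots> = (exp (- (pi * t)) + exp (pi * t)) / 2" by (simp add: w_def)
  also have "\<dots> \<le> (exp (pi * \<bar>t\<bar>) + exp (pi * \<bar>t\<bar>)) / 2"
   by (intro divide_right_mono add_mono) (auto simp: abs_if mult_le_0_iff)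
  finally show ?thesis by simp
 qed
 then have "(norm (rGamma (1 + w)))\<^sup>2 \<le> exp (pi * \<bar>t\<bar>)"
 proof -
  have "1 * (norm (rGamma (1 + w)))\<^sup>2 \<le> \<bar>t\<bar> * (norm (rGamma (1 + w)))\<^sup>2" using assms by (intro mult_right_mono) auto
  also have "\<dots> \<le> norm (sin (of_real pi * w))" unfolding e using pi_gt3 by (simp add: divide_le_eq mult_le_cancel_left1)
  finally show ?thesis using \<open>norm (sin (of_real pi * w)) \<le> exp (pi * \<bar>t\<bar>)\<close> by simp
 qed
 also have "\<dots> \<le> (exp (pi * \<bar>t\<bar>))\<^sup>2" by (simp add: power2_eq_square)
 finally have r1: "norm (rGamma (1 + w)) \<le> exp (pi * \<bar>t\<bar>)" by (rule power2_le_imp_le) simp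
 have "(1 + w) * rGamma (2 + w) = rGamma (1 + w)" using rGamma_plus1[of "1 + w"] by (simp add: add_ac)
 then have "norm (1 + w) * norm (rGamma (2 + w)) = norm (rGamma (1 + w))" by (metis norm_mult)
 moreover have "1 \<le> norm (1 + w)" using complex_Re_le_cmod[of "1 + w"] by (simp add: w_def)
 ultimately have "norm (rGamma (2 + w)) \<le> norm (rGamma (1 + w))"
  by (metis mult_le_cancel_right1 norm_ge_zero not_le)
 then show ?thesis using r1 by (simp add: w_def)
qed

text \<open>The terms after the first add up to at most \<pi>^2 / 6 - 1 \<le> 3 / 4 in
  modulus.\<close>

lemma zeta_series_lower_bound:
 assumes "Re s = 2"
 shows "1 / 4 \<le> norm (zeta_series s)"
proof -
 have s: "Re s > 1" using assms by simp
 have sm: "summable (\<lambda>n. 1 / of_nat (Suc n) powr s)" by (rule summable_norm_cancel[OF zeta_series_summable[OF s]])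
 have "zeta_series s = 1 + (\<Sum>n. 1 / of_nat (Suc (Suc n)) powr s)"
  unfolding zeta_series_def using suminf_split_head[OF sm] by simp
 moreover have "norm (\<Sum>n. 1 / of_nat (Suc (Suc n)) powr s) \<le> pi\<^sup>2 / 6 - 1"
 proof -
  have nn: "norm (1 / of_nat (Suc n) powr s) = 1 / (real n + 1)\<^sup>2" for n
   unfolding norm_inverse_nat_powr assms by (simp add: powr_minus powr_realpow inverse_eq_divide add.commute)
  have sq: "(\<lambda>n. 1 / (real n + 1)\<^sup>2) sums (pi\<^sup>2 / 6)" using inverse_squares_sums by (simp add: add.commute)
  then have "(\<lambda>n. 1 / (real (Suc n) + 1)\<^sup>2) sums (pi\<^sup>2 / 6 - 1)" by (subst sums_Suc_iff) simp
  then have "(\<lambda>n. norm (1 / of_nat (Suc (Suc n)) powr s)) sums (pi\<^sup>2 / 6 - 1)" unfolding nn .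
  then show ?thesis using summable_norm[of "\<lambda>n. 1 / of_nat (Suc (Suc n)) powr s"] by (simp only: sums_iff)
 qed
 moreover have "pi\<^sup>2 / 6 - 1 \<le> 3 / 4"
 proof -
  have "pi \<le> 3.2" using pi_approx by simp
  then have "pi\<^sup>2 \<le> 3.2\<^sup>2" by (intro power_mono) auto
  then show ?thesis by (simp add: power2_eq_square)
 qed
 ultimately show ?thesis using norm_diff_ineq[of 1 "\<Sum>n. 1 / of_nat (Suc (Suc n)) powr s"] by simp
qed

text \<open>On Re s = 2 the product of \<open>zeta_factor\<close> and \<xi> is bounded below, so an
  upper bound for the reciprocal Gamma factor suffices. The exponential is far from sharp, but its
  logarithm is linear in |y|, as \<open>riemann_xi_good_heights\<close> requires.\<close>

lemma riemann_xi_lower_bound: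
 assumes "\<bar>y\<bar> \<ge> 2"
 shows "exp (- (2 * \<bar>y\<bar>)) / 16 \<le> norm (riemann_xi (Complex 2 y))"
proof -
 let ?s = "Complex 2 y"
 have f: "norm (zeta_factor ?s) \<le> 4 * exp (2 * \<bar>y\<bar>)"
 proof -
  have eq: "?s / 2 + 1 = 2 + \<i> * of_real (y / 2)" by (simp add: complex_eq_iff)
  have "norm (rGamma (?s / 2 + 1)) \<le> exp (pi * \<bar>y / 2\<bar>)"
   unfolding eq by (rule norm_rGamma_le) (use assms in simp)
  also have "\<dots> \<le> exp (2 * \<bar>y\<bar>)" using pi_less_4 by (simp add: mult_right_mono)
  finally have "norm (rGamma (?s / 2 + 1)) \<le> exp (2 * \<bar>y\<bar>)" .
  moreover have "norm (of_real pi powr (?s / 2) :: complex) = pi" by (subst norm_powr_real_powr) auto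
  ultimately have "norm (zeta_factor ?s) \<le> pi * exp (2 * \<bar>y\<bar>) / 2" by (simp add: zeta_factor_def norm_mult norm_divide)
  also have "\<dots> \<le> 4 * exp (2 * \<bar>y\<bar>)" using pi_less_4 by simp
  finally show ?thesis .
 qed
 have z: "1 / 4 \<le> norm (zeta_entire ?s)"
 proof -
  have "1 / 4 \<le> norm (zeta_series ?s)" by (rule zeta_series_lower_bound) simp
  moreover have "1 \<le> norm (?s - 1)" using complex_Re_le_cmod[of "?s - 1"] by simp
  ultimately have "1 * (1 / 4) \<le> norm (?s - 1) * norm (zeta_series ?s)" by (intro mult_mono) auto
  then show ?thesis by (simp add: zeta_entire_eq_series norm_mult)
 qed
 have "1 / 4 \<le> (4 * exp (2 * \<bar>y\<bar>)) * norm (riemann_xi ?s)"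
  using z mult_right_mono[OF f, of "norm (riemann_xi ?s)"] by (simp add: zeta_entire_def norm_mult)
 then show ?thesis by (simp add: exp_minus field_simps)
qed

text \<open>The theta moments are bounded on vertical strips, so only the factor s (1 - s) grows.
  The width 100 covers the discs of radius 36 used in
  \<open>riemann_xi_good_heights\<close>.\<close>

lemma riemann_xi_upper_bound:
 "\<exists>C>0. \<forall>s. \<bar>Re s\<bar> \<le> 100 \<longrightarrow> norm (riemann_xi s) \<le> C * (1 + norm s)\<^sup>2"
proof -
 define B where "B = (LINT u|lborel. norm (theta_density u) * exp (101 * \<bar>u\<bar>))"
 have B: "norm (theta_moment s) \<le> B" if "\<bar>Re s\<bar> \<le> 101" for s
  unfolding B_def using that by (intro norm_theta_moment_le) auto
 have B0: "B \<ge> 0" using order_trans[OF norm_ge_zero B[of 0]] by simp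
 show ?thesis
 proof (intro exI[of _ "1 + 2 * B"] conjI allI impI)
  show "1 + 2 * B > 0" using B0 by simp
  fix s assume s: "\<bar>Re s\<bar> \<le> 100"
  have "norm (riemann_xi s) \<le> 1 + norm s * norm (1 - s) * norm (theta_moment s + theta_moment (1 - s))"
   unfolding riemann_xi_def using norm_triangle_ineq4[of 1 "s * (1 - s) * (theta_moment s + theta_moment (1 - s))"]
   by (simp add: norm_mult)
  also have "\<dots> \<le> 1 + (1 + norm s) * (1 + norm s) * (2 * B)"
  proof -
   have "\<bar>Re s\<bar> \<le> 101" "\<bar>Re (1 - s)\<bar> \<le> 101" using s by auto
   then have "norm (theta_moment s + theta_moment (1 - s)) \<le> 2 * B"
    using B[of s] B[of "1 - s"] norm_triangle_ineq[of "theta_moment s" "theta_moment (1 - s)"] by linarith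
   moreover have "norm (1 - s) \<le> 1 + norm s" using norm_triangle_ineq4[of 1 s] by simp
   ultimately show ?thesis by (intro add_left_mono mult_mono) auto
  qed
  also have "\<dots> \<le> (1 + norm s)\<^sup>2 + (1 + norm s) * (1 + norm s) * (2 * B)"
   by (simp add: one_le_power)
  also have "\<dots> = (1 + 2 * B) * (1 + norm s)\<^sup>2" by (simp add: power2_eq_square algebra_simps)
  finally show "norm (riemann_xi s) \<le> (1 + 2 * B) * (1 + norm s)\<^sup>2" .
 qed
qed

text \<open>With R = 4, the disc about 2 + i N contains the segments -1 \<le> x \<le> 2 at all
  heights between N and N + 1. There ln (M / m) is O(N), so O(N) zeros matter; a height at distance
  of order 1 / N or more from all of them makes the logarithmic derivative a sum of O(N) terms of
  size O(N).\<close>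

lemma riemann_xi_good_heights:
 "\<exists>C>0. \<forall>N::nat\<ge>2. \<exists>Y. real N \<le> Y \<and> Y \<le> real N + 1 \<and>
   (\<forall>x\<in>{-1..2}. riemann_xi (Complex x Y) \<noteq> 0 \<and>
    norm (deriv riemann_xi (Complex x Y) / riemann_xi (Complex x Y)) \<le> C * (1 + real N) ^ 2)"
proof -
 obtain C0 where C0: "C0 > 0" "\<And>s. \<bar>Re s\<bar> \<le> 100 \<Longrightarrow> norm (riemann_xi s) \<le> C0 * (1 + norm s)\<^sup>2"
  using riemann_xi_upper_bound by blast
 define D where "D = \<bar>ln (16 * C0)\<bar> + 100"
 define E where "E = 2 * D + 1"
 have D0: "D \<ge> 100" by (simp add: D_def)
 show ?thesis
 proof (rule exI[of _ "8 * E * E + 2 * E"], intro conjI allI impI)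
  show "8 * E * E + 2 * E > 0" using D0 by (simp add: E_def add_pos_pos)
  fix N :: nat assume N: "N \<ge> 2"
  define M where "M = C0 * (100 + real N)\<^sup>2"
  define m where "m = exp (- (2 * real N)) / 16"
  have m0: "m > 0" by (simp add: m_def)
  have Mb: "norm (riemann_xi s) \<le> M" if s: "s \<in> cball (Complex 2 (real N)) (9 * 4)" for s
  proof -
   have d: "norm (s - Complex 2 (real N)) \<le> 36" using s by (simp add: dist_norm norm_minus_commute)
   have "\<bar>Re (s - Complex 2 (real N))\<bar> \<le> 36" using d abs_Re_le_cmod[of "s - Complex 2 (real N)"] by linarith
   then have re: "\<bar>Re s\<bar> \<le> 100" by simp
   have "norm s \<le> norm (Complex 2 (real N)) + 36" using d norm_triangle_ineq2[of s "Complex 2 (real N)"] by linarith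
   moreover have "norm (Complex 2 (real N)) \<le> 2 + real N" using cmod_le[of "Complex 2 (real N)"] by simp
   ultimately have "1 + norm s \<le> 100 + real N" by linarith
   then have "(1 + norm s)\<^sup>2 \<le> (100 + real N)\<^sup>2" by (intro power_mono) auto
   then show ?thesis using C0(2)[OF re] C0(1) unfolding M_def by (meson mult_left_mono order_trans less_imp_le)
  qed
  have mb: "m \<le> norm (riemann_xi (Complex 2 (real N)))"
   using riemann_xi_lower_bound[of "real N"] N by (simp add: m_def)
  have Rp: "(4::real) > 0" by simp
  obtain zs where zs: "real (length zs) * ln 2 \<le> ln (M / m)" "set zs = {s \<in> cball (Complex 2 (real N)) (3 * 4). riemann_xi s = 0}"
   "\<And>s. s \<in> ball (Complex 2 (real N)) 4 \<Longrightarrow> riemann_xi s \<noteq> 0 \<Longrightarrow>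
    norm (deriv riemann_xi s / riemann_xi s) \<le> (\<Sum>z\<leftarrow>zs. 1 / norm (s - z)) + 4 * (ln (M / m) + 1) / 4"
   using local_log_derivative[OF holomorphic_riemann_xi Rp Mb m0 mb] by blast
  have lnMm: "ln (M / m) \<le> D * (1 + real N)"
  proof -
   have "M / m = (16 * C0) * (100 + real N)\<^sup>2 * exp (2 * real N)" by (simp add: M_def m_def exp_minus field_simps)
   then have "ln (M / m) = ln (16 * C0) + 2 * ln (100 + real N) + 2 * real N"
    using C0(1) by (simp add: ln_mult ln_realpow)
   also have "ln (100 + real N) \<le> 49 + real N"
   proof -
    define q where "q = (100 + real N) / 50"
    have q: "q > 0" "50 * q = 100 + real N" by (simp_all add: q_def)
    have "ln (50 * q) = ln 50 + ln q" using q(1) by (subst ln_mult) auto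
    moreover have "ln q \<le> q - 1" using q(1) by (rule ln_le_minus_one)
    moreover have "ln (5 * 10) = ln 5 + ln (10::real)" by (subst ln_mult) auto
    then have "ln 50 \<le> (47::real)" using ln_le_minus_one[of "5::real"] ln_le_minus_one[of "10::real"] by simp
    moreover have "ln (50 * q) = ln (100 + real N)" by (simp only: q(2))
    moreover have "real N \<ge> 0" by simp
    ultimately show ?thesis using q(2) by linarith
   qed
   also have "ln (16 * C0) + 2 * (49 + real N) + 2 * real N \<le> D * (1 + real N)"
   proof -
    have "D * (1 + real N) = D + D * real N" by (simp add: algebra_simps)
    moreover have "100 * real N \<le> D * real N" using D0 by (intro mult_right_mono) auto
    moreover have "ln (16 * C0) \<le> D - 100" by (simp add: D_def)
    moreover have "l + 2 * (49 + k) + 2 * k \<le> d + p" if "100 * k \<le> p" "l \<le> d - 100" "0 \<le> k" for l k p d :: real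
    proof -
     have "l + 98 + 4 * k \<le> d + p" using that by linarith
     then show ?thesis by (simp add: algebra_simps)
    qed
    ultimately show ?thesis by (metis of_nat_0_le_iff)
   qed
   finally show ?thesis by simp
  qed
  define n where "n = length zs"
  have n: "real n \<le> 2 * D * (1 + real N)"
  proof -
   have "real n * (1 / 2) \<le> real n * ln 2" using ln2_ge_two_thirds by (intro mult_left_mono) auto
   then show ?thesis using zs(1) lnMm unfolding n_def by linarith
  qed
  have "card (Im ` set zs) \<le> n"
   unfolding n_def by (meson List.finite_set card_image_le card_length order_trans)
  then obtain Y where Y: "real N \<le> Y" "Y \<le> real N + 1" "\<And>z. z \<in> set zs \<Longrightarrow> 1 / (4 * (real n + 1)) \<le> \<bar>Y - Im z\<bar>"
   using point_avoiding_finite_set[of "Im ` set zs" n "real N"] by auto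
  show "\<exists>Y. real N \<le> Y \<and> Y \<le> real N + 1 \<and>
   (\<forall>x\<in>{-1..2}. riemann_xi (Complex x Y) \<noteq> 0 \<and>
    norm (deriv riemann_xi (Complex x Y) / riemann_xi (Complex x Y)) \<le> (8 * E * E + 2 * E) * (1 + real N) ^ 2)"
  proof (intro exI[of _ Y] conjI ballI Y)
   fix x :: real assume x: "x \<in> {-1..2}"
   let ?s = "Complex x Y"
   have "norm (?s - Complex 2 (real N)) < 4"
   proof -
    have "(norm (?s - Complex 2 (real N)))\<^sup>2 = (x - 2)\<^sup>2 + (Y - real N)\<^sup>2" unfolding cmod_power2 by simp
    also have "(x - 2)\<^sup>2 \<le> 3\<^sup>2" using x by (intro abs_le_square_iff[THEN iffD1]) auto
    also have "(Y - real N)\<^sup>2 \<le> 1\<^sup>2" using Y by (intro power_mono) auto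
    finally have "(norm (?s - Complex 2 (real N)))\<^sup>2 < 4\<^sup>2" by simp
    then show ?thesis by (rule power_less_imp_less_base) simp
   qed
   then have sb: "?s \<in> ball (Complex 2 (real N)) 4" by (simp add: dist_norm norm_minus_commute)
   show nz: "riemann_xi ?s \<noteq> 0"
   proof
    assume "riemann_xi ?s = 0"
    then have "?s \<in> set zs" using zs(2) sb by auto
    from Y(3)[OF this] show False by simp
   qed
   have "1 / norm (?s - z) \<le> 4 * (real n + 1)" if z: "z \<in> set zs" for z
   proof -
    have "1 / (4 * (real n + 1)) \<le> norm (?s - z)" using Y(3)[OF z] abs_Im_le_cmod[of "?s - z"] by simp
    then have "1 / norm (?s - z) \<le> 1 / (1 / (4 * (real n + 1)))" by (intro divide_left_mono mult_pos_pos) (auto intro: less_le_trans[rotated])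
    then show ?thesis by simp
   qed
   then have "(\<Sum>z\<leftarrow>zs. 1 / norm (?s - z)) \<le> (\<Sum>z\<leftarrow>zs. 4 * (real n + 1))" by (intro sum_list_mono)
   also have "\<dots> = real n * (4 * (real n + 1))" by (simp add: n_def sum_list_triv)
   finally have sl: "(\<Sum>z\<leftarrow>zs. 1 / norm (?s - z)) \<le> real n * (4 * (real n + 1))" .
   have "4 * (ln (M / m) + 1) / 4 = ln (M / m) + 1" by simp
   then have "norm (deriv riemann_xi ?s / riemann_xi ?s) \<le> real n * (4 * (real n + 1)) + (D * (1 + real N) + 1)"
    using zs(3)[OF sb nz] lnMm sl by linarith
   also have "\<dots> \<le> (8 * E * E + 2 * E) * (1 + real N)\<^sup>2"
   proof -
    define v where "v = 1 + real N"
    have v: "v \<ge> 1" by (simp add: v_def)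
    have v2: "v \<le> v\<^sup>2" using v by (simp add: power2_eq_square)
    have nE: "real n \<le> E * v" using n unfolding v_def[symmetric] E_def using v by (simp add: algebra_simps)
    have E1: "E \<ge> 1" using D0 by (simp add: E_def)
    have "1 \<le> E * v" using mult_mono[of 1 E 1 v] E1 v by simp
    then have "real n + 1 \<le> 2 * (E * v)" using nE by linarith
    then have "real n * (4 * (real n + 1)) \<le> (E * v) * (4 * (2 * (E * v)))"
     using nE by (intro mult_mono) auto
    moreover have "D * v \<le> E * v" using v D0 by (intro mult_right_mono) (auto simp: E_def)
    then have "D * v + 1 \<le> 2 * (E * v)" using \<open>1 \<le> E * v\<close> by linarith
    moreover have "2 * (E * v) \<le> 2 * (E * v\<^sup>2)" using v2 E1 by simp
    ultimately show ?thesis unfolding v_def[symmetric] by (simp add: power2_eq_square algebra_simps)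
   qed
   finally show "norm (deriv riemann_xi ?s / riemann_xi ?s) \<le> (8 * E * E + 2 * E) * (1 + real N) ^ 2" .
  qed
 qed
qed

subsection \<open>The explicit formula\<close>

text \<open>Linear growth suffices because the function is only integrated against Gaussians. The
  condition Re z \<ge> 1 / 4 keeps z + n away from 0, so the terms of the series are O((1 + |z|) /
  (n + 1)^2).\<close>

lemma norm_Digamma_le:
 "\<exists>C\<ge>0. \<forall>z::complex. Re z \<ge> 1 / 4 \<longrightarrow> norm (Digamma z) \<le> C * (1 + norm z)"
proof -
 define B where "B = (\<Sum>n. 4 * (1 / (real n + 1)\<^sup>2))"
 have sB: "summable (\<lambda>n. 4 * (1 / (real n + 1)\<^sup>2))"
  using inverse_squares_sums by (intro summable_mult) (auto simp: sums_iff add.commute)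
 have B0: "B \<ge> 0" unfolding B_def by (intro suminf_nonneg sB) auto
 define C where "C = B + norm (euler_mascheroni :: complex)"
 show ?thesis
 proof (rule exI[of _ C], intro conjI allI impI)
  show "C \<ge> 0" using B0 by (simp add: C_def)
  fix z :: complex assume z: "Re z \<ge> 1 / 4"
  have tm: "norm (inverse (of_nat (Suc n)) - inverse (z + of_nat n)) \<le> (1 + norm z) * (4 * (1 / (real n + 1)\<^sup>2))" for n
  proof -
   have r: "(real n + 1) / 4 \<le> norm (z + of_nat n)"
    using z complex_Re_le_cmod[of "z + of_nat n"] by simp
   then have nz: "z + of_nat n \<noteq> 0" by (auto simp: add_nonneg_eq_0_iff)
   have "inverse (of_nat (Suc n)) - inverse (z + of_nat n) = (z - 1) / (of_nat (Suc n) * (z + of_nat n))"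
    using nz by (simp add: field_simps del: of_nat_Suc) (simp add: algebra_simps)
   then have "norm (inverse (of_nat (Suc n)) - inverse (z + of_nat n)) = norm (z - 1) / ((real n + 1) * norm (z + of_nat n))"
    by (simp only: norm_divide norm_mult norm_of_nat) (simp add: add.commute)
   also have "\<dots> \<le> (1 + norm z) / ((real n + 1) * ((real n + 1) / 4))"
    using r norm_triangle_ineq4[of z 1] by (intro frac_le mult_left_mono) (auto simp: add.commute)
   also have "\<dots> = (1 + norm z) * (4 * (1 / (real n + 1)\<^sup>2))" by (simp add: power2_eq_square)
   finally show ?thesis .
  qed
  have sz: "summable (\<lambda>n. (1 + norm z) * (4 * (1 / (real n + 1)\<^sup>2)))" by (rule summable_mult[OF sB])
  have sn: "summable (\<lambda>n. norm (inverse (of_nat (Suc n)) - inverse (z + of_nat n)))"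
   by (rule summable_comparison_test'[OF sz]) (use tm in simp)
  have "norm (\<Sum>n. inverse (of_nat (Suc n)) - inverse (z + of_nat n)) \<le> (\<Sum>n. (1 + norm z) * (4 * (1 / (real n + 1)\<^sup>2)))"
   by (rule order_trans[OF summable_norm[OF sn]]) (rule suminf_le[OF tm sn sz])
  also have "\<dots> = (1 + norm z) * B" unfolding B_def by (rule suminf_mult[OF sB])
  finally have "norm (Digamma z) \<le> (1 + norm z) * B + norm (euler_mascheroni :: complex)"
   unfolding Digamma_def using norm_triangle_ineq4 order_trans add_right_mono by blast
  also have "\<dots> \<le> C * (1 + norm z)" by (simp add: C_def algebra_simps)
  finally show "norm (Digamma z) \<le> C * (1 + norm z)" .
 qed
qed

text \<open>Compares \<open>\<Sum> Re (1 / (z + n))\<close> with \<open>\<Sum> 1 / (n + 1 + \<bar>t\<bar>)\<close>; the difference is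
 \<open>O (\<Sum> (1 + \<bar>t\<bar>) / (n + 1 + \<bar>t\<bar>)\<^sup>2) = O (1)\<close>.\<close>
lemma Re_Digamma_bound:
 "\<bar>Re (Digamma (Complex (1 / 4) t)) - ln (1 + \<bar>t\<bar>)\<bar> \<le> 66"
proof -
 define z where "z = Complex (1 / 4) t"
 define T where "T = 1 + \<bar>t\<bar>"
 have T: "T \<ge> 1" by (simp add: T_def)
 have z0: "z \<noteq> 0" by (simp add: z_def complex_eq_iff)
 define r where "r = (\<lambda>n::nat. Re (inverse (z + of_nat n)))"
 have tm: "\<bar>r n - 1 / (real n + T)\<bar> \<le> 32 * T / (real n + T)\<^sup>2" for n
 proof -
  define u where "u = real n + 1 / 4"
  have u: "u > 0" by (simp add: u_def)
  have rn: "r n = u / (u\<^sup>2 + t\<^sup>2)" by (simp add: r_def z_def u_def add.commute)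
  have q: "(u + \<bar>t\<bar>)\<^sup>2 \<le> 2 * (u\<^sup>2 + t\<^sup>2)"
  proof -
   have "0 \<le> (u - \<bar>t\<bar>)\<^sup>2" by simp
   then show ?thesis by (simp add: power2_eq_square algebra_simps)
  qed
  have ut: "(real n + T) / 4 \<le> u + \<bar>t\<bar>" by (simp add: u_def T_def)
  have "((real n + T) / 4)\<^sup>2 \<le> (u + \<bar>t\<bar>)\<^sup>2" using T ut by (intro power_mono) auto
  then have low: "(real n + T)\<^sup>2 / 32 \<le> u\<^sup>2 + t\<^sup>2" using q by (simp add: power_divide)
  have pos: "u\<^sup>2 + t\<^sup>2 > 0" using u by (simp add: add_pos_nonneg)
  have nT: "real n + T > 0" using T by linarith
  have e: "r n - 1 / (real n + T) = (u * (real n + T) - (u\<^sup>2 + t\<^sup>2)) / ((u\<^sup>2 + t\<^sup>2) * (real n + T))"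
  proof -
   have "u / A - 1 / B = (u * B - A) / (A * B)" if "A > 0" "B > 0" for A B :: real using that by (simp add: field_simps)
   then show ?thesis unfolding rn using pos nT by blast
  qed
  have l: "\<bar>u * (real n + T) - (u\<^sup>2 + t\<^sup>2)\<bar> \<le> T * (real n + T)"
  proof -
   have e: "u * (real n + T) - (u\<^sup>2 + t\<^sup>2) = u * (\<bar>t\<bar> + 3 / 4) - \<bar>t\<bar> * \<bar>t\<bar>"
    by (simp add: u_def T_def power2_eq_square field_simps)
   have n1: "u * (\<bar>t\<bar> + 3 / 4) \<le> (real n + T) * T" using u by (intro mult_mono) (auto simp: u_def T_def)
   have n2: "\<bar>t\<bar> * \<bar>t\<bar> \<le> T * (real n + T)" by (intro mult_mono) (auto simp: T_def)
   have n3: "0 \<le> u * (\<bar>t\<bar> + 3 / 4)" using u by simp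
   have n4: "0 \<le> \<bar>t\<bar> * \<bar>t\<bar>" by simp
   have "u * (\<bar>t\<bar> + 3 / 4) \<le> T * (real n + T)" using n1 by (simp only: mult.commute)
   then show ?thesis unfolding e using n2 n3 n4 by linarith
  qed
  have "\<bar>r n - 1 / (real n + T)\<bar> \<le> (T * (real n + T)) / ((u\<^sup>2 + t\<^sup>2) * (real n + T))"
  proof -
   have AB: "(u\<^sup>2 + t\<^sup>2) * (real n + T) > 0" using pos nT by (rule mult_pos_pos)
   show ?thesis unfolding e abs_divide abs_of_pos[OF AB] using AB by (intro divide_right_mono l) simp
  qed
  also have "\<dots> = T / (u\<^sup>2 + t\<^sup>2)" using nT by simp
  also have "\<dots> \<le> T / ((real n + T)\<^sup>2 / 32)"
  proof (rule divide_left_mono[OF low])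
   show "0 \<le> T" using T by linarith
   show "0 < (u\<^sup>2 + t\<^sup>2) * ((real n + T)\<^sup>2 / 32)" using nT by (intro mult_pos_pos[OF pos]) simp
  qed
  finally show ?thesis by (simp add: mult.commute)
 qed
 have nT: "real n + T > 0" for n using T by linarith
 have telesc: "(\<Sum>n<m. 1 / (real n + T)\<^sup>2) \<le> 2 / T - 2 / (real m + T)" for m
 proof (induction m)
  case (Suc m)
  have "1 / (real m + T) - 1 / (real (Suc m) + T) = 1 / ((real m + T) * (real m + T + 1))"
   using nT[of m] by (simp add: field_simps)
  moreover have "(real m + T) * (real m + T + 1) \<le> 2 * (real m + T)\<^sup>2"
  proof -
   have "(real m + T) * (real m + T + 1) \<le> (real m + T) * (2 * (real m + T))"
    using T nT[of m] by (intro mult_left_mono) auto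
   also have "\<dots> = 2 * (real m + T)\<^sup>2" by (simp only: power2_eq_square mult_ac)
   finally show ?thesis .
  qed
  then have "2 / (2 * (real m + T)\<^sup>2) \<le> 2 / ((real m + T) * (real m + T + 1))"
   using nT[of m] by (intro divide_left_mono) auto
  ultimately have "1 / (real m + T)\<^sup>2 \<le> 2 / (real m + T) - 2 / (real (Suc m) + T)" by simp
  then show ?case using Suc by simp
 qed simp
 have lnstep: "ln (real (Suc n) + T) - ln (real n + T) \<le> 1 / (real n + T)"
  "1 / (real (Suc n) + T) \<le> ln (real (Suc n) + T) - ln (real n + T)" for n
 proof -
  have "ln ((real (Suc n) + T) / (real n + T)) \<le> (real (Suc n) + T) / (real n + T) - 1"
   using nT[of n] nT[of "Suc n"] by (intro ln_le_minus_one) auto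
  also have "\<dots> = 1 / (real n + T)" using nT[of n] by (simp add: field_simps)
  finally show "ln (real (Suc n) + T) - ln (real n + T) \<le> 1 / (real n + T)"
   using nT[of n] nT[of "Suc n"] by (simp add: ln_div)
  have "ln ((real n + T) / (real (Suc n) + T)) \<le> (real n + T) / (real (Suc n) + T) - 1"
   using nT[of n] nT[of "Suc n"] by (intro ln_le_minus_one) auto
  also have "\<dots> = - (1 / (real (Suc n) + T))" using nT[of "Suc n"] by (simp add: field_simps)
  finally show "1 / (real (Suc n) + T) \<le> ln (real (Suc n) + T) - ln (real n + T)"
   using nT[of n] nT[of "Suc n"] by (simp add: ln_div)
 qed
 have harm: "ln (real m + T) - ln T \<le> (\<Sum>n<m. 1 / (real n + T))"
  "(\<Sum>n<m. 1 / (real n + T)) \<le> 1 / T - 1 / (real m + T) + (ln (real m + T) - ln T)" for m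
 proof (induction m)
  case (Suc m)
  { case 1 show ?case using Suc.IH(1) lnstep(1)[of m] by simp
  next case 2 show ?case using Suc.IH(2) lnstep(2)[of m] by simp }
 qed simp_all
 have bnd: "\<bar>(ln (real m) - (\<Sum>n<m. r n)) - (ln T + (ln (real m) - ln (real m + T)))\<bar> \<le> 66" for m
 proof -
  have "\<bar>(\<Sum>n<m. r n) - (\<Sum>n<m. 1 / (real n + T))\<bar> \<le> (\<Sum>n<m. 32 * T / (real n + T)\<^sup>2)"
   unfolding sum_subtractf[symmetric] by (rule order_trans[OF sum_abs sum_mono]) (rule tm)
  also have "\<dots> = 32 * T * (\<Sum>n<m. 1 / (real n + T)\<^sup>2)" by (simp add: sum_distrib_left)
  also have "\<dots> \<le> 32 * T * (2 / T)"
  proof (rule mult_left_mono)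
   have "0 \<le> 2 / (real m + T)" using nT[of m] by simp
   then show "(\<Sum>n<m. 1 / (real n + T)\<^sup>2) \<le> 2 / T" using telesc[of m] by linarith
  qed (use T in simp)
  also have "\<dots> = 64" using T by simp
  finally have A: "\<bar>(\<Sum>n<m. r n) - (\<Sum>n<m. 1 / (real n + T))\<bar> \<le> 64" .
  have "1 / T \<le> 1" "0 \<le> 1 / (real m + T)" using T nT[of m] by auto
  then show ?thesis using A harm[of m] by linarith
 qed
 have "(\<lambda>m. of_real (ln (real m)) - (\<Sum>n<m. inverse (z + of_nat n))) \<longlonglongrightarrow> Digamma z"
  by (rule Digamma_LIMSEQ[OF z0])
 then have "(\<lambda>m. Re (of_real (ln (real m)) - (\<Sum>n<m. inverse (z + of_nat n)))) \<longlonglongrightarrow> Re (Digamma z)"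
  by (rule tendsto_Re)
 then have L1: "(\<lambda>m. ln (real m) - (\<Sum>n<m. r n)) \<longlonglongrightarrow> Re (Digamma z)" by (simp add: r_def)
 have L2: "(\<lambda>m. ln (real m) - ln (real m + T)) \<longlonglongrightarrow> 0" using T by real_asymp
 have "(\<lambda>m. \<bar>(ln (real m) - (\<Sum>n<m. r n)) - (ln T + (ln (real m) - ln (real m + T)))\<bar>) \<longlonglongrightarrow> \<bar>Re (Digamma z) - (ln T + 0)\<bar>"
  by (intro tendsto_intros L1 L2)
 then have "\<bar>Re (Digamma z) - (ln T + 0)\<bar> \<le> 66" by (rule LIMSEQ_le_const2) (use bnd in auto)
 then show ?thesis by (simp add: z_def T_def)
qed

text \<open>The logarithmic derivative of \<pi>^(-s/2) Gamma (s / 2) \<zeta>(s), which is \<xi>(s) /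
  (s (s - 1)). Its poles at 0 and 1 produce the terms \<open>F 0 + F 1\<close> of the explicit
  formula.\<close>

definition completed_log_deriv :: "complex \<Rightarrow> complex" where
 "completed_log_deriv s = deriv riemann_xi s / riemann_xi s - (1 / s + 1 / (s - 1))"

lemma completed_log_deriv_eq:
 assumes s: "Re s > 1"
 shows "completed_log_deriv s = - mangoldt_series s + (Digamma (s / 2) - of_real (ln pi)) / 2"
proof -
 have s0: "s \<noteq> 0" "s / 2 \<noteq> 0" using s by auto
 have np: "s / 2 + 1 \<notin> \<int>\<^sub>\<le>\<^sub>0" using s by (auto elim!: nonpos_Ints_cases simp: complex_eq_iff)
 have fn: "zeta_factor s \<noteq> 0" using s by (intro zeta_factor_nonzero) simp
 have en: "zeta_entire s \<noteq> 0" using s by (intro zeta_entire_nonzero) simp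
 then have xn: "riemann_xi s \<noteq> 0" by (auto simp: zeta_entire_def)
 have pe: "of_real pi powr (w / 2) = exp (w / 2 * of_real (ln pi))" for w :: complex
  by (simp add: powr_def Ln_of_real)
 have d1: "((\<lambda>s. exp (s / 2 * of_real (ln pi))) has_field_derivative exp (s / 2 * of_real (ln pi)) * (of_real (ln pi) / 2)) (at s)"
  by (auto intro!: derivative_eq_intros)
 have d2: "((\<lambda>s. rGamma (s / 2 + 1)) has_field_derivative (- rGamma (s / 2 + 1) * Digamma (s / 2 + 1)) * (1 / 2 + 0)) (at s)"
  by (rule DERIV_chain2[where g = "\<lambda>s. s / 2 + 1", OF has_field_derivative_rGamma_no_nonpos_int[OF np]])
   (intro derivative_intros DERIV_cdivide DERIV_ident)
 have "(zeta_factor has_field_derivative ((exp (s / 2 * of_real (ln pi)) * (of_real (ln pi) / 2)) * rGamma (s / 2 + 1)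
   + ((- rGamma (s / 2 + 1) * Digamma (s / 2 + 1)) * (1 / 2 + 0)) * exp (s / 2 * of_real (ln pi))) / 2) (at s)"
  unfolding zeta_factor_def[abs_def] pe by (rule DERIV_cdivide[OF DERIV_mult[OF d1 d2]])
 moreover have "((exp (s / 2 * of_real (ln pi)) * (of_real (ln pi) / 2)) * rGamma (s / 2 + 1)
   + ((- rGamma (s / 2 + 1) * Digamma (s / 2 + 1)) * (1 / 2 + 0)) * exp (s / 2 * of_real (ln pi))) / 2 =
   zeta_factor s * ((of_real (ln pi) - Digamma (s / 2 + 1)) / 2)"
 proof -
  have "((e * (L / 2)) * r + ((- r * D) * (1 / 2 + 0)) * e) / 2 = e * r / 2 * ((L - D) / 2)" for e r D L :: complex
   by (simp add: field_simps)
  then show ?thesis unfolding zeta_factor_def pe by blast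
 qed
 ultimately have fd: "(zeta_factor has_field_derivative (zeta_factor s * ((of_real (ln pi) - Digamma (s / 2 + 1)) / 2))) (at s)"
  by (rule DERIV_cong)
 have xd: "(riemann_xi has_field_derivative deriv riemann_xi s) (at s)"
  by (rule holomorphic_derivI[OF holomorphic_riemann_xi open_UNIV UNIV_I])
 have "(zeta_entire has_field_derivative (zeta_factor s * ((of_real (ln pi) - Digamma (s / 2 + 1)) / 2) * riemann_xi s + deriv riemann_xi s * zeta_factor s)) (at s)"
  unfolding zeta_entire_def[abs_def] by (rule DERIV_mult[OF fd xd])
 then have "deriv zeta_entire s = zeta_factor s * ((of_real (ln pi) - Digamma (s / 2 + 1)) / 2) * riemann_xi s + deriv riemann_xi s * zeta_factor s"
  by (rule DERIV_imp_deriv)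
 then have "deriv zeta_entire s / zeta_entire s = (of_real (ln pi) - Digamma (s / 2 + 1)) / 2 + deriv riemann_xi s / riemann_xi s"
  unfolding zeta_entire_def using fn xn by (simp add: add_divide_distrib)
 moreover have "Digamma (s / 2 + 1) = Digamma (s / 2) + 2 / s" using Digamma_plus1[OF s0(2)] by simp
 ultimately have "deriv riemann_xi s / riemann_xi s = 1 / (s - 1) - mangoldt_series s - (of_real (ln pi) - (Digamma (s / 2) + 2 / s)) / 2"
  using zeta_entire_log_deriv[OF s] by (metis add_diff_cancel_left')
 then show ?thesis unfolding completed_log_deriv_def by (simp add: field_simps)
qed

lemma completed_log_deriv_bound:
 "\<exists>C\<ge>0. \<forall>y. norm (completed_log_deriv (Complex 2 y)) \<le> C * (1 + \<bar>y\<bar>)"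
proof -
 obtain C where C: "C \<ge> 0" "\<And>z::complex. Re z \<ge> 1 / 4 \<Longrightarrow> norm (Digamma z) \<le> C * (1 + norm z)"
  using norm_Digamma_le by blast
 define M where "M = (\<Sum>n. mangoldt (Suc n) * real (Suc n) powr (- 2))"
 have M: "norm (mangoldt_series (Complex 2 y)) \<le> M" for y unfolding M_def by (rule norm_mangoldt_series_le) auto
 have M0: "M \<ge> 0" using order_trans[OF norm_ge_zero M[of 0]] .
 show ?thesis
 proof (rule exI[of _ "M + \<bar>ln pi\<bar> + 2 * C"], intro conjI allI)
  show "0 \<le> M + \<bar>ln pi\<bar> + 2 * C" using M0 C(1) by simp
  fix y :: real
  have "norm (Complex 2 y / 2) \<le> 1 + \<bar>y\<bar>" using cmod_le[of "Complex 2 y"] by (simp add: norm_divide)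
  then have "C * (1 + norm (Complex 2 y / 2)) \<le> C * (2 * (1 + \<bar>y\<bar>))" using C(1) by (intro mult_left_mono) auto
  moreover have "norm (Digamma (Complex 2 y / 2)) \<le> C * (1 + norm (Complex 2 y / 2))" by (rule C(2)) simp
  ultimately have D: "norm (Digamma (Complex 2 y / 2)) \<le> 2 * C * (1 + \<bar>y\<bar>)" by linarith
  have "completed_log_deriv (Complex 2 y) = - mangoldt_series (Complex 2 y) + (Digamma (Complex 2 y / 2) - of_real (ln pi)) / 2"
   by (rule completed_log_deriv_eq) simp
  then have "norm (completed_log_deriv (Complex 2 y)) \<le> norm (mangoldt_series (Complex 2 y)) + norm ((Digamma (Complex 2 y / 2) - of_real (ln pi)) / 2)"
   using norm_triangle_ineq[of "- mangoldt_series (Complex 2 y)" "(Digamma (Complex 2 y / 2) - of_real (ln pi)) / 2"] by (simp only: norm_minus_cancel)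
  also have "norm ((Digamma (Complex 2 y / 2) - of_real (ln pi)) / 2) = norm (Digamma (Complex 2 y / 2) - of_real (ln pi)) / 2"
   by (simp add: norm_divide)
  also have "\<dots> \<le> (norm (Digamma (Complex 2 y / 2)) + norm (of_real (ln pi) :: complex)) / 2"
   by (intro divide_right_mono norm_triangle_ineq4) simp
  finally have "norm (completed_log_deriv (Complex 2 y)) \<le> norm (mangoldt_series (Complex 2 y)) + (norm (Digamma (Complex 2 y / 2)) + norm (of_real (ln pi) :: complex)) / 2"
   by simp
  also have "\<dots> \<le> M + (2 * C * (1 + \<bar>y\<bar>) + \<bar>ln pi\<bar>)"
  proof -
   have "0 \<le> 2 * C * (1 + \<bar>y\<bar>)" using C(1) by simp
   moreover have "m + (d + l) / 2 \<le> M + (X + l)" if "0 \<le> X" "m \<le> M" "d \<le> X" "0 \<le> l" for m d l X :: real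
   proof -
    have "(d + l) / 2 = d / 2 + l / 2" by (rule add_divide_distrib)
    then show ?thesis using that by linarith
   qed
   ultimately show ?thesis using M[of y] D by (simp only: norm_of_real abs_ge_zero)
  qed
  also have "\<dots> \<le> (M + \<bar>ln pi\<bar>) * (1 + \<bar>y\<bar>) + 2 * C * (1 + \<bar>y\<bar>)"
   using mult_left_mono[of 1 "1 + \<bar>y\<bar>" "M + \<bar>ln pi\<bar>"] M0 by simp
  finally show "norm (completed_log_deriv (Complex 2 y)) \<le> (M + \<bar>ln pi\<bar> + 2 * C) * (1 + \<bar>y\<bar>)"
   by (simp add: algebra_simps)
 qed
qed

lemma deriv_riemann_xi_reflect: "deriv riemann_xi (1 - s) = - deriv riemann_xi s"
proof -
 have "(riemann_xi has_field_derivative deriv riemann_xi (1 - s)) (at (1 - s))"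
  by (rule holomorphic_derivI[OF holomorphic_riemann_xi open_UNIV UNIV_I])
 then have "((\<lambda>s. riemann_xi (1 - s)) has_field_derivative deriv riemann_xi (1 - s) * (0 - 1)) (at s)"
  by (intro DERIV_chain2[where g = "\<lambda>s. 1 - s"] derivative_intros)
 then have "(riemann_xi has_field_derivative - deriv riemann_xi (1 - s)) (at s)" by (simp add: riemann_xi_reflect)
 then show ?thesis by (simp add: DERIV_imp_deriv)
qed

lemma deriv_riemann_xi_cnj: "deriv riemann_xi (cnj s) = cnj (deriv riemann_xi s)"
proof -
 have "(riemann_xi has_field_derivative deriv riemann_xi s) (at s)"
  by (rule holomorphic_derivI[OF holomorphic_riemann_xi open_UNIV UNIV_I])
 then have "((cnj \<circ> riemann_xi \<circ> cnj) has_field_derivative cnj (deriv riemann_xi s)) (at (cnj s))"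
  by (intro has_field_derivative_cnj_cnj) simp_all
 moreover have "cnj \<circ> riemann_xi \<circ> cnj = riemann_xi" by (auto simp: riemann_xi_cnj)
 ultimately show ?thesis by (simp add: DERIV_imp_deriv)
qed

lemma completed_log_deriv_cnj: "completed_log_deriv (cnj s) = cnj (completed_log_deriv s)"
 by (simp add: completed_log_deriv_def deriv_riemann_xi_cnj riemann_xi_cnj)

lemma completed_log_deriv_reflect: "completed_log_deriv (1 - s) = - completed_log_deriv s"
proof -
 have "1 / (1 - s) = - (1 / (s - 1))" "1 / (1 - s - 1) = - (1 / s)"
  by (metis minus_diff_eq minus_divide_right) (simp add: minus_divide_right[symmetric])
 then show ?thesis unfolding completed_log_deriv_def deriv_riemann_xi_reflect riemann_xi_reflect by simp
qed

lemma integrable_linear_gaussian: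
 fixes g :: "real \<Rightarrow> complex"
 assumes k: "\<kappa> > 0" and m: "g \<in> borel_measurable lborel" and b: "\<And>y. norm (g y) \<le> C * (1 + \<bar>y\<bar>) * exp (- (\<kappa> * y\<^sup>2))"
 shows "integrable lborel g"
proof (rule Bochner_Integration.integrable_bound[OF integrable_gaussian_exp[of "\<kappa> / 2" "\<bar>C\<bar> * exp (1 / (2 * \<kappa>))"] m])
 show "AE y in lborel. norm (g y) \<le> norm (\<bar>C\<bar> * exp (1 / (2 * \<kappa>)) * exp (- (\<kappa> / 2 * y\<^sup>2)))"
 proof (rule AE_I2)
  fix y :: real
  have "0 \<le> (1 - \<kappa> * \<bar>y\<bar>)\<^sup>2 / (2 * \<kappa>)" using k by simp
  also have "\<dots> = 1 / (2 * \<kappa>) + \<kappa> / 2 * y\<^sup>2 - \<bar>y\<bar>" using k by (simp add: power2_eq_square field_simps)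
  finally have "exp \<bar>y\<bar> \<le> exp (1 / (2 * \<kappa>) + \<kappa> / 2 * y\<^sup>2)" by simp
  moreover have "1 + \<bar>y\<bar> \<le> exp \<bar>y\<bar>" by (rule exp_ge_add_one_self)
  ultimately have y1: "1 + \<bar>y\<bar> \<le> exp (1 / (2 * \<kappa>)) * exp (\<kappa> / 2 * y\<^sup>2)"
   unfolding exp_add[symmetric] by (rule order_trans[rotated])
  have "norm (g y) \<le> C * (1 + \<bar>y\<bar>) * exp (- (\<kappa> * y\<^sup>2))" by (rule b)
  also have "\<dots> \<le> \<bar>C\<bar> * (1 + \<bar>y\<bar>) * exp (- (\<kappa> * y\<^sup>2))" by (intro mult_right_mono) auto
  also have "\<dots> \<le> \<bar>C\<bar> * (exp (1 / (2 * \<kappa>)) * exp (\<kappa> / 2 * y\<^sup>2)) * exp (- (\<kappa> * y\<^sup>2))"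
   using y1 by (intro mult_right_mono mult_left_mono) auto
  also have "\<dots> = \<bar>C\<bar> * exp (1 / (2 * \<kappa>)) * exp (\<kappa> / 2 * y\<^sup>2 + - (\<kappa> * y\<^sup>2))" by (simp only: exp_add mult.assoc)
  also have "\<kappa> / 2 * y\<^sup>2 + - (\<kappa> * y\<^sup>2) = - (\<kappa> / 2 * y\<^sup>2)" by simp
  finally show "norm (g y) \<le> norm (\<bar>C\<bar> * exp (1 / (2 * \<kappa>)) * exp (- (\<kappa> / 2 * y\<^sup>2)))" by (simp only: real_norm_def abs_mult abs_abs abs_exp_cancel)
 qed
qed (use k in auto)

text \<open>Cauchy's theorem in the strip 1/2 \<le> Re s \<le> 2. It serves to move the Gamma part
  of the explicit formula to the critical line, where the test function is real; the sum over prime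
  powers stays on Re s = 2, inside absolute convergence.\<close>

lemma line_shift:
 fixes G :: "complex \<Rightarrow> complex"
 assumes holo: "G holomorphic_on {s. Re s > 0}" and k: "\<kappa> > 0"
  and b: "\<And>x y. 1 / 2 \<le> x \<Longrightarrow> x \<le> 2 \<Longrightarrow> norm (G (Complex x y)) \<le> C * (1 + \<bar>y\<bar>) * exp (- (\<kappa> * y\<^sup>2))"
 shows "(LINT y|lborel. G (Complex 2 y)) = (LINT y|lborel. G (Complex (1 / 2) y))"
  and "integrable lborel (\<lambda>y. G (Complex 2 y))" and "integrable lborel (\<lambda>y. G (Complex (1 / 2) y))"
proof -
 have cont: "continuous_on {s. Re s > 0} G" using holo by (rule holomorphic_on_imp_continuous_on)
 have int: "integrable lborel (\<lambda>y. G (Complex x y))" if x: "1 / 2 \<le> x" "x \<le> 2" for x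
 proof (rule integrable_linear_gaussian[OF k _ b[OF x]])
  have "continuous_on UNIV (\<lambda>y. G (Complex x y))"
   by (rule continuous_on_compose2[OF cont]) (use x in \<open>auto intro!: continuous_intros simp: Complex_eq\<close>)
  then show "(\<lambda>y. G (Complex x y)) \<in> borel_measurable lborel" by (simp add: borel_measurable_continuous_onI)
 qed
 then show i: "integrable lborel (\<lambda>y. G (Complex 2 y))" "integrable lborel (\<lambda>y. G (Complex (1 / 2) y))" by auto
 let ?Y = "\<lambda>n::nat. real n + 1"
 have img: "path_image (rectpath (Complex (1 / 2) (- ?Y n)) (Complex 2 (?Y n))) \<subseteq> {s. Re s > 0}" for n
  by (auto simp: path_image_rectpath)
 have "(\<lambda>n. contour_integral (rectpath (Complex (1 / 2) (- ?Y n)) (Complex 2 (?Y n))) G) \<longlonglongrightarrow>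
   \<i> * (LINT y|lborel. G (Complex 2 y)) - \<i> * (LINT y|lborel. G (Complex (1 / 2) y))"
 proof (rule rectpath_strip_limit[where e = "\<lambda>n. C * (1 + \<bar>?Y n\<bar>) * exp (- (\<kappa> * (?Y n)\<^sup>2))"])
  show "filterlim ?Y at_top sequentially" by real_asymp
  show "(\<lambda>n. C * (1 + \<bar>?Y n\<bar>) * exp (- (\<kappa> * (?Y n)\<^sup>2))) \<longlonglongrightarrow> 0"
  proof -
   have "(\<lambda>n. (2 + real n) * exp (- (\<kappa> * (real n + 1)\<^sup>2))) \<longlonglongrightarrow> 0" using k by real_asymp
   then have "(\<lambda>n. C * ((2 + real n) * exp (- (\<kappa> * (real n + 1)\<^sup>2)))) \<longlonglongrightarrow> C * 0" by (rule tendsto_mult_left)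
   then show ?thesis by (simp add: mult.assoc)
  qed
  show "continuous_on (path_image (rectpath (Complex (1 / 2) (- ?Y n)) (Complex 2 (?Y n)))) G" for n
   by (rule continuous_on_subset[OF cont img])
  show "norm (G (Complex x (?Y n))) \<le> C * (1 + \<bar>?Y n\<bar>) * exp (- (\<kappa> * (?Y n)\<^sup>2)) \<and>
   norm (G (Complex x (- ?Y n))) \<le> C * (1 + \<bar>?Y n\<bar>) * exp (- (\<kappa> * (?Y n)\<^sup>2))" if "1 / 2 \<le> x" "x \<le> 2" for n x
   using b[OF that, of "?Y n"] b[OF that, of "- ?Y n"] by (simp only: abs_minus_cancel power2_minus simp_thms)
 qed (use i in auto)
 moreover have "contour_integral (rectpath (Complex (1 / 2) (- ?Y n)) (Complex 2 (?Y n))) G = 0" for n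
  by (rule contour_integral_unique, rule Cauchy_theorem_convex_simple[OF holo convex_halfspace_Re_gt]) (use img in auto)
 ultimately have "\<i> * (LINT y|lborel. G (Complex 2 y)) - \<i> * (LINT y|lborel. G (Complex (1 / 2) y)) = 0"
  by (intro LIMSEQ_unique[OF _ tendsto_const]) simp
 then show "(LINT y|lborel. G (Complex 2 y)) = (LINT y|lborel. G (Complex (1 / 2) y))" by simp
qed

lemma finite_xi_zeros: "finite {p. riemann_xi p = 0 \<and> \<bar>Im p\<bar> \<le> Y}"
proof -
 have "finite {p \<in> cbox (Complex (-1) (-Y)) (Complex 2 Y). riemann_xi p = 0}"
 proof (cases "riemann_xi constant_on UNIV")
  case True
  then have "riemann_xi s = 1" for s using riemann_xi_1 unfolding constant_on_def by (metis UNIV_I)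
  then show ?thesis by simp
 next
  case False
  then show ?thesis
   by (intro holomorphic_compact_finite_zeros[OF holomorphic_riemann_xi[of UNIV]]) auto
 qed
 then show ?thesis
  by (rule finite_subset[rotated]) (auto simp: in_cbox_complex_iff dest: riemann_xi_zero_strip intro: less_imp_le)
qed

text \<open>The path runs around the strip between Re s = -1 and Re s = 2. The functional equation
  and the symmetry of F turn the left line into minus the conjugate of the right one, so twice the
  real part of the right one remains. The sum over zeros converges along the good heights, which is
  why a sequence \<open>Y\<close> is asserted to exist.\<close>

theorem explicit_formula_contour:
 fixes F :: "complex \<Rightarrow> complex"
 assumes F: "F holomorphic_on UNIV" and sym: "\<And>s. F (1 - cnj s) = cnj (F s)"
  and k: "\<kappa> > 0" and b: "\<And>x y. -1 \<le> x \<Longrightarrow> x \<le> 2 \<Longrightarrow> norm (F (Complex x y)) \<le> C * exp (- (\<kappa> * y\<^sup>2))"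
 shows "\<exists>Y. filterlim Y at_top sequentially \<and>
  (\<lambda>n::nat. \<Sum>p | riemann_xi p = 0 \<and> \<bar>Im p\<bar> < Y n. F p * of_int (zorder riemann_xi p)) \<longlonglongrightarrow>
   F 0 + F 1 + of_real (Re (LINT y|lborel. completed_log_deriv (Complex 2 y) * F (Complex 2 y)) / pi)"
proof -
 obtain B where B: "B > 0" "\<And>N::nat. N \<ge> 2 \<Longrightarrow> \<exists>Y. real N \<le> Y \<and> Y \<le> real N + 1 \<and>
   (\<forall>x\<in>{-1..2}. riemann_xi (Complex x Y) \<noteq> 0 \<and>
    norm (deriv riemann_xi (Complex x Y) / riemann_xi (Complex x Y)) \<le> B * (1 + real N) ^ 2)"
  using riemann_xi_good_heights by blast
 have "\<forall>n::nat. \<exists>Y. real (n + 2) \<le> Y \<and> Y \<le> real (n + 2) + 1 \<and>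
   (\<forall>x\<in>{-1..2}. riemann_xi (Complex x Y) \<noteq> 0 \<and>
    norm (deriv riemann_xi (Complex x Y) / riemann_xi (Complex x Y)) \<le> B * (1 + real (n + 2)) ^ 2)"
  by (intro allI B(2)) simp
 then obtain Y where Y: "\<And>n::nat. real (n + 2) \<le> Y n" "\<And>n. Y n \<le> real (n + 2) + 1"
  and Yx: "\<And>n x. x \<in> {-1..2} \<Longrightarrow> riemann_xi (Complex x (Y n)) \<noteq> 0"
  and Yb: "\<And>n x. x \<in> {-1..2} \<Longrightarrow> norm (deriv riemann_xi (Complex x (Y n)) / riemann_xi (Complex x (Y n))) \<le> B * (1 + real (n + 2)) ^ 2"
  by metis
 have Y2: "Y n \<ge> 2" for n using Y(1)[of n] by simp
 have Ytop: "filterlim Y at_top sequentially"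
  by (rule filterlim_at_top_mono[OF filterlim_real_sequentially]) (use Y(1) in \<open>auto intro!: always_eventually order_trans[OF _ Y(1)]\<close>)
 have Yx': "riemann_xi (Complex x (- Y n)) \<noteq> 0" if "x \<in> {-1..2}" for x n
  using Yx[OF that, of n] riemann_xi_cnj[of "Complex x (Y n)"] by (metis complex_cnj complex_cnj_zero_iff)
 define H where "H = (\<lambda>s. completed_log_deriv s * F s)"
 define g where "g = (\<lambda>n. rectpath (Complex (-1) (- Y n)) (Complex 2 (Y n)))"
 have Fc: "continuous_on A F" for A using F holomorphic_on_imp_continuous_on holomorphic_on_subset by blast
 have dxh: "deriv riemann_xi holomorphic_on UNIV" by (intro holomorphic_deriv holomorphic_riemann_xi) auto
 have img: "s \<in> path_image (g n) \<Longrightarrow> (Re s \<in> {-1, 2} \<and> Im s \<in> {- Y n..Y n}) \<or> (Im s \<in> {- Y n, Y n} \<and> Re s \<in> {-1..2})" for s n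
  using Y2[of n] unfolding g_def by (subst (asm) path_image_rectpath) auto
 have xi_path: "riemann_xi s \<noteq> 0" if "s \<in> path_image (g n)" for s n
 proof
  assume z: "riemann_xi s = 0"
  from img[OF that] show False
  proof
   assume "Re s \<in> {-1, 2} \<and> Im s \<in> {- Y n..Y n}"
   then show False using riemann_xi_zero_strip[OF z] by auto
  next
   assume a: "Im s \<in> {- Y n, Y n} \<and> Re s \<in> {-1..2}"
   then have "s = Complex (Re s) (Y n) \<or> s = Complex (Re s) (- Y n)" by (auto simp: complex_eq_iff)
   then show False using Yx[of "Re s" n] Yx'[of "Re s" n] a z by metis
  qed
 qed
 have s01_path: "s \<noteq> 0 \<and> s \<noteq> 1" if "s \<in> path_image (g n)" for s n
  using img[OF that] Y2[of n] by auto
 have Hcont: "continuous_on A H" if "\<And>s. s \<in> A \<Longrightarrow> riemann_xi s \<noteq> 0 \<and> s \<noteq> 0 \<and> s \<noteq> 1" for A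
  unfolding H_def completed_log_deriv_def using that
  by (intro continuous_intros Fc holomorphic_on_imp_continuous_on holomorphic_riemann_xi holomorphic_on_subset[OF dxh]) auto
 have contour: "contour_integral (g n) H = 2 * pi * \<i> * ((\<Sum>p | riemann_xi p = 0 \<and> \<bar>Im p\<bar> < Y n. F p * of_int (zorder riemann_xi p)) - (F 0 + F 1))" for n
 proof -
  define S where "S = box (Complex (-2) (- (Y n + 1))) (Complex 3 (Y n + 1))"
  have S: "open S" "connected S" unfolding S_def by (auto intro: convex_connected convex_box)
  have vp: "valid_path (g n)" "pathfinish (g n) = pathstart (g n)" by (auto simp: g_def)
  have gS: "path_image (g n) \<subseteq> S"
  proof
   fix s assume "s \<in> path_image (g n)"
   from img[OF this] show "s \<in> S"
    by (rule disjE) (use Y2[of n] in \<open>auto simp: S_def in_box_complex_iff\<close>)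
  qed
  have wn0: "\<forall>z. z \<notin> S \<longrightarrow> winding_number (g n) z = 0"
   unfolding g_def using Y2[of n]
   by (intro allI impI winding_number_rectpath_outside) (auto simp: S_def in_box_complex_iff in_cbox_complex_iff)
  have wn1: "winding_number (g n) z = 1" if "-1 < Re z" "Re z < 2" "\<bar>Im z\<bar> < Y n" for z
   unfolding g_def by (rule winding_number_rectpath) (use that in \<open>auto simp: in_box_complex_iff\<close>)
  have wn2: "winding_number (g n) z = 0" if "\<bar>Im z\<bar> > Y n" for z
   unfolding g_def using that Y2[of n] by (intro winding_number_rectpath_outside) (auto simp: in_cbox_complex_iff)
  have c1: "contour_integral (g n) (\<lambda>x. deriv riemann_xi x * F x / riemann_xi x) = 2 * pi * \<i> *
   (\<Sum>p\<in>{w\<in>S. riemann_xi w = 0 \<or> w \<in> {}}. winding_number (g n) p * F p * zorder riemann_xi p)"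
  proof (rule argument_principle[OF S _ _ vp _ wn0])
   show "finite {w\<in>S. riemann_xi w = 0 \<or> w \<in> {}}"
    by (rule finite_subset[OF _ finite_xi_zeros[of "Y n + 1"]]) (auto simp: S_def in_box_complex_iff)
   show "path_image (g n) \<subseteq> S - {w\<in>S. riemann_xi w = 0 \<or> w \<in> {}}" using gS xi_path by auto
  qed (use F holomorphic_riemann_xi in \<open>auto intro: holomorphic_on_subset\<close>)
  also have "(\<Sum>p\<in>{w\<in>S. riemann_xi w = 0 \<or> w \<in> {}}. winding_number (g n) p * F p * zorder riemann_xi p) =
   (\<Sum>p | riemann_xi p = 0 \<and> \<bar>Im p\<bar> < Y n. winding_number (g n) p * F p * zorder riemann_xi p)"
  proof (rule sum.mono_neutral_right)
   show "finite {w\<in>S. riemann_xi w = 0 \<or> w \<in> {}}"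
    by (rule finite_subset[OF _ finite_xi_zeros[of "Y n + 1"]]) (auto simp: S_def in_box_complex_iff)
   show "{p. riemann_xi p = 0 \<and> \<bar>Im p\<bar> < Y n} \<subseteq> {w\<in>S. riemann_xi w = 0 \<or> w \<in> {}}"
    by (auto simp: S_def in_box_complex_iff dest: riemann_xi_zero_strip)
   show "\<forall>i\<in>{w\<in>S. riemann_xi w = 0 \<or> w \<in> {}} - {p. riemann_xi p = 0 \<and> \<bar>Im p\<bar> < Y n}. winding_number (g n) i * F i * zorder riemann_xi i = 0"
   proof
    fix i assume i: "i \<in> {w\<in>S. riemann_xi w = 0 \<or> w \<in> {}} - {p. riemann_xi p = 0 \<and> \<bar>Im p\<bar> < Y n}"
    then have z: "riemann_xi i = 0" "\<bar>Im i\<bar> \<ge> Y n" by auto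
    have "\<bar>Im i\<bar> \<noteq> Y n"
    proof
     assume "\<bar>Im i\<bar> = Y n"
     then have "i \<in> path_image (g n)" unfolding g_def using riemann_xi_zero_strip[OF z(1)] Y2[of n]
      by (subst path_image_rectpath) (auto simp: abs_if split: if_splits)
     then show False using xi_path z(1) by blast
    qed
    then show "winding_number (g n) i * F i * zorder riemann_xi i = 0" using wn2[of i] z by simp
   qed
  qed
  also have "\<dots> = (\<Sum>p | riemann_xi p = 0 \<and> \<bar>Im p\<bar> < Y n. F p * of_int (zorder riemann_xi p))"
  proof (rule sum.cong[OF refl])
   fix p assume "p \<in> {p. riemann_xi p = 0 \<and> \<bar>Im p\<bar> < Y n}"
   then have "winding_number (g n) p = 1" using riemann_xi_zero_strip[of p] by (intro wn1) auto
   then show "winding_number (g n) p * F p * zorder riemann_xi p = F p * of_int (zorder riemann_xi p)" by simp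
  qed
  finally have c1': "contour_integral (g n) (\<lambda>x. deriv riemann_xi x * F x / riemann_xi x) = 2 * pi * \<i> *
   (\<Sum>p | riemann_xi p = 0 \<and> \<bar>Im p\<bar> < Y n. F p * of_int (zorder riemann_xi p))" .
  \<comment> \<open>1 / s + 1 / (s - 1) is the logarithmic derivative of q, so a second use of the
    argument principle handles the poles at 0 and 1.\<close>
  define q where "q = (\<lambda>s::complex. s * (s - 1))"
  have qd: "deriv q s = 2 * s - 1" for s
   unfolding q_def by (rule DERIV_imp_deriv) (auto intro!: derivative_eq_intros)
  have pz: "{w\<in>S. q w = 0 \<or> w \<in> {}} = {0, 1}"
   using Y2[of n] by (auto simp: q_def S_def in_box_complex_iff)
  have c2: "contour_integral (g n) (\<lambda>x. deriv q x * F x / q x) = 2 * pi * \<i> *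
   (\<Sum>p\<in>{w\<in>S. q w = 0 \<or> w \<in> {}}. winding_number (g n) p * F p * zorder q p)"
  proof (rule argument_principle[OF S _ _ vp _ wn0])
   show "finite {w\<in>S. q w = 0 \<or> w \<in> {}}" unfolding pz by simp
   show "path_image (g n) \<subseteq> S - {w\<in>S. q w = 0 \<or> w \<in> {}}" unfolding pz using gS s01_path by blast
   show "q holomorphic_on S - {}" unfolding q_def by (intro holomorphic_intros)
  qed (use F in \<open>auto intro: holomorphic_on_subset\<close>)
  also have "(\<Sum>p\<in>{w\<in>S. q w = 0 \<or> w \<in> {}}. winding_number (g n) p * F p * zorder q p) = F 0 + F 1"
  proof -
   have "zorder q 0 = 1" by (rule simple_zeroI[of UNIV _ "\<lambda>s. s - 1"]) (auto simp: q_def intro!: holomorphic_intros)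
   moreover have "zorder q 1 = 1" by (rule simple_zeroI[of UNIV _ "\<lambda>s. s"]) (auto simp: q_def intro!: holomorphic_intros)
   moreover have "winding_number (g n) 0 = 1" "winding_number (g n) 1 = 1" using Y2[of n] by (intro wn1; simp)+
   ultimately show ?thesis unfolding pz by simp
  qed
  finally have c2': "contour_integral (g n) (\<lambda>x. deriv q x * F x / q x) = 2 * pi * \<i> * (F 0 + F 1)" .
  define U where "U = {s. riemann_xi s \<noteq> 0} \<inter> (- {0, 1})"
  have U: "open U" unfolding U_def
   by (intro open_Int open_Collect_neq holomorphic_on_imp_continuous_on holomorphic_riemann_xi continuous_intros) (auto simp: open_Compl finite_imp_closed)
  have gU: "path_image (g n) \<subseteq> U" unfolding U_def using xi_path s01_path by blast
  have i1: "(\<lambda>x. deriv riemann_xi x * F x / riemann_xi x) contour_integrable_on (g n)"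
  proof (rule contour_integrable_holomorphic_simple[OF _ U vp(1) gU])
   show "(\<lambda>x. deriv riemann_xi x * F x / riemann_xi x) holomorphic_on U"
    by (intro holomorphic_intros holomorphic_on_subset[OF dxh] holomorphic_on_subset[OF F] holomorphic_riemann_xi) (auto simp: U_def)
  qed
  have i2: "(\<lambda>x. deriv q x * F x / q x) contour_integrable_on (g n)"
  proof (rule contour_integrable_holomorphic_simple[OF _ U vp(1) gU])
   show "(\<lambda>x. deriv q x * F x / q x) holomorphic_on U"
    unfolding qd unfolding q_def by (intro holomorphic_intros holomorphic_on_subset[OF F]) (auto simp: U_def)
  qed
  have "contour_integral (g n) H = contour_integral (g n) (\<lambda>x. deriv riemann_xi x * F x / riemann_xi x - deriv q x * F x / q x)"
  proof (rule contour_integral_eq)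
   fix x assume "x \<in> path_image (g n)"
   then have x: "x \<noteq> 0" "x - 1 \<noteq> 0" using s01_path by auto
   have "1 / x + 1 / (x - 1) = deriv q x / q x" unfolding qd unfolding q_def using x by (simp add: add_frac_eq)
   then show "H x = deriv riemann_xi x * F x / riemann_xi x - deriv q x * F x / q x"
    unfolding H_def completed_log_deriv_def by (simp add: left_diff_distrib)
  qed
  also have "\<dots> = contour_integral (g n) (\<lambda>x. deriv riemann_xi x * F x / riemann_xi x) - contour_integral (g n) (\<lambda>x. deriv q x * F x / q x)"
   by (rule contour_integral_diff[OF i1 i2])
  finally show ?thesis unfolding c1' c2' by (simp only: right_diff_distrib)
 qed
 obtain K where K: "K \<ge> 0" "\<And>y. norm (completed_log_deriv (Complex 2 y)) \<le> K * (1 + \<bar>y\<bar>)"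
  using completed_log_deriv_bound by blast
 have C0: "C \<ge> 0" using order_trans[OF norm_ge_zero b[of 0 0]] by simp
 have Hb: "norm (H (Complex 2 y)) \<le> (K * C) * (1 + \<bar>y\<bar>) * exp (- (\<kappa> * y\<^sup>2))" for y
 proof -
  have "norm (H (Complex 2 y)) \<le> (K * (1 + \<bar>y\<bar>)) * (C * exp (- (\<kappa> * y\<^sup>2)))"
   unfolding H_def norm_mult using K(2)[of y] b[of 2 y] K(1) by (intro mult_mono) auto
  then show ?thesis by (simp add: mult_ac)
 qed
 have Hm: "(\<lambda>y. H (Complex 2 y)) \<in> borel_measurable lborel"
 proof -
  have "continuous_on {s. Re s = 2} H" by (rule Hcont) (auto dest: riemann_xi_zero_strip)
  then have "continuous_on UNIV (\<lambda>y. H (Complex 2 y))"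
   by (rule continuous_on_compose2) (auto intro!: continuous_intros simp: Complex_eq)
  then show ?thesis by (simp add: borel_measurable_continuous_onI)
 qed
 have intb: "integrable lborel (\<lambda>y. H (Complex 2 y))" by (rule integrable_linear_gaussian[OF k Hm Hb])
 have Hneg: "H (Complex (-1) y) = - cnj (H (Complex 2 y))" for y
 proof -
  have e: "Complex (-1) y = 1 - cnj (Complex 2 y)" by (simp add: complex_eq_iff)
  show ?thesis unfolding H_def e completed_log_deriv_reflect completed_log_deriv_cnj sym by simp
 qed
 have inta: "integrable lborel (\<lambda>y. H (Complex (-1) y))" unfolding Hneg using intb by simp
 define J where "J = (LINT y|lborel. H (Complex 2 y))"
 have Ja: "(LINT y|lborel. H (Complex (-1) y)) = - cnj J" unfolding Hneg J_def by simp
 have "(\<lambda>n. contour_integral (rectpath (Complex (-1) (- Y n)) (Complex 2 (Y n))) H) \<longlonglongrightarrow>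
   \<i> * (LINT y|lborel. H (Complex 2 y)) - \<i> * (LINT y|lborel. H (Complex (-1) y))"
 proof (rule rectpath_strip_limit[where e = "\<lambda>n. (B * (1 + real (n + 2))\<^sup>2 + 2) * (C * exp (- (\<kappa> * (real (n + 2))\<^sup>2)))"])
  show "Y n > 0" for n using Y2[of n] by simp
  show "continuous_on (path_image (rectpath (Complex (-1) (- Y n)) (Complex 2 (Y n)))) H" for n
   by (rule Hcont) (use xi_path[of _ n] s01_path[of _ n] in \<open>auto simp: g_def\<close>)
  show "(\<lambda>n. (B * (1 + real (n + 2))\<^sup>2 + 2) * (C * exp (- (\<kappa> * (real (n + 2))\<^sup>2)))) \<longlonglongrightarrow> 0"
  proof -
   have "(\<lambda>n. (B * (1 + real (n + 2))\<^sup>2 + 2) * exp (- (\<kappa> * (real (n + 2))\<^sup>2))) \<longlonglongrightarrow> 0" using k B(1) by real_asymp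
   then have "(\<lambda>n. C * ((B * (1 + real (n + 2))\<^sup>2 + 2) * exp (- (\<kappa> * (real (n + 2))\<^sup>2)))) \<longlonglongrightarrow> C * 0" by (rule tendsto_mult_left)
   then show ?thesis by (simp only: mult.left_commute mult_zero_right)
  qed
  fix n x assume x: "-1 \<le> x" "x \<le> (2::real)"
  have P: "norm (completed_log_deriv (Complex x (Y n))) \<le> B * (1 + real (n + 2))\<^sup>2 + 2"
  proof -
   let ?s = "Complex x (Y n)"
   have "2 \<le> norm ?s" "2 \<le> norm (?s - 1)" using abs_Im_le_cmod[of ?s] abs_Im_le_cmod[of "?s - 1"] Y2[of n] by simp_all
   then have "norm (1 / ?s) \<le> 1" "norm (1 / (?s - 1)) \<le> 1" by (simp_all add: norm_divide divide_le_eq)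
   then have "norm (1 / ?s + 1 / (?s - 1)) \<le> 2" using norm_triangle_ineq[of "1 / ?s" "1 / (?s - 1)"] by linarith
   moreover have "norm (deriv riemann_xi ?s / riemann_xi ?s) \<le> B * (1 + real (n + 2))\<^sup>2" by (rule Yb) (use x in simp)
   ultimately show ?thesis unfolding completed_log_deriv_def
    using norm_triangle_ineq4[of "deriv riemann_xi ?s / riemann_xi ?s" "1 / ?s + 1 / (?s - 1)"] by linarith
  qed
  have P': "norm (completed_log_deriv (Complex x (- Y n))) \<le> B * (1 + real (n + 2))\<^sup>2 + 2"
   using P completed_log_deriv_cnj[of "Complex x (Y n)"] by (metis complex_cnj complex_mod_cnj)
  have Fb: "norm (F (Complex x u)) \<le> C * exp (- (\<kappa> * (real (n + 2))\<^sup>2))" if "u = Y n \<or> u = - Y n" for u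
  proof -
   have "(real (n + 2))\<^sup>2 \<le> u\<^sup>2" using that Y(1)[of n] by (auto intro: power_mono)
   then have "exp (- (\<kappa> * u\<^sup>2)) \<le> exp (- (\<kappa> * (real (n + 2))\<^sup>2))" using k by simp
   then show ?thesis using b[OF x, of u] C0 by (meson mult_left_mono order_trans)
  qed
  show "norm (H (Complex x (Y n))) \<le> (B * (1 + real (n + 2))\<^sup>2 + 2) * (C * exp (- (\<kappa> * (real (n + 2))\<^sup>2))) \<and>
   norm (H (Complex x (- Y n))) \<le> (B * (1 + real (n + 2))\<^sup>2 + 2) * (C * exp (- (\<kappa> * (real (n + 2))\<^sup>2)))"
   unfolding H_def norm_mult using P P' Fb B(1) by (intro conjI mult_mono) auto
 qed (use Ytop inta intb in auto)
 then have "(\<lambda>n. contour_integral (g n) H) \<longlonglongrightarrow> \<i> * J - \<i> * (- cnj J)" unfolding g_def Ja J_def[symmetric] .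
 then have "(\<lambda>n. contour_integral (g n) H / (2 * pi * \<i>) + (F 0 + F 1)) \<longlonglongrightarrow> (\<i> * J - \<i> * (- cnj J)) / (2 * pi * \<i>) + (F 0 + F 1)"
  by (intro tendsto_intros) auto
 moreover have "contour_integral (g n) H / (2 * pi * \<i>) + (F 0 + F 1) = (\<Sum>p | riemann_xi p = 0 \<and> \<bar>Im p\<bar> < Y n. F p * of_int (zorder riemann_xi p))" for n
  unfolding contour by simp
 moreover have "(\<i> * J - \<i> * (- cnj J)) / (2 * pi * \<i>) + (F 0 + F 1) = F 0 + F 1 + of_real (Re J / pi)"
  using complex_add_cnj[of J] by (simp add: right_diff_distrib[symmetric] distrib_left[symmetric])
 ultimately show ?thesis using Ytop unfolding J_def H_def by (intro exI[of _ Y]) (simp add: add_ac)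
qed

subsection \<open>Estimates of Chebyshev and Mertens\<close>

lemma ln_Suc_diff_bounds:
 assumes "n > 0"
 shows "ln (real (Suc n)) - ln (real n) \<le> 1 / real n" and "1 / real (Suc n) \<le> ln (real (Suc n)) - ln (real n)"
proof -
 have "ln (real (Suc n) / real n) \<le> real (Suc n) / real n - 1" using assms by (intro ln_le_minus_one) auto
 then show "ln (real (Suc n)) - ln (real n) \<le> 1 / real n" using assms by (simp add: ln_div field_simps)
 have "ln (real n / real (Suc n)) \<le> real n / real (Suc n) - 1" using assms by (intro ln_le_minus_one) auto
 then show "1 / real (Suc n) \<le> ln (real (Suc n)) - ln (real n)" using assms by (simp add: ln_div field_simps)
qed

lemma ln_fact_bounds:
 assumes "n > 0"
 shows "ln (fact n) \<le> real n * ln (real n)" and "real n * ln (real n) - real n \<le> ln (fact n)"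
 using assms
proof (induction n rule: nat_induct_non_zero)
 case (Suc n)
 have f: "ln (fact (Suc n)) = ln (real (Suc n)) + ln (fact n)"
  using Suc.hyps by (simp add: ln_mult del: of_nat_Suc)
 {
  case 1
  have "real n * ln (real n) \<le> real n * ln (real (Suc n))" using Suc.hyps by (intro mult_left_mono) auto
  then show ?case unfolding f using Suc.IH(1) by (simp add: algebra_simps)
 next
  case 2
  have "real n * (ln (real (Suc n)) - ln (real n)) \<le> real n * (1 / real n)"
   using ln_Suc_diff_bounds(1)[OF Suc.hyps] by (intro mult_left_mono) auto
  then have "real n * ln (real (Suc n)) - real n * ln (real n) \<le> 1" using Suc.hyps by (simp add: algebra_simps)
  then show ?case unfolding f using Suc.IH(2) by (simp add: algebra_simps)
 }
qed simp_all

lemma ln_fact_mangoldt: "ln (fact n) = (\<Sum>d\<in>{1..n}. mangoldt d * real (n div d))"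
proof (induction n)
 case (Suc n)
 have "(\<Sum>d\<in>{1..Suc n}. mangoldt d * real (Suc n div d)) =
  (\<Sum>d\<in>{1..Suc n}. mangoldt d * real (n div d) + (if d dvd Suc n then mangoldt d else 0))"
  by (intro sum.cong refl) (auto simp: div_Suc algebra_simps dvd_eq_mod_eq_0)
 also have "\<dots> = (\<Sum>d\<in>{1..Suc n}. mangoldt d * real (n div d)) + (\<Sum>d\<in>{1..Suc n}. if d dvd Suc n then mangoldt d else 0)"
  by (rule sum.distrib)
 also have "(\<Sum>d\<in>{1..Suc n}. mangoldt d * real (n div d)) = ln (fact n)" using Suc by simp
 also have "(\<Sum>d\<in>{1..Suc n}. if d dvd Suc n then mangoldt d else 0) = (\<Sum>d | d dvd Suc n. mangoldt d :: real)"
  by (subst sum.inter_filter[symmetric]) (auto intro!: sum.cong dest: dvd_imp_le intro: Suc_leI dvd_pos_nat)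
 also have "\<dots> = ln (real (Suc n))" using mangoldt_sum[of "Suc n", where ?'a = real] by simp
 finally show ?case by (simp add: ln_mult del: of_nat_Suc)
qed simp

lemma real_div_bounds: "real (n div d) \<le> real n / real d" "real n / real d \<le> real (n div d) + 1"
proof -
 have "\<lfloor>real n / real d\<rfloor> = int (n div d)" by (rule floor_divide_of_nat_eq)
 then show "real (n div d) \<le> real n / real d" "real n / real d \<le> real (n div d) + 1" by linarith+
qed

definition chebyshev_psi :: "nat \<Rightarrow> real" where
 "chebyshev_psi n = (\<Sum>d\<in>{1..n}. mangoldt d)"

text \<open>Chebyshev's argument with m = n div 2: the number n div d - 2 (m div d) is never
  negative and is at least 1 for m < d \<le> n, so the sum of \<open>mangoldt d\<close> over these d
  is at most ln (n! / (m!)^2).\<close>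

lemma chebyshev_psi_half: "chebyshev_psi n \<le> chebyshev_psi (n div 2) + 4 * real n"
proof (cases "n div 2 = 0")
 case True
 then have "n \<le> 1" by linarith
 then have "chebyshev_psi n = 0" by (cases n) (auto simp: chebyshev_psi_def le_Suc_eq)
 then show ?thesis by (simp add: chebyshev_psi_def sum_nonneg mangoldt_nonneg add_nonneg_nonneg)
next
 case False
 define m where "m = n div 2"
 have m: "m > 0" "2 * m \<le> n" "n \<le> 2 * m + 1" using False by (auto simp: m_def)
 have "chebyshev_psi n - chebyshev_psi m = (\<Sum>d\<in>{m<..n}. mangoldt d)"
 proof -
  have "{1..n} = {1..m} \<union> {m<..n}" using m by auto
  then have "(\<Sum>d\<in>{1..n}. mangoldt d) = (\<Sum>d\<in>{1..m} \<union> {m<..n}. mangoldt d :: real)" by (simp only:)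
  also have "\<dots> = (\<Sum>d\<in>{1..m}. mangoldt d) + (\<Sum>d\<in>{m<..n}. mangoldt d)" by (rule sum.union_disjoint) auto
  finally show ?thesis unfolding chebyshev_psi_def by linarith
 qed
 also have "\<dots> \<le> (\<Sum>d\<in>{m<..n}. mangoldt d * (real (n div d) - 2 * real (m div d)))"
 proof (rule sum_mono)
  fix d assume d: "d \<in> {m<..n}"
  have "1 \<le> n div d" using d by (simp add: Suc_le_eq div_greater_zero_iff)
  then have "1 \<le> real (n div d) - 2 * real (m div d)" using d by (simp del: One_nat_def)
  then show "mangoldt d \<le> mangoldt d * (real (n div d) - 2 * real (m div d))"
   using mult_left_mono[of 1 _ "mangoldt d"] mangoldt_nonneg[of d] by simp
 qed
 also have "\<dots> \<le> (\<Sum>d\<in>{1..n}. mangoldt d * (real (n div d) - 2 * real (m div d)))"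
 proof (rule sum_mono2)
  fix d assume "d \<in> {1..n} - {m<..n}"
  have "2 * (m div d) \<le> n div d"
  proof (cases "d = 0")
   case False
   have "2 * (m div d) * d \<le> n" using m(2) by (metis div_times_less_eq_dividend mult.assoc mult_le_mono2 order_trans)
   then show ?thesis using False by (simp add: less_eq_div_iff_mult_less_eq)
  qed simp
  then have "0 \<le> real (n div d) - 2 * real (m div d)" by linarith
  then show "0 \<le> mangoldt d * (real (n div d) - 2 * real (m div d))" by (simp add: mangoldt_nonneg)
 qed auto
 also have "\<dots> = ln (fact n) - 2 * (\<Sum>d\<in>{1..n}. mangoldt d * real (m div d))"
  unfolding ln_fact_mangoldt[of n] by (simp add: right_diff_distrib sum_subtractf sum_distrib_left mult_ac)
 also have "(\<Sum>d\<in>{1..n}. mangoldt d * real (m div d)) = (\<Sum>d\<in>{1..m}. mangoldt d * real (m div d))"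
  using m by (intro sum.mono_neutral_right) auto
 also have "\<dots> = ln (fact m)" by (rule ln_fact_mangoldt[symmetric])
 also have "ln (fact n) - 2 * ln (fact m) \<le> real n * ln (real n) - 2 * (real m * ln (real m) - real m)"
  using ln_fact_bounds(1)[of n] ln_fact_bounds(2)[of m] m by simp
 also have "\<dots> \<le> 4 * real n"
 proof -
  have "real n * ln (real n) \<le> (2 * real m + 1) * (ln (3 * real m))"
   using m by (intro mult_mono) auto
  also have "\<dots> = 2 * real m * ln (real m) + 2 * real m * ln 3 + ln (3 * real m)"
   using m by (simp add: ln_mult algebra_simps)
  also have "\<dots> \<le> 2 * real m * ln (real m) + 2 * real m * (3/2) + (3 * real m - 1)"
  proof -
   have "ln 3 \<le> (3/2::real)"
   proof -
    have "ln (2 * (3/2)) = ln 2 + ln (3/2::real)" by (subst ln_mult) auto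
    then show ?thesis using ln_le_minus_one[of "2::real"] ln_le_minus_one[of "3/2::real"] by simp
   qed
   then show ?thesis using ln_le_minus_one[of "3 * real m"] m by (intro add_mono mult_left_mono) auto
  qed
  finally have "real n * ln (real n) - 2 * (real m * ln (real m) - real m) \<le> 8 * real m" by (simp add: algebra_simps)
  also have "\<dots> \<le> 4 * real n" using m(2) by simp
  finally show ?thesis .
 qed
 finally show ?thesis by (simp add: m_def)
qed

lemma chebyshev_psi_le: "chebyshev_psi n \<le> 8 * real n"
proof (induction n rule: less_induct)
 case (less n)
 show ?case
 proof (cases "n = 0")
  case False
  then have "chebyshev_psi (n div 2) \<le> 8 * real (n div 2)" by (intro less) auto
  also have "\<dots> \<le> 4 * real n" using real_div_bounds(1)[of n 2] by simp
  finally show ?thesis using chebyshev_psi_half[of n] by linarith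
 qed (simp add: chebyshev_psi_def)
qed

text \<open>Divide ln n! = \<Sum> \<open>mangoldt d\<close> (n div d) by n. Replacing n div d by n /
  d costs at most \<open>chebyshev_psi n\<close>, which is O(n).\<close>

lemma mertens_nat:
 assumes "n > 0"
 shows "\<bar>(\<Sum>d\<in>{1..n}. mangoldt d / real d) - ln (real n)\<bar> \<le> 9"
proof -
 define S where "S = (\<Sum>d\<in>{1..n}. mangoldt d / real d)"
 have nS: "real n * S = (\<Sum>d\<in>{1..n}. mangoldt d * (real n / real d))"
  unfolding S_def sum_distrib_left by (intro sum.cong refl) simp
 have "ln (fact n) \<le> real n * S"
  unfolding nS ln_fact_mangoldt using real_div_bounds(1)[of n] by (intro sum_mono mult_left_mono) (auto simp: mangoldt_nonneg)
 moreover have "real n * S \<le> ln (fact n) + chebyshev_psi n"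
  unfolding nS ln_fact_mangoldt chebyshev_psi_def sum.distrib[symmetric]
 proof (rule sum_mono)
  fix d assume "d \<in> {1..n}"
  have "real n / real d \<le> real (n div d) + 1" using real_div_bounds(2)[of n d] by linarith
  then have "mangoldt d * (real n / real d) \<le> mangoldt d * (real (n div d) + 1)" by (intro mult_left_mono) (auto simp: mangoldt_nonneg)
  then show "mangoldt d * (real n / real d) \<le> mangoldt d * real (n div d) + mangoldt d" by (simp add: algebra_simps)
 qed
 ultimately have "real n * (ln (real n) - 1) \<le> real n * S" "real n * S \<le> real n * (ln (real n) + 8)"
  using ln_fact_bounds[OF assms] chebyshev_psi_le[of n] by (simp_all add: algebra_simps)
 then have "ln (real n) - 1 \<le> S" "S \<le> ln (real n) + 8" using assms by simp_all
 then show ?thesis unfolding S_def by linarith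
qed

text \<open>Ranges are measured on a logarithmic scale: division by a shortens the range by ln a,
  and sums with weights like 1 / n are compared with integrals over t.\<close>

definition exp_range :: "real \<Rightarrow> nat set" where
 "exp_range t = {n. n > 0 \<and> ln (real n) \<le> t}"

lemma exp_range_eq: "exp_range t = {1..nat \<lfloor>exp t\<rfloor>}"
proof -
 have "ln (real n) \<le> t \<longleftrightarrow> n \<le> nat \<lfloor>exp t\<rfloor>" if "n > 0" for n
 proof -
  have "ln (real n) \<le> t \<longleftrightarrow> real n \<le> exp t" using that by (metis exp_gt_zero ln_exp ln_le_cancel_iff of_nat_0_less_iff)
  also have "\<dots> \<longleftrightarrow> n \<le> nat \<lfloor>exp t\<rfloor>" by (simp add: le_nat_floor le_floor_iff nat_le_iff le_nat_iff)
  finally show ?thesis .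
 qed
 then show ?thesis unfolding exp_range_def by auto
qed

lemma finite_exp_range [simp]: "finite (exp_range t)" by (simp add: exp_range_eq)

lemma floor_exp_bounds:
 assumes "t \<ge> 0"
 shows "nat \<lfloor>exp t\<rfloor> > 0" and "\<bar>ln (real (nat \<lfloor>exp t\<rfloor>)) - t\<bar> \<le> 1"
proof -
 define N where "N = nat \<lfloor>exp t\<rfloor>"
 have e: "exp t \<ge> 1" using assms by simp
 then have "\<lfloor>exp t\<rfloor> \<ge> 1" by (simp add: le_floor_iff)
 then have N: "real N = of_int \<lfloor>exp t\<rfloor>" "N > 0" by (simp_all add: N_def)
 show "nat \<lfloor>exp t\<rfloor> > 0" using N by (simp add: N_def)
 have "real N \<le> exp t" "exp t < real N + 1" unfolding N(1) by linarith+
 moreover have "real N + 1 \<le> 2 * real N" using N(2) by simp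
 ultimately have b: "real N \<le> exp t" "exp t \<le> 2 * real N" by linarith+
 have "ln (real N) \<le> ln (exp t)" by (rule iffD2[OF ln_le_cancel_iff]) (use b N(2) in simp_all)
 moreover have "ln (exp t) \<le> ln (2 * real N)" by (rule iffD2[OF ln_le_cancel_iff]) (use b N(2) in simp_all)
 moreover have "ln (2 * real N) = ln 2 + ln (real N)" using N by (subst ln_mult) auto
 ultimately show "\<bar>ln (real (nat \<lfloor>exp t\<rfloor>)) - t\<bar> \<le> 1"
  using ln_le_minus_one[of "2::real"] unfolding N_def[symmetric] by simp
qed

lemma mertens_mangoldt:
 assumes "t \<ge> 0"
 shows "\<bar>(\<Sum>d\<in>exp_range t. mangoldt d / real d) - t\<bar> \<le> 10"
 unfolding exp_range_eq using mertens_nat[OF floor_exp_bounds(1)[OF assms]] floor_exp_bounds(2)[OF assms] by linarith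

lemma summable_mangoldt_square: "summable (\<lambda>n. mangoldt n / (real n)\<^sup>2 :: real)"
proof (rule summable_comparison_test')
 show "summable (\<lambda>n. 2 * real n powr (- (3/2)))" by (intro summable_mult) (simp add: summable_real_powr_iff)
 fix n :: nat
 show "norm (mangoldt n / (real n)\<^sup>2 :: real) \<le> 2 * real n powr (- (3/2))"
 proof (cases "n = 0")
  case False
  have "mangoldt n \<le> (\<Sum>d | d dvd n. mangoldt d :: real)"
   using False by (intro member_le_sum) (auto simp: mangoldt_nonneg)
  also have "\<dots> = ln (real n)" using False mangoldt_sum[of n, where ?'a = real] by simp
  also have "\<dots> \<le> real n powr (1/2) / (1/2)" using False by (intro ln_powr_bound) auto
  finally have "mangoldt n / (real n)\<^sup>2 \<le> (real n powr (1/2) / (1/2)) / (real n)\<^sup>2" by (intro divide_right_mono) auto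
  also have "\<dots> = 2 * real n powr (- (3/2))"
  proof -
   have "(real n)\<^sup>2 = real n powr 2" using False using powr_realpow[of "real n" 2] by simp
   then have "(real n powr (1/2) / (1/2)) / (real n)\<^sup>2 = 2 * (real n powr (1/2) / real n powr 2)" by simp
   also have "real n powr (1/2) / real n powr 2 = real n powr (1/2 - 2)" by (rule powr_diff[symmetric])
   also have "1/2 - 2 = - (3/2 :: real)" by simp
   finally show ?thesis .
  qed
  finally show ?thesis by (simp add: mangoldt_nonneg)
 qed simp
qed

definition mangoldt_square_sum :: real where
 "mangoldt_square_sum = (\<Sum>n. mangoldt n / (real n)\<^sup>2)"

lemma sum_mangoldt_square_le:
 assumes "finite A"
 shows "(\<Sum>n\<in>A. mangoldt n / (real n)\<^sup>2) \<le> mangoldt_square_sum"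
 unfolding mangoldt_square_sum_def using assms
 by (intro sum_le_suminf summable_mangoldt_square) (auto simp: mangoldt_nonneg)

text \<open>A proper prime power \<open>p ^ k\<close> is sent to \<open>p ^ (k div 2)\<close>, which is injective on each parity class of \<open>k\<close>.\<close>
lemma proper_prime_power_sum:
 assumes "finite A"
 shows "(\<Sum>n\<in>{n\<in>A. \<not> prime n}. mangoldt n / real n) \<le> 2 * mangoldt_square_sum"
proof -
 define B where "B = (\<lambda>r. {n\<in>A. \<exists>p k. prime p \<and> k \<ge> 1 \<and> n = p ^ (2 * k + r)})"
 have key: "(\<Sum>n\<in>B r. mangoldt n / real n) \<le> mangoldt_square_sum" if r: "r \<le> 1" for r
 proof -
  have "\<forall>n\<in>B r. \<exists>p k. prime p \<and> k \<ge> 1 \<and> n = p ^ (2 * k + r)" by (auto simp: B_def)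
  then obtain p k where pk: "\<And>n. n \<in> B r \<Longrightarrow> prime (p n) \<and> k n \<ge> 1 \<and> n = p n ^ (2 * k n + r)" by metis
  have inj: "inj_on (\<lambda>n. p n ^ k n) (B r)"
  proof (rule inj_onI)
   fix n m assume nm: "n \<in> B r" "m \<in> B r" "p n ^ k n = p m ^ k m"
   have a: "prime (p n)" "k n \<ge> 1" "prime (p m)" "k m \<ge> 1" using pk nm by auto
   have "p n = p m" "k n = k m" using prime_power_inj'[OF a(1,3) nm(3)] a by auto
   then have "p n ^ (2 * k n + r) = p m ^ (2 * k m + r)" by simp
   then show "n = m" using pk[OF nm(1)] pk[OF nm(2)] by simp
  qed
  have "(\<Sum>n\<in>B r. mangoldt n / real n) \<le> (\<Sum>n\<in>B r. mangoldt (p n ^ k n) / (real (p n ^ k n))\<^sup>2)"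
  proof (rule sum_mono)
   fix n assume n: "n \<in> B r"
   have a: "prime (p n)" "k n \<ge> 1" "n = p n ^ (2 * k n + r)" using pk[OF n] by auto
   have "mangoldt n = (mangoldt (p n ^ k n) :: real)"
   proof -
    have "mangoldt (p n ^ (2 * k n + r)) = (mangoldt (p n ^ k n) :: real)" using a(1,2) by (simp del: power_mult)
    then show ?thesis using a(3) by simp
   qed
   moreover have "(real (p n ^ k n))\<^sup>2 \<le> real n"
   proof -
    have "(p n ^ k n)\<^sup>2 = p n ^ (2 * k n)" by (simp add: power_mult[symmetric] mult.commute)
    also have "\<dots> \<le> p n ^ (2 * k n + r)" using a(1) by (intro power_increasing) (auto simp: Suc_le_eq prime_gt_0_nat)
    finally have "(p n ^ k n)\<^sup>2 \<le> n" using a(3) by simp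
    then show ?thesis by (metis of_nat_le_iff of_nat_power)
   qed
   moreover have "real (p n ^ k n) > 0" using a(1) by (simp add: prime_gt_0_nat)
   ultimately show "mangoldt n / real n \<le> mangoldt (p n ^ k n) / (real (p n ^ k n))\<^sup>2"
    by (intro frac_le) (auto simp: mangoldt_nonneg simp del: of_nat_power)
  qed
  also have "\<dots> = (\<Sum>m\<in>(\<lambda>n. p n ^ k n) ` B r. mangoldt m / (real m)\<^sup>2)"
   by (subst sum.reindex[OF inj]) (simp add: o_def)
  also have "\<dots> \<le> mangoldt_square_sum" using assms by (intro sum_mangoldt_square_le) (auto simp: B_def)
  finally show ?thesis .
 qed
 have "(\<Sum>n\<in>{n\<in>A. \<not> prime n}. mangoldt n / real n) = (\<Sum>n\<in>{n\<in>A. \<not> prime n \<and> primepow n}. mangoldt n / real n)"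
  using assms by (intro sum.mono_neutral_right) (auto simp: mangoldt_def)
 also have "\<dots> \<le> (\<Sum>n\<in>B 0 \<union> B 1. mangoldt n / real n)"
 proof (rule sum_mono2)
  show "finite (B 0 \<union> B 1)" using assms by (auto simp: B_def)
  show "{n\<in>A. \<not> prime n \<and> primepow n} \<subseteq> B 0 \<union> B 1"
  proof
   fix n assume n: "n \<in> {n\<in>A. \<not> prime n \<and> primepow n}"
   then obtain p j where pj: "prime p" "j > 0" "n = p ^ j" by (auto simp: primepow_def)
   have "j \<noteq> 1" using pj n by auto
   then have j: "j div 2 \<ge> 1" "j = 2 * (j div 2) + j mod 2" using pj(2) by auto
   have "n \<in> A" "n = p ^ (2 * (j div 2) + j mod 2)" using n pj(3) j(2) by auto
   then have "n \<in> B (j mod 2)" unfolding B_def using pj(1) j(1) by blast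
   moreover have "j mod 2 = 0 \<or> j mod 2 = 1" by auto
   ultimately show "n \<in> B 0 \<union> B 1" by (metis UnCI)
  qed
 qed (auto simp: mangoldt_nonneg)
 also have "\<dots> \<le> (\<Sum>n\<in>B 0. mangoldt n / real n) + (\<Sum>n\<in>B 1. mangoldt n / real n)"
 proof -
  have "finite (B 0)" "finite (B 1)" using assms by (auto simp: B_def)
  then have "(\<Sum>n\<in>B 0 \<union> B 1. mangoldt n / real n) + (\<Sum>n\<in>B 0 \<inter> B 1. mangoldt n / real n)
    = (\<Sum>n\<in>B 0. mangoldt n / real n) + (\<Sum>n\<in>B 1. mangoldt n / real n :: real)"
   by (rule sum.union_inter)
  moreover have "0 \<le> (\<Sum>n\<in>B 0 \<inter> B 1. mangoldt n / real n :: real)" by (intro sum_nonneg) (auto simp: mangoldt_nonneg)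
  ultimately show ?thesis by linarith
 qed
 also have "\<dots> \<le> 2 * mangoldt_square_sum" using key[of 0] key[of 1] by simp
 finally show ?thesis .
qed

lemma mertens_primes:
 assumes "t \<ge> 0"
 shows "\<bar>(\<Sum>d\<in>exp_range t. (if prime d then ln (real d) / real d else 0)) - t\<bar> \<le> 10 + 2 * mangoldt_square_sum"
proof -
 have split: "(\<Sum>d\<in>exp_range t. mangoldt d / real d) =
  (\<Sum>d\<in>exp_range t. (if prime d then ln (real d) / real d else 0)) + (\<Sum>d\<in>{d\<in>exp_range t. \<not> prime d}. mangoldt d / real d)"
 proof -
  have "(\<Sum>d\<in>{d\<in>exp_range t. \<not> prime d}. mangoldt d / real d) = (\<Sum>d\<in>exp_range t. if \<not> prime d then mangoldt d / real d else 0)"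
   by (rule sum.inter_filter) simp
  then show ?thesis by (simp only: sum.distrib[symmetric]) (auto intro!: sum.cong)
 qed
 have "0 \<le> (\<Sum>d\<in>{d\<in>exp_range t. \<not> prime d}. mangoldt d / real d)" by (intro sum_nonneg) (auto simp: mangoldt_nonneg)
 then show ?thesis using mertens_mangoldt[OF assms] proper_prime_power_sum[of "exp_range t"] split by simp
qed

text \<open>Each f(Y) - f(ln n) is the integral of f' over [ln n, Y]. Interchanging sum and integral
  puts the partial sums of b against f', where their deviation from \<kappa> t is at most C.\<close>

lemma abel_summation_bound:
 fixes b :: "nat \<Rightarrow> real" and f f' :: "real \<Rightarrow> real"
 assumes B: "\<And>t. t \<ge> 0 \<Longrightarrow> \<bar>(\<Sum>n\<in>exp_range t. b n) - \<kappa> * t\<bar> \<le> C" and Y: "Y \<ge> 0"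
  and f: "\<And>t. t \<in> {0..Y} \<Longrightarrow> (f has_real_derivative f' t) (at t)"
  and f'c: "continuous_on {0..Y} f'" and f'b: "\<And>t. t \<in> {0..Y} \<Longrightarrow> \<bar>f' t\<bar> \<le> D"
 shows "\<bar>(\<Sum>n\<in>exp_range Y. b n * f (ln (real n))) - \<kappa> * integral {0..Y} f\<bar> \<le> C * (\<bar>f Y\<bar> + Y * D)"
proof -
 define S where "S = (\<lambda>t. \<Sum>n\<in>exp_range t. b n)"
 define \<phi> where "\<phi> = (\<lambda>n t. if ln (real n) \<le> t then f' t else 0)"
 have C0: "C \<ge> 0" using B[of 0] by simp
 have fc: "continuous_on {0..Y} f" using f by (meson DERIV_isCont continuous_at_imp_continuous_on)
 have f'i: "f' integrable_on {u..Y}" if "0 \<le> u" for u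
  using that by (intro integrable_continuous_real continuous_on_subset[OF f'c]) auto
 have ftc: "(f' has_integral (f Y - f u)) {u..Y}" if "0 \<le> u" "u \<le> Y" for u
  using that f by (intro fundamental_theorem_of_calculus)
   (auto simp: has_real_derivative_iff_has_vector_derivative[symmetric] intro: has_field_derivative_at_within)
 have \<phi>: "(\<phi> n has_integral (f Y - f (ln (real n)))) {0..Y}" if n: "n \<in> exp_range Y" for n
 proof -
  have l: "0 \<le> ln (real n)" "ln (real n) \<le> Y" using n by (auto simp: exp_range_def)
  have "((\<lambda>t. if t \<in> {ln (real n)..Y} then f' t else 0) has_integral (f Y - f (ln (real n)))) {0..Y}"
   using ftc[OF l] l by (subst has_integral_restrict) auto
  then show ?thesis by (rule has_integral_eq[rotated]) (auto simp: \<phi>_def)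
 qed
 have sumphi: "(\<Sum>n\<in>exp_range Y. b n * \<phi> n t) = S t * f' t" if t: "t \<in> {0..Y}" for t
 proof -
  have sub: "exp_range t \<subseteq> exp_range Y" using t by (auto simp: exp_range_def)
  have "(\<Sum>n\<in>exp_range Y. b n * \<phi> n t) = (\<Sum>n\<in>exp_range t. b n * \<phi> n t)"
   by (rule sum.mono_neutral_right[OF finite_exp_range sub]) (auto simp: \<phi>_def exp_range_def)
  also have "\<dots> = (\<Sum>n\<in>exp_range t. b n * f' t)" by (intro sum.cong) (auto simp: \<phi>_def exp_range_def)
  finally show ?thesis by (simp add: S_def sum_distrib_right)
 qed
 have "((\<lambda>t. \<Sum>n\<in>exp_range Y. b n * \<phi> n t) has_integral (\<Sum>n\<in>exp_range Y. b n * (f Y - f (ln (real n))))) {0..Y}"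
  by (intro has_integral_sum has_integral_mult_right \<phi>) auto
 then have I1: "((\<lambda>t. S t * f' t) has_integral (S Y * f Y - (\<Sum>n\<in>exp_range Y. b n * f (ln (real n))))) {0..Y}"
  using sumphi by (subst (asm) has_integral_cong) (auto simp: S_def right_diff_distrib sum_subtractf sum_distrib_right)
 have "((\<lambda>t. f t + t * f' t) has_integral (Y * f Y - 0 * f 0)) {0..Y}"
 proof (rule fundamental_theorem_of_calculus[OF Y])
  fix t assume t: "t \<in> {0..Y}"
  have "((\<lambda>t. t * f t) has_real_derivative (1 * f t + f' t * t)) (at t)" by (rule DERIV_mult[OF DERIV_ident f[OF t]])
  then have "((\<lambda>t. t * f t) has_real_derivative (f t + t * f' t)) (at t within {0..Y})"
   by (simp add: mult.commute has_field_derivative_at_within)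
  then show "((\<lambda>t. t * f t) has_vector_derivative (f t + t * f' t)) (at t within {0..Y})"
   by (simp add: has_real_derivative_iff_has_vector_derivative)
 qed
 moreover have "(f has_integral integral {0..Y} f) {0..Y}" using integrable_continuous_real[OF fc] by (rule integrable_integral)
 ultimately have "((\<lambda>t. f t + t * f' t - f t) has_integral (Y * f Y - 0 * f 0 - integral {0..Y} f)) {0..Y}"
  by (rule has_integral_diff)
 then have I2: "((\<lambda>t. t * f' t) has_integral (Y * f Y - integral {0..Y} f)) {0..Y}" by simp
 have I3: "((\<lambda>t. S t * f' t - \<kappa> * (t * f' t)) has_integral
   (S Y * f Y - (\<Sum>n\<in>exp_range Y. b n * f (ln (real n))) - \<kappa> * (Y * f Y - integral {0..Y} f))) {0..Y}"
  by (intro has_integral_diff I1 has_integral_mult_right I2)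
 have D0: "D \<ge> 0" using f'b[of 0] Y by force
 have "norm (S Y * f Y - (\<Sum>n\<in>exp_range Y. b n * f (ln (real n))) - \<kappa> * (Y * f Y - integral {0..Y} f)) \<le> (C * D) * measure lborel (cbox 0 Y)"
 proof (rule has_integral_bound)
  show "((\<lambda>t. S t * f' t - \<kappa> * (t * f' t)) has_integral (S Y * f Y - (\<Sum>n\<in>exp_range Y. b n * f (ln (real n))) - \<kappa> * (Y * f Y - integral {0..Y} f))) (cbox 0 Y)"
   using I3 by simp
  fix t assume "t \<in> cbox 0 Y"
  then have t: "t \<in> {0..Y}" by simp
  have "norm (S t * f' t - \<kappa> * (t * f' t)) = \<bar>S t - \<kappa> * t\<bar> * \<bar>f' t\<bar>"
   by (simp add: abs_mult[symmetric] algebra_simps)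
  also have "\<dots> \<le> C * D" using B[of t] t f'b[OF t] C0 unfolding S_def by (intro mult_mono) auto
  finally show "norm (S t * f' t - \<kappa> * (t * f' t)) \<le> C * D" .
 qed (use C0 D0 in auto)
 then have 1: "\<bar>S Y * f Y - (\<Sum>n\<in>exp_range Y. b n * f (ln (real n))) - \<kappa> * (Y * f Y - integral {0..Y} f)\<bar> \<le> C * D * Y"
  using Y by simp
 have 2: "\<bar>(S Y - \<kappa> * Y) * f Y\<bar> \<le> C * \<bar>f Y\<bar>"
  unfolding abs_mult using B[OF Y] by (intro mult_right_mono) (auto simp: S_def)
 have "(\<Sum>n\<in>exp_range Y. b n * f (ln (real n))) - \<kappa> * integral {0..Y} f =
   (S Y - \<kappa> * Y) * f Y - (S Y * f Y - (\<Sum>n\<in>exp_range Y. b n * f (ln (real n))) - \<kappa> * (Y * f Y - integral {0..Y} f))"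
  by (simp add: algebra_simps)
 then show ?thesis using 1 2 by (simp add: algebra_simps)
qed

definition rough_inverse :: "nat \<Rightarrow> nat \<Rightarrow> real" where
 "rough_inverse P n = (if coprime n P then 1 / real n else 0)"

lemma rough_inverse_nonneg [simp]: "rough_inverse P n \<ge> 0" by (simp add: rough_inverse_def)

text \<open>Coprimality to P is periodic, so the counting function deviates from \<kappa> N by at
  most P, where \<kappa> is the proportion of residues coprime to P. Partial summation then adds the
  weight 1 / n.\<close>

lemma rough_sum:
 assumes P: "P > 0"
 shows "\<exists>\<kappa>>0. \<exists>C\<ge>0. \<forall>t\<ge>0. \<bar>(\<Sum>n\<in>exp_range t. rough_inverse P n) - \<kappa> * t\<bar> \<le> C"
proof -
 define c where "c = (\<lambda>n. if coprime n P then 1 else (0::real))"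
 define A where "A = (\<lambda>N. \<Sum>n\<in>{1..N}. c n)"
 define \<kappa> where "\<kappa> = A P / real P"
 have cper: "c (n + P) = c n" for n by (simp only: c_def coprime_iff_gcd_eq_1 gcd_add1)
 have Aper: "A (N + P) = A N + A P" for N
 proof (induction N)
  case (Suc N)
  have "A (Suc N + P) = A (N + P) + c (Suc N + P)" by (simp add: A_def)
  then show ?case using Suc cper[of "Suc N"] by (simp add: A_def)
 qed (simp add: A_def)
 have c01: "0 \<le> c n" "c n \<le> 1" for n by (auto simp: c_def)
 have A01: "0 \<le> A N" "A N \<le> real N" for N
 proof -
  show "0 \<le> A N" unfolding A_def by (intro sum_nonneg c01)
  have "A N \<le> (\<Sum>n\<in>{1..N}. 1)" unfolding A_def by (intro sum_mono c01)
  then show "A N \<le> real N" by simp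
 qed
 have kpos: "\<kappa> > 0"
 proof -
  have "c 1 \<le> A P" unfolding A_def using P c01 by (intro member_le_sum) auto
  then show ?thesis using P by (simp add: \<kappa>_def c_def)
 qed
 have k1: "\<kappa> \<le> 1" using A01(2)[of P] P by (simp add: \<kappa>_def)
 define E where "E = (\<lambda>N. A N - \<kappa> * real N)"
 have Eb: "\<bar>E N\<bar> \<le> real P" for N
 proof (induction N rule: less_induct)
  case (less N)
  show ?case
  proof (cases "N < P")
   case True
   have "0 \<le> \<kappa> * real N" "\<kappa> * real N \<le> real N" using kpos k1 by (auto simp: mult_left_le_one_le)
   then show ?thesis using A01[of N] True unfolding E_def by linarith
  next
   case False
   then have "E N = E (N - P)" using Aper[of "N - P"] P by (simp add: E_def \<kappa>_def of_nat_diff field_simps)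
   then show ?thesis using less[of "N - P"] P False by simp
  qed
 qed
 have abel: "\<bar>(\<Sum>n\<in>{1..N}. (c n - \<kappa>) / real n) - E N / real N\<bar> \<le> real P * (1 - 1 / real N)" if "N > 0" for N
  using that
 proof (induction N rule: nat_induct_non_zero)
  case 1
  show ?case by (simp add: E_def A_def)
 next
  case (Suc n)
  have "E (Suc n) = E n + (c (Suc n) - \<kappa>)" by (simp add: E_def A_def algebra_simps)
  then have "(\<Sum>n\<in>{1..Suc n}. (c n - \<kappa>) / real n) - E (Suc n) / real (Suc n) =
   ((\<Sum>n\<in>{1..n}. (c n - \<kappa>) / real n) - E n / real n) + E n * (1 / real n - 1 / real (Suc n))"
   by (simp add: add_divide_distrib right_diff_distrib del: of_nat_Suc)
  moreover have "\<bar>E n * (1 / real n - 1 / real (Suc n))\<bar> \<le> real P * (1 / real n - 1 / real (Suc n))"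
  proof -
   have "0 \<le> 1 / real n - 1 / real (Suc n)" using Suc.hyps by (simp add: field_simps)
   then show ?thesis unfolding abs_mult using Eb[of n] by (simp add: mult_right_mono del: of_nat_Suc)
  qed
  ultimately show ?case using Suc.IH by (simp add: right_diff_distrib del: of_nat_Suc)
 qed
 have harm: "\<bar>(\<Sum>n\<in>{1..N}. 1 / real n) - ln (real N)\<bar> \<le> 1" if "N > 0" for N
 proof -
  have "ln (real N) \<le> (\<Sum>n\<in>{1..N}. 1 / real n) \<and> (\<Sum>n\<in>{1..N}. 1 / real n) \<le> ln (real N) + 1"
   using that
  proof (induction N rule: nat_induct_non_zero)
   case (Suc n)
   have up: "(\<Sum>n\<in>{1..Suc n}. 1 / real n) \<le> ln (real (Suc n)) + 1"
    using Suc.IH ln_Suc_diff_bounds(2)[OF Suc.hyps] by (simp del: of_nat_Suc)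
   have "(\<Sum>k\<in>{1..m}. 1 / real k) - 1 / real m \<ge> ln (real m) - 1 / real m" if "ln (real m) \<le> (\<Sum>k\<in>{1..m}. 1 / real k)" for m using that by simp
   have lo: "ln (real (Suc m)) \<le> (\<Sum>k\<in>{1..m}. 1 / real k)" if "m > 0" for m using that
   proof (induction m rule: nat_induct_non_zero)
    case 1 show ?case using ln_le_minus_one[of "2::real"] by simp
   next
    case (Suc m)
    then show ?case using ln_Suc_diff_bounds(1)[of "Suc m"] by (simp del: of_nat_Suc)
   qed
   have "ln (real (Suc n)) \<le> (\<Sum>k\<in>{1..Suc n}. 1 / real k)" using lo[OF Suc.hyps] by (simp add: add_increasing2 del: of_nat_Suc)
   then show ?case using up by blast
  qed simp
  then show ?thesis by linarith
 qed
 have fin: "\<bar>(\<Sum>n\<in>{1..N}. rough_inverse P n) - \<kappa> * ln (real N)\<bar> \<le> 2 * real P + 1" if N: "N > 0" for N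
 proof -
  have "(\<Sum>n\<in>{1..N}. rough_inverse P n) = (\<Sum>n\<in>{1..N}. (c n - \<kappa>) / real n + \<kappa> * (1 / real n))"
   by (intro sum.cong refl) (auto simp: rough_inverse_def c_def field_simps)
  also have "\<dots> = (\<Sum>n\<in>{1..N}. (c n - \<kappa>) / real n) + \<kappa> * (\<Sum>n\<in>{1..N}. 1 / real n)"
   by (simp add: sum.distrib sum_distrib_left)
  finally have e: "(\<Sum>n\<in>{1..N}. rough_inverse P n) - \<kappa> * ln (real N) =
   ((\<Sum>n\<in>{1..N}. (c n - \<kappa>) / real n) - E N / real N) + E N / real N + \<kappa> * ((\<Sum>n\<in>{1..N}. 1 / real n) - ln (real N))"
   by (simp add: algebra_simps)
  have "\<bar>E N / real N\<bar> \<le> real P / 1" unfolding abs_divide using Eb[of N] N by (intro frac_le) auto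
  moreover have "\<bar>\<kappa> * ((\<Sum>n\<in>{1..N}. 1 / real n) - ln (real N))\<bar> \<le> 1 * 1"
   unfolding abs_mult using kpos k1 harm[OF N] by (intro mult_mono) auto
  moreover have "real P * (1 - 1 / real N) \<le> real P" using N by (simp add: field_simps)
  ultimately show ?thesis unfolding e using abel[OF N] by linarith
 qed
 show ?thesis
 proof (rule exI[of _ \<kappa>], rule conjI[OF kpos], rule exI[of _ "2 * real P + 2"], intro conjI allI impI)
  fix t :: real assume t: "t \<ge> 0"
  have "\<bar>\<kappa> * (ln (real (nat \<lfloor>exp t\<rfloor>)) - t)\<bar> \<le> 1 * 1"
   unfolding abs_mult using kpos k1 floor_exp_bounds(2)[OF t] by (intro mult_mono) auto
  then show "\<bar>(\<Sum>n\<in>exp_range t. rough_inverse P n) - \<kappa> * t\<bar> \<le> 2 * real P + 2"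
   unfolding exp_range_eq using fin[OF floor_exp_bounds(1)[OF t]] by (simp add: algebra_simps)
 qed auto
qed

subsection \<open>Divisor sums over rough numbers\<close>

text \<open>The weight g of the overview, with the exclusion of small primes built in: later P is
  \<open>fact z\<close>, so every prime factor of the support exceeds z.\<close>

definition rough_divisor :: "nat \<Rightarrow> nat \<Rightarrow> real" where
 "rough_divisor P n = (if coprime n P then real (card {d. d dvd n}) / real n else 0)"

definition rough_divisor_sum :: "nat \<Rightarrow> real \<Rightarrow> real" where
 "rough_divisor_sum P y = (\<Sum>n\<in>exp_range y. rough_divisor P n)"

lemma rough_divisor_nonneg [simp]: "rough_divisor P n \<ge> 0" by (simp add: rough_divisor_def)

lemma rough_divisor_sum_nonneg [simp]: "rough_divisor_sum P y \<ge> 0"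
 by (simp add: rough_divisor_sum_def sum_nonneg)

lemma exp_range_pos: "n \<in> exp_range y \<Longrightarrow> n > 0" by (simp add: exp_range_def)

lemma exp_range_mono: "y \<le> y' \<Longrightarrow> exp_range y \<subseteq> exp_range y'" by (auto simp: exp_range_def)

lemma rough_divisor_sum_mono: "y \<le> y' \<Longrightarrow> rough_divisor_sum P y \<le> rough_divisor_sum P y'"
 unfolding rough_divisor_sum_def by (intro sum_mono2) (use exp_range_mono in auto)

lemma rough_divisor_sum_convolution:
 "rough_divisor_sum P y = (\<Sum>a\<in>exp_range y. rough_inverse P a * (\<Sum>b\<in>exp_range (y - ln (real a)). rough_inverse P b))"
proof -
 have conv: "rough_divisor P n = (\<Sum>d | d dvd n. rough_inverse P d * rough_inverse P (n div d))" if "n > 0" for n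
 proof -
  have "rough_inverse P d * rough_inverse P (n div d) = (if coprime n P then 1 / real n else 0)" if d: "d dvd n" for d
  proof -
   obtain e where "n = d * e" using d by blast
   then show ?thesis using \<open>n > 0\<close> by (auto simp: rough_inverse_def coprime_mult_left_iff)
  qed
  then show ?thesis by (simp add: rough_divisor_def)
 qed
 have "rough_divisor_sum P y = (\<Sum>n\<in>exp_range y. \<Sum>d | d dvd n. rough_inverse P d * rough_inverse P (n div d))"
  unfolding rough_divisor_sum_def by (intro sum.cong refl conv) (simp add: exp_range_def)
 also have "\<dots> = (\<Sum>(n, d)\<in>Sigma (exp_range y) (\<lambda>n. {d. d dvd n}). rough_inverse P d * rough_inverse P (n div d))"
  by (subst sum.Sigma) (auto dest: exp_range_pos)
 also have "\<dots> = (\<Sum>(a, b)\<in>Sigma (exp_range y) (\<lambda>a. exp_range (y - ln (real a))). rough_inverse P a * rough_inverse P b)"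
 proof (rule sum.reindex_bij_witness[where i = "\<lambda>(a, b). (a * b, a)" and j = "\<lambda>(n, d). (d, n div d)"], goal_cases)
  case (2 x)
  then obtain n d where x: "x = (n, d)" "n > 0" "ln (real n) \<le> y" "d dvd n" by (cases x) (auto simp: exp_range_def)
  then obtain e where e: "n = d * e" by blast
  then have de: "d > 0" "e > 0" using x by auto
  then have "ln (real n) = ln (real d) + ln (real e)" unfolding e by (simp add: ln_mult)
  moreover have "ln (real e) \<ge> 0" using de by simp
  ultimately have "ln (real d) \<le> y" "ln (real e) \<le> y - ln (real d)" using x(3) by linarith+
  then show ?case using x e de by (auto simp: exp_range_def)
 next
  case (4 x)
  then obtain a b where x: "x = (a, b)" "a > 0" "b > 0" "ln (real b) \<le> y - ln (real a)" by (cases x) (auto simp: exp_range_def)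
  then show ?case by (auto simp: exp_range_def ln_mult)
 qed (auto simp: exp_range_def)
 also have "\<dots> = (\<Sum>a\<in>exp_range y. rough_inverse P a * (\<Sum>b\<in>exp_range (y - ln (real a)). rough_inverse P b))"
  by (subst sum.Sigma[symmetric]) (auto simp: sum_distrib_left)
 finally show ?thesis .
qed

text \<open>The divisor function is the convolution of 1 with itself, so the linear law for
  \<open>rough_inverse\<close> is used twice. The resulting power y^2 is the origin of the square in
  the weight (Y - t)^2 further on.\<close>

lemma rough_divisor_sum_asymp:
 assumes P: "P > 0"
 shows "\<exists>\<kappa>>0. \<exists>C\<ge>0. \<forall>y\<ge>0. \<bar>rough_divisor_sum P y - \<kappa> * y\<^sup>2\<bar> \<le> C * (1 + y)"
proof -
 obtain \<kappa> C where k: "\<kappa> > 0" and C: "C \<ge> 0"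
  and A: "\<And>t. t \<ge> 0 \<Longrightarrow> \<bar>(\<Sum>n\<in>exp_range t. rough_inverse P n) - \<kappa> * t\<bar> \<le> C"
  using rough_sum[OF P] by blast
 have "\<bar>rough_divisor_sum P y - \<kappa>\<^sup>2 / 2 * y\<^sup>2\<bar> \<le> (2 * \<kappa> * C + C\<^sup>2) * (1 + y)" if y: "y \<ge> 0" for y
 proof -
  have I: "((\<lambda>t. y - t) has_integral y\<^sup>2 / 2) {0..y}"
  proof -
   have "((\<lambda>t. y - t) has_integral (y * y - y\<^sup>2 / 2) - (y * 0 - 0\<^sup>2 / 2)) {0..y}"
    by (rule fundamental_theorem_of_calculus[OF y]) (auto intro!: derivative_eq_intros simp flip: has_real_derivative_iff_has_vector_derivative)
   then show ?thesis by (simp add: power2_eq_square)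
  qed
  have 1: "\<bar>(\<Sum>n\<in>exp_range y. rough_inverse P n * (y - ln (real n))) - \<kappa> * integral {0..y} (\<lambda>t. y - t)\<bar> \<le> C * (\<bar>y - y\<bar> + y * 1)"
   by (rule abel_summation_bound[OF A y, where f' = "\<lambda>_. -1"]) (auto intro!: derivative_eq_intros)
  have 1: "\<bar>(\<Sum>n\<in>exp_range y. rough_inverse P n * (y - ln (real n))) - \<kappa> * (y\<^sup>2 / 2)\<bar> \<le> C * y"
   using 1 integral_unique[OF I] by simp
  let ?B = "\<Sum>n\<in>exp_range y. rough_inverse P n * (y - ln (real n))"
  have "\<bar>rough_divisor_sum P y - \<kappa> * ?B\<bar> = \<bar>\<Sum>a\<in>exp_range y. rough_inverse P a * ((\<Sum>b\<in>exp_range (y - ln (real a)). rough_inverse P b) - \<kappa> * (y - ln (real a)))\<bar>"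
   unfolding rough_divisor_sum_convolution by (simp add: right_diff_distrib sum_subtractf sum_distrib_left mult_ac)
  also have "\<dots> \<le> (\<Sum>a\<in>exp_range y. rough_inverse P a * C)"
  proof (rule sum_norm_le[where 'a = real, unfolded real_norm_def])
   fix a assume "a \<in> exp_range y"
   then have "\<bar>(\<Sum>b\<in>exp_range (y - ln (real a)). rough_inverse P b) - \<kappa> * (y - ln (real a))\<bar> \<le> C"
    by (intro A) (auto simp: exp_range_def)
   then show "\<bar>rough_inverse P a * ((\<Sum>b\<in>exp_range (y - ln (real a)). rough_inverse P b) - \<kappa> * (y - ln (real a)))\<bar> \<le> rough_inverse P a * C"
    by (simp add: abs_mult mult_left_mono)
  qed
  also have "\<dots> = C * (\<Sum>a\<in>exp_range y. rough_inverse P a)" by (simp add: sum_distrib_left mult.commute)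
  also have "\<dots> \<le> C * (\<kappa> * y + C)" using A[OF y] C by (intro mult_left_mono) auto
  finally have 2: "\<bar>rough_divisor_sum P y - \<kappa> * ?B\<bar> \<le> C * (\<kappa> * y + C)" .
  have "\<bar>\<kappa> * ?B - \<kappa> * (\<kappa> * (y\<^sup>2 / 2))\<bar> = \<kappa> * \<bar>?B - \<kappa> * (y\<^sup>2 / 2)\<bar>"
   using k by (simp only: right_diff_distrib[symmetric] abs_mult)
  also have "\<dots> \<le> \<kappa> * (C * y)" using 1 k by (intro mult_left_mono) auto
  finally have 3: "\<bar>\<kappa> * ?B - \<kappa> * (\<kappa> * (y\<^sup>2 / 2))\<bar> \<le> \<kappa> * (C * y)" .
  have "\<bar>rough_divisor_sum P y - \<kappa> * (\<kappa> * (y\<^sup>2 / 2))\<bar> \<le> C * (\<kappa> * y + C) + \<kappa> * (C * y)" using 2 3 by linarith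
  also have "\<dots> = (2 * \<kappa> * C) * y + C\<^sup>2" by (simp add: algebra_simps power2_eq_square)
  also have "\<dots> \<le> (2 * \<kappa> * C + C\<^sup>2) * (1 + y)" using C k y by (simp add: algebra_simps)
  finally show ?thesis by (simp add: power2_eq_square)
 qed
 then show ?thesis using k C by (intro exI[of _ "\<kappa>\<^sup>2 / 2"] conjI exI[of _ "2 * \<kappa> * C + C\<^sup>2"]) auto
qed

lemma divisors_prime_mult:
 fixes q m :: nat
 assumes q: "prime q" and m: "m > 0"
 shows "{d. d dvd q * m} = {d. d dvd m} \<union> (*) q ` {d. d dvd m}"
proof (intro equalityI subsetI)
 fix d assume d: "d \<in> {d. d dvd q * m}"
 show "d \<in> {d. d dvd m} \<union> (*) q ` {d. d dvd m}"
 proof (cases "q dvd d")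
  case True
  then obtain e where e: "d = q * e" by blast
  then have "e dvd m" using d q by (auto simp: prime_gt_0_nat)
  then show ?thesis using e by auto
 next
  case False
  then have "coprime d q" using q by (metis coprime_commute prime_imp_coprime)
  then show ?thesis using d by (simp add: coprime_dvd_mult_right_iff)
 qed
qed auto

lemma rough_divisor_prime_mult_le:
 assumes q: "prime q" and m: "m > 0"
 shows "rough_divisor P (q * m) \<le> 2 / real q * rough_divisor P m"
proof -
 have "card {d. d dvd q * m} \<le> card {d. d dvd m} + card ((*) q ` {d. d dvd m})"
  unfolding divisors_prime_mult[OF assms] by (rule card_Un_le)
 also have "\<dots> \<le> 2 * card {d. d dvd m}" using card_image_le[of "{d. d dvd m}" "(*) q"] m by simp
 finally have "real (card {d. d dvd q * m}) \<le> 2 * real (card {d. d dvd m})" by (simp flip: of_nat_mult of_nat_le_iff)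
 then show ?thesis using m prime_gt_0_nat[OF q]
  by (auto simp: rough_divisor_def coprime_mult_left_iff divide_simps)
qed

lemma rough_divisor_prime_mult:
 assumes q: "prime q" "coprime q P" and m: "m > 0" "\<not> q dvd m"
 shows "rough_divisor P (q * m) = 2 / real q * rough_divisor P m"
proof -
 have "card {d. d dvd q * m} = card {d. d dvd m} + card ((*) q ` {d. d dvd m})"
  unfolding divisors_prime_mult[OF q(1) m(1)] using m dvd_trans[of q _ m]
  by (intro card_Un_disjoint) auto
 also have "card ((*) q ` {d. d dvd m}) = card {d. d dvd m}"
  using prime_gt_0_nat[OF q(1)] by (intro card_image inj_onI) auto
 finally show ?thesis using q m prime_gt_0_nat[OF q(1)]
  by (simp add: rough_divisor_def coprime_mult_left_iff)
qed

lemma rough_divisor_eq_0: "prime q \<Longrightarrow> \<not> coprime q P \<Longrightarrow> q dvd h \<Longrightarrow> rough_divisor P h = 0"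
 unfolding rough_divisor_def by (metis coprime_mult_left_iff dvdE)

lemma rough_divisor_sum_multiples:
 assumes c: "c > 0" and K: "\<And>m. m > 0 \<Longrightarrow> rough_divisor P (c * m) \<le> K * rough_divisor P m" "K \<ge> 0"
 shows "(\<Sum>h\<in>exp_range y. rough_divisor P h * of_bool (c dvd h)) \<le> K * rough_divisor_sum P y"
proof -
 have c1: "m \<in> exp_range y" if "c * m \<in> exp_range y" for m
 proof -
  have "m > 0" "m \<le> c * m" using that c by (auto simp: exp_range_def)
  then have "ln (real m) \<le> ln (real (c * m))" using c by (simp del: of_nat_mult)
  moreover have "ln (real (c * m)) \<le> y" using that unfolding exp_range_def by blast
  ultimately show ?thesis using \<open>m > 0\<close> unfolding exp_range_def by (simp del: of_nat_mult)
 qed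
 have "(\<Sum>h\<in>exp_range y. rough_divisor P h * of_bool (c dvd h)) = (\<Sum>h\<in>{h\<in>exp_range y. c dvd h}. rough_divisor P h)"
  unfolding sum.inter_filter[OF finite_exp_range] by (intro sum.cong) auto
 also have "{h\<in>exp_range y. c dvd h} = (*) c ` {m\<in>exp_range y. c * m \<in> exp_range y}"
  using c1 by (auto elim!: dvdE)
 also have "(\<Sum>h\<in>\<dots>. rough_divisor P h) = (\<Sum>m\<in>{m\<in>exp_range y. c * m \<in> exp_range y}. rough_divisor P (c * m))"
  using c by (subst sum.reindex) (auto intro!: inj_onI)
 also have "\<dots> \<le> (\<Sum>m\<in>{m\<in>exp_range y. c * m \<in> exp_range y}. K * rough_divisor P m)"
  by (intro sum_mono K) (auto simp: exp_range_def)
 also have "\<dots> \<le> (\<Sum>m\<in>exp_range y. K * rough_divisor P m)" using K by (intro sum_mono2) auto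
 finally show ?thesis by (simp add: rough_divisor_sum_def sum_distrib_left)
qed

lemma rough_divisor_sum_prime_multiples:
 assumes "prime q"
 shows "(\<Sum>h\<in>exp_range y. rough_divisor P h * of_bool (q dvd h)) \<le> 2 / real q * rough_divisor_sum P y"
  and "(\<Sum>h\<in>exp_range y. rough_divisor P h * of_bool (q\<^sup>2 dvd h)) \<le> 4 / (real q)\<^sup>2 * rough_divisor_sum P y"
proof -
 have q: "q > 0" using assms by (rule prime_gt_0_nat)
 show "(\<Sum>h\<in>exp_range y. rough_divisor P h * of_bool (q dvd h)) \<le> 2 / real q * rough_divisor_sum P y"
  by (rule rough_divisor_sum_multiples) (use q rough_divisor_prime_mult_le[OF assms] in auto)
 have "rough_divisor P (q\<^sup>2 * m) \<le> 4 / (real q)\<^sup>2 * rough_divisor P m" if "m > 0" for m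
 proof -
  have "rough_divisor P (q\<^sup>2 * m) = rough_divisor P (q * (q * m))" by (simp add: power2_eq_square mult.assoc)
  also have "\<dots> \<le> 2 / real q * rough_divisor P (q * m)" using q that by (intro rough_divisor_prime_mult_le assms) auto
  also have "\<dots> \<le> 2 / real q * (2 / real q * rough_divisor P m)" using q that by (intro mult_left_mono rough_divisor_prime_mult_le assms) auto
  finally show ?thesis by (simp add: power2_eq_square)
 qed
 then show "(\<Sum>h\<in>exp_range y. rough_divisor P h * of_bool (q\<^sup>2 dvd h)) \<le> 4 / (real q)\<^sup>2 * rough_divisor_sum P y"
  by (intro rough_divisor_sum_multiples) (use q in auto)
qed

section \<open>Coprime squarefree pairs\<close>

lemma sum_inverse_squares_tail:
 assumes "z > 0" "finite A" "\<And>q. q \<in> A \<Longrightarrow> q > z"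
 shows "(\<Sum>q\<in>A. 1 / (real q)\<^sup>2) \<le> 1 / real z"
proof -
 have *: "(\<Sum>q\<in>{z<..z+k}. 1 / (real q)\<^sup>2) \<le> 1 / real z - 1 / real (z + k)" for k
 proof (induction k)
  case (Suc k)
  have "{z<..z + Suc k} = insert (z + Suc k) {z<..z + k}" by auto
  then have "(\<Sum>q\<in>{z<..z+Suc k}. 1 / (real q)\<^sup>2) = (\<Sum>q\<in>{z<..z+k}. 1 / (real q)\<^sup>2) + 1 / (real (z + Suc k))\<^sup>2" by simp
  also have "\<dots> \<le> 1 / real z - 1 / real (z + k) + 1 / (real (z + Suc k))\<^sup>2" using Suc by simp
  also have "1 / (real (z + Suc k))\<^sup>2 \<le> 1 / real (z + k) - 1 / real (z + Suc k)"
  proof -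
   have "1 / (u + 1)\<^sup>2 \<le> 1 / u - 1 / (u + 1)" if "u > 0" for u :: real
   proof -
    have "1 / (u + 1)\<^sup>2 \<le> 1 / (u * (u + 1))"
     unfolding power2_eq_square using that by (intro divide_left_mono mult_right_mono) auto
    also have "\<dots> = 1 / u - 1 / (u + 1)" using that by (simp add: field_simps)
    finally show ?thesis .
   qed
   from this[of "real (z + k)"] show ?thesis using \<open>z > 0\<close> by (simp add: add_ac)
  qed
  finally show ?case by simp
 qed simp
 obtain k where "A \<subseteq> {z<..z+k}"
 proof
  show "A \<subseteq> {z<..z + Max (insert 0 A)}" using assms by (auto intro!: trans_le_add2)
 qed
 then have "(\<Sum>q\<in>A. 1 / (real q)\<^sup>2) \<le> (\<Sum>q\<in>{z<..z+k}. 1 / (real q)\<^sup>2)" by (intro sum_mono2) auto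
 also have "\<dots> \<le> 1 / real z" using *[of k] by (smt (verit) of_nat_0_le_iff divide_nonneg_nonneg)
 finally show ?thesis .
qed

lemma not_squarefree_prime:
 fixes h :: nat
 assumes "\<not> squarefree h"
 obtains q where "prime q" "q\<^sup>2 dvd h"
proof -
 obtain x where x: "x\<^sup>2 dvd h" "\<not> x dvd 1" using assms by (rule not_squarefreeE)
 then obtain q where q: "prime q" "q dvd x" using prime_factor_nat[of x] by auto
 then have "q\<^sup>2 dvd h" using x(1) by (meson dvd_power_same dvd_trans)
 then show ?thesis using q that by blast
qed

text \<open>The fractions h / k to which a factor p can be attached: with y = Y - ln p and y' = Y,
  both h / k and p h / k are reduced fractions of squarefree numbers within the range.\<close>

definition reduced_pairs :: "real \<Rightarrow> real \<Rightarrow> nat \<Rightarrow> (nat \<times> nat) set" where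
 "reduced_pairs y y' p = {(h, k). h \<in> exp_range y \<and> k \<in> exp_range y' \<and> squarefree h \<and> squarefree k \<and>
   coprime h k \<and> \<not> p dvd h \<and> \<not> p dvd k}"

lemma finite_reduced_pairs [simp, intro]: "finite (reduced_pairs y y' p)"
 by (rule finite_subset[of _ "exp_range y \<times> exp_range y'"]) (auto simp: reduced_pairs_def)

text \<open>An excluded pair of nonzero weight has p dividing h or k, or a prime q > z whose square
  divides h or k, or such a q dividing both. In proportion to the full sum these cases weigh at most
  2 / p twice and 4 / q^2 three times, and the sum of 1 / q^2 over q > z is at most 1 / z.\<close>

lemma reduced_pairs_sum_bounds:
 fixes p z :: nat
 assumes z: "z > 0" and p: "prime p"
 defines "g \<equiv> rough_divisor (fact z)" and "S \<equiv> rough_divisor_sum (fact z)"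
 shows "(\<Sum>(h, k)\<in>reduced_pairs y y' p. g h * g k) \<le> S y * S y'"
  and "(\<Sum>(h, k)\<in>reduced_pairs y y' p. g h * g k) \<ge> (1 - 12 / real z - 4 / real p) * (S y * S y')"
proof -
 have g0: "g n \<ge> 0" for n by (simp add: g_def)
 have S0: "S t \<ge> 0" for t by (simp add: S_def)
 let ?E = "exp_range y \<times> exp_range y'"
 have full: "S y * S y' = (\<Sum>(h, k)\<in>?E. g h * g k)"
  by (simp add: S_def g_def rough_divisor_sum_def sum_product sum.cartesian_product)
 have sub: "reduced_pairs y y' p \<subseteq> ?E" by (auto simp: reduced_pairs_def)
 show "(\<Sum>(h, k)\<in>reduced_pairs y y' p. g h * g k) \<le> S y * S y'"
  unfolding full by (intro sum_mono2 sub) (auto simp: g0)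
 \<comment> \<open>Contains every prime that can divide a component of a pair of nonzero weight; the
   bound by the range makes it finite.\<close>
 define Q where "Q = {q. prime q \<and> coprime q (fact z :: nat) \<and> q \<in> exp_range (max y y')}"
 have Q: "finite Q" unfolding Q_def by (rule finite_subset[of _ "exp_range (max y y')"]) auto
 have Qz: "q > z" if "q \<in> Q" for q
 proof (rule ccontr)
  assume "\<not> q > z"
  then have "q dvd fact z" using that by (auto simp: Q_def prime_dvd_fact_iff)
  then show False using that by (auto simp: Q_def dest: coprime_common_divisor_nat)
 qed
 \<comment> \<open>Counts the reasons for excluding a pair. It is at least 1 on excluded pairs of
   nonzero weight, and each summand factors into a condition on h and one on k.\<close>
 define bad where "bad = (\<lambda>h k. of_bool (p dvd h) + of_bool (p dvd k) + (\<Sum>q\<in>Q. of_bool (q\<^sup>2 dvd h) + of_bool (q\<^sup>2 dvd k) + of_bool (q dvd h) * (of_bool (q dvd k) :: real)))"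
 have bad0: "bad h k \<ge> 0" for h k unfolding bad_def by (intro add_nonneg_nonneg sum_nonneg) auto
 have bad: "g h * g k \<le> g h * g k * bad h k" if hk: "(h, k) \<in> ?E - reduced_pairs y y' p" for h k
 proof (cases "g h = 0 \<or> g k = 0")
  case True then show ?thesis by auto
 next
  case False
  have hpos: "h > 0" "k > 0" using hk by (auto simp: exp_range_def)
  have inQ: "q \<in> Q" if q: "prime q" "q dvd h \<or> q dvd k" for q
  proof -
   have "coprime q (fact z :: nat)" using q False rough_divisor_eq_0 unfolding g_def by blast
   moreover have "q \<in> exp_range (max y y')"
   proof -
    have "q \<le> h \<or> q \<le> k" using q(2) hpos by (auto dest: dvd_imp_le)
    then have "ln (real q) \<le> ln (real h) \<or> ln (real q) \<le> ln (real k)" using prime_gt_0_nat[OF q(1)] by auto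
    moreover have "ln (real h) \<le> y" "ln (real k) \<le> y'" using hk by (auto simp: exp_range_def)
    ultimately have "ln (real q) \<le> max y y'" by linarith
    then show ?thesis using prime_gt_0_nat[OF q(1)] by (simp add: exp_range_def)
   qed
   ultimately show ?thesis using q by (simp add: Q_def)
  qed
  have one: "1 \<le> (\<Sum>q\<in>Q. of_bool (q\<^sup>2 dvd h) + of_bool (q\<^sup>2 dvd k) + of_bool (q dvd h) * (of_bool (q dvd k) :: real))"
   if "q \<in> Q" "q\<^sup>2 dvd h \<or> q\<^sup>2 dvd k \<or> q dvd h \<and> q dvd k" for q
  proof -
   have "1 \<le> of_bool (q\<^sup>2 dvd h) + of_bool (q\<^sup>2 dvd k) + of_bool (q dvd h) * (of_bool (q dvd k) :: real)" using that(2) by auto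
   also have "\<dots> \<le> (\<Sum>q\<in>Q. of_bool (q\<^sup>2 dvd h) + of_bool (q\<^sup>2 dvd k) + of_bool (q dvd h) * (of_bool (q dvd k) :: real))"
    by (rule member_le_sum[OF that(1) _ Q]) auto
   finally show ?thesis .
  qed
  have s0: "0 \<le> (\<Sum>q\<in>Q. of_bool (q\<^sup>2 dvd h) + of_bool (q\<^sup>2 dvd k) + of_bool (q dvd h) * (of_bool (q dvd k) :: real))"
   by (intro sum_nonneg) auto
  have "bad h k \<ge> 1"
  proof -
   consider "p dvd h \<or> p dvd k" | "\<not> squarefree h" | "\<not> squarefree k" | "\<not> coprime h k"
    using hk unfolding reduced_pairs_def by auto
   then show ?thesis
   proof cases
    case 1 then show ?thesis unfolding bad_def using s0 by auto
   next
    case 2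
    then obtain q where "prime q" "q\<^sup>2 dvd h" by (rule not_squarefree_prime)
    moreover have "q dvd h" using \<open>q\<^sup>2 dvd h\<close> by (metis dvd_trans power2_eq_square dvd_triv_left)
    ultimately show ?thesis unfolding bad_def using one[OF inQ, of q] by auto
   next
    case 3
    then obtain q where "prime q" "q\<^sup>2 dvd k" by (rule not_squarefree_prime)
    moreover have "q dvd k" using \<open>q\<^sup>2 dvd k\<close> by (metis dvd_trans power2_eq_square dvd_triv_left)
    ultimately show ?thesis unfolding bad_def using one[OF inQ, of q] by auto
   next
    case 4
    then obtain q where "prime q" "q dvd h" "q dvd k" by (metis coprime_iff_gcd_eq_1 gcd_dvd1 gcd_dvd2 dvd_trans prime_factor_nat)
    then show ?thesis unfolding bad_def using one[OF inQ, of q] by auto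
   qed
  qed
  then show ?thesis using mult_left_mono[of 1 "bad h k" "g h * g k"] g0 by simp
 qed
 have m1: "(\<Sum>h\<in>exp_range t. g h * of_bool (q dvd h)) \<le> 2 / real q * S t"
  and m2: "(\<Sum>h\<in>exp_range t. g h * of_bool (q\<^sup>2 dvd h)) \<le> 4 / (real q)\<^sup>2 * S t" if "prime q" for q t
  using rough_divisor_sum_prime_multiples[OF that] unfolding g_def S_def by auto
 have prod: "(\<Sum>(h, k)\<in>?E. g h * g k * (u h * v k)) = (\<Sum>h\<in>exp_range y. g h * u h) * (\<Sum>k\<in>exp_range y'. g k * v k)" for u v :: "nat \<Rightarrow> real"
  by (simp add: sum_product sum.cartesian_product mult_ac)
 have prod1: "(\<Sum>(h, k)\<in>?E. g h * g k * u h) = (\<Sum>h\<in>exp_range y. g h * u h) * S y'"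
  and prod2: "(\<Sum>(h, k)\<in>?E. g h * g k * u k) = S y * (\<Sum>k\<in>exp_range y'. g k * u k)" for u :: "nat \<Rightarrow> real"
  using prod[of u "\<lambda>_. 1"] prod[of "\<lambda>_. 1" u] by (simp_all add: S_def g_def rough_divisor_sum_def)
 have "S y * S y' - (\<Sum>(h, k)\<in>reduced_pairs y y' p. g h * g k) = (\<Sum>(h, k)\<in>?E - reduced_pairs y y' p. g h * g k)"
  unfolding full by (subst sum_diff[OF _ sub]) auto
 also have "\<dots> \<le> (\<Sum>(h, k)\<in>?E - reduced_pairs y y' p. g h * g k * bad h k)"
  by (intro sum_mono) (use bad in auto)
 also have "\<dots> \<le> (\<Sum>(h, k)\<in>?E. g h * g k * bad h k)"
  by (intro sum_mono2) (auto simp: g0 bad0)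
 also have "\<dots> = (\<Sum>(h, k)\<in>?E. g h * g k * of_bool (p dvd h)) + (\<Sum>(h, k)\<in>?E. g h * g k * of_bool (p dvd k)) +
   (\<Sum>q\<in>Q. (\<Sum>(h, k)\<in>?E. g h * g k * of_bool (q\<^sup>2 dvd h)) + (\<Sum>(h, k)\<in>?E. g h * g k * of_bool (q\<^sup>2 dvd k)) +
     (\<Sum>(h, k)\<in>?E. g h * g k * (of_bool (q dvd h) * of_bool (q dvd k))))"
  unfolding bad_def distrib_left sum_distrib_left case_prod_unfold sum.distrib
  by (simp only: sum.swap[of _ Q ?E])
 also have "\<dots> \<le> 2 / real p * S y * S y' + S y * (2 / real p * S y') +
   (\<Sum>q\<in>Q. 4 / (real q)\<^sup>2 * S y * S y' + S y * (4 / (real q)\<^sup>2 * S y') + (2 / real q * S y) * (2 / real q * S y'))"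
  unfolding prod prod1 prod2
  by (intro add_mono sum_mono mult_mono mult_right_mono mult_left_mono m1 m2 p)
   (auto simp: S0 Q_def g0 intro!: sum_nonneg mult_nonneg_nonneg)
 also have "\<dots> = 4 / real p * (S y * S y') + 12 * (\<Sum>q\<in>Q. 1 / (real q)\<^sup>2) * (S y * S y')"
  unfolding sum_distrib_left sum_distrib_right
  by (simp add: power2_eq_square mult_ac) (simp flip: sum.distrib add: field_simps)?
 also have "\<dots> \<le> 4 / real p * (S y * S y') + 12 * (1 / real z) * (S y * S y')"
  using sum_inverse_squares_tail[OF z Q Qz] by (intro add_left_mono mult_right_mono mult_left_mono) (auto simp: S0)
 finally show "(\<Sum>(h, k)\<in>reduced_pairs y y' p. g h * g k) \<ge> (1 - 12 / real z - 4 / real p) * (S y * S y')"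
  by (simp add: algebra_simps)
qed

subsection \<open>Diagonal correlations of the resonator\<close>

definition resonator_pairs :: "real \<Rightarrow> (nat \<times> nat) set" where
 "resonator_pairs Y = {(h, k). h \<in> exp_range Y \<and> k \<in> exp_range Y \<and> squarefree h \<and> squarefree k \<and> coprime h k}"

definition resonator_coeff :: "nat \<Rightarrow> nat \<times> nat \<Rightarrow> real" where
 "resonator_coeff P = (\<lambda>(h, k). sqrt (rough_divisor P h * rough_divisor P k))"

text \<open>The correlation of the coefficients along h' / k' = n h / k. These are the pairs for
  which ln n + ln (h / k) - ln (h' / k') vanishes, so that the Gaussian does not damp them.\<close>

definition resonator_diagonal :: "nat \<Rightarrow> real \<Rightarrow> nat \<Rightarrow> real" where
 "resonator_diagonal P Y n = (\<Sum>(q, q')\<in>{(q, q'). q \<in> resonator_pairs Y \<and> q' \<in> resonator_pairs Y \<and>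
   n * fst q * snd q' = snd q * fst q'}. resonator_coeff P q * resonator_coeff P q')"

lemma finite_resonator_pairs [simp, intro]: "finite (resonator_pairs Y)"
 by (rule finite_subset[of _ "exp_range Y \<times> exp_range Y"]) (auto simp: resonator_pairs_def)

lemma resonator_coeff_nonneg [simp]: "resonator_coeff P q \<ge> 0"
 by (simp add: resonator_coeff_def split: prod.split)

lemma resonator_diagonal_nonneg [simp]: "resonator_diagonal P Y n \<ge> 0"
 unfolding resonator_diagonal_def by (intro sum_nonneg) auto

lemma resonator_pairs_pos: "(h, k) \<in> resonator_pairs Y \<Longrightarrow> h > 0 \<and> k > 0"
 by (auto simp: resonator_pairs_def exp_range_def)

lemma finite_resonator_diagonal [simp, intro]:
 "finite {(q, q'). q \<in> resonator_pairs Y \<and> q' \<in> resonator_pairs Y \<and> P q q'}"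
 by (rule finite_subset[of _ "resonator_pairs Y \<times> resonator_pairs Y"]) auto

lemma reduced_fraction_eq:
 fixes h k h' k' :: nat
 assumes "h * k' = k * h'" "coprime h k" "coprime h' k'"
 shows "h = h' \<and> k = k'"
proof -
 have "h * k' = h' * k" using assms(1) by (simp add: mult.commute)
 then show ?thesis using coprime_crossproduct_nat[of h k h' k'] assms(2,3) by (simp add: coprime_commute)
qed

lemma resonator_diagonal_1: "resonator_diagonal P Y 1 = (\<Sum>(h, k)\<in>resonator_pairs Y. rough_divisor P h * rough_divisor P k)"
proof -
 have set: "{(q, q'). q \<in> resonator_pairs Y \<and> q' \<in> resonator_pairs Y \<and> 1 * fst q * snd q' = snd q * fst q'} = (\<lambda>q. (q, q)) ` resonator_pairs Y"
  by (auto simp: resonator_pairs_def dest!: reduced_fraction_eq)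
 then have "resonator_diagonal P Y 1 = (\<Sum>q\<in>resonator_pairs Y. resonator_coeff P q * resonator_coeff P q)"
  unfolding resonator_diagonal_def set by (subst sum.reindex) (auto intro: inj_onI)
 also have "\<dots> = (\<Sum>(h, k)\<in>resonator_pairs Y. rough_divisor P h * rough_divisor P k)"
  by (intro sum.cong) (auto simp: resonator_coeff_def)
 finally show ?thesis .
qed

lemma resonator_diagonal_1_le: "resonator_diagonal P Y 1 \<le> (rough_divisor_sum P Y)\<^sup>2"
proof -
 have "resonator_diagonal P Y 1 \<le> (\<Sum>(h, k)\<in>exp_range Y \<times> exp_range Y. rough_divisor P h * rough_divisor P k)"
  unfolding resonator_diagonal_1 by (intro sum_mono2) (auto simp: resonator_pairs_def)
 then show ?thesis by (simp add: rough_divisor_sum_def power2_eq_square sum_product sum.cartesian_product)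
qed

lemma resonator_diagonal_1_ge: "Y \<ge> 0 \<Longrightarrow> resonator_diagonal P Y 1 \<ge> 1"
proof -
 assume Y: "Y \<ge> 0"
 have "{d::nat. d dvd 1} = {1}" by auto
 then have "rough_divisor P 1 = 1" by (simp add: rough_divisor_def)
 moreover have "(1, 1) \<in> resonator_pairs Y" using Y by (simp add: resonator_pairs_def exp_range_def)
 then have "(case (1, 1) of (h, k) \<Rightarrow> rough_divisor P h * rough_divisor P k) \<le> resonator_diagonal P Y 1"
  unfolding resonator_diagonal_1 by (intro member_le_sum) auto
 ultimately show ?thesis by simp
qed

lemma squarefree_prime_mult_iff:
 fixes p h :: nat
 assumes "prime p"
 shows "squarefree (p * h) \<longleftrightarrow> squarefree h \<and> \<not> p dvd h"
proof
 assume s: "squarefree (p * h)"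
 show "squarefree h \<and> \<not> p dvd h"
 proof
  show "squarefree h" using s by (rule squarefree_mono[rotated]) simp
  show "\<not> p dvd h"
  proof
   assume "p dvd h"
   then have "p\<^sup>2 dvd p * h" by (simp add: power2_eq_square)
   then have "p dvd 1" using s by (rule squarefreeD[rotated])
   then show False using assms by auto
  qed
 qed
next
 assume a: "squarefree h \<and> \<not> p dvd h"
 then have "coprime p h" using assms by (simp add: prime_imp_coprime)
 then show "squarefree (p * h)" using a assms by (simp add: squarefree_mult_coprime squarefree_prime)
qed

lemma prime_mult_exp_range_iff:
 assumes "p > 0" shows "p * h \<in> exp_range Y \<longleftrightarrow> h \<in> exp_range (Y - ln (real p))"
 using assms by (auto simp: exp_range_def ln_mult)

text \<open>When h' / k' = p h / k with both fractions reduced, p either enters the numerator (the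
  set A) or cancels from the denominator (the set B). Exchanging numerator and denominator
  parametrizes both by the same \<open>reduced_pairs\<close>, hence the factor 2; the weight of a
  pair is sqrt (g h * g (p h)) g k = sqrt (2 / p) g h g k.\<close>

lemma resonator_diagonal_prime:
 fixes p :: nat
 assumes p: "prime p"
 shows "resonator_diagonal P Y p = (if coprime p P then 2 * sqrt (2 / real p) *
  (\<Sum>(h, k)\<in>reduced_pairs (Y - ln (real p)) Y p. rough_divisor P h * rough_divisor P k) else 0)"
proof -
 let ?g = "rough_divisor P" and ?V = "reduced_pairs (Y - ln (real p)) Y p"
 let ?f = "\<lambda>(q, q'). resonator_coeff P q * resonator_coeff P q'"
 have p0: "p > 0" using p by (rule prime_gt_0_nat)
 define A where "A = (\<lambda>(h, k). ((h, k), (p * h, k))) ` ?V"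
 define B where "B = (\<lambda>(h, k). ((k, p * h), (k, h))) ` ?V"
 have lnp: "ln (real p) \<ge> 0" using p0 by simp
 have mono: "h \<in> exp_range Y" if "h \<in> exp_range (Y - ln (real p))" for h
  using that exp_range_mono[of "Y - ln (real p)" Y] lnp by auto
 have V: "h > 0" "k > 0" "(h, k) \<in> resonator_pairs Y" "(p * h, k) \<in> resonator_pairs Y" "(k, h) \<in> resonator_pairs Y" "(k, p * h) \<in> resonator_pairs Y"
  "\<not> p dvd h" "\<not> p dvd k" if "(h, k) \<in> ?V" for h k
 proof -
  note a = that[unfolded reduced_pairs_def]
  have c: "coprime p k" using a p by (auto simp: prime_imp_coprime)
  show "h > 0" "k > 0" "\<not> p dvd h" "\<not> p dvd k" using a by (auto simp: exp_range_def)
  show "(h, k) \<in> resonator_pairs Y" "(k, h) \<in> resonator_pairs Y" using a mono by (auto simp: resonator_pairs_def coprime_commute)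
  show "(p * h, k) \<in> resonator_pairs Y" "(k, p * h) \<in> resonator_pairs Y" using a c p p0
   by (auto simp: resonator_pairs_def coprime_commute squarefree_prime_mult_iff prime_mult_exp_range_iff)
 qed
 have inV: "(h, k) \<in> ?V" if "(p * h, k) \<in> resonator_pairs Y" for h k
  using that p p0 by (auto simp: resonator_pairs_def reduced_pairs_def squarefree_prime_mult_iff prime_mult_exp_range_iff
    dest: coprime_common_divisor_nat[of p k p])
 have swap: "(k, h) \<in> resonator_pairs Y \<longleftrightarrow> (h, k) \<in> resonator_pairs Y" for h k
  by (auto simp: resonator_pairs_def coprime_commute)
 have set: "{(q, q'). q \<in> resonator_pairs Y \<and> q' \<in> resonator_pairs Y \<and> p * fst q * snd q' = snd q * fst q'} = A \<union> B"
 proof (intro equalityI subsetI)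
  fix x assume "x \<in> {(q, q'). q \<in> resonator_pairs Y \<and> q' \<in> resonator_pairs Y \<and> p * fst q * snd q' = snd q * fst q'}"
  then obtain h k h' k' where x: "x = ((h, k), (h', k'))" "(h, k) \<in> resonator_pairs Y" "(h', k') \<in> resonator_pairs Y" "p * h * k' = k * h'"
   by (cases x) auto
  then have co: "coprime h k" "coprime h' k'" by (auto simp: resonator_pairs_def)
  show "x \<in> A \<union> B"
  proof (cases "p dvd k")
   case True
   then obtain k1 where k1: "k = p * k1" by blast
   then have "h * k' = k1 * h'" using x(4) p0 by simp
   moreover have "coprime h k1" using co k1 by simp
   ultimately have "h = h' \<and> k1 = k'" using co(2) by (rule reduced_fraction_eq)
   moreover have "(k1, h) \<in> ?V" using inV x(2) k1 swap by blast
   ultimately show ?thesis unfolding x(1) k1 B_def by force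
  next
   case False
   then have "coprime (p * h) k" using co p by (simp add: prime_imp_coprime)
   then have "p * h = h' \<and> k = k'" using co(2) x(4) by (intro reduced_fraction_eq) auto
   moreover from this have "(h, k) \<in> ?V" using inV x(3) by blast
   ultimately show ?thesis unfolding x(1) A_def by force
  qed
 next
  fix x assume "x \<in> A \<union> B"
  then show "x \<in> {(q, q'). q \<in> resonator_pairs Y \<and> q' \<in> resonator_pairs Y \<and> p * fst q * snd q' = snd q * fst q'}"
   by (auto simp: A_def B_def V)
 qed
 have "\<not> p dvd snd (fst x)" if "x \<in> A" for x using that V(8) by (auto simp: A_def)
 moreover have "p dvd snd (fst x)" if "x \<in> B" for x using that by (auto simp: B_def)
 ultimately have disj: "A \<inter> B = {}" by blast
 have val: "?g h * ?g (p * h) = 2 / real p * (?g h)\<^sup>2" if "(h, k) \<in> ?V" "coprime p P" for h k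
  using rough_divisor_prime_mult[OF p that(2) V(1)[OF that(1)] V(7)[OF that(1)]] by (simp add: power2_eq_square)
 have rt: "sqrt (2 / real p * (u * v)\<^sup>2) = sqrt (2 / real p) * (u * v)" if "u \<ge> 0" "v \<ge> 0" for u v
  using that by (subst real_sqrt_mult) (simp add: real_sqrt_abs abs_mult)
 have fA: "?f ((h, k), (p * h, k)) = (if coprime p P then sqrt (2 / real p) * (?g h * ?g k) else 0)" if hk: "(h, k) \<in> ?V" for h k
 proof (cases "coprime p P")
  case True
  have "?f ((h, k), (p * h, k)) = sqrt ((?g h * ?g (p * h)) * (?g k * ?g k))"
   by (simp add: resonator_coeff_def real_sqrt_mult mult_ac)
  also have "\<dots> = sqrt (2 / real p * (?g h * ?g k)\<^sup>2)" unfolding val[OF hk True] by (simp add: power2_eq_square mult_ac)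
  finally show ?thesis using True rt by simp
 next
  case False then show ?thesis using rough_divisor_eq_0[OF p False, of "p * h"] by (simp add: resonator_coeff_def)
 qed
 have fB: "?f ((k, p * h), (k, h)) = (if coprime p P then sqrt (2 / real p) * (?g h * ?g k) else 0)" if hk: "(h, k) \<in> ?V" for h k
  using fA[OF hk] by (simp add: resonator_coeff_def mult_ac)
 have "resonator_diagonal P Y p = sum ?f (A \<union> B)" unfolding resonator_diagonal_def set ..
 also have "\<dots> = sum ?f A + sum ?f B" by (rule sum.union_disjoint[OF _ _ disj]) (auto simp: A_def B_def)
 also have "sum ?f A = (\<Sum>(h, k)\<in>?V. if coprime p P then sqrt (2 / real p) * (?g h * ?g k) else 0)"
  unfolding A_def by (subst sum.reindex) (use fA in \<open>auto intro!: inj_onI sum.cong\<close>)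
 also have "sum ?f B = (\<Sum>(h, k)\<in>?V. if coprime p P then sqrt (2 / real p) * (?g h * ?g k) else 0)"
  unfolding B_def by (subst sum.reindex) (use fB in \<open>auto intro!: inj_onI sum.cong\<close>)
 finally show ?thesis by (auto simp: sum_distrib_left case_prod_unfold mult.assoc)
qed

text \<open>By squarefreeness p can enter a numerator at most once and leave a denominator at most
  once. So j is at most 2, and j = 2 forces k = p k' and h' = p h at the same time, which leaves h
  and k' as free parameters.\<close>

lemma resonator_diagonal_prime_power:
 fixes p j :: nat
 assumes p: "prime p" and j: "j \<ge> 2"
 shows "resonator_diagonal P Y (p ^ j) \<le> (if j = 2 then 2 / real p * (rough_divisor_sum P Y)\<^sup>2 else 0)"
proof -
 let ?g = "rough_divisor P"
 define E where "E = {(q, q'). q \<in> resonator_pairs Y \<and> q' \<in> resonator_pairs Y \<and> p ^ j * fst q * snd q' = snd q * fst q'}"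
 have p0: "p > 0" using p by (rule prime_gt_0_nat)
 have fE: "finite E" by (simp add: E_def)
 have E: "j = 2 \<and> k = p * k' \<and> h' = p * h \<and> h > 0 \<and> k' > 0 \<and> \<not> p dvd h \<and> \<not> p dvd k' \<and> h \<in> exp_range Y \<and> k' \<in> exp_range Y"
  if "((h, k), (h', k')) \<in> E" for h k h' k'
 proof -
  have q: "(h, k) \<in> resonator_pairs Y" "(h', k') \<in> resonator_pairs Y" and e: "p ^ j * h * k' = k * h'" using that by (auto simp: E_def)
  then have co: "coprime h k" "coprime h' k'" and sq: "squarefree k" "squarefree h'"
   and r: "h \<in> exp_range Y" "k' \<in> exp_range Y" by (auto simp: resonator_pairs_def)
  have "p ^ j = p\<^sup>2 * p ^ (j - 2)" unfolding power_add[symmetric] le_add_diff_inverse[OF j] by (rule refl)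
  then have e2: "k * h' = p\<^sup>2 * (p ^ (j - 2) * (h * k'))" using e by (simp add: mult_ac)
  then have p2: "p\<^sup>2 dvd k * h'" by simp
  have np: "\<not> p\<^sup>2 dvd m" if "squarefree m" for m using squarefreeD[OF that, of p] p by auto
  have "p dvd k"
  proof (rule ccontr)
   assume "\<not> p dvd k"
   then have "coprime (p\<^sup>2) k" using p by (simp add: prime_imp_coprime)
   then have "p\<^sup>2 dvd h'" using p2 by (simp add: coprime_dvd_mult_right_iff)
   then show False using np sq by blast
  qed
  then obtain k1 where k1: "k = p * k1" by blast
  have "p dvd h'"
  proof (rule ccontr)
   assume "\<not> p dvd h'"
   then have "coprime (p\<^sup>2) h'" using p by (simp add: prime_imp_coprime)
   then have "p\<^sup>2 dvd k" using p2 by (simp add: coprime_dvd_mult_left_iff)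
   then show False using np sq by blast
  qed
  then obtain h1 where h1: "h' = p * h1" by blast
  have n1: "\<not> p dvd k1" "\<not> p dvd h1" using sq unfolding k1 h1 squarefree_prime_mult_iff[OF p] by auto
  have e3: "k1 * h1 = p ^ (j - 2) * (h * k')" using e2 p0 unfolding k1 h1 by (simp add: power2_eq_square mult_ac)
  have j2: "j = 2"
  proof (rule ccontr)
   assume "j \<noteq> 2"
   then have "p dvd p ^ (j - 2)" using j by (simp add: dvd_power)
   then have "p dvd k1 * h1" unfolding e3 by (rule dvd_mult2)
   then show False using n1 p by (simp add: prime_dvd_mult_iff)
  qed
  have "h * k' = k1 * h1" using e3 j2 by simp
  moreover have "coprime h k1" "coprime h1 k'" using co k1 h1 by auto
  ultimately have "h = h1 \<and> k1 = k'" by (rule reduced_fraction_eq)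
  then show ?thesis using j2 k1 h1 n1 r by (auto simp: exp_range_def)
 qed
 show ?thesis
 proof (cases "j = 2")
  case False
  then have "E = {}" using E by auto
  then show ?thesis using False by (simp add: resonator_diagonal_def E_def[symmetric])
 next
  case True
  define i :: "(nat \<times> nat) \<times> (nat \<times> nat) \<Rightarrow> nat \<times> nat" where "i = (\<lambda>((h, k), (h', k')). (h, k'))"
  have inj: "inj_on i E"
   by (rule inj_onI) (auto simp: i_def dest!: E)
  have b: "resonator_coeff P q * resonator_coeff P q' \<le> 2 / real p * (case i (q, q') of (h, k) \<Rightarrow> ?g h * ?g k)" if "(q, q') \<in> E" for q q'
  proof -
   obtain h k h' k' where q: "q = (h, k)" "q' = (h', k')" by (cases q; cases q')
   note F = E[OF that[unfolded q]]
   show ?thesis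
   proof (cases "coprime p P")
    case True
    have gp: "?g (p * m) = 2 / real p * ?g m" if "m > 0" "\<not> p dvd m" for m
     by (rule rough_divisor_prime_mult[OF p True that])
    have "resonator_coeff P q * resonator_coeff P q' = sqrt ((?g h * ?g (p * h)) * (?g k' * ?g (p * k')))"
     using F by (simp add: q resonator_coeff_def real_sqrt_mult mult_ac)
    also have "\<dots> = sqrt ((2 / real p * (?g h * ?g k'))\<^sup>2)"
     using F gp by (simp add: power2_eq_square mult_ac)
    also have "\<dots> = 2 / real p * (?g h * ?g k')" by (subst real_sqrt_abs) (simp add: abs_mult)
    finally show ?thesis by (simp add: q i_def)
   next
    case False
    then have "resonator_coeff P q' = 0" using F rough_divisor_eq_0[OF p False, of "p * h"] by (simp add: q resonator_coeff_def)
    then show ?thesis by (auto simp: i_def q)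
   qed
  qed
  have "resonator_diagonal P Y (p ^ j) = (\<Sum>(q, q')\<in>E. resonator_coeff P q * resonator_coeff P q')"
   by (simp add: resonator_diagonal_def E_def)
  also have "\<dots> \<le> (\<Sum>x\<in>E. 2 / real p * (case i x of (h, k) \<Rightarrow> ?g h * ?g k))" by (intro sum_mono) (use b in auto)
  also have "\<dots> = (\<Sum>x\<in>i ` E. 2 / real p * (case x of (h, k) \<Rightarrow> ?g h * ?g k))" by (subst sum.reindex[OF inj]) simp
  also have "\<dots> \<le> (\<Sum>x\<in>exp_range Y \<times> exp_range Y. 2 / real p * (case x of (h, k) \<Rightarrow> ?g h * ?g k))"
   by (intro sum_mono2) (auto simp: i_def dest: E)
  also have "\<dots> = 2 / real p * (rough_divisor_sum P Y)\<^sup>2"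
   unfolding sum_distrib_left[symmetric] by (simp only: rough_divisor_sum_def power2_eq_square sum_product sum.cartesian_product)
  finally show ?thesis using True by simp
 qed
qed

text \<open>The cut at exp (2 Y) loses nothing: h' / k' = n h / k with all four numbers at most exp
  Y forces n \<le> exp (2 Y).\<close>

definition resonator_prime_sum :: "nat \<Rightarrow> real \<Rightarrow> real \<Rightarrow> real" where
 "resonator_prime_sum P Y \<alpha> = (\<Sum>n\<in>exp_range (2 * Y). mangoldt n / sqrt (real n) * cos (\<alpha> * ln (real n)) * resonator_diagonal P Y n)"

text \<open>A lower bound for \<open>\<integral>\<^sub>0\<^sup>1 cos (b v) (1 - v)\<^sup>2 dv\<close>: its Taylor polynomial with the bound for the remainder subtracted.\<close>
definition cos_weight_poly :: "real \<Rightarrow> real" where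
 "cos_weight_poly b = 2 * (\<Sum>k<6. (- 1) ^ k * b ^ (2 * k) / fact (2 * k + 3)) - 2 * b ^ 12 / fact 15"

section \<open>Cosine integrals against (Y - t)^2\<close>

lemma cos_taylor_bound: "\<bar>cos x - (\<Sum>k<6. (- 1) ^ k * x ^ (2 * k) / fact (2 * k))\<bar> \<le> x ^ 12 / fact 12" for x :: real
proof -
 obtain t where t: "cos x = (\<Sum>m<12. cos_coeff m * x ^ m) + cos (t + 1 / 2 * real 12 * pi) / fact 12 * x ^ 12"
  using Maclaurin_cos_expansion[of x 12] by blast
 have "(\<Sum>m<2 * n. cos_coeff m * x ^ m) = (\<Sum>k<n. (- 1) ^ k * x ^ (2 * k) / fact (2 * k))" for n
  by (induction n) (auto simp: cos_coeff_def)
 from this[of 6] have e: "(\<Sum>m<12. cos_coeff m * x ^ m) = (\<Sum>k<6. (- 1) ^ k * x ^ (2 * k) / fact (2 * k))" by simp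
 have p: "0 \<le> x ^ 12" by (rule zero_le_even_power) simp
 have "\<bar>cos (t + 1 / 2 * real 12 * pi)\<bar> * (x ^ 12 / fact 12) \<le> 1 * (x ^ 12 / fact 12)"
  using p by (intro mult_right_mono) auto
 then show ?thesis unfolding t e using p by (simp add: abs_mult)
qed

text \<open>Euler's beta integral with second exponent 2, proved here by expanding the
  square.\<close>

lemma has_integral_power_weight:
 fixes Y :: real
 assumes "Y \<ge> 0"
 shows "((\<lambda>t. t ^ m * (Y - t)\<^sup>2) has_integral 2 * fact m * Y ^ (m + 3) / fact (m + 3)) {0..Y}"
proof -
 let ?F = "\<lambda>t::real. Y\<^sup>2 * t ^ (m + 1) / real (m + 1) - 2 * Y * t ^ (m + 2) / real (m + 2) + t ^ (m + 3) / real (m + 3)"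
 have "((\<lambda>t. t ^ m * (Y - t)\<^sup>2) has_integral ?F Y - ?F 0) {0..Y}"
 proof (rule fundamental_theorem_of_calculus[OF assms])
  fix t assume "t \<in> {0..Y}"
  have "(?F has_real_derivative Y\<^sup>2 * (real (m + 1) * t ^ m) / real (m + 1) - 2 * Y * (real (m + 2) * t ^ (m + 1)) / real (m + 2) + real (m + 3) * t ^ (m + 2) / real (m + 3)) (at t)"
   by (rule derivative_eq_intros refl | simp)+
  also have "Y\<^sup>2 * (real (m + 1) * t ^ m) / real (m + 1) - 2 * Y * (real (m + 2) * t ^ (m + 1)) / real (m + 2) + real (m + 3) * t ^ (m + 2) / real (m + 3) = Y\<^sup>2 * t ^ m - 2 * Y * t ^ (m + 1) + t ^ (m + 2)"
   by (simp del: of_nat_add)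
  also have "\<dots> = t ^ m * (Y - t)\<^sup>2" by (simp add: power2_eq_square algebra_simps)
  finally show "(?F has_vector_derivative t ^ m * (Y - t)\<^sup>2) (at t within {0..Y})"
   unfolding has_real_derivative_iff_has_vector_derivative by (rule has_vector_derivative_at_within)
 qed
 moreover have "?F Y - ?F 0 = 2 * fact m * Y ^ (m + 3) / fact (m + 3)"
 proof -
  have f: "fact (m + 3) = (real (m + 1) * real (m + 2) * real (m + 3)) * fact m"
   by (simp add: numeral_eq_Suc algebra_simps)
  have "?F Y - ?F 0 = Y ^ (m + 3) * (1 / real (m + 1) - 2 / real (m + 2) + 1 / real (m + 3))"
   by (simp add: algebra_simps power_add power2_eq_square power3_eq_cube)
  also have "1 / real (m + 1) - 2 / real (m + 2) + 1 / real (m + 3) = 2 / (real (m + 1) * real (m + 2) * real (m + 3))"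
   by (simp add: divide_simps) (simp add: algebra_simps)?
  finally show ?thesis unfolding f by (simp add: mult_ac)
 qed
 ultimately show ?thesis by simp
qed

lemma integral_cos_weight_ge:
 assumes "Y \<ge> 0"
 shows "integral {0..Y} (\<lambda>t. cos (\<alpha> * t) * (Y - t)\<^sup>2) \<ge> Y ^ 3 * cos_weight_poly (\<alpha> * Y)"
proof -
 let ?p = "\<lambda>t. (\<Sum>k<6. (- 1) ^ k * \<alpha> ^ (2 * k) / fact (2 * k) * (t ^ (2 * k) * (Y - t)\<^sup>2)) - \<alpha> ^ 12 / fact 12 * (t ^ 12 * (Y - t)\<^sup>2)"
 have I: "(?p has_integral (\<Sum>k<6. (- 1) ^ k * \<alpha> ^ (2 * k) / fact (2 * k) * (2 * fact (2 * k) * Y ^ (2 * k + 3) / fact (2 * k + 3)))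
   - \<alpha> ^ 12 / fact 12 * (2 * fact 12 * Y ^ (12 + 3) / fact (12 + 3))) {0..Y}"
  by (intro has_integral_diff has_integral_sum has_integral_mult_right has_integral_power_weight assms) auto
 have "(\<Sum>k<6. (- 1) ^ k * \<alpha> ^ (2 * k) / fact (2 * k) * (2 * fact (2 * k) * Y ^ (2 * k + 3) / fact (2 * k + 3)))
   - \<alpha> ^ 12 / fact 12 * (2 * fact 12 * Y ^ (12 + 3) / fact (12 + 3)) = Y ^ 3 * cos_weight_poly (\<alpha> * Y)"
 proof -
  have a: "(- 1) ^ k * \<alpha> ^ (2 * k) / fact (2 * k) * (2 * fact (2 * k) * Y ^ (2 * k + 3) / fact (2 * k + 3)) =
   Y ^ 3 * (2 * ((- 1) ^ k * (\<alpha> * Y) ^ (2 * k) / fact (2 * k + 3)))" for k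
   by (simp add: power_mult_distrib power_add mult_ac)
  have b: "\<alpha> ^ 12 / fact 12 * (2 * fact 12 * Y ^ (12 + 3) / fact (12 + 3)) = Y ^ 3 * (2 * (\<alpha> * Y) ^ 12 / fact 15)"
   by (simp add: power_mult_distrib power_add mult_ac)
  show ?thesis unfolding cos_weight_poly_def right_diff_distrib sum_distrib_left a b by (rule refl)
 qed
 then have I': "(?p has_integral Y ^ 3 * cos_weight_poly (\<alpha> * Y)) {0..Y}" using I by simp
 show ?thesis
 proof (rule has_integral_le[OF I'])
  show "((\<lambda>t. cos (\<alpha> * t) * (Y - t)\<^sup>2) has_integral integral {0..Y} (\<lambda>t. cos (\<alpha> * t) * (Y - t)\<^sup>2)) {0..Y}"
   by (intro integrable_integral integrable_continuous_real continuous_intros)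
  fix t
  have "?p t = ((\<Sum>k<6. (- 1) ^ k * (\<alpha> * t) ^ (2 * k) / fact (2 * k)) - (\<alpha> * t) ^ 12 / fact 12) * (Y - t)\<^sup>2"
   unfolding left_diff_distrib sum_distrib_right by (simp add: power_mult_distrib mult_ac)
  also have "\<dots> \<le> cos (\<alpha> * t) * (Y - t)\<^sup>2"
   using cos_taylor_bound[of "\<alpha> * t"] by (intro mult_right_mono) (linarith, simp)
  finally show "?p t \<le> cos (\<alpha> * t) * (Y - t)\<^sup>2" .
 qed
qed

subsection \<open>The prime sum of the resonator\<close>

definition prime_weight :: "nat \<Rightarrow> real" where
 "prime_weight d = (if prime d then ln (real d) / real d else 0)"

lemma prime_weight_nonneg [simp]: "prime_weight d \<ge> 0"
 by (auto simp: prime_weight_def intro!: divide_nonneg_nonneg ln_ge_zero dest: prime_ge_1_nat)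

definition mertens_const :: real where "mertens_const = 10 + 2 * mangoldt_square_sum"

lemma mangoldt_square_sum_nonneg: "mangoldt_square_sum \<ge> 0"
 using sum_mangoldt_square_le[of "{}"] by simp

lemma prime_weight_sum: "t \<ge> 0 \<Longrightarrow> \<bar>(\<Sum>d\<in>exp_range t. prime_weight d) - 1 * t\<bar> \<le> mertens_const"
 using mertens_primes[of t] by (simp add: prime_weight_def mertens_const_def)

lemma prime_weight_sum_over:
 assumes "finite A" shows "(\<Sum>p\<in>A. prime_weight p / real p) \<le> mangoldt_square_sum"
proof -
 have "(\<Sum>p\<in>A. prime_weight p / real p) \<le> (\<Sum>n\<in>A. mangoldt n / (real n)\<^sup>2)"
  by (intro sum_mono) (auto simp: prime_weight_def mangoldt_prime power2_eq_square mangoldt_nonneg)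
 also have "\<dots> \<le> mangoldt_square_sum" by (rule sum_mangoldt_square_le[OF assms])
 finally show ?thesis .
qed

text \<open>Of the proper prime powers only squares have a nonempty diagonal, and 2 / p from the
  diagonal against 1 / p from the weight leaves the summable 1 / p^2. The right side is spread over
  all p, with at most one nonzero term, so that it can be summed over n and interchanged.\<close>

lemma prime_square_term_le:
 assumes n: "n \<in> exp_range t" "\<not> prime n"
 shows "mangoldt n / sqrt (real n) * resonator_diagonal P Y n \<le>
  (\<Sum>p\<in>exp_range t. if n = p\<^sup>2 then 2 * (rough_divisor_sum P Y)\<^sup>2 * (mangoldt p / (real p)\<^sup>2) else 0)"
  (is "_ \<le> ?R")
proof -
 have R: "?R \<ge> 0" by (intro sum_nonneg) (auto simp: mangoldt_nonneg)
 show ?thesis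
 proof (cases "primepow n")
  case False
  then show ?thesis using R by (simp add: mangoldt_def)
 next
  case True
  then obtain p j where p: "prime p" "n = p ^ j" "j > 0" by (auto simp: primepow_def)
  have j2: "j \<ge> 2" using p n(2) by (cases "j = 1") auto
  have p0: "p > 0" using p(1) by (rule prime_gt_0_nat)
  note D = resonator_diagonal_prime_power[OF p(1) j2, of P Y]
  show ?thesis
  proof (cases "j = 2")
   case False
   then have "resonator_diagonal P Y n \<le> 0" using D p(2) by simp
   then have "resonator_diagonal P Y n = 0" using resonator_diagonal_nonneg by (intro antisym)
   then show ?thesis using R by simp
  next
   case True
   have n2: "n = p\<^sup>2" using p True by simp
   have m: "mangoldt n = mangoldt p" using p(1) by (simp add: n2 mangoldt_primepow mangoldt_prime)
   have "p \<le> n" using p0 unfolding n2 power2_eq_square by (simp add: Suc_leI)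
   then have pe: "p \<in> exp_range t" using n p0 unfolding exp_range_eq by auto
   have "mangoldt n / sqrt (real n) * resonator_diagonal P Y n \<le> mangoldt n / sqrt (real n) * (2 / real p * (rough_divisor_sum P Y)\<^sup>2)"
   proof (rule mult_left_mono)
    show "resonator_diagonal P Y n \<le> 2 / real p * (rough_divisor_sum P Y)\<^sup>2" using D True p by simp
    show "0 \<le> mangoldt n / sqrt (real n)" by (simp add: mangoldt_nonneg)
   qed
   also have "\<dots> = 2 * (rough_divisor_sum P Y)\<^sup>2 * (mangoldt p / (real p)\<^sup>2)"
    unfolding m unfolding n2 by (simp add: power2_eq_square)
   also have "\<dots> = (if n = p\<^sup>2 then 2 * (rough_divisor_sum P Y)\<^sup>2 * (mangoldt p / (real p)\<^sup>2) else 0)"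
    using n2 by simp
   also have "\<dots> \<le> ?R" by (rule member_le_sum[OF pe]) (auto simp: mangoldt_nonneg)
   finally show ?thesis .
  qed
 qed
qed

lemma resonator_nonprime_part:
 "\<bar>\<Sum>n\<in>{n\<in>exp_range t. \<not> prime n}. mangoldt n / sqrt (real n) * cos (\<alpha> * ln (real n)) * resonator_diagonal P Y n\<bar>
  \<le> 2 * (rough_divisor_sum P Y)\<^sup>2 * mangoldt_square_sum"
proof -
 let ?S = "2 * (rough_divisor_sum P Y)\<^sup>2"
 have "\<bar>\<Sum>n\<in>{n\<in>exp_range t. \<not> prime n}. mangoldt n / sqrt (real n) * cos (\<alpha> * ln (real n)) * resonator_diagonal P Y n\<bar>
  \<le> (\<Sum>n\<in>{n\<in>exp_range t. \<not> prime n}. mangoldt n / sqrt (real n) * resonator_diagonal P Y n)"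
 proof (rule sum_norm_le[where 'a = real, unfolded real_norm_def])
  fix n
  have "\<bar>mangoldt n / sqrt (real n) * cos (\<alpha> * ln (real n)) * resonator_diagonal P Y n\<bar> = mangoldt n / sqrt (real n) * resonator_diagonal P Y n * \<bar>cos (\<alpha> * ln (real n))\<bar>"
   by (simp add: abs_mult mangoldt_nonneg)
  also have "\<dots> \<le> mangoldt n / sqrt (real n) * resonator_diagonal P Y n"
   by (rule mult_left_le) (auto simp: mangoldt_nonneg)
  finally show "\<bar>mangoldt n / sqrt (real n) * cos (\<alpha> * ln (real n)) * resonator_diagonal P Y n\<bar> \<le> mangoldt n / sqrt (real n) * resonator_diagonal P Y n" .
 qed
 also have "\<dots> \<le> (\<Sum>n\<in>{n\<in>exp_range t. \<not> prime n}. \<Sum>p\<in>exp_range t. if n = p\<^sup>2 then ?S * (mangoldt p / (real p)\<^sup>2) else 0)"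
  by (intro sum_mono prime_square_term_le) auto
 also have "\<dots> = (\<Sum>p\<in>exp_range t. \<Sum>n\<in>{n\<in>exp_range t. \<not> prime n}. if n = p\<^sup>2 then ?S * (mangoldt p / (real p)\<^sup>2) else 0)"
  by (rule sum.swap)
 also have "\<dots> \<le> (\<Sum>p\<in>exp_range t. ?S * (mangoldt p / (real p)\<^sup>2))"
  by (intro sum_mono) (auto simp: sum.delta mangoldt_nonneg)
 also have "\<dots> = ?S * (\<Sum>p\<in>exp_range t. mangoldt p / (real p)\<^sup>2)" by (simp add: sum_distrib_left)
 also have "\<dots> \<le> ?S * mangoldt_square_sum" by (intro mult_left_mono sum_mangoldt_square_le) auto
 finally show ?thesis .
qed

lemma resonator_prime_part:
 assumes Y: "Y \<ge> 0"
 shows "(\<Sum>p\<in>{p\<in>exp_range (2 * Y). prime p}. mangoldt p / sqrt (real p) * cos (\<alpha> * ln (real p)) * resonator_diagonal P Y p) =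
  2 * sqrt 2 * (\<Sum>p\<in>exp_range Y. prime_weight p * (cos (\<alpha> * ln (real p)) * (if coprime p P then
    (\<Sum>(h, k)\<in>reduced_pairs (Y - ln (real p)) Y p. rough_divisor P h * rough_divisor P k) else 0)))"
proof -
 let ?W = "\<lambda>p. if coprime p P then (\<Sum>(h, k)\<in>reduced_pairs (Y - ln (real p)) Y p. rough_divisor P h * rough_divisor P k) else 0"
 \<comment> \<open>For p > exp Y no h is left in the shortened range, which reduces the sum from exp
   (2 Y) to exp Y.\<close>
 have W0: "?W p = 0" if "p \<notin> exp_range Y" "p > 0" for p
 proof -
  have "ln (real p) > Y" using that by (simp add: exp_range_def)
  have "n \<notin> exp_range (Y - ln (real p))" for n
  proof
   assume "n \<in> exp_range (Y - ln (real p))"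
   then have "ln (real n) \<le> Y - ln (real p)" "ln (real n) \<ge> 0" by (auto simp: exp_range_def)
   then show False using \<open>ln (real p) > Y\<close> by linarith
  qed
  then have "exp_range (Y - ln (real p)) = {}" by blast
  then show ?thesis by (simp add: reduced_pairs_def)
 qed
 have t: "mangoldt p / sqrt (real p) * cos (\<alpha> * ln (real p)) * resonator_diagonal P Y p =
   2 * sqrt 2 * (prime_weight p * (cos (\<alpha> * ln (real p)) * ?W p))" if p: "prime p" for p
 proof -
  have "real p > 0" using p by (simp add: prime_gt_0_nat)
  then have "1 / sqrt (real p) * sqrt (2 / real p) = sqrt 2 / real p"
   by (simp add: real_sqrt_divide)
  from arg_cong[OF this, of "(*) (ln (real p))"]
  have "ln (real p) / sqrt (real p) * sqrt (2 / real p) = sqrt 2 * (ln (real p) / real p)" by (simp add: mult_ac)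
  then have "ln (real p) / sqrt (real p) * x * (2 * sqrt (2 / real p) * w) = 2 * sqrt 2 * (ln (real p) / real p * (x * w))" for x w
   by (metis (no_types, opaque_lifting) mult.assoc mult.commute)
  then show ?thesis unfolding resonator_diagonal_prime[OF p] using p by (auto simp: mangoldt_prime prime_weight_def)
 qed
 have "(\<Sum>p\<in>{p\<in>exp_range (2 * Y). prime p}. mangoldt p / sqrt (real p) * cos (\<alpha> * ln (real p)) * resonator_diagonal P Y p) =
  (\<Sum>p\<in>{p\<in>exp_range (2 * Y). prime p}. 2 * sqrt 2 * (prime_weight p * (cos (\<alpha> * ln (real p)) * ?W p)))"
  by (intro sum.cong refl t) auto
 also have "\<dots> = (\<Sum>p\<in>{p\<in>exp_range Y. prime p}. 2 * sqrt 2 * (prime_weight p * (cos (\<alpha> * ln (real p)) * ?W p)))"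
 proof (intro sum.mono_neutral_right ballI)
  fix i assume "i \<in> {p\<in>exp_range (2 * Y). prime p} - {p\<in>exp_range Y. prime p}"
  then have "?W i = 0" by (intro W0) (auto simp: prime_gt_0_nat)
  then show "2 * sqrt 2 * (prime_weight i * (cos (\<alpha> * ln (real i)) * ?W i)) = 0" by (simp only: mult_zero_right)
 qed (use exp_range_mono[of Y "2 * Y"] Y in auto)
 also have "\<dots> = (\<Sum>p\<in>exp_range Y. 2 * sqrt 2 * (prime_weight p * (cos (\<alpha> * ln (real p)) * ?W p)))"
  by (intro sum.mono_neutral_left) (auto simp: prime_weight_def)
 finally show ?thesis unfolding sum_distrib_left .
qed

text \<open>Three replacements lead to the cosine integral: the sum over reduced pairs by S(Y - ln
  p) S(Y) (\<open>e1\<close>), S(Y - ln p) by \<kappa> (Y - ln p)^2 (\<open>e2\<close>), and the sum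
  over primes by an integral through Mertens' estimate (\<open>e3\<close>). Relative to S(Y)^2 all
  errors are bounded except 12 Y / z, which stays visible in the statement. The condition |\<alpha>|
  Y \<le> 5 keeps the integrand from oscillating.\<close>

lemma resonator_prime_sum_lower:
 assumes z: "z > (0::nat)"
 shows "\<exists>C Y0. \<forall>Y\<ge>Y0. \<forall>\<alpha>. \<bar>\<alpha>\<bar> * Y \<le> 5 \<longrightarrow>
  resonator_prime_sum (fact z) Y \<alpha> \<ge> (rough_divisor_sum (fact z) Y)\<^sup>2 *
   (2 * sqrt 2 * (Y * (cos_weight_poly (\<alpha> * Y) - 12 / real z)) - C)"
proof -
 define g where "g = rough_divisor (fact z)"
 define S where "S = rough_divisor_sum (fact z)"
 have f0: "(fact z :: nat) > 0" by simp
 obtain \<kappa> C where k: "\<kappa> > 0" and C: "C \<ge> 0" and SC: "\<And>y. y \<ge> 0 \<Longrightarrow> \<bar>S y - \<kappa> * y\<^sup>2\<bar> \<le> C * (1 + y)"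
  using rough_divisor_sum_asymp[OF f0] unfolding S_def by blast
 let ?M = mangoldt_square_sum
 let ?m = mertens_const
 have M0: "?M \<ge> 0" by (rule mangoldt_square_sum_nonneg)
 have m0: "?m \<ge> 0" using M0 by (simp add: mertens_const_def)
 have S0: "S y \<ge> 0" for y by (simp add: S_def)
 have lnz: "ln (real z) \<ge> 0" using z by simp
 \<comment> \<open>Errors relative to s^2: the first three terms come from \<open>r1\<close>,
   \<open>r2\<close> and \<open>r3\<close>, the others from \<open>e1\<close>.\<close>
 define E where "E = 4 * C / \<kappa> + 14 * ?m + 4 * C * (1 + ?m) / \<kappa> + (12 / real z * ?m + 4 * ?M + (ln (real z) + ?m))"
 \<comment> \<open>From here on \<kappa> Y^2 \<le> 2 S(Y), so errors of order Y^2 count as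
   O(S(Y)).\<close>
 define Y0 where "Y0 = max 1 (4 * C / \<kappa>)"
 have main: "resonator_prime_sum (fact z) Y \<alpha> \<ge> (S Y)\<^sup>2 * (2 * sqrt 2 * (Y * (cos_weight_poly (\<alpha> * Y) - 12 / real z)) - (2 * sqrt 2 * E + 2 * ?M))"
  if Y: "Y \<ge> Y0" and aY: "\<bar>\<alpha>\<bar> * Y \<le> 5" for Y \<alpha>
 proof -
  have Y1: "Y \<ge> 1" using Y by (simp add: Y0_def)
  have "4 * C / \<kappa> \<le> Y" using Y by (simp add: Y0_def)
  then have CY: "4 * C \<le> \<kappa> * Y" using k by (simp add: field_simps)
  define s where "s = S Y"
  have s0: "s \<ge> 0" by (simp add: s_def S0)
  have Ys: "Y\<^sup>2 \<le> 2 * s / \<kappa>"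
  proof -
   have "C * (1 + Y) \<le> C * (2 * Y)" using Y1 C by (intro mult_left_mono) auto
   also have "\<dots> = (4 * C) * Y / 2" by simp
   also have "\<dots> \<le> (\<kappa> * Y) * Y / 2" using CY Y1 by (intro divide_right_mono mult_right_mono) auto
   finally have "C * (1 + Y) \<le> \<kappa> * Y\<^sup>2 / 2" by (simp add: power2_eq_square mult.assoc)
   then have "\<kappa> * Y\<^sup>2 / 2 \<le> s" using SC[of Y] Y1 unfolding s_def by linarith
   then show ?thesis using k by (simp add: field_simps)
  qed
  define c where "c = (\<lambda>p::nat. cos (\<alpha> * ln (real p)))"
  define W where "W = (\<lambda>p. if coprime p (fact z) then (\<Sum>(h, k)\<in>reduced_pairs (Y - ln (real p)) Y p. g h * g k) else 0)"
  have c1: "\<bar>c p\<bar> \<le> 1" for p by (simp add: c_def)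
  have split: "resonator_prime_sum (fact z) Y \<alpha> = 2 * sqrt 2 * (\<Sum>p\<in>exp_range Y. prime_weight p * (c p * W p)) +
   (\<Sum>n\<in>{n\<in>exp_range (2 * Y). \<not> prime n}. mangoldt n / sqrt (real n) * cos (\<alpha> * ln (real n)) * resonator_diagonal (fact z) Y n)"
  proof -
   let ?t = "\<lambda>n. mangoldt n / sqrt (real n) * cos (\<alpha> * ln (real n)) * resonator_diagonal (fact z) Y n"
   have "resonator_prime_sum (fact z) Y \<alpha> = sum ?t ({n\<in>exp_range (2 * Y). prime n} \<union> {n\<in>exp_range (2 * Y). \<not> prime n})"
    unfolding resonator_prime_sum_def by (intro sum.cong) auto
   also have "\<dots> = sum ?t {n\<in>exp_range (2 * Y). prime n} + sum ?t {n\<in>exp_range (2 * Y). \<not> prime n}"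
    by (intro sum.union_disjoint) auto
   also have "sum ?t {n\<in>exp_range (2 * Y). prime n} = 2 * sqrt 2 * (\<Sum>p\<in>exp_range Y. prime_weight p * (c p * W p))"
    unfolding W_def c_def g_def by (rule resonator_prime_part) (use Y1 in simp)
   finally show ?thesis .
  qed
  have pw: "(\<Sum>p\<in>exp_range Y. prime_weight p) \<le> Y + ?m" using prime_weight_sum[of Y] Y1 by simp
  have e1: "\<bar>(\<Sum>p\<in>exp_range Y. prime_weight p * (c p * W p)) - (\<Sum>p\<in>exp_range Y. prime_weight p * (c p * (S (Y - ln (real p)) * s)))\<bar>
    \<le> s\<^sup>2 * (12 / real z * (Y + ?m) + 4 * ?M + (ln (real z) + ?m))"
  proof -
   have b: "\<bar>prime_weight p * (c p * W p) - prime_weight p * (c p * (S (Y - ln (real p)) * s))\<bar> \<le>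
     s\<^sup>2 * (12 / real z * prime_weight p + 4 * (prime_weight p / real p) + (if p \<in> exp_range (ln (real z)) then prime_weight p else 0))"
    if p: "p \<in> exp_range Y" for p
   proof (cases "prime p")
    case False then show ?thesis by (simp add: prime_weight_def)
   next
    case True
    define S' where "S' = S (Y - ln (real p))"
    have lp: "ln (real p) \<ge> 0" using p by (simp add: exp_range_def)
    have "S' \<le> s" unfolding S'_def s_def S_def by (intro rough_divisor_sum_mono) (use lp in auto)
    then have S's: "S' * s \<le> s\<^sup>2" unfolding power2_eq_square using s0 by (intro mult_right_mono)
    have S'0: "S' * s \<ge> 0" using S0 s0 by (simp add: S'_def)
    have q0: "0 \<le> 12 / real z + 4 / real p" by simp
    \<comment> \<open>For p \<le> z the sum \<open>W p\<close> is 0 and the error is the whole main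
      term; the last summand pays for these finitely many primes.\<close>
    have "\<bar>W p - S' * s\<bar> \<le> s\<^sup>2 * (12 / real z + 4 / real p + (if p \<in> exp_range (ln (real z)) then 1 else 0))"
    proof (cases "coprime p (fact z)")
     case True
     have w: "W p \<le> S' * s" "W p \<ge> (1 - 12 / real z - 4 / real p) * (S' * s)"
      using reduced_pairs_sum_bounds[OF z \<open>prime p\<close>, of "Y - ln (real p)" Y] True
      by (auto simp: W_def S'_def s_def S_def g_def)
     have "(12 / real z + 4 / real p) * (S' * s) \<le> (12 / real z + 4 / real p) * s\<^sup>2" by (rule mult_left_mono[OF S's q0])
     moreover have "(1 - 12 / real z - 4 / real p) * (S' * s) = S' * s - (12 / real z + 4 / real p) * (S' * s)" by (simp only: left_diff_distrib distrib_right mult_1)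
     ultimately have "\<bar>W p - S' * s\<bar> \<le> (12 / real z + 4 / real p) * s\<^sup>2" using w by linarith
     also have "\<dots> \<le> (12 / real z + 4 / real p + (if p \<in> exp_range (ln (real z)) then 1 else 0)) * s\<^sup>2" by (intro mult_right_mono) auto
     finally show ?thesis by (simp only: mult.commute)
    next
     case False
     have "p dvd fact z" using False \<open>prime p\<close> by (metis prime_imp_coprime)
     then have "p \<le> z" using \<open>prime p\<close> by (simp add: prime_dvd_fact_iff)
     then have pz: "p \<in> exp_range (ln (real z))" using p z by (simp add: exp_range_def)
     have "\<bar>W p - S' * s\<bar> \<le> s\<^sup>2 * 1" using False S'0 S's by (simp add: W_def)
     also have "\<dots> \<le> s\<^sup>2 * (12 / real z + 4 / real p + (if p \<in> exp_range (ln (real z)) then 1 else 0))"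
      using pz q0 by (intro mult_left_mono) auto
     finally show ?thesis .
    qed
    then have A: "prime_weight p * (\<bar>c p\<bar> * \<bar>W p - S' * s\<bar>) \<le> prime_weight p * (1 * (s\<^sup>2 * (12 / real z + 4 / real p + (if p \<in> exp_range (ln (real z)) then 1 else 0))))"
     by (intro mult_left_mono mult_mono c1) auto
    have B: "\<bar>prime_weight p * (c p * W p) - prime_weight p * (c p * (S' * s))\<bar> = prime_weight p * (\<bar>c p\<bar> * \<bar>W p - S' * s\<bar>)"
     by (simp only: right_diff_distrib[symmetric] abs_mult) simp
    have D: "prime_weight p * (1 * (s\<^sup>2 * (12 / real z + 4 / real p + (if p \<in> exp_range (ln (real z)) then 1 else 0)))) =
     s\<^sup>2 * (12 / real z * prime_weight p + 4 * (prime_weight p / real p) + (if p \<in> exp_range (ln (real z)) then prime_weight p else 0))"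
     by (simp add: algebra_simps)
    show ?thesis unfolding S'_def[symmetric] B D[symmetric] by (rule A)
   qed
   have fz: "(\<Sum>p\<in>exp_range Y. if p \<in> exp_range (ln (real z)) then prime_weight p else 0) \<le> ln (real z) + ?m"
   proof -
    have "(\<Sum>p\<in>exp_range Y. if p \<in> exp_range (ln (real z)) then prime_weight p else 0) = (\<Sum>p\<in>exp_range Y \<inter> exp_range (ln (real z)). prime_weight p)"
     by (simp add: sum.inter_restrict)
    also have "\<dots> \<le> (\<Sum>p\<in>exp_range (ln (real z)). prime_weight p)" by (intro sum_mono2) auto
    also have "\<dots> \<le> ln (real z) + ?m" using prime_weight_sum[OF lnz] by simp
    finally show ?thesis .
   qed
   have "\<bar>(\<Sum>p\<in>exp_range Y. prime_weight p * (c p * W p)) - (\<Sum>p\<in>exp_range Y. prime_weight p * (c p * (S (Y - ln (real p)) * s)))\<bar> \<le>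
    (\<Sum>p\<in>exp_range Y. s\<^sup>2 * (12 / real z * prime_weight p + 4 * (prime_weight p / real p) + (if p \<in> exp_range (ln (real z)) then prime_weight p else 0)))"
    unfolding sum_subtractf[symmetric] by (rule sum_norm_le[where 'a = real, unfolded real_norm_def]) (rule b)
   also have "\<dots> = s\<^sup>2 * (12 / real z * (\<Sum>p\<in>exp_range Y. prime_weight p) + 4 * (\<Sum>p\<in>exp_range Y. prime_weight p / real p) +
     (\<Sum>p\<in>exp_range Y. if p \<in> exp_range (ln (real z)) then prime_weight p else 0))"
    by (simp only: sum_distrib_left[symmetric] sum.distrib)
   also have "\<dots> \<le> s\<^sup>2 * (12 / real z * (Y + ?m) + 4 * ?M + (ln (real z) + ?m))"
    by (intro mult_left_mono add_mono pw fz prime_weight_sum_over) auto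
   finally show ?thesis .
  qed
  have e2: "\<bar>(\<Sum>p\<in>exp_range Y. prime_weight p * (c p * (S (Y - ln (real p)) * s))) - s * (\<kappa> * (\<Sum>p\<in>exp_range Y. prime_weight p * (c p * (Y - ln (real p))\<^sup>2)))\<bar>
    \<le> s * (C * (1 + Y) * (Y + ?m))"
  proof -
   have b: "\<bar>prime_weight p * (c p * (S (Y - ln (real p)) * s)) - s * (\<kappa> * (prime_weight p * (c p * (Y - ln (real p))\<^sup>2)))\<bar> \<le> s * (C * (1 + Y) * prime_weight p)"
    if p: "p \<in> exp_range Y" for p
   proof -
    have lp: "0 \<le> ln (real p)" "ln (real p) \<le> Y" using p by (auto simp: exp_range_def)
    have "\<bar>S (Y - ln (real p)) - \<kappa> * (Y - ln (real p))\<^sup>2\<bar> \<le> C * (1 + (Y - ln (real p)))" by (rule SC) (use lp in simp)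
    also have "\<dots> \<le> C * (1 + Y)" using C lp by (intro mult_left_mono) auto
    finally have d: "\<bar>S (Y - ln (real p)) - \<kappa> * (Y - ln (real p))\<^sup>2\<bar> \<le> C * (1 + Y)" .
    have "\<bar>prime_weight p * (c p * (S (Y - ln (real p)) * s)) - s * (\<kappa> * (prime_weight p * (c p * (Y - ln (real p))\<^sup>2)))\<bar> =
     \<bar>(s * prime_weight p) * (c p * (S (Y - ln (real p)) - \<kappa> * (Y - ln (real p))\<^sup>2))\<bar>" by (simp only: right_diff_distrib mult_ac)
    also have "\<dots> = (s * prime_weight p) * (\<bar>c p\<bar> * \<bar>S (Y - ln (real p)) - \<kappa> * (Y - ln (real p))\<^sup>2\<bar>)"
     using s0 by (simp only: abs_mult abs_of_nonneg prime_weight_nonneg)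
    also have "\<dots> \<le> (s * prime_weight p) * (1 * (C * (1 + Y)))"
     using s0 by (intro mult_left_mono mult_mono c1 d) auto
    finally show ?thesis by (simp add: mult_ac)
   qed
   have "\<bar>(\<Sum>p\<in>exp_range Y. prime_weight p * (c p * (S (Y - ln (real p)) * s))) - s * (\<kappa> * (\<Sum>p\<in>exp_range Y. prime_weight p * (c p * (Y - ln (real p))\<^sup>2)))\<bar>
    \<le> (\<Sum>p\<in>exp_range Y. s * (C * (1 + Y) * prime_weight p))"
    unfolding sum_distrib_left sum_subtractf[symmetric] by (rule sum_norm_le[where 'a = real, unfolded real_norm_def]) (rule b)
   also have "\<dots> = s * (C * (1 + Y) * (\<Sum>p\<in>exp_range Y. prime_weight p))" by (simp only: sum_distrib_left)
   also have "\<dots> \<le> s * (C * (1 + Y) * (Y + ?m))" using s0 C Y1 by (intro mult_left_mono pw) auto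
   finally show ?thesis .
  qed
  define f where "f = (\<lambda>t. cos (\<alpha> * t) * (Y - t)\<^sup>2)"
  define I where "I = integral {0..Y} f"
  have e3: "\<bar>(\<Sum>p\<in>exp_range Y. prime_weight p * (c p * (Y - ln (real p))\<^sup>2)) - I\<bar> \<le> ?m * (7 * Y\<^sup>2)"
  proof -
   let ?f' = "\<lambda>t. - \<alpha> * sin (\<alpha> * t) * (Y - t)\<^sup>2 - 2 * cos (\<alpha> * t) * (Y - t)"
   have "\<bar>(\<Sum>n\<in>exp_range Y. prime_weight n * f (ln (real n))) - 1 * integral {0..Y} f\<bar> \<le> ?m * (\<bar>f Y\<bar> + Y * (7 * Y))"
   proof (rule abel_summation_bound[OF prime_weight_sum, where f' = ?f'])
    show "(f has_real_derivative ?f' t) (at t)" for t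
     unfolding f_def by (auto intro!: derivative_eq_intros simp: algebra_simps)
    show "continuous_on {0..Y} ?f'" by (intro continuous_intros)
    \<comment> \<open>5 Y arises from the derivative of the cosine, by |\<alpha>| Y \<le> 5, and 2 Y
      from that of the square.\<close>
    show "\<bar>?f' t\<bar> \<le> 7 * Y" if t: "t \<in> {0..Y}" for t
    proof -
     have "\<bar>?f' t\<bar> \<le> \<bar>\<alpha>\<bar> * \<bar>sin (\<alpha> * t)\<bar> * (Y - t)\<^sup>2 + 2 * \<bar>cos (\<alpha> * t)\<bar> * \<bar>Y - t\<bar>"
      by (rule order_trans[OF abs_triangle_ineq4]) (simp add: abs_mult)
     also have "\<dots> \<le> \<bar>\<alpha>\<bar> * 1 * Y\<^sup>2 + 2 * 1 * Y"
      using t Y1 by (intro add_mono mult_mono power_mono) auto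
     also have "\<bar>\<alpha>\<bar> * 1 * Y\<^sup>2 = (\<bar>\<alpha>\<bar> * Y) * Y" by (simp add: power2_eq_square)
     also have "\<dots> \<le> 5 * Y" using aY Y1 by (intro mult_right_mono) auto
     finally show ?thesis by simp
    qed
   qed (use Y1 in auto)
   then show ?thesis by (simp add: f_def I_def c_def power2_eq_square mult_ac)
  qed
  have fc: "f integrable_on {0..Y}" unfolding f_def by (intro integrable_continuous_real continuous_intros)
  have Iabs: "\<bar>I\<bar> \<le> Y * Y\<^sup>2"
  proof -
   have "norm I \<le> Y\<^sup>2 * (Y - 0)"
    unfolding I_def
   proof (rule integral_bound)
    show "continuous_on {0..Y} f" unfolding f_def by (intro continuous_intros)
    show "norm (f t) \<le> Y\<^sup>2" if "t \<in> {0..Y}" for t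
    proof -
     have "norm (f t) \<le> 1 * (Y - t)\<^sup>2" unfolding f_def real_norm_def abs_mult by (intro mult_mono) auto
     also have "\<dots> \<le> Y\<^sup>2" using that by (simp add: power_mono)
     finally show ?thesis .
    qed
   qed (use Y1 in auto)
   then show ?thesis by (simp add: mult.commute)
  qed
  have Ilow: "I \<ge> Y ^ 3 * cos_weight_poly (\<alpha> * Y)"
   unfolding I_def f_def using Y1 by (intro integral_cos_weight_ge) auto
  \<comment> \<open>Writing I = i Y^2 with |i| \<le> Y allows \<kappa> Y^2 to be exchanged for s at
    the cost of the error in \<open>SC\<close>.\<close>
  have kI: "\<kappa> * I \<ge> s * (Y * cos_weight_poly (\<alpha> * Y)) - C * (1 + Y) * Y"
  proof -
   define i where "i = I / Y\<^sup>2"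
   have Ii: "I = i * Y\<^sup>2" using Y1 by (simp add: i_def)
   have i1: "\<bar>i\<bar> \<le> Y" using Iabs Y1 by (simp add: i_def abs_divide field_simps)
   have i2: "Y * cos_weight_poly (\<alpha> * Y) \<le> i" using Ilow Y1 by (simp add: i_def field_simps power2_eq_square power3_eq_cube)
   have "\<bar>s - \<kappa> * Y\<^sup>2\<bar> * \<bar>i\<bar> \<le> C * (1 + Y) * Y"
    using SC[of Y] Y1 C i1 by (intro mult_mono) (auto simp: s_def)
   moreover have "\<bar>s * i - \<kappa> * I\<bar> \<le> C * (1 + Y) * Y" if "\<bar>s - \<kappa> * Y\<^sup>2\<bar> * \<bar>i\<bar> \<le> C * (1 + Y) * Y"
   proof -
    have "s * i - \<kappa> * I = (s - \<kappa> * Y\<^sup>2) * i" by (simp add: Ii algebra_simps)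
    then show ?thesis using that by (simp only: abs_mult)
   qed
   ultimately have "\<bar>s * i - \<kappa> * I\<bar> \<le> C * (1 + Y) * Y" by blast
   moreover have "s * (Y * cos_weight_poly (\<alpha> * Y)) \<le> s * i" by (rule mult_left_mono[OF i2 s0])
   ultimately show ?thesis by linarith
  qed
  define V where "V = (\<Sum>p\<in>exp_range Y. prime_weight p * (c p * (Y - ln (real p))\<^sup>2))"
  have V: "s * (\<kappa> * V) \<ge> s * (s * (Y * cos_weight_poly (\<alpha> * Y)) - C * (1 + Y) * Y - \<kappa> * (?m * (7 * Y\<^sup>2)))"
  proof (rule mult_left_mono[OF _ s0])
   have "\<kappa> * (I - ?m * (7 * Y\<^sup>2)) \<le> \<kappa> * V" using e3 k unfolding V_def by (intro mult_left_mono) auto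
   then have "\<kappa> * I - \<kappa> * (?m * (7 * Y\<^sup>2)) \<le> \<kappa> * V" by (simp only: right_diff_distrib)
   then show "s * (Y * cos_weight_poly (\<alpha> * Y)) - C * (1 + Y) * Y - \<kappa> * (?m * (7 * Y\<^sup>2)) \<le> \<kappa> * V" using kI by linarith
  qed
  have r1: "C * (1 + Y) * Y \<le> 4 * C / \<kappa> * s"
  proof -
   have "C * (1 + Y) * Y \<le> C * (2 * Y) * Y" using C Y1 by (intro mult_right_mono mult_left_mono) auto
   also have "\<dots> = 2 * C * Y\<^sup>2" by (simp add: power2_eq_square)
   also have "\<dots> \<le> 2 * C * (2 * s / \<kappa>)" using C by (intro mult_left_mono Ys) auto
   finally show ?thesis by simp
  qed
  have r2: "\<kappa> * (?m * (7 * Y\<^sup>2)) \<le> 14 * ?m * s"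
  proof -
   have "\<kappa> * (?m * (7 * Y\<^sup>2)) \<le> \<kappa> * (?m * (7 * (2 * s / \<kappa>)))" using k m0 by (intro mult_left_mono Ys) auto
   then show ?thesis using k by (simp add: mult_ac)
  qed
  have r3: "C * (1 + Y) * (Y + ?m) \<le> 4 * C * (1 + ?m) / \<kappa> * s"
  proof -
   have "Y + ?m \<le> (1 + ?m) * Y" using mult_left_mono[OF Y1 m0] by (simp add: algebra_simps)
   then have "C * (1 + Y) * (Y + ?m) \<le> C * (2 * Y) * ((1 + ?m) * Y)" using C Y1 m0 by (intro mult_mono) auto
   also have "\<dots> = 2 * C * (1 + ?m) * Y\<^sup>2" by (simp add: power2_eq_square)
   also have "\<dots> \<le> 2 * C * (1 + ?m) * (2 * s / \<kappa>)" using C m0 by (intro mult_left_mono Ys) auto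
   finally show ?thesis by simp
  qed
  have r123: "s * (C * (1 + Y) * Y + \<kappa> * (?m * (7 * Y\<^sup>2)) + C * (1 + Y) * (Y + ?m)) \<le> s * (4 * C / \<kappa> * s + 14 * ?m * s + 4 * C * (1 + ?m) / \<kappa> * s)"
   by (rule mult_left_mono[OF _ s0]) (use r1 r2 r3 in linarith)
  have lower: "(\<Sum>p\<in>exp_range Y. prime_weight p * (c p * W p)) \<ge> s\<^sup>2 * (Y * (cos_weight_poly (\<alpha> * Y) - 12 / real z) - E)"
  proof -
   have "(\<Sum>p\<in>exp_range Y. prime_weight p * (c p * W p)) \<ge> s * (s * (Y * cos_weight_poly (\<alpha> * Y)) - C * (1 + Y) * Y - \<kappa> * (?m * (7 * Y\<^sup>2)))
    - s * (C * (1 + Y) * (Y + ?m)) - s\<^sup>2 * (12 / real z * (Y + ?m) + 4 * ?M + (ln (real z) + ?m))"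
    using e1 e2 V unfolding V_def by linarith
   also have "s * (s * (Y * cos_weight_poly (\<alpha> * Y)) - C * (1 + Y) * Y - \<kappa> * (?m * (7 * Y\<^sup>2))) - s * (C * (1 + Y) * (Y + ?m)) =
    s * (s * (Y * cos_weight_poly (\<alpha> * Y))) - s * (C * (1 + Y) * Y + \<kappa> * (?m * (7 * Y\<^sup>2)) + C * (1 + Y) * (Y + ?m))"
    by (simp only: right_diff_distrib distrib_left)
   finally have "(\<Sum>p\<in>exp_range Y. prime_weight p * (c p * W p)) \<ge> s * (s * (Y * cos_weight_poly (\<alpha> * Y))) - s * (4 * C / \<kappa> * s + 14 * ?m * s + 4 * C * (1 + ?m) / \<kappa> * s)
     - s\<^sup>2 * (12 / real z * (Y + ?m) + 4 * ?M + (ln (real z) + ?m))" using r123 by linarith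
   also have "s * (s * (Y * cos_weight_poly (\<alpha> * Y))) - s * (4 * C / \<kappa> * s + 14 * ?m * s + 4 * C * (1 + ?m) / \<kappa> * s)
     - s\<^sup>2 * (12 / real z * (Y + ?m) + 4 * ?M + (ln (real z) + ?m)) = s\<^sup>2 * (Y * (cos_weight_poly (\<alpha> * Y) - 12 / real z) - E)"
    unfolding E_def by (simp add: algebra_simps power2_eq_square add_divide_distrib)
   finally show ?thesis .
  qed
  have "2 * sqrt 2 * (\<Sum>p\<in>exp_range Y. prime_weight p * (c p * W p)) \<ge> 2 * sqrt 2 * (s\<^sup>2 * (Y * (cos_weight_poly (\<alpha> * Y) - 12 / real z) - E))"
   by (rule mult_left_mono[OF lower]) simp
  moreover note resonator_nonprime_part[where t = "2 * Y" and \<alpha> = \<alpha> and P = "fact z" and Y = Y]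
  ultimately have "resonator_prime_sum (fact z) Y \<alpha> \<ge> 2 * sqrt 2 * (s\<^sup>2 * (Y * (cos_weight_poly (\<alpha> * Y) - 12 / real z) - E)) - 2 * s\<^sup>2 * ?M"
   unfolding split s_def S_def by linarith
  also have "2 * sqrt 2 * (s\<^sup>2 * (Y * (cos_weight_poly (\<alpha> * Y) - 12 / real z) - E)) - 2 * s\<^sup>2 * ?M =
   s\<^sup>2 * (2 * sqrt 2 * (Y * (cos_weight_poly (\<alpha> * Y) - 12 / real z)) - (2 * sqrt 2 * E + 2 * ?M))"
   by (simp add: algebra_simps)
  finally show ?thesis unfolding s_def .
 qed
 then show ?thesis unfolding S_def by blast
qed

subsection \<open>Resonated Gaussians in the explicit formula\<close>

text \<open>At s = 1/2 + i t this is a Gaussian of width D about T times exp (- i t l); see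
  \<open>gauss_monomial_half\<close>.\<close>

definition gauss_monomial :: "real \<Rightarrow> real \<Rightarrow> real \<Rightarrow> complex \<Rightarrow> complex" where
 "gauss_monomial T D l s = exp ((s - 1 / 2 - \<i> * of_real T)\<^sup>2 / of_real (D\<^sup>2) - (s - 1 / 2) * of_real l)"

text \<open>The integral of \<open>gauss_monomial\<close>, shifted by i \<alpha>, against n^(-s);
  see \<open>gauss_monomial_mangoldt_integral\<close>. It has size sqrt \<pi> D n^(-1/2) when ln n +
  l = 0 and decays rapidly once |ln n + l| is large compared with 1 / D.\<close>

definition gauss_value :: "real \<Rightarrow> real \<Rightarrow> real \<Rightarrow> nat \<Rightarrow> real \<Rightarrow> complex" where
 "gauss_value T D \<alpha> n l = of_real (sqrt pi * D * exp (- (ln (real n) / 2) - D\<^sup>2 * (ln (real n) + l)\<^sup>2 / 4)) *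
   exp (\<i> * of_real (\<alpha> * ln (real n) - T * (ln (real n) + l)))"

lemma gaussian_fourier_shift:
 fixes A w b :: real and K :: complex
 assumes A: "A > 0"
 shows "integrable lborel (\<lambda>y. K * exp (of_real (- (A * (y - b)\<^sup>2)) + \<i> * of_real (w * (y - b))))"
  and "(LINT y|lborel. K * exp (of_real (- (A * (y - b)\<^sup>2)) + \<i> * of_real (w * (y - b)))) =
   K * of_real (sqrt (pi / A) * exp (- (w\<^sup>2) / (4 * A)))"
proof -
 let ?f = "\<lambda>v. exp (of_real (- (A * v\<^sup>2)) + \<i> * of_real (w * v)) :: complex"
 have i: "integrable lborel (\<lambda>y. ?f (- b + 1 * y))"
  by (subst lborel_integrable_real_affine_iff) (use gaussian_fourier(1)[OF A] in auto)
 have e: "- b + 1 * y = y - b" for y by simp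
 show "integrable lborel (\<lambda>y. K * exp (of_real (- (A * (y - b)\<^sup>2)) + \<i> * of_real (w * (y - b))))"
  using i unfolding e by (rule integrable_mult_right)
 have "(LINT y|lborel. ?f y) = \<bar>1\<bar> *\<^sub>R (LINT y|lborel. ?f (- b + 1 * y))" by (rule lborel_integral_real_affine) simp
 then have "(LINT y|lborel. ?f (y - b)) = of_real (sqrt (pi / A) * exp (- (w\<^sup>2) / (4 * A)))"
  unfolding e using gaussian_fourier(2)[OF A] by simp
 then show "(LINT y|lborel. K * exp (of_real (- (A * (y - b)\<^sup>2)) + \<i> * of_real (w * (y - b)))) =
   K * of_real (sqrt (pi / A) * exp (- (w\<^sup>2) / (4 * A)))"
  by (subst integral_mult_right_zero) simp
qed

lemma gauss_monomial_holomorphic: "(\<lambda>s. gauss_monomial T D l (s + c)) holomorphic_on A"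
 unfolding gauss_monomial_def divide_inverse by (intro holomorphic_intros)

lemma norm_gauss_monomial:
 "norm (gauss_monomial T D l (Complex x y)) = exp (((x - 1 / 2)\<^sup>2 - (y - T)\<^sup>2) / D\<^sup>2 - (x - 1 / 2) * l)"
proof -
 have e: "Complex x y - 1 / 2 - \<i> * of_real T = Complex (x - 1 / 2) (y - T)" "Complex x y - 1 / 2 = Complex (x - 1 / 2) y"
  by (simp_all add: complex_eq_iff)
 have "Re ((Complex x y - 1 / 2 - \<i> * of_real T)\<^sup>2 / of_real (D\<^sup>2) - (Complex x y - 1 / 2) * of_real l) =
   ((x - 1 / 2)\<^sup>2 - (y - T)\<^sup>2) / D\<^sup>2 - (x - 1 / 2) * l"
  unfolding e(1) unfolding e(2) by (simp add: Re_divide_of_real power2_eq_square del: of_real_power of_real_mult)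
 then show ?thesis unfolding gauss_monomial_def norm_exp_eq_Re by simp
qed

lemma gauss_monomial_bound:
 assumes D: "D > 0"
 shows "\<exists>C. \<forall>x y. -1 \<le> x \<longrightarrow> x \<le> 2 \<longrightarrow> norm (gauss_monomial T D l (Complex x y + \<i> * of_real \<alpha>)) \<le> C * exp (- (1 / (2 * D\<^sup>2) * y\<^sup>2))"
proof (intro exI[of _ "exp ((9 / 4 + (\<alpha> - T)\<^sup>2) / D\<^sup>2 + 3 / 2 * \<bar>l\<bar>)"] allI impI)
 fix x y :: real assume x: "-1 \<le> x" "x \<le> 2"
 have "Complex x y + \<i> * of_real \<alpha> = Complex x (y + \<alpha>)" by (simp add: complex_eq_iff)
 then have "norm (gauss_monomial T D l (Complex x y + \<i> * of_real \<alpha>)) = exp (((x - 1 / 2)\<^sup>2 - (y + \<alpha> - T)\<^sup>2) / D\<^sup>2 - (x - 1 / 2) * l)"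
  by (simp add: norm_gauss_monomial)
 also have "\<dots> \<le> exp ((9 / 4 + (\<alpha> - T)\<^sup>2) / D\<^sup>2 + 3 / 2 * \<bar>l\<bar> + - (1 / (2 * D\<^sup>2) * y\<^sup>2))"
 proof (subst exp_le_cancel_iff)
  have h: "\<bar>x - 1 / 2\<bar> \<le> 3 / 2" using x by linarith
  have "(x - 1 / 2)\<^sup>2 \<le> (3 / 2)\<^sup>2" using h by (metis abs_ge_zero power2_abs power_mono)
  then have "(x - 1 / 2)\<^sup>2 \<le> 9 / 4" by (simp add: power_divide)
  moreover have "0 \<le> (y / 2 + (\<alpha> - T)) ^ 2 * 2" by simp
  moreover have "(y / 2 + (\<alpha> - T)) ^ 2 * 2 = (y + \<alpha> - T)\<^sup>2 - y\<^sup>2 / 2 + (\<alpha> - T)\<^sup>2" by (simp add: power2_eq_square algebra_simps)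
  ultimately have "(x - 1 / 2)\<^sup>2 - (y + \<alpha> - T)\<^sup>2 \<le> 9 / 4 + (\<alpha> - T)\<^sup>2 - y\<^sup>2 / 2" by linarith
  then have "((x - 1 / 2)\<^sup>2 - (y + \<alpha> - T)\<^sup>2) / D\<^sup>2 \<le> (9 / 4 + (\<alpha> - T)\<^sup>2 - y\<^sup>2 / 2) / D\<^sup>2" by (rule divide_right_mono) simp
  also have "\<dots> = (9 / 4 + (\<alpha> - T)\<^sup>2) / D\<^sup>2 + - (1 / (2 * D\<^sup>2) * y\<^sup>2)" by (simp add: diff_divide_distrib)
  finally have 1: "((x - 1 / 2)\<^sup>2 - (y + \<alpha> - T)\<^sup>2) / D\<^sup>2 \<le> (9 / 4 + (\<alpha> - T)\<^sup>2) / D\<^sup>2 + - (1 / (2 * D\<^sup>2) * y\<^sup>2)" .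
  have "- ((x - 1 / 2) * l) \<le> \<bar>(x - 1 / 2) * l\<bar>" by simp
  also have "\<dots> \<le> 3 / 2 * \<bar>l\<bar>" unfolding abs_mult using h by (intro mult_right_mono) auto
  finally show "((x - 1 / 2)\<^sup>2 - (y + \<alpha> - T)\<^sup>2) / D\<^sup>2 - (x - 1 / 2) * l \<le> (9 / 4 + (\<alpha> - T)\<^sup>2) / D\<^sup>2 + 3 / 2 * \<bar>l\<bar> + - (1 / (2 * D\<^sup>2) * y\<^sup>2)"
   using 1 by linarith
 qed
 finally show "norm (gauss_monomial T D l (Complex x y + \<i> * of_real \<alpha>)) \<le> exp ((9 / 4 + (\<alpha> - T)\<^sup>2) / D\<^sup>2 + 3 / 2 * \<bar>l\<bar>) * exp (- (1 / (2 * D\<^sup>2) * y\<^sup>2))"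
  by (simp only: exp_add)
qed

text \<open>The reflection flips the sign of l. In \<open>resonance_test\<close> this is undone by
  exchanging q and q', which gives the symmetry demanded by the explicit formula.\<close>

lemma gauss_monomial_reflect:
 "gauss_monomial T D l (1 - cnj s + \<i> * of_real \<alpha>) = cnj (gauss_monomial T D (- l) (s + \<i> * of_real \<alpha>))"
proof -
 have "(1 - cnj s + \<i> * of_real \<alpha> - 1 / 2 - \<i> * of_real T)\<^sup>2 = (cnj (s + \<i> * of_real \<alpha> - 1 / 2 - \<i> * of_real T))\<^sup>2"
  by (simp add: power2_eq_square algebra_simps)
 moreover have "(1 - cnj s + \<i> * of_real \<alpha> - 1 / 2) * of_real l = cnj ((s + \<i> * of_real \<alpha> - 1 / 2) * of_real (- l))"
  by (simp add: algebra_simps)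
 ultimately show ?thesis unfolding gauss_monomial_def by (simp only: exp_cnj complex_cnj_diff complex_cnj_divide complex_cnj_power complex_cnj_complex_of_real)
qed

lemma gauss_monomial_half:
 "gauss_monomial T D l (Complex (1 / 2) t) = of_real (exp (- ((t - T)\<^sup>2 / D\<^sup>2))) * exp (- (\<i> * of_real (t * l)))"
proof -
 have "Complex (1 / 2) t - 1 / 2 - \<i> * of_real T = \<i> * of_real (t - T)" "Complex (1 / 2) t - 1 / 2 = \<i> * of_real t"
  by (simp_all add: complex_eq_iff)
 then show ?thesis unfolding gauss_monomial_def
  by (simp add: power_mult_distrib exp_of_real[symmetric] exp_add[symmetric] mult.assoc)
qed

text \<open>Centred at y = T - \<alpha> the exponent is quadratic in v = y - b. Its linear part
  contains 3 / D^2 from Re s - 1/2 = 3/2, and completing the square removes every trace of the line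
  Re s = 2 from the result.\<close>

lemma gauss_monomial_mangoldt_integral:
 assumes D: "D > 0" and n: "n > 0"
 shows "(LINT y|lborel. nat_powr (Complex 2 y) n * gauss_monomial T D l (Complex 2 y + \<i> * of_real \<alpha>)) = gauss_value T D \<alpha> n l"
proof -
 define L where "L = ln (real n)"
 define b where "b = T - \<alpha>"
 define A where "A = 1 / D\<^sup>2"
 define w where "w = 3 / D\<^sup>2 - L - l"
 define r where "r = - 2 * L + 9 / (4 * D\<^sup>2) - 3 / 2 * l"
 define K where "K = exp (of_real r + \<i> * of_real (\<alpha> * L - T * (L + l)))"
 have A: "A > 0" using D by (simp add: A_def)
 have "nat_powr (Complex 2 y) n * gauss_monomial T D l (Complex 2 y + \<i> * of_real \<alpha>) =
   K * exp (of_real (- (A * (y - b)\<^sup>2)) + \<i> * of_real (w * (y - b)))" for y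
 proof -
  define v where "v = y - b"
  have e1: "Complex 2 y + \<i> * of_real \<alpha> - 1 / 2 - \<i> * of_real T = Complex (3 / 2) v"
   and e2: "Complex 2 y + \<i> * of_real \<alpha> - 1 / 2 = Complex (3 / 2) (v + T)"
   and e3: "Complex 2 y = Complex 2 (v + T - \<alpha>)"
   by (simp_all add: complex_eq_iff v_def b_def)
  have "- Complex 2 y * of_real L + ((Complex (3 / 2) v)\<^sup>2 / of_real (D\<^sup>2) - Complex (3 / 2) (v + T) * of_real l) =
   (of_real r + \<i> * of_real (\<alpha> * L - T * (L + l))) + (of_real (- (A * v\<^sup>2)) + \<i> * of_real (w * v))"
  proof (rule complex_eqI)
   have "(3 / 2 * (3 / 2) - v * v) / D\<^sup>2 = 9 / (4 * D\<^sup>2) - A * v\<^sup>2"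
    by (simp add: A_def diff_divide_distrib power2_eq_square)
   then show "Re (- Complex 2 y * of_real L + ((Complex (3 / 2) v)\<^sup>2 / of_real (D\<^sup>2) - Complex (3 / 2) (v + T) * of_real l)) =
    Re ((of_real r + \<i> * of_real (\<alpha> * L - T * (L + l))) + (of_real (- (A * v\<^sup>2)) + \<i> * of_real (w * v)))"
    unfolding e3 by (simp add: Re_divide_of_real power2_eq_square r_def del: of_real_power of_real_mult)
   have "(3 / 2 * v + v * (3 / 2)) / D\<^sup>2 = 3 / D\<^sup>2 * v" by simp
   then show "Im (- Complex 2 y * of_real L + ((Complex (3 / 2) v)\<^sup>2 / of_real (D\<^sup>2) - Complex (3 / 2) (v + T) * of_real l)) =
    Im ((of_real r + \<i> * of_real (\<alpha> * L - T * (L + l))) + (of_real (- (A * v\<^sup>2)) + \<i> * of_real (w * v)))"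
    unfolding e3 by (simp add: Im_divide_of_real power2_eq_square w_def algebra_simps del: of_real_power of_real_mult)
  qed
  then show ?thesis unfolding nat_powr_exp[OF n] gauss_monomial_def e1 unfolding e2 K_def exp_add[symmetric] L_def[symmetric] v_def[symmetric]
   by (simp only:)
 qed
 then have "(LINT y|lborel. nat_powr (Complex 2 y) n * gauss_monomial T D l (Complex 2 y + \<i> * of_real \<alpha>)) =
   K * of_real (sqrt (pi / A) * exp (- (w\<^sup>2) / (4 * A)))"
  by (simp only: gaussian_fourier_shift(2)[OF A])
 also have "\<dots> = gauss_value T D \<alpha> n l"
 proof -
  have s: "sqrt (pi / A) = sqrt pi * D" using D by (simp add: A_def real_sqrt_mult)
  have c0: "w\<^sup>2 / (4 * A) = 9 / (4 * D\<^sup>2) - 3 / 2 * (L + l) + D\<^sup>2 * (L + l)\<^sup>2 / 4"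
   using D by (simp add: w_def A_def power2_eq_square field_simps)
  have "- (w\<^sup>2) / (4 * A) = - (w\<^sup>2 / (4 * A))" by simp
  note c = this
  have "r + - (w\<^sup>2) / (4 * A) = - (L / 2) - D\<^sup>2 * (L + l)\<^sup>2 / 4"
  proof -
   have "- 2 * L + u - 3 / 2 * l + X = - (L / 2) - v" if "X = - Z" "Z = u - 3 / 2 * (L + l) + v" for u v X Z
   proof -
    have "3 / 2 * (L + l) = 3 / 2 * L + 3 / 2 * l" by (rule distrib_left)
    then show ?thesis using that by linarith
   qed
   then show ?thesis unfolding r_def using c c0 by blast
  qed
  then have "exp r * exp (- (w\<^sup>2) / (4 * A)) = exp (- (L / 2) - D\<^sup>2 * (L + l)\<^sup>2 / 4)" by (simp only: exp_add[symmetric])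
  moreover have "K * of_real (sqrt (pi / A) * exp (- (w\<^sup>2) / (4 * A))) =
   of_real (sqrt pi * D * (exp r * exp (- (w\<^sup>2) / (4 * A)))) * exp (\<i> * of_real (\<alpha> * L - T * (L + l)))"
   unfolding K_def s exp_add exp_of_real of_real_mult by (simp only: mult_ac)
  ultimately show ?thesis unfolding gauss_value_def L_def by (simp only:)
 qed
 finally show ?thesis .
qed

lemma continuous_imp_lborel_measurable: "continuous_on UNIV f \<Longrightarrow> f \<in> borel_measurable lborel"
 by (simp add: borel_measurable_continuous_onI)

lemma nat_powr_measurable: "n > 0 \<Longrightarrow> (\<lambda>y. nat_powr (Complex x y) n) \<in> borel_measurable lborel"
 unfolding nat_powr_exp Complex_eq by (intro continuous_imp_lborel_measurable continuous_intros)

lemma nat_powr_integrable: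
 assumes "n > 0" "integrable lborel G"
 shows "integrable lborel (\<lambda>y. nat_powr (Complex 2 y) n * G y)"
proof (rule Bochner_Integration.integrable_bound[OF integrable_norm[OF assms(2)]])
 show "(\<lambda>y. nat_powr (Complex 2 y) n * G y) \<in> borel_measurable lborel"
  using assms nat_powr_measurable[OF assms(1), of 2] by (intro borel_measurable_times) auto
 have "real n powr (- 2) \<le> real n powr 0" using assms(1) by (intro powr_mono) auto
 then have "real n powr (- 2) \<le> 1" using assms(1) by simp
 then show "AE y in lborel. norm (nat_powr (Complex 2 y) n * G y) \<le> norm (norm (G y))"
  using assms(1) by (intro AE_I2) (simp add: norm_mult norm_nat_powr mult_left_le_one_le)
qed

lemma mangoldt_series_integral:
 assumes G: "integrable lborel G"
 shows "(\<lambda>n. mangoldt (Suc n) * (LINT y|lborel. nat_powr (Complex 2 y) (Suc n) * G y)) sums (LINT y|lborel. mangoldt_series (Complex 2 y) * G y)"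
  and "integrable lborel (\<lambda>y. mangoldt_series (Complex 2 y) * G y)"
proof -
 let ?f = "\<lambda>n y. mangoldt (Suc n) * (nat_powr (Complex 2 y) (Suc n) * G y)"
 have i: "integrable lborel (?f n)" for n by (intro integrable_mult_right nat_powr_integrable G) simp
 have nf: "norm (?f n y) = mangoldt (Suc n) * real (Suc n) powr (- 2) * norm (G y)" for n y
  by (simp add: norm_mult norm_nat_powr del: of_nat_Suc)
 have s0: "summable (\<lambda>n. mangoldt (Suc n) * real (Suc n) powr (- 2))" by (rule summable_mangoldt_powr) simp
 have s1: "AE y in lborel. summable (\<lambda>n. norm (?f n y))" unfolding nf by (intro AE_I2 summable_mult2 s0)
 have s2: "summable (\<lambda>n. LINT y|lborel. norm (?f n y))" unfolding nf by (subst integral_mult_right_zero) (intro summable_mult2 s0)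
 have e: "(\<Sum>n. ?f n y) = mangoldt_series (Complex 2 y) * G y" for y
 proof -
  have "summable (\<lambda>n. mangoldt (Suc n) * nat_powr (Complex 2 y) (Suc n))"
   by (rule summable_norm_cancel, rule mangoldt_series_summable) simp
  then show ?thesis unfolding mangoldt_series_def by (subst suminf_mult2) (auto simp: mult.assoc)
 qed
 show "(\<lambda>n. mangoldt (Suc n) * (LINT y|lborel. nat_powr (Complex 2 y) (Suc n) * G y)) sums (LINT y|lborel. mangoldt_series (Complex 2 y) * G y)"
  using sums_integral[OF i s1 s2] unfolding e by (simp only: integral_mult_right_zero)
 show "integrable lborel (\<lambda>y. mangoldt_series (Complex 2 y) * G y)"
  using integrable_suminf[OF i s1 s2] unfolding e .
qed

text \<open>The squared modulus in \<open>resonance\<close> is not holomorphic, but expanded into a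
  double sum it extends from the critical line to an entire function.\<close>

definition resonance_test :: "'k set \<Rightarrow> ('k \<Rightarrow> real) \<Rightarrow> ('k \<Rightarrow> real) \<Rightarrow> real \<Rightarrow> real \<Rightarrow> complex \<Rightarrow> complex" where
 "resonance_test K a x T D s = (\<Sum>q\<in>K. \<Sum>q'\<in>K. of_real (a q * a q') * gauss_monomial T D (x q - x q') s)"

definition resonance :: "'k set \<Rightarrow> ('k \<Rightarrow> real) \<Rightarrow> ('k \<Rightarrow> real) \<Rightarrow> real \<Rightarrow> real \<Rightarrow> real \<Rightarrow> real" where
 "resonance K a x T D t = exp (- ((t - T)\<^sup>2 / D\<^sup>2)) * (norm (\<Sum>q\<in>K. of_real (a q) * exp (- (\<i> * of_real (t * x q)))))\<^sup>2"

lemma resonance_nonneg [simp]: "resonance K a x T D t \<ge> 0"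
 by (simp add: resonance_def)

lemma resonance_le:
 assumes "\<And>q. q \<in> K \<Longrightarrow> a q \<ge> 0"
 shows "resonance K a x T D t \<le> (sum a K)\<^sup>2 * exp (- ((t - T)\<^sup>2 / D\<^sup>2))"
proof -
 have "norm (\<Sum>q\<in>K. of_real (a q) * exp (- (\<i> * of_real (t * x q)))) \<le> sum a K"
  by (rule sum_norm_le) (use assms in \<open>simp add: norm_mult\<close>)
 then have "(norm (\<Sum>q\<in>K. of_real (a q) * exp (- (\<i> * of_real (t * x q)))))\<^sup>2 \<le> (sum a K)\<^sup>2" by (intro power_mono) auto
 then show ?thesis unfolding resonance_def by (simp add: mult.commute)
qed

lemma resonance_continuous: "continuous_on A (resonance K a x T D)"
proof -
 have "continuous_on A (\<lambda>t. exp (- ((t - T)\<^sup>2 * inverse (D\<^sup>2))) * (norm (\<Sum>q\<in>K. of_real (a q) * exp (- (\<i> * of_real (t * x q)))))\<^sup>2)"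
  by (intro continuous_intros)
 then show ?thesis by (simp add: resonance_def[abs_def] divide_inverse)
qed

lemma resonance_test_half: "resonance_test K a x T D (Complex (1 / 2) t) = of_real (resonance K a x T D t)"
proof -
 let ?A = "\<Sum>q\<in>K. of_real (a q) * exp (- (\<i> * of_real (t * x q)))"
 have "of_real (resonance K a x T D t) = of_real (exp (- ((t - T)\<^sup>2 / D\<^sup>2))) * (?A * cnj ?A)"
  unfolding resonance_def of_real_mult complex_norm_square by (rule refl)
 also have "?A * cnj ?A = (\<Sum>q\<in>K. \<Sum>q'\<in>K. (of_real (a q) * exp (- (\<i> * of_real (t * x q)))) * (of_real (a q') * exp (\<i> * of_real (t * x q'))))"
  by (simp add: sum_product exp_cnj)
 also have "of_real (exp (- ((t - T)\<^sup>2 / D\<^sup>2))) * \<dots> = resonance_test K a x T D (Complex (1 / 2) t)"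
  unfolding resonance_test_def sum_distrib_left
 proof (intro sum.cong refl)
  fix q q'
  have "exp (- (\<i> * of_real (t * (x q - x q')))) = exp (- (\<i> * of_real (t * x q))) * exp (\<i> * of_real (t * x q'))"
   unfolding exp_add[symmetric] by (simp add: algebra_simps)
  then show "of_real (exp (- ((t - T)\<^sup>2 / D\<^sup>2))) * (of_real (a q) * exp (- (\<i> * of_real (t * x q))) * (of_real (a q') * exp (\<i> * of_real (t * x q')))) =
    of_real (a q * a q') * gauss_monomial T D (x q - x q') (Complex (1 / 2) t)"
   unfolding gauss_monomial_half of_real_mult by (simp only: mult_ac)
 qed
 finally show ?thesis ..
qed

lemma resonance_test_holomorphic: "(\<lambda>s. resonance_test K a x T D (s + c)) holomorphic_on A"
 unfolding resonance_test_def by (intro holomorphic_intros gauss_monomial_holomorphic)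

lemma resonance_test_reflect:
 "resonance_test K a x T D (1 - cnj s + \<i> * of_real \<alpha>) = cnj (resonance_test K a x T D (s + \<i> * of_real \<alpha>))"
proof -
 have "resonance_test K a x T D (1 - cnj s + \<i> * of_real \<alpha>) = (\<Sum>q\<in>K. \<Sum>q'\<in>K. cnj (of_real (a q' * a q) * gauss_monomial T D (x q' - x q) (s + \<i> * of_real \<alpha>)))"
  unfolding resonance_test_def gauss_monomial_reflect by (intro sum.cong refl) (simp add: mult_ac)
 also have "\<dots> = cnj (resonance_test K a x T D (s + \<i> * of_real \<alpha>))"
  unfolding resonance_test_def cnj_sum by (rule sum.swap)
 finally show ?thesis .
qed

lemma resonance_test_bound:
 assumes D: "D > 0" and K: "finite K"
 shows "\<exists>C. \<forall>x' y. -1 \<le> x' \<longrightarrow> x' \<le> 2 \<longrightarrow> norm (resonance_test K a x T D (Complex x' y + \<i> * of_real \<alpha>)) \<le> C * exp (- (1 / (2 * D\<^sup>2) * y\<^sup>2))"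
proof -
 have "\<forall>l. \<exists>C. \<forall>x y. -1 \<le> x \<longrightarrow> x \<le> 2 \<longrightarrow> norm (gauss_monomial T D l (Complex x y + \<i> * of_real \<alpha>)) \<le> C * exp (- (1 / (2 * D\<^sup>2) * y\<^sup>2))"
  using gauss_monomial_bound[OF D] by blast
 then obtain C where C: "\<And>l x y. -1 \<le> x \<Longrightarrow> x \<le> 2 \<Longrightarrow> norm (gauss_monomial T D l (Complex x y + \<i> * of_real \<alpha>)) \<le> C l * exp (- (1 / (2 * D\<^sup>2) * y\<^sup>2))"
  by metis
 show ?thesis
 proof (intro exI[of _ "\<Sum>q\<in>K. \<Sum>q'\<in>K. \<bar>a q * a q'\<bar> * C (x q - x q')"] allI impI)
  fix x' y :: real assume x: "-1 \<le> x'" "x' \<le> 2"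
  have "norm (resonance_test K a x T D (Complex x' y + \<i> * of_real \<alpha>)) \<le> (\<Sum>q\<in>K. \<Sum>q'\<in>K. \<bar>a q * a q'\<bar> * (C (x q - x q') * exp (- (1 / (2 * D\<^sup>2) * y\<^sup>2))))"
   unfolding resonance_test_def by (intro sum_norm_le) (simp only: norm_mult norm_of_real, intro mult_left_mono C x, simp)
  then show "norm (resonance_test K a x T D (Complex x' y + \<i> * of_real \<alpha>)) \<le> (\<Sum>q\<in>K. \<Sum>q'\<in>K. \<bar>a q * a q'\<bar> * C (x q - x q')) * exp (- (1 / (2 * D\<^sup>2) * y\<^sup>2))"
   by (simp add: sum_distrib_right mult.assoc)
 qed
qed

definition resonance_prime_term :: "'k set \<Rightarrow> ('k \<Rightarrow> real) \<Rightarrow> ('k \<Rightarrow> real) \<Rightarrow> real \<Rightarrow> real \<Rightarrow> real \<Rightarrow> nat \<Rightarrow> real" where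
 "resonance_prime_term K a x T D \<alpha> n = mangoldt n * (\<Sum>q\<in>K. \<Sum>q'\<in>K. a q * a q' * Re (gauss_value T D \<alpha> n (x q - x q')))"

lemma resonance_mangoldt_sums:
 fixes a x :: "'k \<Rightarrow> real" and T D \<alpha> :: real
 assumes D: "D > 0" and K: "finite K"
 defines "F \<equiv> \<lambda>y. resonance_test K a x T D (Complex 2 y + \<i> * of_real \<alpha>)"
 shows "integrable lborel F" "integrable lborel (\<lambda>y. mangoldt_series (Complex 2 y) * F y)"
  and "(\<lambda>n. resonance_prime_term K a x T D \<alpha> (Suc n)) sums Re (LINT y|lborel. mangoldt_series (Complex 2 y) * F y)"
proof -
 have gi: "integrable lborel (\<lambda>y. gauss_monomial T D l (Complex 2 y + \<i> * of_real \<alpha>))" for l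
 proof -
  obtain C where C: "\<And>x y. -1 \<le> x \<Longrightarrow> x \<le> 2 \<Longrightarrow> norm (gauss_monomial T D l (Complex x y + \<i> * of_real \<alpha>)) \<le> C * exp (- (1 / (2 * D\<^sup>2) * y\<^sup>2))"
   using gauss_monomial_bound[OF D] by metis
  show ?thesis
  proof (rule Bochner_Integration.integrable_bound[OF integrable_gaussian_exp[of "1 / (2 * D\<^sup>2)" C]])
   show "(\<lambda>y. gauss_monomial T D l (Complex 2 y + \<i> * of_real \<alpha>)) \<in> borel_measurable lborel"
    unfolding gauss_monomial_def Complex_eq using D by (intro continuous_imp_lborel_measurable continuous_intros) auto
   show "AE y in lborel. norm (gauss_monomial T D l (Complex 2 y + \<i> * of_real \<alpha>)) \<le> norm (C * exp (- (1 / (2 * D\<^sup>2) * y\<^sup>2)))"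
    using C[of 2] by (intro AE_I2) (smt (verit) real_norm_def)
  qed (use D in auto)
 qed
 show F: "integrable lborel F" unfolding F_def resonance_test_def
  by (intro Bochner_Integration.integrable_sum integrable_mult_right gi)
 show "integrable lborel (\<lambda>y. mangoldt_series (Complex 2 y) * F y)" by (rule mangoldt_series_integral(2)[OF F])
 have "(LINT y|lborel. nat_powr (Complex 2 y) (Suc n) * F y) = (\<Sum>q\<in>K. \<Sum>q'\<in>K. of_real (a q * a q') * gauss_value T D \<alpha> (Suc n) (x q - x q'))" for n
 proof -
  have e: "nat_powr (Complex 2 y) (Suc n) * F y = (\<Sum>q\<in>K. \<Sum>q'\<in>K. of_real (a q * a q') * (nat_powr (Complex 2 y) (Suc n) * gauss_monomial T D (x q - x q') (Complex 2 y + \<i> * of_real \<alpha>)))" for y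
   unfolding F_def resonance_test_def sum_distrib_left by (intro sum.cong refl) (simp only: mult_ac)
  have i: "integrable lborel (\<lambda>y. of_real (a q * a q') * (nat_powr (Complex 2 y) (Suc n) * gauss_monomial T D (x q - x q') (Complex 2 y + \<i> * of_real \<alpha>)))" for q q'
   by (intro integrable_mult_right nat_powr_integrable gi) simp
  show ?thesis unfolding e
   by (subst Bochner_Integration.integral_sum, intro Bochner_Integration.integrable_sum i, intro sum.cong refl,
     subst Bochner_Integration.integral_sum, intro i, intro sum.cong refl)
    (simp only: integral_mult_right_zero gauss_monomial_mangoldt_integral[OF D zero_less_Suc])
 qed
 then have "(\<lambda>n. mangoldt (Suc n) * (\<Sum>q\<in>K. \<Sum>q'\<in>K. of_real (a q * a q') * gauss_value T D \<alpha> (Suc n) (x q - x q'))) sums (LINT y|lborel. mangoldt_series (Complex 2 y) * F y)"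
  using mangoldt_series_integral(1)[OF F] by simp
 from sums_Re[OF this] show "(\<lambda>n. resonance_prime_term K a x T D \<alpha> (Suc n)) sums Re (LINT y|lborel. mangoldt_series (Complex 2 y) * F y)"
 proof (rule sums_cong[THEN iffD1, rotated])
  fix n
  have "Re (mangoldt (Suc n) * z) = mangoldt (Suc n) * Re z" for z
   unfolding mangoldt_def by simp
  then show "Re (mangoldt (Suc n) * (\<Sum>q\<in>K. \<Sum>q'\<in>K. of_real (a q * a q') * gauss_value T D \<alpha> (Suc n) (x q - x q'))) = resonance_prime_term K a x T D \<alpha> (Suc n)"
   by (simp add: resonance_prime_term_def Re_sum)
 qed
qed

text \<open>\<open>completed_log_deriv_eq\<close> splits the integral on Re s = 2: the prime powers
  are integrated term by term there, while the Gamma part is moved to the critical line. There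
  \<open>resonance_test\<close> equals the real function \<open>resonance\<close>, and Digamma is
  evaluated at 1/4 + i y / 2.\<close>

theorem resonance_explicit_formula:
 fixes a x :: "'k \<Rightarrow> real" and T D \<alpha> :: real
 assumes D: "D > 0" and K: "finite K"
 defines "F \<equiv> \<lambda>s. resonance_test K a x T D (s + \<i> * of_real \<alpha>)"
 shows "\<exists>Y. filterlim Y at_top sequentially \<and>
  (\<lambda>n::nat. \<Sum>p | riemann_xi p = 0 \<and> \<bar>Im p\<bar> < Y n. Re (F p) * of_int (zorder riemann_xi p)) \<longlonglongrightarrow>
   Re (F 0) + Re (F 1) + (LINT y|lborel. (Re (Digamma (Complex (1 / 4) (y / 2))) - ln pi) * resonance K a x T D (y + \<alpha>)) / (2 * pi)
    - (\<Sum>n. resonance_prime_term K a x T D \<alpha> (Suc n)) / pi"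
  and "integrable lborel (\<lambda>y. (Re (Digamma (Complex (1 / 4) (y / 2))) - ln pi) * resonance K a x T D (y + \<alpha>))"
proof -
 define k where "k = 1 / (2 * D\<^sup>2)"
 have k: "k > 0" using D by (simp add: k_def)
 obtain C where C: "\<And>x y. -1 \<le> x \<Longrightarrow> x \<le> 2 \<Longrightarrow> norm (F (Complex x y)) \<le> C * exp (- (k * y\<^sup>2))"
  using resonance_test_bound[OF D K, of a x T \<alpha>] unfolding F_def k_def by metis
 have hF: "F holomorphic_on A" for A unfolding F_def by (rule resonance_test_holomorphic)
 have sym: "F (1 - cnj s) = cnj (F s)" for s unfolding F_def by (rule resonance_test_reflect)
 obtain Y where Y: "filterlim Y at_top sequentially"
  and lim: "(\<lambda>n::nat. \<Sum>p | riemann_xi p = 0 \<and> \<bar>Im p\<bar> < Y n. F p * of_int (zorder riemann_xi p)) \<longlonglongrightarrow>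
   F 0 + F 1 + of_real (Re (LINT y|lborel. completed_log_deriv (Complex 2 y) * F (Complex 2 y)) / pi)"
  using explicit_formula_contour[OF hF sym k C] by blast
 define G where "G = (\<lambda>s. (Digamma (s / 2) - of_real (ln pi)) / 2 * F s)"
 obtain B where B: "B \<ge> 0" "\<And>z::complex. Re z \<ge> 1 / 4 \<Longrightarrow> norm (Digamma z) \<le> B * (1 + norm z)"
  using norm_Digamma_le by blast
 have "(Digamma \<circ> (\<lambda>s. s / 2)) holomorphic_on {s. Re s > 0}"
 proof (rule holomorphic_on_compose_gen[of _ _ _ "{s. Re s > 0}"])
  show "(Digamma :: complex \<Rightarrow> complex) holomorphic_on {s. Re s > 0}"
   by (rule holomorphic_on_Polygamma) (auto elim!: nonpos_Ints_cases)
 qed (auto intro!: holomorphic_intros)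
 then have Ghol: "G holomorphic_on {s. Re s > 0}"
  unfolding G_def by (intro holomorphic_intros hF) (auto simp: o_def)
 have C0: "C \<ge> 0"
 proof -
  have "0 \<le> C * exp (- (k * 0\<^sup>2))" by (rule order_trans[OF norm_ge_zero C[of 0 0]]) auto
  then show ?thesis by simp
 qed
 have Gb: "norm (G (Complex x y)) \<le> ((2 * B + \<bar>ln pi\<bar>) * C) * (1 + \<bar>y\<bar>) * exp (- (k * y\<^sup>2))" if x: "1 / 2 \<le> x" "x \<le> 2" for x y
 proof -
  have n: "norm (Complex x y / 2) \<le> 1 + \<bar>y\<bar>" using cmod_le[of "Complex x y"] x by (simp add: norm_divide)
  have "norm (Digamma (Complex x y / 2)) \<le> B * (1 + norm (Complex x y / 2))" by (rule B(2)) (use x in simp)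
  also have "\<dots> \<le> B * (2 * (1 + \<bar>y\<bar>))" using B(1) n by (intro mult_left_mono) auto
  finally have d: "norm (Digamma (Complex x y / 2)) \<le> 2 * B * (1 + \<bar>y\<bar>)" by (simp only: mult_ac)
  have "norm ((Digamma (Complex x y / 2) - of_real (ln pi)) / 2) \<le> norm (Digamma (Complex x y / 2) - of_real (ln pi))" by (simp add: norm_divide)
  also have "\<dots> \<le> norm (Digamma (Complex x y / 2)) + norm (of_real (ln pi) :: complex)" by (rule norm_triangle_ineq4)
  also have "\<dots> \<le> 2 * B * (1 + \<bar>y\<bar>) + \<bar>ln pi\<bar> * (1 + \<bar>y\<bar>)"
   using d mult_left_mono[of 1 "1 + \<bar>y\<bar>" "\<bar>ln pi\<bar>"] by (intro add_mono) auto
  also have "\<dots> = (2 * B + \<bar>ln pi\<bar>) * (1 + \<bar>y\<bar>)" by (simp only: distrib_right)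
  finally have "norm (G (Complex x y)) \<le> ((2 * B + \<bar>ln pi\<bar>) * (1 + \<bar>y\<bar>)) * (C * exp (- (k * y\<^sup>2)))"
   unfolding G_def norm_mult using C[of x y] x B(1) C0 by (intro mult_mono) auto
  then show ?thesis by (simp only: mult_ac)
 qed
 note ls = line_shift[OF Ghol k Gb]
 have half: "G (Complex (1 / 2) y) = (Digamma (Complex (1 / 4) (y / 2)) - of_real (ln pi)) / 2 * of_real (resonance K a x T D (y + \<alpha>))" for y
 proof -
  have "Complex (1 / 2) y / 2 = Complex (1 / 4) (y / 2)" "Complex (1 / 2) y + \<i> * of_real \<alpha> = Complex (1 / 2) (y + \<alpha>)"
   by (simp_all add: complex_eq_iff)
  then show ?thesis unfolding G_def F_def by (simp only: resonance_test_half)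
 qed
 have Rehalf: "Re (G (Complex (1 / 2) y)) = 1 / 2 * ((Re (Digamma (Complex (1 / 4) (y / 2))) - ln pi) * resonance K a x T D (y + \<alpha>))" for y
  unfolding half by simp
 have "integrable lborel (\<lambda>y. 2 * Re (G (Complex (1 / 2) y)))" using integrable_Re[OF ls(3)] by (intro integrable_mult_right)
 then show "integrable lborel (\<lambda>y. (Re (Digamma (Complex (1 / 4) (y / 2))) - ln pi) * resonance K a x T D (y + \<alpha>))"
  unfolding Rehalf by simp
 have ReG: "Re (LINT y|lborel. G (Complex 2 y)) = (LINT y|lborel. (Re (Digamma (Complex (1 / 4) (y / 2))) - ln pi) * resonance K a x T D (y + \<alpha>)) / 2"
 proof -
  have "Re (LINT y|lborel. G (Complex 2 y)) = Re (LINT y|lborel. G (Complex (1 / 2) y))" by (simp only: ls(1))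
  also have "\<dots> = (LINT y|lborel. Re (G (Complex (1 / 2) y)))" by (rule integral_Re[OF ls(3), symmetric])
  also have "\<dots> = (LINT y|lborel. 1 / 2 * ((Re (Digamma (Complex (1 / 4) (y / 2))) - ln pi) * resonance K a x T D (y + \<alpha>)))"
   by (simp only: Rehalf)
  also have "\<dots> = 1 / 2 * (LINT y|lborel. (Re (Digamma (Complex (1 / 4) (y / 2))) - ln pi) * resonance K a x T D (y + \<alpha>))"
   by (rule integral_mult_right_zero)
  finally show ?thesis by simp
 qed
 have ms2: "integrable lborel (\<lambda>y. mangoldt_series (Complex 2 y) * F (Complex 2 y))"
  and ms3: "(\<lambda>n. resonance_prime_term K a x T D \<alpha> (Suc n)) sums Re (LINT y|lborel. mangoldt_series (Complex 2 y) * F (Complex 2 y))"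
  using resonance_mangoldt_sums(2,3)[OF D K, of a x T \<alpha>] by (simp_all only: F_def)
 have "completed_log_deriv (Complex 2 y) * F (Complex 2 y) = G (Complex 2 y) - mangoldt_series (Complex 2 y) * F (Complex 2 y)" for y
  unfolding G_def by (subst completed_log_deriv_eq) (auto simp: algebra_simps)
 then have "(LINT y|lborel. completed_log_deriv (Complex 2 y) * F (Complex 2 y)) = (LINT y|lborel. G (Complex 2 y)) - (LINT y|lborel. mangoldt_series (Complex 2 y) * F (Complex 2 y))"
  using ls(2) ms2 by simp
 then have R: "Re (LINT y|lborel. completed_log_deriv (Complex 2 y) * F (Complex 2 y)) =
   (LINT y|lborel. (Re (Digamma (Complex (1 / 4) (y / 2))) - ln pi) * resonance K a x T D (y + \<alpha>)) / 2 - (\<Sum>n. resonance_prime_term K a x T D \<alpha> (Suc n))"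
  using ReG sums_unique[OF ms3] by simp
 show "\<exists>Y. filterlim Y at_top sequentially \<and>
  (\<lambda>n::nat. \<Sum>p | riemann_xi p = 0 \<and> \<bar>Im p\<bar> < Y n. Re (F p) * of_int (zorder riemann_xi p)) \<longlonglongrightarrow>
   Re (F 0) + Re (F 1) + (LINT y|lborel. (Re (Digamma (Complex (1 / 4) (y / 2))) - ln pi) * resonance K a x T D (y + \<alpha>)) / (2 * pi)
    - (\<Sum>n. resonance_prime_term K a x T D \<alpha> (Suc n)) / pi"
  using Y tendsto_Re[OF lim] by (intro exI[of _ Y] conjI) (auto simp: Re_sum R diff_divide_distrib add_diff_eq)
qed

subsection \<open>Off-diagonal terms\<close>

definition frac_log :: "nat \<times> nat \<Rightarrow> real" where
 "frac_log q = ln (real (fst q)) - ln (real (snd q))"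

lemma rough_divisor_le_1: "rough_divisor P n \<le> 1"
proof (cases "n = 0")
 case False
 then have "{d. d dvd n} \<subseteq> {1..n}" by (auto dest: dvd_imp_le intro: Suc_leI dvd_pos_nat)
 then have "card {d. d dvd n} \<le> card {1..n}" by (intro card_mono) auto
 then have "real (card {d. d dvd n}) \<le> real n" by simp
 then show ?thesis using False by (simp add: rough_divisor_def)
qed (simp add: rough_divisor_def)

lemma resonator_coeff_le_1: "resonator_coeff P q \<le> 1"
proof -
 obtain h k where q: "q = (h, k)" by (cases q)
 have "rough_divisor P h * rough_divisor P k \<le> 1 * 1" by (intro mult_mono rough_divisor_le_1) auto
 then show ?thesis by (simp add: resonator_coeff_def q)
qed

lemma sum_resonator_coeff_le: "sum (resonator_coeff P) (resonator_pairs Y) \<le> exp (2 * Y)"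
proof -
 have "real (card (exp_range Y)) \<le> exp Y" by (simp add: exp_range_eq)
 have "sum (resonator_coeff P) (resonator_pairs Y) \<le> (\<Sum>q\<in>resonator_pairs Y. 1)" by (intro sum_mono resonator_coeff_le_1)
 also have "\<dots> \<le> (\<Sum>q\<in>exp_range Y \<times> exp_range Y. 1)" by (intro sum_mono2) (auto simp: resonator_pairs_def)
 also have "\<dots> = real (card (exp_range Y)) * real (card (exp_range Y))" by (simp add: card_cartesian_product)
 also have "\<dots> \<le> exp Y * exp Y" using \<open>real (card (exp_range Y)) \<le> exp Y\<close> by (intro mult_mono) auto
 finally show ?thesis by (simp add: exp_add[symmetric])
qed

lemma sum_resonator_coeff_sq_le: "(sum (resonator_coeff P) (resonator_pairs Y))\<^sup>2 \<le> exp (4 * Y)"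
proof -
 have "(sum (resonator_coeff P) (resonator_pairs Y))\<^sup>2 \<le> (exp (2 * Y))\<^sup>2"
  by (intro power_mono sum_resonator_coeff_le sum_nonneg) auto
 then show ?thesis by (simp add: power2_eq_square exp_add[symmetric])
qed

text \<open>Only v is bounded, since u = n h k' may be arbitrarily large in the application. Above v
  the closest case is u = v + 1, whence 2 M in place of M.\<close>

lemma ln_ratio_ge:
 fixes u v :: nat
 assumes "u > 0" "v > 0" "u \<noteq> v" "real v \<le> M"
 shows "\<bar>ln (real u) - ln (real v)\<bar> \<ge> 1 / (2 * M)"
proof -
 have M: "M > 0" using assms by linarith
 have g: "ln (real b) - ln (real a) \<ge> 1 / real b" if "a < b" "a > 0" for a b :: nat
 proof -
  have "ln (real a / real b) \<le> real a / real b - 1" using that by (intro ln_le_minus_one) auto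
  also have "\<dots> = (real a - real b) / real b" using that by (simp add: field_simps)
  also have "\<dots> \<le> (- 1) / real b" using that by (intro divide_right_mono) auto
  finally show ?thesis using that by (simp add: ln_div)
 qed
 show ?thesis
 proof (cases "u < v")
  case True
  have "1 / (2 * M) \<le> 1 / real v" using assms M by (intro divide_left_mono) auto
  then show ?thesis using g[OF True assms(1)] by linarith
 next
  case False
  then have "Suc v \<le> u" using assms by simp
  then have "ln (real (Suc v)) \<le> ln (real u)" using assms(1) by (subst ln_le_cancel_iff) auto
  moreover have "1 / (2 * M) \<le> 1 / real (Suc v)" using assms M by (intro divide_left_mono) auto
  moreover have "1 / real (Suc v) \<le> ln (real (Suc v)) - ln (real v)" by (rule g[OF lessI assms(2)])
  ultimately have "1 / (2 * M) \<le> ln (real u) - ln (real v)" by linarith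
  then show ?thesis by linarith
 qed
qed

text \<open>Clearing denominators compares the integers n h k' and k h', the second of which is at
  most exp (2 Y). Either they coincide or their logarithms are separated accordingly.\<close>

lemma frac_log_shift:
 assumes n: "n > 0" and q: "q \<in> resonator_pairs Y" "q' \<in> resonator_pairs Y"
 shows "n * fst q * snd q' = snd q * fst q' \<Longrightarrow> ln (real n) + (frac_log q - frac_log q') = 0"
  and "n * fst q * snd q' \<noteq> snd q * fst q' \<Longrightarrow> \<bar>ln (real n) + (frac_log q - frac_log q')\<bar> \<ge> exp (- (2 * Y)) / 2"
  and "\<bar>frac_log q - frac_log q'\<bar> \<le> 2 * Y"
proof -
 obtain h k h' k' where e: "q = (h, k)" "q' = (h', k')" by (cases q; cases q')
 have p: "h > 0" "k > 0" "h' > 0" "k' > 0" using q unfolding e by (auto dest: resonator_pairs_pos)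
 have b: "ln (real h) \<le> Y" "ln (real k) \<le> Y" "ln (real h') \<le> Y" "ln (real k') \<le> Y"
  using q unfolding e by (auto simp: resonator_pairs_def exp_range_def)
 have ln: "ln (real n) + (frac_log q - frac_log q') = ln (real (n * h * k')) - ln (real (k * h'))"
  using p n by (simp add: frac_log_def e ln_mult)
 show "n * fst q * snd q' = snd q * fst q' \<Longrightarrow> ln (real n) + (frac_log q - frac_log q') = 0"
  unfolding ln by (simp add: e del: of_nat_mult)
 have z: "ln (real h) \<ge> 0" "ln (real k) \<ge> 0" "ln (real h') \<ge> 0" "ln (real k') \<ge> 0" using p by auto
 show "\<bar>frac_log q - frac_log q'\<bar> \<le> 2 * Y" using b z by (simp add: frac_log_def e)
 have "ln (real (k * h')) \<le> 2 * Y" using p b by (simp add: ln_mult)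
 then have "real (k * h') \<le> exp (2 * Y)" using p by (metis exp_ln exp_le_cancel_iff mult_pos_pos of_nat_0_less_iff)
 then have "1 / (2 * exp (2 * Y)) \<le> \<bar>ln (real (n * h * k')) - ln (real (k * h'))\<bar>" if "n * fst q * snd q' \<noteq> snd q * fst q'"
  using p n that by (intro ln_ratio_ge) (auto simp: e)
 then show "n * fst q * snd q' \<noteq> snd q * fst q' \<Longrightarrow> \<bar>ln (real n) + (frac_log q - frac_log q')\<bar> \<ge> exp (- (2 * Y)) / 2"
  unfolding ln by (simp add: exp_minus field_simps)
qed

text \<open>With \<open>X = exp Y\<close>, the height is \<open>X\<close> to the power \<open>2 + 1/200\<close> and the width of the Gaussian weight \<open>X\<close> to the power \<open>2 + 1/400\<close>: wide enough to separate the ratios of elements of the resonator, short compared with the height.\<close>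
definition heightT :: "real \<Rightarrow> real" where "heightT Y = exp (401 / 200 * Y)"
definition widthD :: "real \<Rightarrow> real" where "widthD Y = exp (801 / 400 * Y)"
text \<open>The size of off-diagonal terms and Gaussian tails: it is doubly exponentially small and
  absorbs every factor exp (c Y). The rate 1 / 32 is what \<open>gauss_value_off_diagonal\<close>
  yields; the other tails decay at least as fast.\<close>

definition small_exp :: "real \<Rightarrow> real" where "small_exp Y = exp (- (exp (Y / 200) / 32))"

lemma heightT_pos [simp]: "heightT Y > 0" and widthD_pos [simp]: "widthD Y > 0" and small_exp_pos [simp]: "small_exp Y > 0"
 by (simp_all add: heightT_def widthD_def small_exp_def)

lemma heightT_nonneg [simp]: "heightT Y \<ge> 0" and widthD_nonneg [simp]: "widthD Y \<ge> 0" and small_exp_nonneg [simp]: "small_exp Y \<ge> 0"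
 by (simp_all add: heightT_def widthD_def small_exp_def)

lemma height_width: "(heightT Y)\<^sup>2 / (widthD Y)\<^sup>2 = exp (Y / 200)"
proof -
 have "(heightT Y)\<^sup>2 = exp (Y / 200) * (widthD Y)\<^sup>2"
  unfolding heightT_def widthD_def exp_double[symmetric] exp_add[symmetric] by (simp add: field_simps)
 moreover have "widthD Y \<noteq> 0" using widthD_pos[of Y] by linarith
 ultimately show ?thesis by simp
qed

lemma widthD_ge: "Y \<ge> 1 \<Longrightarrow> widthD Y \<ge> 2"
proof -
 assume "Y \<ge> 1"
 then have "1 + 1 \<le> 1 + 801 / 400 * Y" by simp
 also have "\<dots> \<le> widthD Y" unfolding widthD_def by (rule exp_ge_add_one_self)
 finally show ?thesis by simp
qed

lemma widthD_le_heightT: "Y \<ge> 1 \<Longrightarrow> widthD Y \<le> heightT Y"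
 by (simp add: widthD_def heightT_def)

text \<open>With t = ln n + l, one half of the exponent D^2 t^2 / 4 supplies
  \<open>small_exp\<close>. The other half exceeds 2 t - 2 and is spent on the factor n^(-2), which
  makes the sum over n converge.\<close>

lemma gauss_value_off_diagonal:
 assumes Y: "Y \<ge> 1" and n: "n > 0" and q: "q \<in> resonator_pairs Y" "q' \<in> resonator_pairs Y"
  and nd: "n * fst q * snd q' \<noteq> snd q * fst q'"
 shows "\<bar>Re (gauss_value T (widthD Y) \<alpha> n (frac_log q - frac_log q'))\<bar> \<le>
  sqrt pi * widthD Y * (exp (2 + 4 * Y) * small_exp Y / (real n)\<^sup>2)"
proof -
 define l where "l = frac_log q - frac_log q'"
 define L where "L = ln (real n)"
 define t where "t = L + l"
 let ?D = "widthD Y"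
 have L: "L \<ge> 0" using n by (simp add: L_def)
 have t: "\<bar>t\<bar> \<ge> exp (- (2 * Y)) / 2" using frac_log_shift(2)[OF n q nd] by (simp add: t_def L_def l_def)
 have l: "\<bar>l\<bar> \<le> 2 * Y" using frac_log_shift(3)[OF n q] by (simp add: l_def)
 have D2: "?D\<^sup>2 = exp (801 / 200 * Y)" by (simp add: widthD_def exp_double[symmetric])
 have "(exp (- (2 * Y)) / 2)\<^sup>2 \<le> \<bar>t\<bar>\<^sup>2" by (rule power_mono[OF t]) simp
 then have t2: "exp (- (4 * Y)) / 4 \<le> t\<^sup>2" by (simp add: power_divide exp_double[symmetric])
 have "exp (Y / 200) / 4 = ?D\<^sup>2 * (exp (- (4 * Y)) / 4)"
  unfolding D2 times_divide_eq_right exp_add[symmetric] by simp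
 also have "\<dots> \<le> ?D\<^sup>2 * t\<^sup>2" by (intro mult_left_mono t2) simp
 finally have b1: "exp (Y / 200) / 32 \<le> ?D\<^sup>2 * t\<^sup>2 / 8" by simp
 have "2\<^sup>2 \<le> ?D\<^sup>2" using widthD_ge[OF Y] by (intro power_mono) auto
 then have "4 * t\<^sup>2 \<le> ?D\<^sup>2 * t\<^sup>2" by (intro mult_right_mono) auto
 moreover have "0 \<le> (t - 2)\<^sup>2" by simp
 moreover have "(t - 2)\<^sup>2 = t\<^sup>2 - 4 * t + 4" by (simp add: power2_eq_square algebra_simps)
 ultimately have b2: "2 * t - 2 \<le> ?D\<^sup>2 * t\<^sup>2 / 8" by linarith
 have le: "- (L / 2) - ?D\<^sup>2 * t\<^sup>2 / 4 \<le> (2 + 4 * Y) - exp (Y / 200) / 32 - 2 * L"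
 proof -
  have g: "- (L / 2) - p \<le> (2 + 4 * Y) - E - 2 * L" if "E \<le> p / 2" "2 * t - 2 \<le> p / 2" for p E
  proof -
   have "2 * t = 2 * L + 2 * l" "- (2 * Y) \<le> l" using l by (simp_all add: t_def)
   then show ?thesis using that L by linarith
  qed
  show ?thesis by (rule g) (use b1 b2 in simp_all)
 qed
 then have e: "exp (- (L / 2) - ?D\<^sup>2 * t\<^sup>2 / 4) \<le> exp (2 + 4 * Y) * small_exp Y / (real n)\<^sup>2"
 proof -
  have "exp ((2 + 4 * Y) - exp (Y / 200) / 32 - 2 * L) = exp (2 + 4 * Y) * small_exp Y / (real n)\<^sup>2"
  proof -
   have "exp (2 * L) = (real n)\<^sup>2" unfolding exp_double L_def using n by simp
   moreover have "exp ((2 + 4 * Y) - exp (Y / 200) / 32 - 2 * L) = exp (2 + 4 * Y) * exp (- (exp (Y / 200) / 32)) / exp (2 * L)"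
    unfolding exp_add[symmetric] exp_diff[symmetric] by (simp only: diff_conv_add_uminus)
   ultimately show ?thesis unfolding small_exp_def by (simp only:)
  qed
  moreover have "exp (- (L / 2) - ?D\<^sup>2 * t\<^sup>2 / 4) \<le> exp ((2 + 4 * Y) - exp (Y / 200) / 32 - 2 * L)"
   unfolding exp_le_cancel_iff by (rule le)
  ultimately show ?thesis by simp
 qed
 have "\<bar>Re (gauss_value T ?D \<alpha> n l)\<bar> \<le> norm (gauss_value T ?D \<alpha> n l)" by (rule abs_Re_le_cmod)
 also have "\<dots> = sqrt pi * ?D * exp (- (L / 2) - ?D\<^sup>2 * t\<^sup>2 / 4)"
  unfolding gauss_value_def norm_mult norm_exp_i_times norm_of_real t_def L_def by (simp add: abs_mult)
 also have "\<dots> \<le> sqrt pi * ?D * (exp (2 + 4 * Y) * small_exp Y / (real n)\<^sup>2)"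
  by (intro mult_left_mono e) auto
 finally show ?thesis by (simp add: l_def)
qed

lemma gauss_value_diagonal:
 assumes n: "n > 0" and q: "q \<in> resonator_pairs Y" "q' \<in> resonator_pairs Y"
  and d: "n * fst q * snd q' = snd q * fst q'"
 shows "Re (gauss_value T D \<alpha> n (frac_log q - frac_log q')) = sqrt pi * D * (cos (\<alpha> * ln (real n)) / sqrt (real n))"
proof -
 have s: "exp (- (ln (real n) / 2)) = 1 / sqrt (real n)"
 proof -
  have "(exp (ln (real n) / 2))\<^sup>2 = real n" using n by (simp add: exp_double[symmetric])
  then have "exp (ln (real n) / 2) = sqrt (real n)" by (metis exp_ge_zero real_sqrt_unique)
  then show ?thesis by (simp add: exp_minus inverse_eq_divide)
 qed
 have e: "exp (\<i> * of_real u) = Complex (cos u) (sin u)" for u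
  by (simp add: exp_Euler cos_of_real sin_of_real complex_eq_iff)
 show ?thesis unfolding gauss_value_def frac_log_shift(1)[OF n q d] e by (simp add: s)
qed

text \<open>On the diagonal the Gaussian factor and the phase involving T are trivial, so cos
  (\<alpha> ln n) / sqrt n remains. Off the diagonal the bound for one pair is multiplied by the
  square of the sum of the coefficients, at most exp (4 Y).\<close>

lemma resonator_correlation:
 fixes P :: nat and \<alpha> T :: real
 assumes Y: "Y \<ge> 1" and n: "n > 0"
 shows "\<bar>(\<Sum>q\<in>resonator_pairs Y. \<Sum>q'\<in>resonator_pairs Y. resonator_coeff P q * resonator_coeff P q' *
   Re (gauss_value T (widthD Y) \<alpha> n (frac_log q - frac_log q')))
   - sqrt pi * widthD Y * (cos (\<alpha> * ln (real n)) / sqrt (real n) * resonator_diagonal P Y n)\<bar>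
  \<le> sqrt pi * widthD Y * (exp (2 + 8 * Y) * small_exp Y / (real n)\<^sup>2)"
proof -
 let ?K = "resonator_pairs Y" and ?a = "resonator_coeff P"
 let ?B = "sqrt pi * widthD Y" and ?c = "cos (\<alpha> * ln (real n)) / sqrt (real n)"
 let ?d = "\<lambda>q q'. n * fst q * snd q' = snd q * fst q'"
 define e where "e = exp (2 + 4 * Y) * small_exp Y / (real n)\<^sup>2"
 have "resonator_diagonal P Y n = (\<Sum>(q, q')\<in>{x \<in> ?K \<times> ?K. ?d (fst x) (snd x)}. ?a q * ?a q')"
  unfolding resonator_diagonal_def by (intro sum.cong) auto
 also have "\<dots> = (\<Sum>x\<in>?K \<times> ?K. if ?d (fst x) (snd x) then case x of (q, q') \<Rightarrow> ?a q * ?a q' else 0)"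
  by (rule sum.inter_filter) auto
 also have "\<dots> = (\<Sum>q\<in>?K. \<Sum>q'\<in>?K. if ?d q q' then ?a q * ?a q' else 0)"
  unfolding sum.cartesian_product case_prod_unfold by (rule refl)
 finally have D: "resonator_diagonal P Y n = (\<Sum>q\<in>?K. \<Sum>q'\<in>?K. if ?d q q' then ?a q * ?a q' else 0)" .
 have "\<bar>(\<Sum>q\<in>?K. \<Sum>q'\<in>?K. ?a q * ?a q' * Re (gauss_value T (widthD Y) \<alpha> n (frac_log q - frac_log q'))) - ?B * (?c * resonator_diagonal P Y n)\<bar>
  = \<bar>\<Sum>q\<in>?K. \<Sum>q'\<in>?K. ?a q * ?a q' * Re (gauss_value T (widthD Y) \<alpha> n (frac_log q - frac_log q')) - ?B * (?c * (if ?d q q' then ?a q * ?a q' else 0))\<bar>"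
  unfolding D sum_distrib_left sum_subtractf ..
 also have "\<dots> \<le> (\<Sum>q\<in>?K. \<Sum>q'\<in>?K. ?a q * ?a q' * (?B * e))"
 proof (intro sum_norm_le[where 'a = real, unfolded real_norm_def])
  fix q q' assume q: "q \<in> ?K" "q' \<in> ?K"
  show "\<bar>?a q * ?a q' * Re (gauss_value T (widthD Y) \<alpha> n (frac_log q - frac_log q')) - ?B * (?c * (if ?d q q' then ?a q * ?a q' else 0))\<bar> \<le> ?a q * ?a q' * (?B * e)"
  proof (cases "?d q q'")
   case True
   have "?a q * ?a q' * Re (gauss_value T (widthD Y) \<alpha> n (frac_log q - frac_log q')) - ?B * (?c * (?a q * ?a q')) = 0"
    unfolding gauss_value_diagonal[OF n q True] by (simp only: mult_ac)
   moreover have "0 \<le> ?a q * ?a q' * (?B * e)" by (simp add: e_def)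
   ultimately show ?thesis using True by simp
  next
   case False
   have "?a q * ?a q' * \<bar>Re (gauss_value T (widthD Y) \<alpha> n (frac_log q - frac_log q'))\<bar> \<le> ?a q * ?a q' * (?B * e)"
    unfolding e_def by (intro mult_left_mono gauss_value_off_diagonal Y n q False) auto
   then show ?thesis using False by (simp add: abs_mult)
  qed
 qed
 also have "\<dots> = (sum ?a ?K)\<^sup>2 * (?B * e)"
  by (simp only: power2_eq_square sum_product) (simp only: sum_distrib_right)
 also have "\<dots> \<le> exp (4 * Y) * (?B * e)"
  by (intro mult_right_mono sum_resonator_coeff_sq_le) (simp add: e_def)
 also have "\<dots> = ?B * (exp (2 + 8 * Y) * small_exp Y / (real n)\<^sup>2)"
 proof -
  have "exp (2 + 8 * Y) = exp (4 * Y) * exp (2 + 4 * Y)" by (simp add: exp_add[symmetric])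
  then show ?thesis unfolding e_def by simp
 qed
 finally show ?thesis .
qed

lemma resonator_diagonal_eq_0:
 assumes "n > 0" "n \<notin> exp_range (2 * Y)" shows "resonator_diagonal P Y n = 0"
proof -
 have e: "{(q, q'). q \<in> resonator_pairs Y \<and> q' \<in> resonator_pairs Y \<and> n * fst q * snd q' = snd q * fst q'} = {}"
 proof (intro equals0I)
  fix x assume "x \<in> {(q, q'). q \<in> resonator_pairs Y \<and> q' \<in> resonator_pairs Y \<and> n * fst q * snd q' = snd q * fst q'}"
  then obtain q q' where q: "q \<in> resonator_pairs Y" "q' \<in> resonator_pairs Y" "n * fst q * snd q' = snd q * fst q'" by auto
  have "ln (real n) \<le> 2 * Y" using frac_log_shift(1)[OF assms(1) q] frac_log_shift(3)[OF assms(1) q(1,2)] by linarith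
  then show False using assms by (simp add: exp_range_def)
 qed
 show ?thesis unfolding resonator_diagonal_def e by simp
qed

lemma resonator_prime_terms:
 fixes P :: nat and \<alpha> T :: real
 assumes Y: "Y \<ge> 1"
 defines "r \<equiv> resonance_prime_term (resonator_pairs Y) (resonator_coeff P) frac_log T (widthD Y) \<alpha>"
 shows "(\<Sum>n. r (Suc n)) \<ge> sqrt pi * widthD Y * (resonator_prime_sum P Y \<alpha> - exp (2 + 8 * Y) * small_exp Y * mangoldt_square_sum)"
proof -
 let ?B = "sqrt pi * widthD Y"
 let ?e = "exp (2 + 8 * Y) * small_exp Y"
 define d where "d = (\<lambda>n. mangoldt n / sqrt (real n) * cos (\<alpha> * ln (real n)) * resonator_diagonal P Y n)"
 have sr: "summable (\<lambda>n. r (Suc n))" unfolding r_def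
  using resonance_mangoldt_sums(3)[OF widthD_pos finite_resonator_pairs] by (rule sums_summable)
 have dsums: "(\<lambda>n. d (Suc n)) sums resonator_prime_sum P Y \<alpha>"
 proof -
  have "(\<lambda>n. d n) sums (\<Sum>n\<in>exp_range (2 * Y). d n)"
   by (rule sums_finite) (auto simp: d_def resonator_diagonal_eq_0)
  then have "(\<lambda>n. d (Suc n)) sums ((\<Sum>n\<in>exp_range (2 * Y). d n) - d 0)" by (subst sums_Suc_iff) simp
  moreover have "d 0 = 0" by (simp add: d_def)
  ultimately show ?thesis by (simp add: d_def resonator_prime_sum_def)
 qed
 have sm: "summable (\<lambda>n. mangoldt (Suc n) / (real (Suc n))\<^sup>2)" using summable_mangoldt_square by (subst summable_Suc_iff)
 have ms: "(\<Sum>n. mangoldt (Suc n) / (real (Suc n))\<^sup>2) = mangoldt_square_sum"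
  unfolding mangoldt_square_sum_def using suminf_split_head[OF summable_mangoldt_square] by simp
 have t: "?B * d (Suc n) - ?B * (?e * (mangoldt (Suc n) / (real (Suc n))\<^sup>2)) \<le> r (Suc n)" for n
 proof -
  let ?n = "Suc n"
  let ?s = "\<Sum>q\<in>resonator_pairs Y. \<Sum>q'\<in>resonator_pairs Y. resonator_coeff P q * resonator_coeff P q' * Re (gauss_value T (widthD Y) \<alpha> ?n (frac_log q - frac_log q'))"
  have "?B * (cos (\<alpha> * ln (real ?n)) / sqrt (real ?n) * resonator_diagonal P Y ?n) - ?B * (?e / (real ?n)\<^sup>2) \<le> ?s"
   using resonator_correlation[OF Y zero_less_Suc, where n1 = n and \<alpha> = \<alpha> and P = P and T = T] by linarith
  then have "mangoldt ?n * (?B * (cos (\<alpha> * ln (real ?n)) / sqrt (real ?n) * resonator_diagonal P Y ?n) - ?B * (?e / (real ?n)\<^sup>2)) \<le> mangoldt ?n * ?s"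
   by (rule mult_left_mono) (rule mangoldt_nonneg)
  moreover have "mangoldt ?n * (?B * (cos (\<alpha> * ln (real ?n)) / sqrt (real ?n) * resonator_diagonal P Y ?n) - ?B * (?e / (real ?n)\<^sup>2)) =
   ?B * d ?n - ?B * (?e * (mangoldt ?n / (real ?n)\<^sup>2))"
   by (simp add: d_def right_diff_distrib mult_ac del: of_nat_Suc)
  ultimately show ?thesis unfolding r_def resonance_prime_term_def by simp
 qed
 have s1: "(\<lambda>n. ?B * d (Suc n) - ?B * (?e * (mangoldt (Suc n) / (real (Suc n))\<^sup>2))) sums (?B * resonator_prime_sum P Y \<alpha> - ?B * (?e * mangoldt_square_sum))"
  unfolding ms[symmetric] by (intro sums_diff sums_mult dsums summable_sums sm)
 have "?B * resonator_prime_sum P Y \<alpha> - ?B * (?e * mangoldt_square_sum) \<le> (\<Sum>n. r (Suc n))"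
  by (rule sums_le[OF t s1 summable_sums[OF sr]])
 then show ?thesis by (simp only: right_diff_distrib)
qed

section \<open>Total mass of the resonance\<close>

lemma gauss_shift_integral:
 fixes b c :: real assumes "c > 0"
 shows "integrable lborel (\<lambda>t. C * exp (- (c * (t - b)\<^sup>2)))" "(LINT t|lborel. exp (- (c * (t - b)\<^sup>2))) = sqrt (pi / c)"
proof -
 let ?f = "\<lambda>t. exp (- (c * t\<^sup>2)) :: real"
 have e: "- b + 1 * y = y - b" for y by simp
 have "integrable lborel ?f" using integrable_gaussian_exp[OF assms, of 1] by simp
 then have "integrable lborel (\<lambda>t. ?f (- b + 1 * t))" by (subst lborel_integrable_real_affine_iff) auto
 then show "integrable lborel (\<lambda>t. C * exp (- (c * (t - b)\<^sup>2)))" unfolding e by (rule integrable_mult_right)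
 have "(LINT y|lborel. ?f y) = \<bar>1\<bar> *\<^sub>R (LINT y|lborel. ?f (- b + 1 * y))" by (rule lborel_integral_real_affine) simp
 then show "(LINT t|lborel. exp (- (c * (t - b)\<^sup>2))) = sqrt (pi / c)"
  unfolding e integral_gaussian_exp[OF assms] by simp
qed

lemma resonance_integrable:
 fixes a x :: "'k \<Rightarrow> real"
 assumes D: "D > 0" and a: "\<And>q. q \<in> K \<Longrightarrow> a q \<ge> 0"
 shows "integrable lborel (resonance K a x T D)"
proof (rule Bochner_Integration.integrable_bound[OF gauss_shift_integral(1)[of "1 / D\<^sup>2" "(sum a K)\<^sup>2" T]])
 show "resonance K a x T D \<in> borel_measurable lborel"
  by (intro continuous_imp_lborel_measurable resonance_continuous)
 show "AE t in lborel. norm (resonance K a x T D t) \<le> norm ((sum a K)\<^sup>2 * exp (- (1 / D\<^sup>2 * (t - T)\<^sup>2)))"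
  using resonance_le[where K = K and a = a and x = x and T = T and D = D, OF a] by (intro AE_I2) simp
qed (use D in auto)

text \<open>The mass is the correlation at n = 1: each monomial integrates over the critical line to
  \<open>gauss_value\<close> at n = 1, where \<alpha> is irrelevant because ln 1 = 0.\<close>

lemma resonance_mass:
 fixes a x :: "'k \<Rightarrow> real" and T D \<alpha> :: real
 assumes D: "D > 0" and K: "finite K"
 shows "(LINT t|lborel. resonance K a x T D t) = (\<Sum>q\<in>K. \<Sum>q'\<in>K. a q * a q' * Re (gauss_value T D \<alpha> 1 (x q - x q')))"
proof -
 have A: "1 / D\<^sup>2 > 0" using D by simp
 have e: "gauss_monomial T D l (Complex (1 / 2) t) = exp (- (\<i> * of_real (T * l))) * exp (of_real (- (1 / D\<^sup>2 * (t - T)\<^sup>2)) + \<i> * of_real (- l * (t - T)))" for l t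
 proof -
  have "- (\<i> * of_real (t * l)) = - (\<i> * of_real (T * l)) + \<i> * of_real (- l * (t - T))" by (simp add: algebra_simps)
  moreover have "exp (- ((t - T)\<^sup>2 / D\<^sup>2)) = exp (- (1 / D\<^sup>2 * (t - T)\<^sup>2))" by simp
  ultimately show ?thesis unfolding gauss_monomial_half exp_add exp_of_real by (simp only: mult_ac exp_add)
 qed
 have i: "integrable lborel (\<lambda>t. gauss_monomial T D l (Complex (1 / 2) t))" for l
  unfolding e by (rule gaussian_fourier_shift(1)[OF A])
 have i': "integrable lborel (\<lambda>t. c * gauss_monomial T D l (Complex (1 / 2) t))" for l c
  by (rule integrable_mult_right) (rule i)
 have v: "(LINT t|lborel. gauss_monomial T D l (Complex (1 / 2) t)) = gauss_value T D \<alpha> 1 l" for l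
 proof -
  have "sqrt (pi / (1 / D\<^sup>2)) = sqrt pi * D" using D by (simp add: real_sqrt_mult)
  moreover have "- ((- l)\<^sup>2) / (4 * (1 / D\<^sup>2)) = - (D\<^sup>2 * l\<^sup>2 / 4)" by simp
  ultimately show ?thesis unfolding e gaussian_fourier_shift(2)[OF A] gauss_value_def by simp
 qed
 have "complex_of_real (LINT t|lborel. resonance K a x T D t) = (LINT t|lborel. resonance_test K a x T D (Complex (1 / 2) t))"
  unfolding resonance_test_half by (rule integral_complex_of_real[symmetric])
 also have "\<dots> = (\<Sum>q\<in>K. \<Sum>q'\<in>K. of_real (a q * a q') * gauss_value T D \<alpha> 1 (x q - x q'))"
  unfolding resonance_test_def
  by (subst Bochner_Integration.integral_sum, intro Bochner_Integration.integrable_sum i', intro sum.cong refl,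
    subst Bochner_Integration.integral_sum, rule i', intro sum.cong refl)
   (simp only: integral_mult_right_zero v)
 finally have "Re (complex_of_real (LINT t|lborel. resonance K a x T D t)) = Re (\<Sum>q\<in>K. \<Sum>q'\<in>K. of_real (a q * a q') * gauss_value T D \<alpha> 1 (x q - x q'))" by (rule arg_cong)
 moreover have "Re (of_real r * z) = r * Re z" for r z by simp
 ultimately show ?thesis by (simp only: Re_complex_of_real Re_sum)
qed

subsection \<open>The mean value over a window\<close>

lemma widthD_nonzero [simp]: "widthD Y \<noteq> 0" by (simp add: widthD_def)

text \<open>The primitive of \<open>cos_weight_poly\<close> that vanishes at 0. Its value at 477 /
  100 is therefore a lower bound for the double integral J of the overview.\<close>

definition cos_weight_primitive :: "real \<Rightarrow> real" where
 "cos_weight_primitive b = 2 * (\<Sum>k<6. (- 1) ^ k * b ^ (2 * k + 1) / (real (2 * k + 1) * fact (2 * k + 3))) - 2 * b ^ 13 / (13 * fact 15)"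

lemma cos_weight_primitive_deriv: "(cos_weight_primitive has_real_derivative cos_weight_poly b) (at b)"
proof -
 have t: "((\<lambda>b. (- 1) ^ k * b ^ (2 * k + 1) / (real (2 * k + 1) * fact (2 * k + 3))) has_real_derivative (- 1) ^ k * b ^ (2 * k) / fact (2 * k + 3)) (at b)" for k
 proof -
  have "((\<lambda>b. (- 1) ^ k * b ^ (2 * k + 1) / (real (2 * k + 1) * fact (2 * k + 3))) has_real_derivative
    (- 1) ^ k * (real (2 * k + 1) * b ^ (2 * k)) / (real (2 * k + 1) * fact (2 * k + 3))) (at b)"
   by (rule derivative_eq_intros refl | simp)+
  moreover have "(- 1) ^ k * (real (2 * k + 1) * b ^ (2 * k)) / (real (2 * k + 1) * fact (2 * k + 3)) = (- 1) ^ k * b ^ (2 * k) / fact (2 * k + 3)"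
   by (simp del: of_nat_add of_nat_mult)
  ultimately show ?thesis by simp
 qed
 have u: "((\<lambda>b. 2 * b ^ 13 / (13 * fact 15)) has_real_derivative 2 * b ^ 12 / fact 15) (at b)"
  by (rule derivative_eq_intros refl | simp)+
 show ?thesis unfolding cos_weight_primitive_def[abs_def] cos_weight_poly_def
  by (intro DERIV_diff DERIV_cmult DERIV_sum t u)
qed

lemma cos_weight_primitive_minus: "cos_weight_primitive (- b) = - cos_weight_primitive b"
proof -
 have "(- b) ^ 13 = - (b ^ 13)" "(- b) ^ (2 * k + 1) = - (b ^ (2 * k + 1))" for k by (simp_all add: power_minus_odd)
 then show ?thesis unfolding cos_weight_primitive_def by (simp add: sum_negf)
qed

lemma cos_weight_primitive_value: "cos_weight_primitive (477 / 100) \<ge> 1144 / 1000"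
proof -
 have "{..<6} = {0, 1, 2, 3, 4, 5::nat}" by auto
 then show ?thesis unfolding cos_weight_primitive_def by (simp add: fact_numeral power_divide)
qed

text \<open>The Gaussian is split in three: half of the exponent remains as decay, a quarter stays
  integrable, and the last quarter absorbs the factor u.\<close>

lemma lebesgue_gauss_tail: "u * exp (- u\<^sup>2) \<le> exp (- (u\<^sup>2 / 2)) * exp (- (1 / 4 * u\<^sup>2))" for u :: real
proof -
 have "u \<le> 1 + u\<^sup>2 / 4" using zero_le_power2[of "u / 2 - 1"] by (simp add: power2_eq_square algebra_simps)
 also have "\<dots> \<le> exp (u\<^sup>2 / 4)" by (rule exp_ge_add_one_self)
 finally have "u * exp (- u\<^sup>2) \<le> exp (u\<^sup>2 / 4) * exp (- u\<^sup>2)" by (intro mult_right_mono) auto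
 also have "\<dots> = exp (- (u\<^sup>2 / 2)) * exp (- (1 / 4 * u\<^sup>2))" unfolding exp_add[symmetric] by (rule arg_cong[of _ _ exp]) (simp add: field_simps)
 finally show ?thesis .
qed

lemma small_exp_ge: "c \<ge> 1 / 32 \<Longrightarrow> exp (- (c * exp (Y / 200))) \<le> small_exp Y"
proof -
 assume c: "c \<ge> 1 / 32"
 have "1 / 32 * exp (Y / 200) \<le> c * exp (Y / 200)" by (intro mult_right_mono c) simp
 then show ?thesis by (simp add: small_exp_def)
qed

context
 fixes Y :: real and P :: nat
 assumes Y: "Y \<ge> 5"
begin

abbreviation (input) "rT \<equiv> heightT Y"
abbreviation (input) "rD \<equiv> widthD Y"
abbreviation (input) "rB \<equiv> sqrt pi * widthD Y"
abbreviation (input) "rR \<equiv> resonance (resonator_pairs Y) (resonator_coeff P) frac_log (heightT Y) (widthD Y)"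
abbreviation (input) "rF \<equiv> resonance_test (resonator_pairs Y) (resonator_coeff P) frac_log (heightT Y) (widthD Y)"

lemma resonator_heightT_ge: "heightT Y \<ge> 2"
proof -
 have "2 \<le> 1 + 401 / 200 * Y" using Y by simp
 also have "\<dots> \<le> heightT Y" unfolding heightT_def by (rule exp_ge_add_one_self)
 finally show ?thesis .
qed

lemma resonator_width_ge: "widthD Y \<ge> 2" by (rule widthD_ge) (use Y in simp)

lemma resonator_resonance_le: "rR t \<le> exp (4 * Y) * exp (- ((t - rT)\<^sup>2 / rD\<^sup>2))"
proof -
 have "rR t \<le> (sum (resonator_coeff P) (resonator_pairs Y))\<^sup>2 * exp (- ((t - rT)\<^sup>2 / rD\<^sup>2))" by (rule resonance_le) simp
 also have "\<dots> \<le> exp (4 * Y) * exp (- ((t - rT)\<^sup>2 / rD\<^sup>2))" by (intro mult_right_mono sum_resonator_coeff_sq_le) simp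
 finally show ?thesis .
qed

lemma resonator_resonance_integrable: "integrable lborel rR"
 by (rule resonance_integrable) auto

lemma resonator_mass: "\<bar>(LINT t|lborel. rR t) - rB * resonator_diagonal P Y 1\<bar> \<le> rB * (exp (2 + 8 * Y) * small_exp Y)"
proof -
 have "1 \<le> Y" using Y by simp
 from resonator_correlation[OF this, of 1 P rT 0] show ?thesis
  unfolding resonance_mass[OF widthD_pos finite_resonator_pairs, where \<alpha> = 0] by simp
qed

lemma gauss_decomp:
 assumes c: "(t - rT)\<^sup>2 \<ge> d * rT\<^sup>2"
 shows "d * exp (Y / 200) \<le> (t - rT)\<^sup>2 / rD\<^sup>2"
proof -
 have "d * exp (Y / 200) = (d * rT\<^sup>2) / rD\<^sup>2" unfolding height_width[symmetric] by simp
 also have "\<dots> \<le> (t - rT)\<^sup>2 / rD\<^sup>2" using c by (intro divide_right_mono) auto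
 finally show ?thesis .
qed

text \<open>The points 0 and 1, shifted by at most 1, lie at distance at least T / 2 in height from
  the centre of the Gaussian. So the pole terms of the explicit formula are negligible.\<close>

lemma resonator_test_end:
 assumes a: "\<bar>\<alpha>\<bar> \<le> 1" and s: "s = 0 \<or> s = 1"
 shows "Re (rF (s + \<i> * of_real \<alpha>)) \<le> exp (1 + 5 * Y) * small_exp Y"
proof -
 define x where "x = Re s"
 have x: "x = 0 \<or> x = 1" and sx: "s + \<i> * of_real \<alpha> = Complex x \<alpha>" using s by (auto simp: x_def complex_eq_iff)
 have x2: "(x - 1 / 2)\<^sup>2 = 1 / 4" using x by (auto simp: power2_eq_square)
 have T2: "(\<alpha> - rT)\<^sup>2 \<ge> 1 / 4 * rT\<^sup>2"
 proof -
  have "rT / 2 \<le> \<bar>\<alpha> - rT\<bar>" using a resonator_heightT_ge by linarith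
  then have "(rT / 2)\<^sup>2 \<le> \<bar>\<alpha> - rT\<bar>\<^sup>2" by (intro power_mono) auto
  then show ?thesis by (simp add: power_divide)
 qed
 have gm: "norm (gauss_monomial rT rD l (Complex x \<alpha>)) \<le> exp (1 + Y) * small_exp Y" if l: "\<bar>l\<bar> \<le> 2 * Y" for l
 proof -
  have "1 * 1 \<le> rD * rD" using resonator_width_ge by (intro mult_mono) auto
  then have "1 / 4 / rD\<^sup>2 \<le> 1" by (simp add: power2_eq_square field_simps)
  moreover have "- ((x - 1 / 2) * l) \<le> Y" using x l by auto
  moreover have "1 / 4 * exp (Y / 200) \<le> (\<alpha> - rT)\<^sup>2 / rD\<^sup>2" by (rule gauss_decomp[OF T2])
  ultimately have "((x - 1 / 2)\<^sup>2 - (\<alpha> - rT)\<^sup>2) / rD\<^sup>2 - (x - 1 / 2) * l \<le> (1 + Y) + - (1 / 4 * exp (Y / 200))"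
   unfolding x2 diff_divide_distrib by linarith
  then have "norm (gauss_monomial rT rD l (Complex x \<alpha>)) \<le> exp ((1 + Y) + - (1 / 4 * exp (Y / 200)))"
   unfolding norm_gauss_monomial by (subst exp_le_cancel_iff)
  also have "\<dots> = exp (1 + Y) * exp (- (1 / 4 * exp (Y / 200)))" by (rule exp_add)
  also have "\<dots> \<le> exp (1 + Y) * small_exp Y" by (intro mult_left_mono small_exp_ge) auto
  finally show ?thesis .
 qed
 let ?K = "resonator_pairs Y" and ?a = "resonator_coeff P"
 have "Re (rF (Complex x \<alpha>)) \<le> norm (rF (Complex x \<alpha>))" by (rule complex_Re_le_cmod)
 also have "\<dots> \<le> (\<Sum>q\<in>?K. \<Sum>q'\<in>?K. ?a q * ?a q' * (exp (1 + Y) * small_exp Y))"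
  unfolding resonance_test_def
 proof (intro sum_norm_le)
  fix q q' assume q: "q \<in> ?K" "q' \<in> ?K"
  have "norm (gauss_monomial rT rD (frac_log q - frac_log q') (Complex x \<alpha>)) \<le> exp (1 + Y) * small_exp Y"
   by (rule gm[OF frac_log_shift(3)[OF zero_less_one q]])
  then have "?a q * ?a q' * norm (gauss_monomial rT rD (frac_log q - frac_log q') (Complex x \<alpha>)) \<le> ?a q * ?a q' * (exp (1 + Y) * small_exp Y)"
   by (intro mult_left_mono) auto
  then show "norm (of_real (?a q * ?a q') * gauss_monomial rT rD (frac_log q - frac_log q') (Complex x \<alpha>)) \<le> ?a q * ?a q' * (exp (1 + Y) * small_exp Y)"
   by (simp add: norm_mult)
 qed
 also have "\<dots> = (sum ?a ?K)\<^sup>2 * (exp (1 + Y) * small_exp Y)"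
  by (simp only: power2_eq_square sum_product) (simp only: sum_distrib_right)
 also have "\<dots> \<le> exp (4 * Y) * (exp (1 + Y) * small_exp Y)" by (intro mult_right_mono sum_resonator_coeff_sq_le) simp
 also have "\<dots> = exp (1 + 5 * Y) * small_exp Y"
 proof -
  have "exp (1 + 5 * Y) = exp (4 * Y) * exp (1 + Y)" by (simp add: exp_add[symmetric])
  then show ?thesis by simp
 qed
 finally show ?thesis unfolding sx .
qed

text \<open>For |t - T| \<le> T the logarithm exceeds ln (2 + T) by at most ln 2. Farther out it
  exceeds it by at most u = |t - T| / D, which the Gaussian decay absorbs.\<close>

lemma resonator_log_bound:
 "ln (2 + \<bar>t\<bar>) * rR t \<le> (ln (2 + rT) + 1) * rR t + exp (4 * Y) * small_exp Y * exp (- (1 / (4 * rD\<^sup>2) * (t - rT)\<^sup>2))"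
proof (cases "\<bar>t - rT\<bar> \<le> rT")
 case True
 have "2 * (2 + rT) = 4 + 2 * rT" by simp
 then have "2 + \<bar>t\<bar> \<le> 2 * (2 + rT)" using True resonator_heightT_ge by linarith
 then have "ln (2 + \<bar>t\<bar>) \<le> ln (2 * (2 + rT))" using resonator_heightT_ge by (subst ln_le_cancel_iff) auto
 also have "\<dots> = ln 2 + ln (2 + rT)" using resonator_heightT_ge by (subst ln_mult) auto
 also have "\<dots> \<le> ln (2 + rT) + 1" using ln_le_minus_one[of "2::real"] by simp
 finally have "ln (2 + \<bar>t\<bar>) * rR t \<le> (ln (2 + rT) + 1) * rR t" by (rule mult_right_mono) simp
 moreover have "0 \<le> exp (4 * Y) * small_exp Y * exp (- (1 / (4 * rD\<^sup>2) * (t - rT)\<^sup>2))" by simp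
 ultimately show ?thesis by linarith
next
 case False
 define u where "u = \<bar>t - rT\<bar> / rD"
 have u0: "u \<ge> 0" by (simp add: u_def)
 have u2: "u\<^sup>2 = (t - rT)\<^sup>2 / rD\<^sup>2" by (simp add: u_def power_divide)
 have "2 + \<bar>t\<bar> \<le> 2 + rT + \<bar>t - rT\<bar>" using resonator_heightT_ge by linarith
 also have "\<dots> \<le> (2 + rT) * (1 + u)"
 proof -
  have "rD \<le> 2 + rT" using widthD_le_heightT[of Y] Y by simp
  then have "rD * u \<le> (2 + rT) * u" using u0 by (intro mult_right_mono)
  moreover have "rD * u = \<bar>t - rT\<bar>" using widthD_pos[of Y] by (simp add: u_def)
  ultimately show ?thesis by (simp add: algebra_simps)
 qed
 finally have "ln (2 + \<bar>t\<bar>) \<le> ln ((2 + rT) * (1 + u))" using u0 resonator_heightT_ge by (subst ln_le_cancel_iff) auto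
 also have "\<dots> = ln (2 + rT) + ln (1 + u)" using u0 resonator_heightT_ge by (subst ln_mult) auto
 also have "\<dots> \<le> ln (2 + rT) + u" using ln_add_one_self_le_self[OF u0] by simp
 finally have "ln (2 + \<bar>t\<bar>) * rR t \<le> (ln (2 + rT) + u) * rR t" by (rule mult_right_mono) simp
 also have "\<dots> = ln (2 + rT) * rR t + u * rR t" by (rule distrib_right)
 also have "u * rR t \<le> u * (exp (4 * Y) * exp (- u\<^sup>2))"
  using resonator_resonance_le[of t] u0 unfolding u2 by (intro mult_left_mono) auto
 also have "\<dots> = exp (4 * Y) * (u * exp (- u\<^sup>2))" by simp
 also have "\<dots> \<le> exp (4 * Y) * (exp (- (u\<^sup>2 / 2)) * exp (- (1 / 4 * u\<^sup>2)))" by (intro mult_left_mono lebesgue_gauss_tail) simp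
 also have "\<dots> \<le> exp (4 * Y) * (small_exp Y * exp (- (1 / 4 * u\<^sup>2)))"
 proof (intro mult_left_mono mult_right_mono)
  have "rT\<^sup>2 \<le> \<bar>t - rT\<bar>\<^sup>2" using False by (intro power_mono) auto
  then have "1 * exp (Y / 200) \<le> u\<^sup>2" unfolding u2 by (intro gauss_decomp) simp
  then have "exp (- (u\<^sup>2 / 2)) \<le> exp (- (1 / 2 * exp (Y / 200)))" by simp
  also have "\<dots> \<le> small_exp Y" by (rule small_exp_ge) simp
  finally show "exp (- (u\<^sup>2 / 2)) \<le> small_exp Y" .
 qed auto
 also have "\<dots> = exp (4 * Y) * small_exp Y * exp (- (1 / (4 * rD\<^sup>2) * (t - rT)\<^sup>2))" unfolding u2 by simp
 finally have m: "ln (2 + \<bar>t\<bar>) * rR t \<le> ln (2 + rT) * rR t + exp (4 * Y) * small_exp Y * exp (- (1 / (4 * rD\<^sup>2) * (t - rT)\<^sup>2))" by simp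
 have "(ln (2 + rT) + 1) * rR t = ln (2 + rT) * rR t + rR t" by (simp add: distrib_right)
 moreover have "rR t \<ge> 0" by simp
 ultimately show ?thesis using m by linarith
qed

text \<open>The 67 is composed of 66 from \<open>Re_Digamma_bound\<close> and 1 from
  \<open>resonator_log_bound\<close>. The shift by at most 1 and the halving of y are hidden in ln
  (1 + |y / 2|) \<le> ln (2 + |y + \<alpha>|).\<close>

lemma resonator_gamma_part:
 assumes a: "\<bar>\<alpha>\<bar> \<le> 1"
 shows "(LINT y|lborel. (Re (Digamma (Complex (1 / 4) (y / 2))) - ln pi) * rR (y + \<alpha>)) \<le>
  (ln (2 + rT) + 67) * (LINT t|lborel. rR t) + exp (4 * Y) * small_exp Y * (2 * rB)"
proof -
 let ?e = "exp (4 * Y) * small_exp Y"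
 let ?g = "\<lambda>y. exp (- (1 / (4 * rD\<^sup>2) * (y - (rT - \<alpha>))\<^sup>2))"
 have c: "1 / (4 * rD\<^sup>2) > 0" using widthD_pos[of Y] by simp
 have shift: "(LINT t|lborel. rR t) = (LINT y|lborel. rR (y + \<alpha>))"
  using lborel_integral_real_affine[of 1 rR \<alpha>] by (simp add: add.commute)
 have ishift: "integrable lborel (\<lambda>y. rR (y + \<alpha>))"
  using lborel_integrable_real_affine_iff[of 1 rR \<alpha>] resonator_resonance_integrable by (simp add: add.commute)
 have ig: "integrable lborel (\<lambda>y. ?e * ?g y)" by (rule gauss_shift_integral(1)[OF c])
 have "(LINT y|lborel. (Re (Digamma (Complex (1 / 4) (y / 2))) - ln pi) * rR (y + \<alpha>)) \<le>
  (LINT y|lborel. (ln (2 + rT) + 67) * rR (y + \<alpha>) + ?e * ?g y)"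
 proof (rule integral_mono)
  show "integrable lborel (\<lambda>y. (Re (Digamma (Complex (1 / 4) (y / 2))) - ln pi) * rR (y + \<alpha>))"
   by (rule resonance_explicit_formula(2)) auto
  show "integrable lborel (\<lambda>y. (ln (2 + rT) + 67) * rR (y + \<alpha>) + ?e * ?g y)"
   by (rule Bochner_Integration.integrable_add[OF _ ig], rule integrable_mult_right, rule ishift)
  fix y :: real
  have "Re (Digamma (Complex (1 / 4) (y / 2))) \<le> ln (1 + \<bar>y / 2\<bar>) + 66" using Re_Digamma_bound[of "y / 2"] by linarith
  moreover have "ln (1 + \<bar>y / 2\<bar>) \<le> ln (2 + \<bar>y + \<alpha>\<bar>)"
  proof -
   have "\<bar>y\<bar> \<le> \<bar>y + \<alpha>\<bar> + 1" using a by linarith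
   moreover have "\<bar>y / 2\<bar> = \<bar>y\<bar> / 2" by simp
   ultimately have "1 + \<bar>y / 2\<bar> \<le> 2 + \<bar>y + \<alpha>\<bar>" by linarith
   then show ?thesis by (intro ln_mono) auto
  qed
  moreover have "ln pi \<ge> 0" using pi_ge_two by (intro ln_ge_zero) linarith
  ultimately have "Re (Digamma (Complex (1 / 4) (y / 2))) - ln pi \<le> ln (2 + \<bar>y + \<alpha>\<bar>) + 66" by linarith
  then have "(Re (Digamma (Complex (1 / 4) (y / 2))) - ln pi) * rR (y + \<alpha>) \<le> (ln (2 + \<bar>y + \<alpha>\<bar>) + 66) * rR (y + \<alpha>)"
   by (rule mult_right_mono) simp
  also have "\<dots> = ln (2 + \<bar>y + \<alpha>\<bar>) * rR (y + \<alpha>) + 66 * rR (y + \<alpha>)" by (rule distrib_right)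
  also have "\<dots> \<le> (ln (2 + rT) + 1) * rR (y + \<alpha>) + ?e * exp (- (1 / (4 * rD\<^sup>2) * (y + \<alpha> - rT)\<^sup>2)) + 66 * rR (y + \<alpha>)"
   by (intro add_right_mono resonator_log_bound)
  also have "\<dots> = (ln (2 + rT) + 67) * rR (y + \<alpha>) + ?e * ?g y"
  proof -
   have "y + \<alpha> - rT = y - (rT - \<alpha>)" by simp
   then show ?thesis by (simp only: distrib_right)
  qed
  finally show "(Re (Digamma (Complex (1 / 4) (y / 2))) - ln pi) * rR (y + \<alpha>) \<le> (ln (2 + rT) + 67) * rR (y + \<alpha>) + ?e * ?g y" .
 qed
 also have "\<dots> = (LINT y|lborel. (ln (2 + rT) + 67) * rR (y + \<alpha>)) + (LINT y|lborel. ?e * ?g y)"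
  by (rule Bochner_Integration.integral_add[OF _ ig], rule integrable_mult_right, rule ishift)
 also have "\<dots> = (ln (2 + rT) + 67) * (LINT t|lborel. rR t) + ?e * (LINT y|lborel. ?g y)"
  unfolding shift by (simp only: integral_mult_right_zero)
 also have "(LINT y|lborel. ?g y) = sqrt (pi / (1 / (4 * rD\<^sup>2)))" by (rule gauss_shift_integral(2)[OF c])
 also have "\<dots> = 2 * rB" by (simp add: real_sqrt_mult)
 finally show ?thesis .
qed

text \<open>Outside the window (t - T)^2 is at least T^2 / 4. Half of the Gaussian exponent is then
  at least exp (Y / 200) / 8, and the other half is integrated.\<close>

lemma resonator_mass_window:
 "(LINT t|lborel. rR t) \<le> (LINT t|lborel. rR t * indicator {rT / 2..3 * rT / 2} t) + exp (4 * Y) * small_exp Y * (2 * rB)"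
proof -
 let ?e = "exp (4 * Y) * small_exp Y"
 let ?g = "\<lambda>t. exp (- (1 / (2 * rD\<^sup>2) * (t - rT)\<^sup>2))"
 have c: "1 / (2 * rD\<^sup>2) > 0" using widthD_pos[of Y] by simp
 have ig: "integrable lborel (\<lambda>t. ?e * ?g t)" by (rule gauss_shift_integral(1)[OF c])
 have ii: "integrable lborel (\<lambda>t. rR t * indicator {rT / 2..3 * rT / 2} t)"
  by (intro integrable_real_mult_indicator resonator_resonance_integrable) simp
 have "(LINT t|lborel. rR t) \<le> (LINT t|lborel. rR t * indicator {rT / 2..3 * rT / 2} t + ?e * ?g t)"
 proof (rule integral_mono[OF resonator_resonance_integrable Bochner_Integration.integrable_add[OF ii ig]])
  fix t
  show "rR t \<le> rR t * indicator {rT / 2..3 * rT / 2} t + ?e * ?g t"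
  proof (cases "t \<in> {rT / 2..3 * rT / 2}")
   case False
   then have "rT / 2 \<le> \<bar>t - rT\<bar>" using resonator_heightT_ge by auto
   then have "(rT / 2)\<^sup>2 \<le> \<bar>t - rT\<bar>\<^sup>2" by (intro power_mono) auto
   then have d: "1 / 4 * exp (Y / 200) \<le> (t - rT)\<^sup>2 / rD\<^sup>2" by (intro gauss_decomp) (simp add: power_divide)
   have "exp (- ((t - rT)\<^sup>2 / rD\<^sup>2)) = exp (- ((t - rT)\<^sup>2 / rD\<^sup>2 / 2)) * ?g t"
    unfolding exp_add[symmetric] by (rule arg_cong[of _ _ exp]) simp
   also have "\<dots> \<le> small_exp Y * ?g t"
   proof (rule mult_right_mono)
    have "exp (- ((t - rT)\<^sup>2 / rD\<^sup>2 / 2)) \<le> exp (- (1 / 8 * exp (Y / 200)))"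
     unfolding exp_le_cancel_iff neg_le_iff_le using divide_right_mono[OF d, of 2] by simp
    also have "\<dots> \<le> small_exp Y" by (rule small_exp_ge) simp
    finally show "exp (- ((t - rT)\<^sup>2 / rD\<^sup>2 / 2)) \<le> small_exp Y" .
   qed simp
   finally have g: "exp (- ((t - rT)\<^sup>2 / rD\<^sup>2)) \<le> small_exp Y * ?g t" .
   have "rR t \<le> exp (4 * Y) * exp (- ((t - rT)\<^sup>2 / rD\<^sup>2))" by (rule resonator_resonance_le)
   also have "\<dots> \<le> exp (4 * Y) * (small_exp Y * ?g t)" by (intro mult_left_mono g) simp
   also have "\<dots> = rR t * indicator {rT / 2..3 * rT / 2} t + ?e * ?g t"
    unfolding indicator_simps(2)[OF False] by (simp only: mult_zero_right add_0 mult.assoc)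
   finally show ?thesis .
  qed simp
 qed
 also have "\<dots> = (LINT t|lborel. rR t * indicator {rT / 2..3 * rT / 2} t) + (LINT t|lborel. ?e * ?g t)"
  by (rule Bochner_Integration.integral_add[OF ii ig])
 also have "(LINT t|lborel. ?e * ?g t) = ?e * (LINT t|lborel. ?g t)" by (rule integral_mult_right_zero)
 also have "(LINT t|lborel. ?g t) = sqrt (pi / (1 / (2 * rD\<^sup>2)))" by (rule gauss_shift_integral(2)[OF c])
 also have "\<dots> = sqrt 2 * rB" by (simp add: real_sqrt_mult)
 also have "?e * (sqrt 2 * rB) \<le> ?e * (2 * rB)"
  by (intro mult_left_mono mult_right_mono) (auto intro: real_le_lsqrt)
 finally show ?thesis by simp
qed

text \<open>Under the Riemann hypothesis every term of the explicit formula is a value of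
  \<open>resonance\<close> times a positive multiplicity. Hence a sum over any finite set of
  ordinates, each counted once, is at most the full sum over zeros.\<close>

lemma resonator_zero_sum:
 assumes RH: "\<And>p. riemann_xi p = 0 \<Longrightarrow> Re p = 1 / 2" and Z: "finite Z" "\<And>c. c \<in> Z \<Longrightarrow> riemann_xi (Complex (1 / 2) c) = 0"
  and a: "\<bar>\<alpha>\<bar> \<le> 1"
 shows "(\<Sum>c\<in>Z. rR (c + \<alpha>)) \<le> 2 * (exp (1 + 5 * Y) * small_exp Y) +
  ((ln (2 + rT) + 67) * (LINT t|lborel. rR t) + exp (4 * Y) * small_exp Y * (2 * rB)) / (2 * pi) -
  rB * (resonator_prime_sum P Y \<alpha> - exp (2 + 8 * Y) * small_exp Y * mangoldt_square_sum) / pi"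
proof -
 let ?F = "\<lambda>s. rF (s + \<i> * of_real \<alpha>)"
 let ?r = "resonance_prime_term (resonator_pairs Y) (resonator_coeff P) frac_log rT rD \<alpha>"
 let ?G = "LINT y|lborel. (Re (Digamma (Complex (1 / 4) (y / 2))) - ln pi) * rR (y + \<alpha>)"
 obtain V where V: "filterlim V at_top sequentially"
  and lim: "(\<lambda>n::nat. \<Sum>p | riemann_xi p = 0 \<and> \<bar>Im p\<bar> < V n. Re (?F p) * of_int (zorder riemann_xi p)) \<longlonglongrightarrow>
   Re (?F 0) + Re (?F 1) + ?G / (2 * pi) - (\<Sum>n. ?r (Suc n)) / pi"
  using resonance_explicit_formula(1)[OF widthD_pos finite_resonator_pairs] by blast
 define M where "M = Max (insert 0 (abs ` Z)) + 1"
 have "eventually (\<lambda>n. V n \<ge> M) sequentially" using V by (simp add: filterlim_at_top)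
 then have "eventually (\<lambda>n. (\<Sum>c\<in>Z. rR (c + \<alpha>)) \<le> (\<Sum>p | riemann_xi p = 0 \<and> \<bar>Im p\<bar> < V n. Re (?F p) * of_int (zorder riemann_xi p))) sequentially"
 proof eventually_elim
  case (elim n)
  have Fp: "Re (?F (Complex (1 / 2) c)) = rR (c + \<alpha>)" for c
  proof -
   have "Complex (1 / 2) c + \<i> * of_real \<alpha> = Complex (1 / 2) (c + \<alpha>)" by (simp add: complex_eq_iff)
   then show ?thesis by (simp only: resonance_test_half) simp
  qed
  have zo: "zorder riemann_xi p \<ge> 1" if "riemann_xi p = 0" for p
  proof -
   have "zorder riemann_xi p > 0"
    by (rule log_derivative_limit(3)[OF holomorphic_riemann_xi open_UNIV connected_UNIV UNIV_I _ that]) (rule bexI[of _ 1], auto)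
   then show ?thesis by simp
  qed
  have fin: "finite {p. riemann_xi p = 0 \<and> \<bar>Im p\<bar> < V n}"
   by (rule finite_subset[OF _ finite_xi_zeros[of "V n"]]) auto
  have "(\<Sum>c\<in>Z. rR (c + \<alpha>)) = (\<Sum>p\<in>Complex (1 / 2) ` Z. Re (?F p))"
   by (subst sum.reindex) (auto intro!: inj_onI simp: Fp)
  also have "\<dots> \<le> (\<Sum>p | riemann_xi p = 0 \<and> \<bar>Im p\<bar> < V n. Re (?F p))"
  proof (rule sum_mono2[OF fin])
   show "Complex (1 / 2) ` Z \<subseteq> {p. riemann_xi p = 0 \<and> \<bar>Im p\<bar> < V n}"
   proof
    fix p assume "p \<in> Complex (1 / 2) ` Z"
    then obtain c where c: "c \<in> Z" "p = Complex (1 / 2) c" by blast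
    have "\<bar>c\<bar> \<le> Max (insert 0 (abs ` Z))" using Z(1) c(1) by (intro Max_ge) auto
    then show "p \<in> {p. riemann_xi p = 0 \<and> \<bar>Im p\<bar> < V n}" using c Z(2) elim by (auto simp: M_def)
   qed
   fix p assume "p \<in> {p. riemann_xi p = 0 \<and> \<bar>Im p\<bar> < V n} - Complex (1 / 2) ` Z"
   then have "p = Complex (1 / 2) (Im p)" using RH[of p] by (auto simp: complex_eq_iff)
   then show "0 \<le> Re (?F p)" using Fp[of "Im p"] by simp
  qed
  also have "\<dots> \<le> (\<Sum>p | riemann_xi p = 0 \<and> \<bar>Im p\<bar> < V n. Re (?F p) * of_int (zorder riemann_xi p))"
  proof (rule sum_mono)
   fix p assume "p \<in> {p. riemann_xi p = 0 \<and> \<bar>Im p\<bar> < V n}"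
   then have p: "riemann_xi p = 0" "p = Complex (1 / 2) (Im p)" using RH[of p] by (auto simp: complex_eq_iff)
   then have "Re (?F p) \<ge> 0" using Fp[of "Im p"] by simp
   then show "Re (?F p) \<le> Re (?F p) * of_int (zorder riemann_xi p)"
    using mult_left_mono[of 1 "real_of_int (zorder riemann_xi p)" "Re (?F p)"] zo[OF p(1)] by simp
  qed
  finally show ?case .
 qed
 then have "(\<Sum>c\<in>Z. rR (c + \<alpha>)) \<le> Re (?F 0) + Re (?F 1) + ?G / (2 * pi) - (\<Sum>n. ?r (Suc n)) / pi"
  by (intro tendsto_lowerbound[OF lim]) auto
 moreover have "Re (?F 0) \<le> exp (1 + 5 * Y) * small_exp Y" "Re (?F 1) \<le> exp (1 + 5 * Y) * small_exp Y"
  using resonator_test_end[OF a, of 0] resonator_test_end[OF a, of 1] by simp_all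
 moreover have "?G / (2 * pi) \<le> ((ln (2 + rT) + 67) * (LINT t|lborel. rR t) + exp (4 * Y) * small_exp Y * (2 * rB)) / (2 * pi)"
  by (intro divide_right_mono resonator_gamma_part a) auto
 moreover have "rB * (resonator_prime_sum P Y \<alpha> - exp (2 + 8 * Y) * small_exp Y * mangoldt_square_sum) / pi \<le> (\<Sum>n. ?r (Suc n)) / pi"
  by (intro divide_right_mono resonator_prime_terms) (use Y in auto)
 ultimately show ?thesis by linarith
qed

text \<open>The intervals of radius h about the points of Z cover the window and the integrand is
  nonnegative; each interval is then translated to the origin.\<close>

lemma resonator_covering:
 assumes Z: "finite Z" and cov: "\<And>t. t \<in> {rT / 2..3 * rT / 2} \<Longrightarrow> \<exists>c\<in>Z. \<bar>t - c\<bar> \<le> h"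
 shows "(LINT t|lborel. rR t * indicator {rT / 2..3 * rT / 2} t) \<le> (LINT \<alpha>|lborel. (\<Sum>c\<in>Z. rR (c + \<alpha>)) * indicator {-h..h} \<alpha>)"
proof -
 have i1: "integrable lborel (\<lambda>t. rR t * indicator {c - h..c + h} t)" for c
  by (intro integrable_real_mult_indicator resonator_resonance_integrable) simp
 have i2: "integrable lborel (\<lambda>\<alpha>. rR (c + \<alpha>) * indicator {-h..h} \<alpha>)"
  and e: "(LINT t|lborel. rR t * indicator {c - h..c + h} t) = (LINT \<alpha>|lborel. rR (c + \<alpha>) * indicator {-h..h} \<alpha>)" for c
 proof -
  have ind: "indicator {c - h..c + h} (c + 1 * \<alpha>) = (indicator {-h..h} \<alpha> :: real)" for \<alpha>
   by (auto simp: indicator_def)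
  show "integrable lborel (\<lambda>\<alpha>. rR (c + \<alpha>) * indicator {-h..h} \<alpha>)"
   using lborel_integrable_real_affine_iff[of 1 "\<lambda>t. rR t * indicator {c - h..c + h} t" c] i1[of c] unfolding ind by simp
  show "(LINT t|lborel. rR t * indicator {c - h..c + h} t) = (LINT \<alpha>|lborel. rR (c + \<alpha>) * indicator {-h..h} \<alpha>)"
   using lborel_integral_real_affine[of 1 "\<lambda>t. rR t * indicator {c - h..c + h} t" c] unfolding ind by simp
 qed
 have "(LINT t|lborel. rR t * indicator {rT / 2..3 * rT / 2} t) \<le> (LINT t|lborel. (\<Sum>c\<in>Z. rR t * indicator {c - h..c + h} t))"
 proof (rule integral_mono)
  show "integrable lborel (\<lambda>t. rR t * indicator {rT / 2..3 * rT / 2} t)"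
   by (intro integrable_real_mult_indicator resonator_resonance_integrable) simp
  show "integrable lborel (\<lambda>t. \<Sum>c\<in>Z. rR t * indicator {c - h..c + h} t)"
   by (intro Bochner_Integration.integrable_sum i1)
  fix t
  have s0: "0 \<le> (\<Sum>c\<in>Z. rR t * indicator {c - h..c + h} t)" by (intro sum_nonneg) simp
  show "rR t * indicator {rT / 2..3 * rT / 2} t \<le> (\<Sum>c\<in>Z. rR t * indicator {c - h..c + h} t)"
  proof (cases "t \<in> {rT / 2..3 * rT / 2}")
   case True
   then obtain c where c: "c \<in> Z" "\<bar>t - c\<bar> \<le> h" using cov by blast
   then have "rR t * indicator {rT / 2..3 * rT / 2} t = rR t * indicator {c - h..c + h} t" using True by (auto simp: indicator_def)
   also have "\<dots> \<le> (\<Sum>c\<in>Z. rR t * indicator {c - h..c + h} t)" by (rule member_le_sum[OF c(1) _ Z]) simp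
   finally show ?thesis .
  qed (use s0 in simp)
 qed
 also have "\<dots> = (\<Sum>c\<in>Z. LINT t|lborel. rR t * indicator {c - h..c + h} t)" by (rule Bochner_Integration.integral_sum[OF i1])
 also have "\<dots> = (\<Sum>c\<in>Z. LINT \<alpha>|lborel. rR (c + \<alpha>) * indicator {-h..h} \<alpha>)" by (simp only: e)
 also have "\<dots> = (LINT \<alpha>|lborel. (\<Sum>c\<in>Z. rR (c + \<alpha>) * indicator {-h..h} \<alpha>))" by (rule Bochner_Integration.integral_sum[OF i2, symmetric])
 finally show ?thesis by (simp only: sum_distrib_right)
qed

end

subsection \<open>Windows without zeros\<close>

text \<open>The Taylor polynomial gives cos 1.56 > 0 and cos 1.571 < 0, which locates \<pi> / 2
  between these points.\<close>

lemma pi_bounds: "pi > 312 / 100" "pi < 3142 / 1000"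
proof -
 have s: "{..<6} = {0, 1, 2, 3, 4, 5::nat}" by auto
 have lo: "(\<Sum>k<6. (- 1) ^ k * x ^ (2 * k) / fact (2 * k)) - x ^ 12 / fact 12 \<le> cos x"
  and up: "cos x \<le> (\<Sum>k<6. (- 1) ^ k * x ^ (2 * k) / fact (2 * k)) + x ^ 12 / fact 12" for x :: real
  using cos_taylor_bound[of x] by linarith+
 have "cos (156 / 100 :: real) > 0"
  using lo[of "156 / 100"] by (simp add: s fact_numeral power_divide)
 moreover have "cos (156 / 100 :: real) \<le> cos (pi / 2)" if "pi / 2 \<le> 156 / 100"
  using that pi_ge_two by (intro cos_monotone_0_pi_le) auto
 ultimately have "\<not> pi / 2 \<le> 156 / 100" by auto
 then show "pi > 312 / 100" by simp
 have "cos (1571 / 1000 :: real) < 0"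
  using up[of "1571 / 1000"] by (simp add: s fact_numeral power_divide)
 moreover have "cos (1571 / 1000 :: real) \<ge> 0" if "1571 / 1000 \<le> pi / 2"
  using that by (intro cos_ge_zero) auto
 ultimately have "\<not> 1571 / 1000 \<le> pi / 2" by auto
 then show "pi < 3142 / 1000" by simp
qed

text \<open>The covering bounds the mass by the integral of \<open>resonator_zero_sum\<close> over
  |\<alpha>| \<le> h, whose main terms are w N / \<pi> from the Gamma part and the primitive of
  \<open>cos_weight_poly\<close> from the primes, both up to the factor B. Here w tends to 2.005 *
  4.77, and G collects all doubly exponentially small errors. The common factor S is divided out at
  the end.\<close>

lemma resonator_contradiction:
 fixes Y :: real and z :: nat
 assumes Y: "Y \<ge> 5" and z: "z > 0"
  and RH: "\<And>p. riemann_xi p = 0 \<Longrightarrow> Re p = 1 / 2"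
  and low: "\<And>\<alpha>. \<bar>\<alpha>\<bar> * Y \<le> 5 \<Longrightarrow> resonator_prime_sum (fact z) Y \<alpha> \<ge> (rough_divisor_sum (fact z) Y)\<^sup>2 *
   (2 * sqrt 2 * (Y * (cos_weight_poly (\<alpha> * Y) - 12 / real z)) - C)"
  and cov: "\<And>t. t \<in> {heightT Y / 2..3 * heightT Y / 2} \<Longrightarrow> \<exists>c. riemann_xi (Complex (1 / 2) c) = 0 \<and> \<bar>t - c\<bar> \<le> 477 / 100 / Y"
 defines "G \<equiv> exp (4 + 10 * Y) * small_exp Y" and "w \<equiv> 477 / 100 / Y * (ln (2 + heightT Y) + 67)"
 assumes w: "w \<ge> pi"
 shows "pi \<le> w + G * (3 * pi + 10 * pi * (3 + mangoldt_square_sum) + w) + 477 / 50 * (24 * sqrt 2 / real z + \<bar>C\<bar> / Y) - 4 * sqrt 2 * cos_weight_primitive (477 / 100)"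
proof -
 let ?T = "heightT Y"
 define P :: nat where "P = fact z"
 define a :: real where "a = 477 / 100"
 define h where "h = a / Y"
 define B where "B = sqrt pi * widthD Y"
 define R where "R = resonance (resonator_pairs Y) (resonator_coeff P) frac_log ?T (widthD Y)"
 define M where "M = (LINT t|lborel. R t)"
 define N where "N = resonator_diagonal P Y 1"
 define S where "S = (rough_divisor_sum P Y)\<^sup>2"
 define J where "J = cos_weight_primitive a"
 define l where "l = ln (2 + ?T) + 67"
 define Q where "Q = mangoldt_square_sum"
 have a5: "0 < a" "a \<le> 5" by (simp_all add: a_def)
 have h: "0 < h" "h \<le> 1" "h * Y = a" using Y a5 by (simp_all add: h_def)
 have Q0: "Q \<ge> 0" by (simp add: Q_def mangoldt_square_sum_nonneg)
 have G0: "G > 0" by (simp add: G_def)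
 have T2: "?T \<ge> 2" using Y by (rule resonator_heightT_ge)
 have l0: "l \<ge> 0" using T2 by (simp add: l_def)
 have B1: "B \<ge> 1"
 proof -
  have "1 * 1 \<le> sqrt pi * widthD Y" using resonator_width_ge[OF Y] pi_ge_two by (intro mult_mono) auto
  then show ?thesis by (simp add: B_def)
 qed
 have N: "N \<le> S" "N \<ge> 1" unfolding N_def S_def using resonator_diagonal_1_le resonator_diagonal_1_ge[of Y P] Y by auto
 have S1: "S \<ge> 1" using N by linarith
 have small: "exp (c + d * Y) * small_exp Y \<le> G" if "c \<le> 4" "d \<le> 10" for c d
 proof -
  have "d * Y \<le> 10 * Y" using that Y by (intro mult_right_mono) auto
  then show ?thesis unfolding G_def using that by (intro mult_right_mono) auto
 qed
 define e1 where "e1 = exp (1 + 5 * Y) * small_exp Y"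
 define e2 where "e2 = exp (4 * Y) * small_exp Y"
 define e3 where "e3 = exp (2 + 8 * Y) * small_exp Y"
 have e: "0 \<le> e1" "e1 \<le> G" "0 \<le> e2" "e2 \<le> G" "0 \<le> e3" "e3 \<le> G"
  using small[of 1 5] small[of 0 4] small[of 2 8] by (simp_all add: e1_def e2_def e3_def)
 have mass: "\<bar>M - B * N\<bar> \<le> B * e3" using resonator_mass[OF Y, of P] by (simp add: M_def R_def B_def N_def e3_def)
 have Be3: "B * e3 \<le> B * G" using e B1 by (intro mult_left_mono) auto
 have M: "M \<le> B * (N + G)" "M \<ge> B * (N - G)" using mass Be3 by (simp_all add: distrib_left right_diff_distrib)
 \<comment> \<open>An ordinate within h \<le> 1 of the window is at most 3 T / 2 + 1 \<le> 2
   T.\<close>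
 define Z where "Z = Im ` {p. riemann_xi p = 0 \<and> \<bar>Im p\<bar> \<le> 2 * ?T}"
 have Zf: "finite Z" unfolding Z_def by (intro finite_imageI finite_xi_zeros)
 have Zx: "riemann_xi (Complex (1 / 2) c) = 0" if c: "c \<in> Z" for c
 proof -
  obtain p where p: "riemann_xi p = 0" "c = Im p" using c by (auto simp: Z_def)
  then have "Complex (1 / 2) c = p" using RH[of p] by (simp add: complex_eq_iff)
  then show ?thesis using p by simp
 qed
 have Zc: "\<exists>c\<in>Z. \<bar>t - c\<bar> \<le> h" if t: "t \<in> {?T / 2..3 * ?T / 2}" for t
 proof -
  obtain c where c: "riemann_xi (Complex (1 / 2) c) = 0" "\<bar>t - c\<bar> \<le> h" using cov[OF t] by (auto simp: h_def a_def)
  have "\<bar>c\<bar> \<le> 2 * ?T" using c(2) t T2 h(2) by auto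
  then have "c \<in> Z" unfolding Z_def using c(1) by (intro image_eqI[of _ _ "Complex (1 / 2) c"]) auto
  then show ?thesis using c by blast
 qed
 \<comment> \<open>Collects everything in the bound for the zero sum that does not depend on
   \<alpha>, so that only \<open>cos_weight_poly\<close> remains to be integrated.\<close>
 define v0 where "v0 = 3 * G + Q * G + l * (N + G) / (2 * pi) + S * (24 * sqrt 2 * Y / real z + C) / pi"
 define k where "k = 2 * sqrt 2 * S / pi"
 have zs: "(\<Sum>c\<in>Z. R (c + \<alpha>)) \<le> B * (v0 - k * (Y * cos_weight_poly (\<alpha> * Y)))" if \<alpha>: "\<alpha> \<in> {-h..h}" for \<alpha>
 proof -
  have a1: "\<bar>\<alpha>\<bar> \<le> h" using \<alpha> by auto
  then have "\<bar>\<alpha>\<bar> * Y \<le> h * Y" using Y by (intro mult_right_mono) auto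
  then have aY: "\<bar>\<alpha>\<bar> * Y \<le> 5" using h a5 by simp
  define L where "L = S * (2 * sqrt 2 * (Y * (cos_weight_poly (\<alpha> * Y) - 12 / real z)) - C)"
  have L: "L \<le> resonator_prime_sum P Y \<alpha>" using low[OF aY] by (simp add: L_def S_def P_def)
  have "\<bar>\<alpha>\<bar> \<le> 1" using a1 h(2) by linarith
  from resonator_zero_sum[OF Y RH Zf Zx this, of P]
  have "(\<Sum>c\<in>Z. R (c + \<alpha>)) \<le> 2 * e1 + (l * M + e2 * (2 * B)) / (2 * pi) - B * (resonator_prime_sum P Y \<alpha> - e3 * Q) / pi"
   by (simp add: R_def M_def B_def l_def e1_def e2_def e3_def Q_def)
  also have "\<dots> \<le> 2 * (B * G) + (l * (B * (N + G)) + G * (2 * B)) / (2 * pi) - B * (L - G * Q) / pi"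
  proof (intro add_mono diff_mono divide_right_mono mult_left_mono mult_right_mono)
   have "1 * G \<le> B * G" using B1 G0 by (intro mult_right_mono) auto
   then show "e1 \<le> B * G" using e by linarith
  qed (use e L Q0 l0 M B1 in auto)
  also have "\<dots> = B * (2 * G + l * (N + G) / (2 * pi) + G / pi + G * Q / pi - L / pi)"
   by (simp add: field_simps)
  also have "\<dots> \<le> B * (v0 - k * (Y * cos_weight_poly (\<alpha> * Y)))"
  proof (rule mult_left_mono)
   have "G / pi \<le> G / 1" using G0 pi_ge_two by (intro divide_left_mono) auto
   moreover have "G * Q / pi \<le> G * Q / 1" using G0 Q0 pi_ge_two by (intro divide_left_mono) auto
   moreover have "L / pi = k * (Y * cos_weight_poly (\<alpha> * Y)) - S * (24 * sqrt 2 * Y / real z + C) / pi"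
    unfolding L_def k_def by (simp add: diff_divide_distrib add_divide_distrib algebra_simps)
   ultimately show "2 * G + l * (N + G) / (2 * pi) + G / pi + G * Q / pi - L / pi \<le> v0 - k * (Y * cos_weight_poly (\<alpha> * Y))"
    unfolding v0_def by (simp add: mult.commute)
  qed (use B1 in simp)
  finally show ?thesis .
 qed
 have Rc: "isCont (\<lambda>\<alpha>. R (c + \<alpha>)) x" for c x
 proof -
  have "continuous_on UNIV (\<lambda>\<alpha>. R (c + \<alpha>))"
   unfolding R_def by (intro continuous_on_compose2[OF resonance_continuous[of UNIV]] continuous_intros) auto
  then show ?thesis by (simp add: continuous_on_eq_continuous_at)
 qed
 have pc: "isCont (\<lambda>\<alpha>. cos_weight_poly (\<alpha> * Y)) x" for x
  unfolding cos_weight_poly_def by (intro continuous_intros) auto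
 let ?V = "\<lambda>\<alpha>. B * (v0 - k * (Y * cos_weight_poly (\<alpha> * Y)))"
 have "(LINT \<alpha>|lborel. (\<Sum>c\<in>Z. R (c + \<alpha>)) * indicator {-h..h} \<alpha>) \<le> (LINT \<alpha>|lborel. ?V \<alpha> * indicator {-h..h} \<alpha>)"
 proof (rule integral_mono)
  show "integrable lborel (\<lambda>\<alpha>. (\<Sum>c\<in>Z. R (c + \<alpha>)) * indicator {-h..h} \<alpha>)"
   by (intro borel_integrable_atLeastAtMost continuous_intros Rc)
  show "integrable lborel (\<lambda>\<alpha>. ?V \<alpha> * indicator {-h..h} \<alpha>)"
   by (intro borel_integrable_atLeastAtMost continuous_intros pc)
  show "(\<Sum>c\<in>Z. R (c + \<alpha>)) * indicator {-h..h} \<alpha> \<le> ?V \<alpha> * indicator {-h..h} \<alpha>" for \<alpha>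
   using zs[of \<alpha>] by (cases "\<alpha> \<in> {-h..h}") auto
 qed
 also have "\<dots> = B * (v0 * h - k * cos_weight_primitive (h * Y)) - B * (v0 * (- h) - k * cos_weight_primitive ((- h) * Y))"
 proof (rule integral_FTC_Icc_real)
  show "- h \<le> h" using h by simp
  show "isCont ?V x" for x by (intro continuous_intros pc)
  show "((\<lambda>\<alpha>. B * (v0 * \<alpha> - k * cos_weight_primitive (\<alpha> * Y))) has_real_derivative ?V x) (at x)" for x
   by (rule derivative_eq_intros DERIV_chain2[OF cos_weight_primitive_deriv] refl | simp)+
 qed
 also have "(- h) * Y = - (h * Y)" by simp
 also have "B * (v0 * h - k * cos_weight_primitive (h * Y)) - B * (v0 * (- h) - k * cos_weight_primitive (- (h * Y))) = B * (2 * h * v0 - 2 * k * J)"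
  unfolding cos_weight_primitive_minus h(3) J_def by (simp add: algebra_simps)
 finally have int: "(LINT \<alpha>|lborel. (\<Sum>c\<in>Z. R (c + \<alpha>)) * indicator {-h..h} \<alpha>) \<le> B * (2 * h * v0 - 2 * k * J)" .
 have "M \<le> (LINT t|lborel. R t * indicator {?T / 2..3 * ?T / 2} t) + e2 * (2 * B)"
  using resonator_mass_window[OF Y, of P] by (simp add: M_def R_def e2_def B_def)
 also have "(LINT t|lborel. R t * indicator {?T / 2..3 * ?T / 2} t) \<le> (LINT \<alpha>|lborel. (\<Sum>c\<in>Z. R (c + \<alpha>)) * indicator {-h..h} \<alpha>)"
  unfolding R_def by (rule resonator_covering[OF Y Zf Zc])
 also note int
 also have "e2 * (2 * B) \<le> G * (2 * B)" using e B1 by (intro mult_right_mono) auto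
 finally have "M \<le> B * (2 * h * v0 - 2 * k * J) + G * (2 * B)" by simp
 then have "B * (N - G) \<le> B * (2 * h * v0 - 2 * k * J + 2 * G)" using M(2) by (simp add: algebra_simps)
 then have n1: "N - G \<le> 2 * h * v0 - 2 * k * J + 2 * G" using B1 by simp
 have wl: "w = h * l" by (simp add: w_def h_def a_def l_def)
 have pv: "pi * (2 * h * v0) = 2 * h * pi * (3 + Q) * G + w * (N + G) + S * (2 * (24 * sqrt 2 * a / real z + C * h))"
 proof -
  have "pi * (2 * h * v0) = 2 * h * pi * (3 + Q) * G + 2 * h * (pi * (l * (N + G) / (2 * pi))) + 2 * h * (pi * (S * (24 * sqrt 2 * Y / real z + C) / pi))"
   unfolding v0_def by (simp add: algebra_simps)
  also have "2 * h * (pi * (l * (N + G) / (2 * pi))) = w * (N + G)" unfolding wl by simp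
  also have "2 * h * (pi * (S * (24 * sqrt 2 * Y / real z + C) / pi)) = S * (2 * (24 * sqrt 2 * (h * Y) / real z + C * h))"
  proof -
   have "2 * h * (pi * (S * x / pi)) = S * (2 * (h * x))" for x by simp
   moreover have "h * (24 * sqrt 2 * Y / real z + C) = 24 * sqrt 2 * (h * Y) / real z + C * h" by (simp add: algebra_simps)
   ultimately show ?thesis by (simp only:)
  qed
  finally show ?thesis unfolding h(3) .
 qed
 have pk: "pi * (2 * k * J) = 4 * sqrt 2 * S * J" by (simp add: k_def)
 have "pi * (N - G) \<le> pi * (2 * h * v0 - 2 * k * J + 2 * G)" by (intro mult_left_mono n1) simp
 then have "pi * N - pi * G \<le> pi * (2 * h * v0) - pi * (2 * k * J) + 2 * pi * G" by (simp add: algebra_simps)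
 then have n2: "pi * N - w * N \<le> (3 * pi * G + 2 * h * pi * (3 + Q) * G + w * G) + S * (2 * (24 * sqrt 2 * a / real z + C * h) - 4 * sqrt 2 * J)"
  unfolding pv pk by (simp add: algebra_simps)
 \<comment> \<open>As w \<ge> \<pi>, the inequality N \<le> S has the right direction: the diagonal
   mass can be replaced by the full square of the divisor sum, in which the prime sum is
   measured.\<close>
 have "(w - pi) * N \<le> (w - pi) * S" using w N by (intro mult_left_mono) auto
 then have n3: "pi * S - w * S \<le> pi * N - w * N" by (simp add: algebra_simps)
 have "h * (pi * (3 + Q) * G) \<le> 5 * (pi * (3 + Q) * G)" using h(2) Q0 G0 by (intro mult_right_mono) auto
 then have n4: "3 * pi * G + 2 * h * pi * (3 + Q) * G + w * G \<le> G * (3 * pi + 10 * pi * (3 + Q) + w)" by (simp add: algebra_simps)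
 also have "\<dots> \<le> G * (3 * pi + 10 * pi * (3 + Q) + w) * S"
 proof -
  have "0 \<le> w" using w pi_ge_zero by linarith
  then have "0 \<le> G * (3 * pi + 10 * pi * (3 + Q) + w)" using G0 Q0 by (intro mult_nonneg_nonneg add_nonneg_nonneg) auto
  then show ?thesis using mult_left_mono[OF S1] by simp
 qed
 finally have "S * pi \<le> S * (w + G * (3 * pi + 10 * pi * (3 + Q) + w) + (2 * (24 * sqrt 2 * a / real z + C * h) - 4 * sqrt 2 * J))"
  using n2 n3 by (simp add: algebra_simps)
 then have "pi \<le> w + G * (3 * pi + 10 * pi * (3 + Q) + w) + (2 * (24 * sqrt 2 * a / real z + C * h) - 4 * sqrt 2 * J)" using S1 by simp
 also have "2 * (24 * sqrt 2 * a / real z + C * h) \<le> 2 * (24 * sqrt 2 * a / real z + \<bar>C\<bar> * h)" using h by (intro mult_left_mono add_left_mono mult_right_mono) auto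
 also have "\<dots> = 477 / 50 * (24 * sqrt 2 / real z + \<bar>C\<bar> / Y)" by (simp add: a_def h_def field_simps)
 finally show ?thesis by (simp add: J_def a_def Q_def)
qed

text \<open>In \<open>resonator_contradiction\<close>, w tends to 4.77 * 2.005 = 9.56385 and 4 sqrt
  2 * 1.144 exceeds 6.471. With z = 20000 the loss from small primes is at most 0.017 and the other
  errors are below 0.001, so the right side is below 3.113, while \<pi> > 3.12.\<close>

theorem exists_large_zero_free_window:
 assumes RH: "\<And>p. riemann_xi p = 0 \<Longrightarrow> Re p = 1 / 2"
 shows "\<forall>\<^sub>F Y in at_top. \<exists>t\<in>{heightT Y / 2..3 * heightT Y / 2}. \<forall>c. riemann_xi (Complex (1 / 2) c) = 0 \<longrightarrow> \<bar>t - c\<bar> > 477 / 100 / Y"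
proof -
 obtain z :: nat where z: "z > 0" "1 / real z \<le> 1 / 20000"
 proof
  show "20000 > (0::nat)" by simp
 qed simp
 obtain C Y0 where low: "\<And>Y \<alpha>. Y \<ge> Y0 \<Longrightarrow> \<bar>\<alpha>\<bar> * Y \<le> 5 \<Longrightarrow> resonator_prime_sum (fact z) Y \<alpha> \<ge> (rough_divisor_sum (fact z) Y)\<^sup>2 *
   (2 * sqrt 2 * (Y * (cos_weight_poly (\<alpha> * Y) - 12 / real z)) - C)"
  using resonator_prime_sum_lower[OF z(1)] by blast
 define G where "G = (\<lambda>Y. exp (4 + 10 * Y) * small_exp Y)"
 define w where "w = (\<lambda>Y. 477 / 100 / Y * (ln (2 + heightT Y) + 67))"
 define K where "K = 3 * pi + 10 * pi * (3 + mangoldt_square_sum) + 10"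
 have wlim: "(w \<longlongrightarrow> 477 / 100 * (401 / 200)) at_top"
  unfolding w_def heightT_def by real_asymp
 have Glim: "(G \<longlongrightarrow> 0) at_top" unfolding G_def small_exp_def by real_asymp
 have "((\<lambda>Y. G Y * K + 477 / 50 * (\<bar>C\<bar> / Y)) \<longlongrightarrow> 0 * K + 477 / 50 * 0) at_top"
  by (intro tendsto_intros Glim tendsto_divide_0[OF tendsto_const] filterlim_at_top_imp_at_infinity filterlim_ident)
 then have "\<forall>\<^sub>F Y in at_top. G Y * K + 477 / 50 * (\<bar>C\<bar> / Y) < 1 / 1000" by (intro order_tendstoD(2)) auto
 moreover have "\<forall>\<^sub>F Y in at_top. w Y < 9566 / 1000" by (rule order_tendstoD(2)[OF wlim]) simp
 moreover have "\<forall>\<^sub>F Y in at_top. w Y > 9" by (rule order_tendstoD(1)[OF wlim]) simp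
 moreover have "\<forall>\<^sub>F Y in at_top. Y \<ge> max 5 Y0" by (rule eventually_ge_at_top)
 ultimately show ?thesis
 proof eventually_elim
  case (elim Y)
  show ?case
  proof (rule ccontr)
   assume neg: "\<not> (\<exists>t\<in>{heightT Y / 2..3 * heightT Y / 2}. \<forall>c. riemann_xi (Complex (1 / 2) c) = 0 \<longrightarrow> \<bar>t - c\<bar> > 477 / 100 / Y)"
   have cov: "\<exists>c. riemann_xi (Complex (1 / 2) c) = 0 \<and> \<bar>t - c\<bar> \<le> 477 / 100 / Y" if "t \<in> {heightT Y / 2..3 * heightT Y / 2}" for t
    using neg that by (meson not_le)
   have "pi \<le> w Y + G Y * (3 * pi + 10 * pi * (3 + mangoldt_square_sum) + w Y) + 477 / 50 * (24 * sqrt 2 / real z + \<bar>C\<bar> / Y) - 4 * sqrt 2 * cos_weight_primitive (477 / 100)"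
    unfolding w_def G_def
   proof (rule resonator_contradiction[OF _ z(1) RH low cov])
    show "pi \<le> 477 / 100 / Y * (ln (2 + heightT Y) + 67)" using elim(3) pi_bounds(2) by (simp add: w_def)
   qed (use elim in auto)
   moreover have "G Y * (3 * pi + 10 * pi * (3 + mangoldt_square_sum) + w Y) \<le> G Y * K"
    using elim by (intro mult_left_mono) (auto simp: K_def G_def)
   moreover have "477 / 50 * (24 * sqrt 2 / real z + \<bar>C\<bar> / Y) = 477 / 50 * (24 * sqrt 2 / real z) + 477 / 50 * (\<bar>C\<bar> / Y)" by (rule distrib_left)
   moreover have "477 / 50 * (24 * sqrt 2 / real z) \<le> 17 / 1000"
   proof -
    have "sqrt 2 \<le> 14143 / 10000" by (rule real_le_lsqrt) (auto simp: power2_eq_square)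
    then have "24 * sqrt 2 * (1 / real z) \<le> 24 * (14143 / 10000) * (1 / 20000)" using z by (intro mult_mono) auto
    then show ?thesis by simp
   qed
   moreover have "4 * sqrt 2 * cos_weight_primitive (477 / 100) \<ge> 4 * (14142 / 10000) * (1144 / 1000)"
   proof -
    have "sqrt 2 \<ge> 14142 / 10000" by (rule real_le_rsqrt) (auto simp: power2_eq_square)
    then show ?thesis using cos_weight_primitive_value by (intro mult_mono) auto
   qed
   ultimately show False using elim pi_bounds(1) by linarith
  qed
 qed
qed

subsection \<open>Ordinates of zeros\<close>

text \<open>If the ordinates were bounded above, then by conjugation there would be finitely many
  zeros, and the zero side of the explicit formula with a Gaussian of width 1 about T would stay
  bounded. The Gamma side, however, grows like ln T.\<close>

lemma xi_zeros_unbounded: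
 assumes RH: "\<And>p. riemann_xi p = 0 \<Longrightarrow> Re p = 1 / 2"
 shows "\<exists>c>U. riemann_xi (Complex (1 / 2) c) = 0"
proof (rule ccontr)
 assume "\<not> (\<exists>c>U. riemann_xi (Complex (1 / 2) c) = 0)"
 then have no: "c \<le> U" if "riemann_xi (Complex (1 / 2) c) = 0" for c using that by (meson not_le)
 define A where "A = {p. riemann_xi p = 0}"
 have A: "\<bar>Im p\<bar> \<le> U" "p = Complex (1 / 2) (Im p)" if p: "riemann_xi p = 0" for p
 proof -
  show e: "p = Complex (1 / 2) (Im p)" using RH[OF p] by (simp add: complex_eq_iff)
  have "riemann_xi (cnj p) = 0" by (simp add: riemann_xi_cnj p)
  moreover have "cnj p = Complex (1 / 2) (- Im p)" using RH[OF p] by (simp add: complex_eq_iff)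
  ultimately show "\<bar>Im p\<bar> \<le> U" using no[of "Im p"] no[of "- Im p"] p e by (simp add: abs_le_iff)
 qed
 define Kc where "Kc = (\<Sum>p\<in>A. \<bar>real_of_int (zorder riemann_xi p)\<bar>)"
 define c where "c = sqrt pi * exp (9 / 4)"
 define W where "W = (66 + ln pi) * sqrt pi"
 define C0 where "C0 = Kc + 2 * exp (1 / 4) + c * mangoldt_square_sum / pi"
 have main: "(2 * exp (- 1) * X - W) / (2 * pi) \<le> C0" if X: "X \<ge> 0" for X
 proof -
  \<comment> \<open>Then ln (1 + |y / 2|) \<ge> X on all of [T - 1, T + 1], where the Gaussian is at
    least exp (-1).\<close>
  define T where "T = 4 * exp X"
  have T: "T \<ge> 4" using X by (simp add: T_def)
  \<comment> \<open>One coefficient 1 with frequency 0: the resonance reduces to the plain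
    Gaussian.\<close>
  define K :: "unit set" where "K = {()}"
  define R where "R = resonance K (\<lambda>_. 1) (\<lambda>_. 0) T 1"
  let ?F = "\<lambda>s. resonance_test K (\<lambda>_. 1) (\<lambda>_. 0) T 1 (s + \<i> * of_real 0)"
  let ?r = "resonance_prime_term K (\<lambda>_. 1) (\<lambda>_. 0) T 1 0"
  have R: "R t = exp (- (1 * (t - T)\<^sup>2))" for t by (simp add: R_def K_def resonance_def)
  have F: "?F s = gauss_monomial T 1 0 s" for s by (simp add: K_def resonance_test_def)
  define G where "G = (LINT y|lborel. (Re (Digamma (Complex (1 / 4) (y / 2))) - ln pi) * R (y + 0))"
  have K: "finite K" by (simp add: K_def)
  obtain V where V: "filterlim V at_top sequentially"
   and lim: "(\<lambda>n::nat. \<Sum>p | riemann_xi p = 0 \<and> \<bar>Im p\<bar> < V n. Re (?F p) * of_int (zorder riemann_xi p)) \<longlonglongrightarrow>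
    Re (?F 0) + Re (?F 1) + G / (2 * pi) - (\<Sum>n. ?r (Suc n)) / pi"
   using resonance_explicit_formula(1)[OF zero_less_one K, of "\<lambda>_. 1" "\<lambda>_. 0" T 0] unfolding G_def R_def by blast
  have "eventually (\<lambda>n. V n \<ge> U + 1) sequentially" using V by (simp add: filterlim_at_top)
  then have "eventually (\<lambda>n. (\<Sum>p | riemann_xi p = 0 \<and> \<bar>Im p\<bar> < V n. Re (?F p) * of_int (zorder riemann_xi p)) \<le> Kc) sequentially"
  proof eventually_elim
   case (elim n)
   have e: "{p. riemann_xi p = 0 \<and> \<bar>Im p\<bar> < V n} = A" unfolding A_def using A(1) elim by force
   show ?case unfolding e Kc_def
   proof (rule sum_mono)
    fix p assume "p \<in> A"
    then have "p = Complex (1 / 2) (Im p)" using A(2) by (simp add: A_def)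
    then have "?F p = of_real (R (Im p))" using resonance_test_half[of K "\<lambda>_. 1" "\<lambda>_. 0" T 1 "Im p"] by (simp add: R_def)
    then have "\<bar>Re (?F p)\<bar> \<le> 1" by (simp add: R)
    then have "\<bar>Re (?F p)\<bar> * \<bar>real_of_int (zorder riemann_xi p)\<bar> \<le> 1 * \<bar>real_of_int (zorder riemann_xi p)\<bar>" by (intro mult_right_mono) auto
    then show "Re (?F p) * of_int (zorder riemann_xi p) \<le> \<bar>real_of_int (zorder riemann_xi p)\<bar>"
     using abs_ge_self[of "Re (?F p) * of_int (zorder riemann_xi p)"] unfolding abs_mult by linarith
   qed
  qed
  then have up: "Re (?F 0) + Re (?F 1) + G / (2 * pi) - (\<Sum>n. ?r (Suc n)) / pi \<le> Kc"
   by (intro tendsto_upperbound[OF lim]) auto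
  have end_le: "\<bar>Re (?F s)\<bar> \<le> exp (1 / 4)" if s: "s = Complex 0 0 \<or> s = Complex 1 0" for s
  proof -
   have "\<bar>Re (?F s)\<bar> \<le> norm (gauss_monomial T 1 0 s)" unfolding F by (rule abs_Re_le_cmod)
   also have "\<dots> \<le> exp (1 / 4)" using s by (auto simp: norm_gauss_monomial power2_eq_square)
   finally show ?thesis .
  qed
  have ends: "Re (?F 0) \<ge> - exp (1 / 4)" "Re (?F 1) \<ge> - exp (1 / 4)"
   using end_le[of 0] end_le[of 1] by (simp_all add: complex_eq_iff)
  have pr: "(\<Sum>n. ?r (Suc n)) \<le> c * mangoldt_square_sum"
  proof -
   have sm: "summable (\<lambda>n. mangoldt (Suc n) / (real (Suc n))\<^sup>2)" using summable_mangoldt_square by (subst summable_Suc_iff)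
   have ms: "(\<Sum>n. mangoldt (Suc n) / (real (Suc n))\<^sup>2) = mangoldt_square_sum"
    unfolding mangoldt_square_sum_def using suminf_split_head[OF summable_mangoldt_square] by simp
   have t: "?r (Suc n) \<le> c * (mangoldt (Suc n) / (real (Suc n))\<^sup>2)" for n
   proof -
    define L where "L = ln (real (Suc n))"
    have "0 \<le> (L / 2 - 3 / 2)\<^sup>2" by simp
    then have "- (L / 2) - L\<^sup>2 / 4 \<le> 9 / 4 - 2 * L" by (simp add: power2_eq_square algebra_simps)
    then have "exp (- (L / 2) - L\<^sup>2 / 4) \<le> exp (9 / 4 - 2 * L)" by simp
    also have "\<dots> = exp (9 / 4) / (real (Suc n))\<^sup>2" unfolding exp_diff exp_double L_def by simp
    finally have el: "exp (- (L / 2) - L\<^sup>2 / 4) \<le> exp (9 / 4) / (real (Suc n))\<^sup>2" .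
    have "Re (gauss_value T 1 0 (Suc n) 0) \<le> norm (gauss_value T 1 0 (Suc n) 0)" by (rule complex_Re_le_cmod)
    also have "\<dots> = sqrt pi * exp (- (L / 2) - L\<^sup>2 / 4)"
     unfolding gauss_value_def norm_mult norm_exp_i_times norm_of_real L_def by (simp add: abs_mult)
    also have "\<dots> \<le> sqrt pi * (exp (9 / 4) / (real (Suc n))\<^sup>2)" by (intro mult_left_mono el) simp
    finally have "mangoldt (Suc n) * Re (gauss_value T 1 0 (Suc n) 0) \<le> mangoldt (Suc n) * (sqrt pi * (exp (9 / 4) / (real (Suc n))\<^sup>2))"
     by (rule mult_left_mono) (rule mangoldt_nonneg)
    then show ?thesis by (simp add: resonance_prime_term_def K_def c_def mult_ac del: of_nat_Suc)
   qed
   have "(\<Sum>n. ?r (Suc n)) \<le> (\<Sum>n. c * (mangoldt (Suc n) / (real (Suc n))\<^sup>2))"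
    by (rule suminf_le[OF t sums_summable[OF resonance_mangoldt_sums(3)[OF zero_less_one K]] summable_mult[OF sm]])
   then show ?thesis unfolding suminf_mult[OF sm] ms .
  qed
  have G: "2 * exp (- 1) * X - W \<le> G"
  proof -
   have iR: "integrable lborel (\<lambda>y. (66 + ln pi) * R y)" unfolding R by (rule gauss_shift_integral(1)) simp
   have iI: "integrable lborel (\<lambda>y. exp (- 1) * X * indicator {T - 1..T + 1} y)"
    by (rule integrable_mult_right) (simp add: integrable_indicator_iff)
   have lp: "ln pi \<ge> 0" using pi_ge_two by (intro ln_ge_zero) linarith
   have "2 * exp (- 1) * X - W = (LINT y|lborel. exp (- 1) * X * indicator {T - 1..T + 1} y) - (LINT y|lborel. (66 + ln pi) * R y)"
   proof -
    have "(LINT y|lborel. R y) = sqrt pi" unfolding R using gauss_shift_integral(2)[of 1 T] by simp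
    then show ?thesis by (simp add: W_def)
   qed
   also have "\<dots> = (LINT y|lborel. exp (- 1) * X * indicator {T - 1..T + 1} y - (66 + ln pi) * R y)"
    by (rule Bochner_Integration.integral_diff[OF iI iR, symmetric])
   also have "\<dots> \<le> G" unfolding G_def
   proof (rule integral_mono[OF Bochner_Integration.integrable_diff[OF iI iR]])
    show "integrable lborel (\<lambda>y. (Re (Digamma (Complex (1 / 4) (y / 2))) - ln pi) * R (y + 0))"
     unfolding R_def by (rule resonance_explicit_formula(2)[OF zero_less_one K])
    fix y :: real
    have R0: "R y \<ge> 0" by (simp add: R)
    have "Re (Digamma (Complex (1 / 4) (y / 2))) \<ge> ln (1 + \<bar>y / 2\<bar>) - 66" using Re_Digamma_bound[of "y / 2"] by linarith
    then have "(ln (1 + \<bar>y / 2\<bar>) - 66 - ln pi) * R y \<le> (Re (Digamma (Complex (1 / 4) (y / 2))) - ln pi) * R y"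
     using R0 by (intro mult_right_mono) auto
    moreover have "exp (- 1) * X * indicator {T - 1..T + 1} y \<le> ln (1 + \<bar>y / 2\<bar>) * R y"
    proof (cases "y \<in> {T - 1..T + 1}")
     case True
     have "exp X \<le> 1 + \<bar>y / 2\<bar>" using True T by (auto simp: T_def)
     then have "ln (exp X) \<le> ln (1 + \<bar>y / 2\<bar>)" by (intro ln_mono) auto
     then have X': "X \<le> ln (1 + \<bar>y / 2\<bar>)" by simp
     have "\<bar>y - T\<bar> \<le> 1" using True by auto
     then have "\<bar>y - T\<bar>\<^sup>2 \<le> 1\<^sup>2" by (intro power_mono) auto
     then have "exp (- 1) \<le> R y" by (simp add: R)
     then have "X * exp (- 1) \<le> ln (1 + \<bar>y / 2\<bar>) * R y" using X X' by (intro mult_mono) auto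
     then show ?thesis using True by (simp add: mult.commute)
    next
     case False
     then show ?thesis using R0 by simp
    qed
    ultimately show "exp (- 1) * X * indicator {T - 1..T + 1} y - (66 + ln pi) * R y \<le> (Re (Digamma (Complex (1 / 4) (y / 2))) - ln pi) * R (y + 0)"
     by (simp add: left_diff_distrib distrib_right)
   qed
   finally show ?thesis .
  qed
  have "(2 * exp (- 1) * X - W) / (2 * pi) \<le> G / (2 * pi)" by (intro divide_right_mono G) simp
  moreover have "(\<Sum>n. ?r (Suc n)) / pi \<le> c * mangoldt_square_sum / pi" by (intro divide_right_mono pr) simp
  ultimately show ?thesis using up ends unfolding C0_def by linarith
 qed
 \<comment> \<open>Chosen so that the left side of \<open>main\<close> is at least |C0| + 1.\<close>
 define X where "X = pi * exp 1 * (\<bar>C0\<bar> + \<bar>W / (2 * pi)\<bar> + 1)"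
 have "X \<ge> 0" by (simp add: X_def)
 then have "(2 * exp (- 1) * X - W) / (2 * pi) \<le> C0" by (rule main)
 moreover have "(2 * exp (- 1) * X - W) / (2 * pi) = (\<bar>C0\<bar> + \<bar>W / (2 * pi)\<bar> + 1) - W / (2 * pi)"
 proof -
  have "2 * exp (- 1) * X = (2 * pi) * (exp (- 1) * exp 1) * (\<bar>C0\<bar> + \<bar>W / (2 * pi)\<bar> + 1)"
   unfolding X_def by (simp only: mult_ac)
  moreover have "exp (- 1) * exp 1 = (1::real)" by (simp add: mult_exp_exp)
  ultimately show ?thesis by (simp add: diff_divide_distrib)
 qed
 ultimately show False by linarith
qed

section \<open>Enumeration of the ordinates under the Riemann hypothesis\<close>

locale riemann_hypothesis =
 assumes xi_zero_Re: "\<And>p. riemann_xi p = 0 \<Longrightarrow> Re p = 1 / 2"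
begin

lemma zeta_zeros_upto_finite: "finite {\<rho> \<in> nontrivial_zeta_zeros. 0 < Im \<rho> \<and> Im \<rho> \<le> T}"
 by (rule finite_subset[OF _ finite_xi_zeros[of T]]) (auto simp: nontrivial_zeta_zeros_eq)

text \<open>The multiplicities in \<open>zeta_zero_count\<close> are those of \<zeta>. That \<zeta>
  is not identically 0 is seen at s = 1/4, which lies in the strip but off the critical
  line.\<close>

lemma zorder_zeta_pos:
 assumes "\<rho> \<in> nontrivial_zeta_zeros" shows "nat (zorder riemann_zeta \<rho>) \<ge> 1"
proof -
 have "riemann_zeta holomorphic_on - {1}"
  by (rule holomorphic_transform[OF holomorphic_zeta_cont]) (simp add: riemann_zeta_eq)
 moreover have "open (- {1::complex})" "connected (- {1::complex})" "\<rho> \<in> - {1}"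
  using assms by (auto simp: nontrivial_zeta_zeros_def intro: connected_punctured_universe)
 moreover have "\<exists>w\<in>- {1}. riemann_zeta w \<noteq> 0"
 proof (rule ccontr)
  assume "\<not> (\<exists>w\<in>- {1}. riemann_zeta w \<noteq> 0)"
  then have "riemann_zeta (Complex (1 / 4) 0) = 0" by (auto simp: complex_eq_iff)
  then have "Complex (1 / 4) 0 \<in> nontrivial_zeta_zeros" by (simp add: nontrivial_zeta_zeros_def)
  then show False using xi_zero_Re[of "Complex (1 / 4) 0"] by (simp add: nontrivial_zeta_zeros_eq)
 qed
 moreover have "riemann_zeta \<rho> = 0" using assms by (simp add: nontrivial_zeta_zeros_def)
 ultimately have "zorder riemann_zeta \<rho> > 0" by (rule log_derivative_limit(3))
 then show ?thesis by simp
qed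

lemma zeta_zero_count_mono: "T \<le> T' \<Longrightarrow> zeta_zero_count T \<le> zeta_zero_count T'"
 unfolding zeta_zero_count_def by (intro sum_mono2 zeta_zeros_upto_finite) auto

lemma zeta_zero_count_unbounded: "\<exists>T. n < zeta_zero_count T"
proof (induction n)
 have step: "\<exists>T'. zeta_zero_count T < zeta_zero_count T'" for T
 proof -
  obtain c where c: "c > max T 0" "riemann_xi (Complex (1 / 2) c) = 0" using xi_zeros_unbounded[OF xi_zero_Re] by blast
  let ?S = "\<lambda>T. {\<rho> \<in> nontrivial_zeta_zeros. 0 < Im \<rho> \<and> Im \<rho> \<le> T}"
  have z: "Complex (1 / 2) c \<in> nontrivial_zeta_zeros" using c by (simp add: nontrivial_zeta_zeros_eq)
  have "zeta_zero_count T < (\<Sum>\<rho>\<in>insert (Complex (1 / 2) c) (?S T). nat (zorder riemann_zeta \<rho>))"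
   using c zorder_zeta_pos[OF z] zeta_zeros_upto_finite[of T] unfolding zeta_zero_count_def by simp
  also have "\<dots> \<le> zeta_zero_count c" unfolding zeta_zero_count_def
   by (intro sum_mono2 zeta_zeros_upto_finite) (use c z in auto)
  finally show ?thesis by blast
 qed
 case 0
 show ?case using step[of 0] by (metis gr_zeroI not_less0)
 case (Suc n)
 then show ?case using step by (meson Suc_lessI less_trans_Suc less_trans Suc_leI le_less_trans)
qed

text \<open>A least real number need not exist in general; here it does because the counting
  function jumps only at ordinates. The minimum is attained within the finite set of ordinates below
  some height \<open>T1\<close> with large enough count.\<close>

lemma zeta_ordinate_least:
 shows "n < zeta_zero_count (zeta_ordinate n)" and "n < zeta_zero_count T \<Longrightarrow> zeta_ordinate n \<le> T"
  and "riemann_xi (Complex (1 / 2) (zeta_ordinate n)) = 0"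
proof -
 let ?S = "\<lambda>T. {\<rho> \<in> nontrivial_zeta_zeros. 0 < Im \<rho> \<and> Im \<rho> \<le> T}"
 obtain T1 where T1: "n < zeta_zero_count T1" using zeta_zero_count_unbounded by blast
 define Or where "Or = {c \<in> Im ` ?S T1. n < zeta_zero_count c}"
 have fin: "finite Or" unfolding Or_def using zeta_zeros_upto_finite[of T1] by auto
 have ex: "\<exists>c\<in>Or. c \<le> T" if T: "n < zeta_zero_count T" "T \<le> T1" for T
 proof -
  have ne: "?S T \<noteq> {}" using T(1) unfolding zeta_zero_count_def by (metis not_less0 sum.empty)
  \<comment> \<open>Lowering T to the highest ordinate not above it leaves the count
    unchanged.\<close>
  define c where "c = Max (Im ` ?S T)"
  have fS: "finite (Im ` ?S T)" using zeta_zeros_upto_finite[of T] by simp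
  have cin: "c \<in> Im ` ?S T" unfolding c_def using fS ne by (intro Max_in) auto
  have "Im \<rho> \<le> c" if "\<rho> \<in> ?S T" for \<rho> unfolding c_def using fS that by (intro Max_ge) auto
  then have "?S c = ?S T" using cin by fastforce
  then have "zeta_zero_count c = zeta_zero_count T" by (simp add: zeta_zero_count_def)
  then show ?thesis using T cin by (intro bexI[of _ c]) (auto simp: Or_def)
 qed
 have ne: "Or \<noteq> {}" using ex[OF T1 order_refl] by auto
 define m where "m = Min Or"
 have m: "m \<in> Or" unfolding m_def using fin ne by (rule Min_in)
 have mle: "m \<le> T" if T: "n < zeta_zero_count T" for T
 proof (cases "T \<le> T1")
  case True
  then obtain c where "c \<in> Or" "c \<le> T" using ex[OF T] by blast
  moreover have "m \<le> c" unfolding m_def using fin \<open>c \<in> Or\<close> by (rule Min_le)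
  ultimately show ?thesis by linarith
 next
  case False
  then show ?thesis using m by (auto simp: Or_def)
 qed
 have eq: "zeta_ordinate n = m"
  unfolding zeta_ordinate_def by (rule Least_equality) (use m mle in \<open>auto simp: Or_def\<close>)
 show "n < zeta_zero_count (zeta_ordinate n)" using m by (simp add: eq Or_def)
 show "n < zeta_zero_count T \<Longrightarrow> zeta_ordinate n \<le> T" using mle by (simp add: eq)
 obtain \<rho> where \<rho>: "riemann_xi \<rho> = 0" "Im \<rho> = m" using m by (auto simp: Or_def nontrivial_zeta_zeros_eq)
 then have "\<rho> = Complex (1 / 2) m" using xi_zero_Re[of \<rho>] by (simp add: complex_eq_iff)
 then show "riemann_xi (Complex (1 / 2) (zeta_ordinate n)) = 0" using \<rho> by (simp add: eq)
qed

text \<open>The number 3.034 lies strictly above 3.033, which turns a bound on the limes superior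
  into one for all late gaps. The ordinates on either side of an uncovered t differ by more than
  9.54 / Y, and the lower one has logarithm at least 2.005 Y - 3. Their product exceeds 19.09, but
  the assumed bound allows less than 3.034 * 2 * 3.142 < 19.066.\<close>

lemma zeta_gap_limsup_gt: "zeta_gap_limsup > ereal 3.033"
proof (rule ccontr)
 assume "\<not> zeta_gap_limsup > ereal 3.033"
 then have "zeta_gap_limsup \<le> ereal 3.033" by simp
 also have "\<dots> < ereal (3034 / 1000)" by simp
 finally have "\<forall>\<^sub>F n in sequentially. ereal (normalized_zeta_gap n) < ereal (3034 / 1000)"
  unfolding zeta_gap_limsup_def by (rule Limsup_lessD)
 then obtain n0 where n0: "\<And>n. n \<ge> n0 \<Longrightarrow> normalized_zeta_gap n < 3034 / 1000"
  by (auto simp: eventually_sequentially)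
 obtain U where U: "n0 + zeta_zero_count 3 + 1 < zeta_zero_count U" using zeta_zero_count_unbounded by blast
 have "filterlim heightT at_top at_top" unfolding heightT_def by real_asymp
 then have "\<forall>\<^sub>F Y in at_top. heightT Y \<ge> max 80 (2 * U)" unfolding filterlim_at_top by blast
 moreover have "\<forall>\<^sub>F Y in at_top. Y \<ge> (1000::real)" by (rule eventually_ge_at_top)
 moreover have "\<forall>\<^sub>F Y in at_top. \<exists>t\<in>{heightT Y / 2..3 * heightT Y / 2}. \<forall>c. riemann_xi (Complex (1 / 2) c) = 0 \<longrightarrow> \<bar>t - c\<bar> > 477 / 100 / Y"
  by (rule exists_large_zero_free_window) (rule xi_zero_Re)
 ultimately have "\<forall>\<^sub>F Y in at_top. heightT Y \<ge> max 80 (2 * U) \<and> Y \<ge> 1000 \<and>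
  (\<exists>t\<in>{heightT Y / 2..3 * heightT Y / 2}. \<forall>c. riemann_xi (Complex (1 / 2) c) = 0 \<longrightarrow> \<bar>t - c\<bar> > 477 / 100 / Y)"
  by eventually_elim blast
 from eventually_happens'[OF trivial_limit_at_top_linorder this]
 obtain Y where elim: "heightT Y \<ge> max 80 (2 * U)" "Y \<ge> 1000"
  "\<exists>t\<in>{heightT Y / 2..3 * heightT Y / 2}. \<forall>c. riemann_xi (Complex (1 / 2) c) = 0 \<longrightarrow> \<bar>t - c\<bar> > 477 / 100 / Y" by blast
 from elim(3) obtain t where t: "heightT Y / 2 \<le> t" and free: "\<And>c. riemann_xi (Complex (1 / 2) c) = 0 \<Longrightarrow> \<bar>t - c\<bar> > 477 / 100 / Y" by auto
 have tU: "t \<ge> U" using t elim(1) by simp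
 \<comment> \<open>Ordinates are indexed from 0, so m is the index of the last one not above t and
   \<open>Suc m\<close> that of the first one beyond t.\<close>
 define m where "m = zeta_zero_count t - 1"
 have cnt: "n0 + zeta_zero_count 3 + 1 < zeta_zero_count t" using U zeta_zero_count_mono[OF tU] by linarith
 have m: "Suc m = zeta_zero_count t" "m \<ge> n0" "m \<ge> zeta_zero_count 3" using cnt by (auto simp: m_def)
 define lo where "lo = zeta_ordinate m"
 define hi where "hi = zeta_ordinate (Suc m)"
 have lo: "lo \<le> t" unfolding lo_def by (rule zeta_ordinate_least(2)) (use m in simp)
 have hi: "hi > t"
 proof (rule ccontr)
  assume "\<not> hi > t"
  then have "zeta_zero_count hi \<le> Suc m" using zeta_zero_count_mono[of hi t] m(1) by simp
  then show False using zeta_ordinate_least(1)[of "Suc m"] by (simp add: hi_def)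
 qed
 have lo3: "lo > 3"
 proof (rule ccontr)
  assume "\<not> lo > 3"
  then have "zeta_zero_count lo \<le> m" using zeta_zero_count_mono[of lo 3] m(3) by simp
  then show False using zeta_ordinate_least(1)[of m] by (simp add: lo_def)
 qed
 have "t - lo > 477 / 100 / Y" using free[OF zeta_ordinate_least(3)[of m]] lo by (simp add: lo_def)
 moreover have "hi - t > 477 / 100 / Y" using free[OF zeta_ordinate_least(3)[of "Suc m"]] hi by (simp add: hi_def)
 ultimately have gap: "hi - lo > 477 / 50 / Y" by (simp add: field_simps)
 have gap0: "hi - lo > 0" using lo hi by simp
 have "(hi - lo) * (ln lo / (2 * pi)) < 3034 / 1000" using n0[OF m(2)] by (simp add: normalized_zeta_gap_def lo_def hi_def)
 then have g: "(hi - lo) * ln lo < 3034 / 1000 * (2 * pi)" by (simp add: field_simps)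
 then have g2: "(hi - lo) * ln lo < 19066 / 1000" using pi_bounds(2) by simp
 have "exp 1 \<le> lo" using exp_le lo3 by linarith
 then have "ln (exp 1) \<le> ln lo" by (intro ln_mono) auto
 \<comment> \<open>A crude bound comes first: ln lo \<ge> 1 gives hi - lo < 20, and since hi > T / 2
   and T \<ge> 80 this places lo above T / 4, which makes ln lo comparable to ln T.\<close>
 then have "(hi - lo) * 1 \<le> (hi - lo) * ln lo" using gap0 by (intro mult_left_mono) auto
 from order.strict_trans1[OF this g2] have "hi - lo < 20" by simp
 then have "lo \<ge> heightT Y / 4" using hi t elim(1) by simp
 then have "ln (heightT Y / 4) \<le> ln lo" by (intro ln_mono) auto
 moreover have "ln (heightT Y / 4) = 401 / 200 * Y - ln 4" by (subst ln_div) (auto simp: heightT_def)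
 moreover have "ln 4 \<le> (3::real)" using ln_le_minus_one[of "4::real"] by simp
 ultimately have "401 / 200 * Y - 3 \<le> ln lo" by linarith
 moreover have "0 \<le> 401 / 200 * Y - 3" using elim(2) by simp
 ultimately have "477 / 50 / Y * (401 / 200 * Y - 3) \<le> (hi - lo) * ln lo" using gap gap0 elim(2) by (intro mult_mono) auto
 moreover have "477 / 50 / Y * (401 / 200 * Y - 3) = 191277 / 10000 - 1431 / 50 / Y" using elim(2) by (simp add: field_simps)
 moreover have "1431 / 50 / Y \<le> 1431 / 50 / 1000" using elim(2) by (intro divide_left_mono) auto
 ultimately show False using g2 by simp
qed

end

theorem theorem1p1:
 assumes "generalized_riemann_hypothesis"
 shows "zeta_gap_limsup > ereal 3.033"
proof -
 interpret riemann_hypothesis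
  by standard (use generalized_riemann_hypothesis_imp_riemann_hypothesis[OF assms] nontrivial_zeta_zeros_eq in auto)
 show ?thesis by (rule zeta_gap_limsup_gt)
qed

end
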